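(* With the density functions $\delta_1,\delta_2,\delta_3$ defined in the context, the maximum of $\delta_i(\mathcal{C}^r(x,p))$ over $i\in\{1,2,3\}$, integers $p\ge7$ and admissible $x$ is attained at $p=7$, $x=s(7)-h(7)\approx0.41108$ (for $i=3$). Therefore the density upper bound of these congruent and non-congruent hyperball packings related to the truncated cube tilings $\{4,3,p\}$ ($p\ge7$ integer) is $\approx0.84931$.
   Context: Work in the Beltrami–Cayley–Klein (projective) model of hyperbolic $3$-space $\mathbb{H}^3$ of curvature $-1$: the interior of the unit ball of $\mathbb{R}^3$, with the polarity induced by the unit sphere. For a point $B$ outside the closed unit ball, its polar plane $\mathrm{pol}(B)$ meets $\mathbb{H}^3$ in a hyperbolic plane orthogonal to every line through $B$. For $y>1/\sqrt3$ let $B_1=(y,-y,-y)$, $B_2=(y,y,-y)$, $B_3=(-y,y,-y)$, $B_4=(-y,-y,-y)$, $B_5=(y,-y,y)$, $B_6=(y,y,y)$, $B_7=(-y,y,y)$, $B_8=(-y,-y,y)$ and $\beta_i=\mathrm{pol}(B_i)$. For real $p>6$, $\mathcal{C}^r(p)$ is the truncated regular cube obtained by cutting this cube by $\beta_1,\dots,\beta_8$, with $y=y(p)$ chosen so that the dihedral angle between two adjacent faces coming from faces of the cube is $2\pi/p$; for integers $p\ge7$ its reflection images tile $\mathbb{H}^3$ ($\{4,3,p\}$ tiling). The hyperball $\mathcal{H}^s_i$ (base plane $\beta_i$, height $s>0$) is the set of points at distance at most $s$ from $\beta_i$; $\mathrm{Vol}(\mathcal{H}^s\cap\mathcal{C}^r(p))$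 is the volume of $\mathcal{H}^s_i\cap\mathcal{C}^r(p)$. $2h(p)$: distance between $\beta_i,\beta_j$ for vertices joined by an edge; $t(p)$: distance from $\beta_i$ to the origin; $s(p)$: distance from $\beta_i$ to the centre of a face of the cube containing $B_i$; $w(p)$: distance from $\beta_i$ to the plane of a face of $\mathcal{C}^r(p)$ coming from a cube face not containing $B_i$. Write $V(s)=\mathrm{Vol}(\mathcal{H}^s\cap\mathcal{C}^r(p))$, $V_0=\mathrm{Vol}(\mathcal{C}^r(p))$. Density functions: $\delta_1(\mathcal{C}^r(x,p))=(2V(h+x)+6V(h-x))/V_0$ for $x\in[0,\min\{2h,w,t\}-h]$; $\delta_2(\mathcal{C}^r(x,p))=(V(t+x)+V(t-x)+3V(2h-t-x)+3V(2h-t+x))/V_0$ for $x\in[0,\min\{2h-t,t,w-t,s-h\}]$; $\delta_3(\mathcal{C}^r(x,p))=(4V(h+x)+4V(h-x))/V_0$ for $x\in[0,\min\{h,s-h\}]$ (all quantities evaluated at $p$). They are the densities in $\mathcal{C}^r(p)$ of the following hyperball arrangements: ($\delta_1$) heights $h+x$ at $B_2,B_8$ and $h-x$ elsewhere; ($\delta_2$) height $t+x$ at $B_2$, $t-x$ at $B_8$, $2h-t-x$ at $B_1,B_3,B_6$, $2h-t+x$ at $B_4,B_5,B_7$; ($\delta_3$) height $h+x$ at $B_1,B_3,B_6,B_8$ and $h-x$ at $B_2,B_4,B_5,B_7$. *)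

theory Defs
  imports "HOL-Analysis.Analysis"
begin

text \<open>Beltrami--Cayley--Klein model of hyperbolic 3-space (curvature -1):
  the open unit ball of real^3.\<close>

type_synonym pt = "real^3"

definition hball :: "pt set" where
  "hball = {x. norm x < 1}"

definition hdist :: "pt \<Rightarrow> pt \<Rightarrow> real" where
  "hdist x z = arcosh ((1 - x \<bullet> z) / sqrt ((1 - x \<bullet> x) * (1 - z \<bullet> z)))"

text \<open>Polar plane of a point B outside the closed unit ball, intersected with H^3.\<close>
definition pol :: "pt \<Rightarrow> pt set" where
  "pol B = {x \<in> hball. x \<bullet> B = 1}"

definition hdist_pt_set :: "pt \<Rightarrow> pt set \<Rightarrow> real" where
  "hdist_pt_set x A = (INF a\<in>A. hdist x a)"

definition hdist_sets :: "pt set \<Rightarrow> pt set \<Rightarrow> real" where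
  "hdist_sets A C = (INF a\<in>A. INF c\<in>C. hdist a c)"

text \<open>Hyperbolic volume: Klein-model volume element dx / (1 - |x|^2)^2.\<close>
definition hvol :: "pt set \<Rightarrow> real" where
  "hvol S = (LINT x:S|lborel. 1 / (1 - (norm x)^2)^2)"

definition hyperball :: "pt \<Rightarrow> real \<Rightarrow> pt set" where
  "hyperball B s = {x \<in> hball. hdist_pt_set x (pol B) \<le> s}"

text \<open>Dihedral angle, at their common edge, of the region {x. x.P <= 1, x.Q <= 1}
  bounded by the (intersecting) planes pol P and pol Q.\<close>
definition dihedral_angle :: "pt \<Rightarrow> pt \<Rightarrow> real" where
  "dihedral_angle P Q = arccos ((1 - P \<bullet> Q) / sqrt ((P \<bullet> P - 1) * (Q \<bullet> Q - 1)))"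

definition cube_vertex :: "real \<Rightarrow> nat \<Rightarrow> pt" where
  "cube_vertex y i =
    (if i = 1 then vector [y, -y, -y] else
     if i = 2 then vector [y, y, -y] else
     if i = 3 then vector [-y, y, -y] else
     if i = 4 then vector [-y, -y, -y] else
     if i = 5 then vector [y, -y, y] else
     if i = 6 then vector [y, y, y] else
     if i = 7 then vector [-y, y, y] else vector [-y, -y, y])"

text \<open>y(p): the faces x1 = y and x2 = y are the polar planes of (1/y,0,0) and (0,1/y,0);
  their dihedral angle must be 2 pi / p. The range (1/sqrt 3, 1/sqrt 2) is where the
  truncated cube is a compact hyperbolic polyhedron (cube edges meet H^3).\<close>
definition cube_param :: "real \<Rightarrow> real" where
  "cube_param p = (THE y. 1 / sqrt 3 < y \<and> y < 1 / sqrt 2 \<and>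
      dihedral_angle (vector [1 / y, 0, 0]) (vector [0, 1 / y, 0]) = 2 * pi / p)"

definition trunc_cube :: "real \<Rightarrow> pt set" where
  "trunc_cube p = {x \<in> hball. (\<forall>k. \<bar>x $ k\<bar> \<le> cube_param p) \<and>
      (\<forall>i\<in>{1..8}. x \<bullet> cube_vertex (cube_param p) i \<le> 1)}"

definition beta :: "real \<Rightarrow> nat \<Rightarrow> pt set" where
  "beta p i = pol (cube_vertex (cube_param p) i)"

text \<open>h(p): half the distance between beta_1, beta_2 (B_1, B_2 are joined by an edge).\<close>
definition h_dist :: "real \<Rightarrow> real" where
  "h_dist p = hdist_sets (beta p 1) (beta p 2) / 2"

definition t_dist :: "real \<Rightarrow> real" where
  "t_dist p = hdist_pt_set 0 (beta p 1)"

text \<open>(y,0,0) is the centre of the cube face x1 = y, which contains B_1.\<close>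
definition s_dist :: "real \<Rightarrow> real" where
  "s_dist p = hdist_pt_set (vector [cube_param p, 0, 0]) (beta p 1)"

text \<open>Plane of the face x1 = -y, which comes from a cube face not containing B_1.\<close>
definition w_dist :: "real \<Rightarrow> real" where
  "w_dist p = hdist_sets (beta p 1) {x \<in> hball. x $ 1 = - cube_param p}"

definition Vh :: "real \<Rightarrow> real \<Rightarrow> real" where
  "Vh p r = hvol (hyperball (cube_vertex (cube_param p) 1) r \<inter> trunc_cube p)"

definition V0 :: "real \<Rightarrow> real" where
  "V0 p = hvol (trunc_cube p)"

definition delta1 :: "real \<Rightarrow> real \<Rightarrow> real" where
  "delta1 p x = (2 * Vh p (h_dist p + x) + 6 * Vh p (h_dist p - x)) / V0 p"

definition delta2 :: "real \<Rightarrow> real \<Rightarrow> real" where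
  "delta2 p x = (Vh p (t_dist p + x) + Vh p (t_dist p - x)
      + 3 * Vh p (2 * h_dist p - t_dist p - x) + 3 * Vh p (2 * h_dist p - t_dist p + x)) / V0 p"

definition delta3 :: "real \<Rightarrow> real \<Rightarrow> real" where
  "delta3 p x = (4 * Vh p (h_dist p + x) + 4 * Vh p (h_dist p - x)) / V0 p"

definition adm1 :: "real \<Rightarrow> real \<Rightarrow> bool" where
  "adm1 p x \<longleftrightarrow> 0 \<le> x \<and>
      x \<le> min (2 * h_dist p) (min (w_dist p) (t_dist p)) - h_dist p"

definition adm2 :: "real \<Rightarrow> real \<Rightarrow> bool" where
  "adm2 p x \<longleftrightarrow> 0 \<le> x \<and>
      x \<le> min (2 * h_dist p - t_dist p) (min (t_dist p)
             (min (w_dist p - t_dist p) (s_dist p - h_dist p)))"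

definition adm3 :: "real \<Rightarrow> real \<Rightarrow> bool" where
  "adm3 p x \<longleftrightarrow> 0 \<le> x \<and> x \<le> min (h_dist p) (s_dist p - h_dist p)"

end

theory Submission imports Defs begin

text \<open>Write \<open>c = cos (2 * pi / p)\<close> and \<open>C = 1 / (2 * c - 1)\<close>. Then \<open>y\<^sup>2 = c / (1 + c)\<close>, \<open>cosh (2 * h) = C\<close>,
  \<open>(sinh s)\<^sup>2 = C\<close> and \<open>(sinh t)\<^sup>2 = (1 + c) / (2 * c - 1)\<close>. The hyperball of height \<open>r\<close> inside the
  trihedral prism over the truncating triangle, whose area is \<open>A = pi - 6 * pi / p\<close>, has volume \<open>A * F r\<close> with
  \<open>F r = (sinh (2 * r) + 2 * r) / 4\<close>. So \<open>Vh p r \<le> A * F r\<close>, with equality as long as this part of the prism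
  stays inside the truncated cube; for \<open>p = 7\<close> this is the case for \<open>r \<le> s\<close>.

  Replacing each hyperball volume by \<open>A * F\<close> turns the numerators of the three densities into sums of values
  of \<open>F\<close>. By the convexity of \<open>F\<close> they are largest at the ends of the admissible intervals. For \<open>p = 7\<close> the sum
  \<open>4 * F s + 4 * F (2 * h - s)\<close> beats the others; for \<open>p \<ge> 8\<close> the density stays below \<open>0.8493\<close>, by
  numerical bounds for finitely many \<open>p\<close> and by monotonicity in \<open>p\<close> for the rest.

  The volume of the truncated cube is eight times that of its part in the positive octant. Cut into cones from
  the origin, that part has a volume given by integrals over a single variable of \<open>Phi z = artanh (sqrt z) / sqrt z\<close>, which
  satisfies a first-order linear differential equation. Polynomials with a residual of one sign therefore bound
  these integrals, and such polynomials can be checked by rational arithmetic.\<close>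

subsection \<open>Integrals over symmetric regions of three-space\<close>

text \<open>Exact hyperball volumes are needed for one configuration only, the one at
  \<open>p = 7\<close>. Every competitor needs just an upper bound, and
  \<open>Vh p r \<le> A * F r\<close> holds without asking how the remaining faces cut the
  hyperball.

  The volume of a truncated cube is of dilogarithm type, so the last of the three integrations is
  left standing and bounded by polynomials. Its data involve the irrational numbers \<open>y\<close>
  and \<open>1 / y\<close>, which move in opposite directions. They are therefore decoupled: the
  octant is cut by \<open>a, b, c \<le> y\<close> and \<open>a + b + c \<le> d\<close> with
  independent parameters, its volume increases in both, and rational values on either side of
  \<open>y\<close> and \<open>1 / y\<close> enclose it. The same device serves all
  \<open>p \<ge> 11\<close> with a single body, because \<open>y\<close> increases towards
  \<open>1 / sqrt 2\<close>.

  The convexity of \<open>F\<close> is used through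
  \<open>F (a + x) + F (a - x) = sinh (2 * a) * cosh (2 * x) / 2 + a\<close>, in which only the cosh
  depends on \<open>x\<close>. The second family needs attention for \<open>p = 7\<close> and
  \<open>p = 8\<close> only: from \<open>p = 9\<close> on \<open>2 * h < t\<close>, and its
  admissible interval is empty.\<close>

lemma vector_3_conv_axis:
  "(vector [a, b, c] :: real^3) = a *\<^sub>R axis 1 1 + b *\<^sub>R axis 2 1 + c *\<^sub>R axis 3 1"
  by (simp add: vec_eq_iff forall_3 axis_def)

lemma borel_measurable_vector_3 [measurable]:
  fixes f g h :: "'a \<Rightarrow> real"
  assumes [measurable]: "f \<in> borel_measurable M" "g \<in> borel_measurable M" "h \<in> borel_measurable M"
  shows "(\<lambda>x. vector [f x, g x, h x] :: real^3) \<in> borel_measurable M"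
  unfolding vector_3_conv_axis by measurable

lemma borel_measurable_vec_nth' [measurable]: "(\<lambda>x::real^3. x $ i) \<in> borel_measurable borel"
  by (intro borel_measurable_continuous_onI continuous_intros)

text \<open>\<open>lborel\<close> on a Euclidean space is the image of a product of real Lebesgue
  measures indexed by \<open>Basis\<close>, here the three axis vectors; they are peeled off one at
  a time. With nonnegative integrals, Fubini and the substitutions below ask for measurability
  only.\<close>

lemma nn_integral_lborel_vec3:
  fixes f :: "real^3 \<Rightarrow> ennreal"
  assumes [measurable]: "f \<in> borel_measurable borel"
  shows "(\<integral>\<^sup>+x. f x \<partial>lborel) =
    (\<integral>\<^sup>+a. \<integral>\<^sup>+b. \<integral>\<^sup>+c. f (vector [a, b, c]) \<partial>lborel \<partial>lborel \<partial>lborel)"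
proof -
  interpret product_sigma_finite "\<lambda>_::real^3. lborel :: real measure" ..
  let ?e = "\<lambda>i::3. axis i (1::real)"
  have B: "(Basis :: (real^3) set) = insert (?e 1) (insert (?e 2) (insert (?e 3) {}))"
    by (auto simp: Basis_vec_def UNIV_3)
  have ne: "?e 1 \<noteq> ?e 2" "?e 1 \<noteq> ?e 3" "?e 2 \<noteq> ?e 3" "?e 2 \<noteq> ?e 1" "?e 3 \<noteq> ?e 1" "?e 3 \<noteq> ?e 2"
    by (auto simp: axis_eq_axis)
  define T where "T = (\<lambda>g::real^3 \<Rightarrow> real. \<Sum>b\<in>Basis. g b *\<^sub>R b)"
  have Tm [measurable]: "T \<in> borel_measurable (Pi\<^sub>M Basis (\<lambda>_. lborel))"
    unfolding T_def by measurable
  have Tv: "T g = vector [g (?e 1), g (?e 2), g (?e 3)]" for g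
    unfolding T_def B using ne
    by (simp add: vec_eq_iff forall_3 axis_def)
  have m: "f \<circ> T \<in> borel_measurable (Pi\<^sub>M Basis (\<lambda>_. lborel))"
    by (rule measurable_comp[OF Tm assms])
  have "(\<integral>\<^sup>+x. f x \<partial>lborel) = (\<integral>\<^sup>+g. f (T g) \<partial>Pi\<^sub>M Basis (\<lambda>_. lborel))"
    by (subst lborel_eq, subst T_def[symmetric], rule nn_integral_distr[OF Tm]) (simp add: assms)
  also have "\<dots> = (\<integral>\<^sup>+g. (f \<circ> T) g \<partial>Pi\<^sub>M Basis (\<lambda>_. lborel))" by simp
  also have "\<dots> = (\<integral>\<^sup>+a. \<integral>\<^sup>+b. \<integral>\<^sup>+c. f (vector [a, b, c]) \<partial>lborel \<partial>lborel \<partial>lborel)"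
  proof -
    have m1: "f \<circ> T \<in> borel_measurable (Pi\<^sub>M (insert (?e 1) {?e 2, ?e 3}) (\<lambda>_. lborel))"
      by (rule m[unfolded B])
    have m2: "(\<lambda>x. (f \<circ> T) (x(?e 1 := a))) \<in> borel_measurable (Pi\<^sub>M (insert (?e 2) {?e 3}) (\<lambda>_. lborel))" for a
      by (rule measurable_compose[OF measurable_fun_upd m1]) auto
    have m3: "(\<lambda>x. (f \<circ> T) (x(?e 2 := b, ?e 1 := a))) \<in> borel_measurable (Pi\<^sub>M (insert (?e 3) {}) (\<lambda>_. lborel))" for a b
      by (rule measurable_compose[OF measurable_fun_upd m2]) auto
    have "(\<integral>\<^sup>+g. (f \<circ> T) g \<partial>Pi\<^sub>M Basis (\<lambda>_. lborel)) =
      (\<integral>\<^sup>+a. \<integral>\<^sup>+g. (f \<circ> T) (g(?e 1 := a)) \<partial>Pi\<^sub>M {?e 2, ?e 3} (\<lambda>_. lborel) \<partial>lborel)"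
      unfolding B by (rule product_nn_integral_insert_rev[OF _ _ m1]) (use ne in auto)
    also have "\<dots> = (\<integral>\<^sup>+a. \<integral>\<^sup>+b. \<integral>\<^sup>+g. (f \<circ> T) (g(?e 2 := b, ?e 1 := a)) \<partial>Pi\<^sub>M {?e 3} (\<lambda>_. lborel) \<partial>lborel \<partial>lborel)"
      by (intro nn_integral_cong product_nn_integral_insert_rev[OF _ _ m2]) (use ne in auto)
    also have "\<dots> = (\<integral>\<^sup>+a. \<integral>\<^sup>+b. \<integral>\<^sup>+c. f (vector [a, b, c]) \<partial>lborel \<partial>lborel \<partial>lborel)"
    proof (intro nn_integral_cong)
      fix a b :: real
      have "(\<integral>\<^sup>+g. (f \<circ> T) (g(?e 2 := b, ?e 1 := a)) \<partial>Pi\<^sub>M {?e 3} (\<lambda>_. lborel)) =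
        (\<integral>\<^sup>+g. (\<lambda>c. f (vector [a, b, c])) (g (?e 3)) \<partial>Pi\<^sub>M {?e 3} (\<lambda>_. lborel))"
        using ne by (intro nn_integral_cong) (simp add: Tv)
      also have "\<dots> = (\<integral>\<^sup>+c. f (vector [a, b, c]) \<partial>lborel)"
        by (rule product_nn_integral_singleton) measurable
      finally show "(\<integral>\<^sup>+g. (f \<circ> T) (g(?e 2 := b, ?e 1 := a)) \<partial>Pi\<^sub>M {?e 3} (\<lambda>_. lborel)) =
        (\<integral>\<^sup>+c. f (vector [a, b, c]) \<partial>lborel)" .
    qed
    finally show ?thesis .
  qed
  finally show ?thesis .
qed

lemma nn_integral_swap:
  fixes f :: "real \<Rightarrow> real \<Rightarrow> ennreal"
  assumes "case_prod f \<in> borel_measurable (borel \<Otimes>\<^sub>M borel)"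
  shows "(\<integral>\<^sup>+x. \<integral>\<^sup>+y. f x y \<partial>lborel \<partial>lborel) = (\<integral>\<^sup>+y. \<integral>\<^sup>+x. f x y \<partial>lborel \<partial>lborel)"
  using lborel_pair.Fubini'[of f] assms by simp

lemma nn_integral_affine:
  fixes f :: "real \<Rightarrow> ennreal"
  assumes "f \<in> borel_measurable borel" "c \<noteq> 0"
  shows "(\<integral>\<^sup>+x. f x \<partial>lborel) = ennreal \<bar>c\<bar> * (\<integral>\<^sup>+x. f (t + c * x) \<partial>lborel)"
  using nn_integral_real_affine[OF assms] .

lemma nn_integral_shift:
  fixes f :: "real \<Rightarrow> ennreal"
  assumes "f \<in> borel_measurable borel"
  shows "(\<integral>\<^sup>+x. f x \<partial>lborel) = (\<integral>\<^sup>+x. f (t + x) \<partial>lborel)"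
  using nn_integral_affine[OF assms, of 1 t] by simp

lemma nn_integral_add3:
  assumes "f \<in> borel_measurable M" "g \<in> borel_measurable M" "h \<in> borel_measurable M"
  shows "(\<integral>\<^sup>+x. f x + (g x + h x) \<partial>M) = integral\<^sup>N M f + (integral\<^sup>N M g + integral\<^sup>N M h)"
  using assms by (simp add: nn_integral_add)

lemma nn_integral_even:
  fixes f :: "real \<Rightarrow> ennreal"
  assumes [measurable]: "f \<in> borel_measurable borel" and even: "\<And>x. f (- x) = f x"
  shows "(\<integral>\<^sup>+x. f x \<partial>lborel) = 2 * (\<integral>\<^sup>+x. f x * indicator {0..} x \<partial>lborel)"
proof -
  have "(\<integral>\<^sup>+x. f x \<partial>lborel) = (\<integral>\<^sup>+x. f x * indicator {0..} x + f x * indicator {..0} x \<partial>lborel)"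
    by (intro nn_integral_cong_AE AE_I[where N="{0}"]) (auto split: split_indicator)
  also have "\<dots> = (\<integral>\<^sup>+x. f x * indicator {0..} x \<partial>lborel) + (\<integral>\<^sup>+x. f x * indicator {..0} x \<partial>lborel)"
    by (intro nn_integral_add) auto
  also have "(\<integral>\<^sup>+x. f x * indicator {..0} x \<partial>lborel) = (\<integral>\<^sup>+x. f x * indicator {0..} x \<partial>lborel)"
    by (subst nn_integral_affine[where c="-1" and t=0])
       (auto simp: even intro!: nn_integral_cong split: split_indicator)
  finally show ?thesis by (simp add: mult_2)
qed

text \<open>Coordinates adapted to the permutation symmetry: \<open>N = a + b + c\<close>,
  \<open>M = \<sigma> * (3 * a - N)\<close>, \<open>L = (b - c) / 2\<close>, with Jacobian 1/3,
  whence the factor 3. The sector in which \<open>\<sigma> * a\<close> is largest becomes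
  \<open>\<bar>L\<bar> \<le> M / 2\<close>, and the quadratic form becomes diagonal. The flags
  \<open>s1\<close>, \<open>s2\<close> decide who owns ties, that is the null set where
  \<open>\<bar>L\<bar> = M / 2\<close>, so the value is the same for all of them.\<close>

lemma nn_integral_symmetric_sector:
  fixes H :: "real \<Rightarrow> real \<Rightarrow> ennreal" and \<sigma> r :: real and s1 s2 :: bool
  assumes H: "case_prod H \<in> borel_measurable (borel \<Otimes>\<^sub>M borel)" and \<sigma>: "\<sigma> = 1 \<or> \<sigma> = -1"
  shows "3 * (\<integral>\<^sup>+a. \<integral>\<^sup>+b. \<integral>\<^sup>+c.
      (if (if s1 then \<sigma> * b < \<sigma> * a else \<sigma> * b \<le> \<sigma> * a) \<and>
          (if s2 then \<sigma> * c < \<sigma> * a else \<sigma> * c \<le> \<sigma> * a) \<and>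
          \<sigma> * (a - (a + b + c) / 3) \<le> r * (a + b + c)
       then H (a + b + c) (a\<^sup>2 + b\<^sup>2 + c\<^sup>2) else 0) \<partial>lborel \<partial>lborel \<partial>lborel) =
    (\<integral>\<^sup>+N. \<integral>\<^sup>+M. \<integral>\<^sup>+L.
      (if 0 \<le> M \<and> M \<le> 3 * r * N \<and> - (1/2) * M \<le> L \<and> L \<le> 1/2 * M
       then H N (1/3 * N\<^sup>2 + 1/6 * M\<^sup>2 + 2 * L\<^sup>2) else 0) \<partial>lborel \<partial>lborel \<partial>lborel)"
proof -
  note [measurable] = H
  have Hm [measurable]: "(\<lambda>x. H (f x) (g x)) \<in> borel_measurable X"
    if [measurable]: "f \<in> borel_measurable X" "g \<in> borel_measurable X" for f g and X :: "'x measure"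
    by measurable
  define G where "G = (\<lambda>a b c.
     if (if s1 then \<sigma> * b < \<sigma> * a else \<sigma> * b \<le> \<sigma> * a) \<and>
          (if s2 then \<sigma> * c < \<sigma> * a else \<sigma> * c \<le> \<sigma> * a) \<and>
          \<sigma> * (a - (a + b + c) / 3) \<le> r * (a + b + c)
       then H (a + b + c) (a\<^sup>2 + b\<^sup>2 + c\<^sup>2) else 0)"
  have Gm [measurable]: "(\<lambda>x. G (f x) (g x) (h x)) \<in> borel_measurable X"
    if [measurable]: "f \<in> borel_measurable X" "g \<in> borel_measurable X" "h \<in> borel_measurable X"
    for f g h and X :: "'x measure"
    unfolding G_def by measurable
  have "(\<integral>\<^sup>+a. \<integral>\<^sup>+b. \<integral>\<^sup>+c. G a b c \<partial>lborel \<partial>lborel \<partial>lborel) =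
     (\<integral>\<^sup>+a. \<integral>\<^sup>+b. \<integral>\<^sup>+N. G a b (N - a - b) \<partial>lborel \<partial>lborel \<partial>lborel)"
  proof (rule nn_integral_cong, rule nn_integral_cong)
    fix a b :: real
    have "(\<integral>\<^sup>+c. G a b c \<partial>lborel) = (\<integral>\<^sup>+N. G a b ((- a - b) + N) \<partial>lborel)"
      by (rule nn_integral_shift) measurable
    also have "\<dots> = (\<integral>\<^sup>+N. G a b (N - a - b) \<partial>lborel)"
      by (intro nn_integral_cong arg_cong[where f="G a b"]) simp
    finally show "(\<integral>\<^sup>+c. G a b c \<partial>lborel) = (\<integral>\<^sup>+N. G a b (N - a - b) \<partial>lborel)" .
  qed
  also have "\<dots> = (\<integral>\<^sup>+N. \<integral>\<^sup>+a. \<integral>\<^sup>+b. G a b (N - a - b) \<partial>lborel \<partial>lborel \<partial>lborel)"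
    by (subst (2) nn_integral_swap, measurable, rule nn_integral_swap, measurable)
  also have "\<dots> = (\<integral>\<^sup>+N. (\<integral>\<^sup>+M. ennreal (1/3) * (\<integral>\<^sup>+L. G (N/3 + \<sigma>/3*M) (N/3 + -\<sigma>/6*M + L) (N/3 + -\<sigma>/6*M - L)
        \<partial>lborel) \<partial>lborel) \<partial>lborel)"
  proof (rule nn_integral_cong)
    fix N :: real
    have "(\<integral>\<^sup>+a. \<integral>\<^sup>+b. G a b (N - a - b) \<partial>lborel \<partial>lborel) =
      ennreal \<bar>\<sigma>/3\<bar> * (\<integral>\<^sup>+M. \<integral>\<^sup>+b. G (N/3 + \<sigma>/3*M) b (N - (N/3 + \<sigma>/3*M) - b) \<partial>lborel \<partial>lborel)"
      by (rule nn_integral_affine) (use \<sigma> in auto)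
    also have "ennreal \<bar>\<sigma>/3\<bar> = ennreal (1/3)" using \<sigma> by auto
    also have "(\<integral>\<^sup>+M. \<integral>\<^sup>+b. G (N/3 + \<sigma>/3*M) b (N - (N/3 + \<sigma>/3*M) - b) \<partial>lborel \<partial>lborel) =
      (\<integral>\<^sup>+M. \<integral>\<^sup>+L. G (N/3 + \<sigma>/3*M) (N/3 + -\<sigma>/6*M + L) (N/3 + -\<sigma>/6*M - L) \<partial>lborel \<partial>lborel)"
    proof (rule nn_integral_cong)
      fix M :: real
      have "(\<integral>\<^sup>+b. G (N/3 + \<sigma>/3*M) b (N - (N/3 + \<sigma>/3*M) - b) \<partial>lborel) =
        (\<integral>\<^sup>+L. G (N/3 + \<sigma>/3*M) (N/3 + -\<sigma>/6*M + L) (N - (N/3 + \<sigma>/3*M) - (N/3 + -\<sigma>/6*M + L)) \<partial>lborel)"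
        by (rule nn_integral_shift) measurable
      also have "\<dots> = (\<integral>\<^sup>+L. G (N/3 + \<sigma>/3*M) (N/3 + -\<sigma>/6*M + L) (N/3 + -\<sigma>/6*M - L) \<partial>lborel)"
        by (intro nn_integral_cong arg_cong[where f="G _ _"]) (auto simp: field_simps)
      finally show "(\<integral>\<^sup>+b. G (N/3 + \<sigma>/3*M) b (N - (N/3 + \<sigma>/3*M) - b) \<partial>lborel) = \<dots>" .
    qed
    also have "ennreal (1/3) * \<dots> = (\<integral>\<^sup>+M. ennreal (1/3) * (\<integral>\<^sup>+L. G (N/3 + \<sigma>/3*M) (N/3 + -\<sigma>/6*M + L) (N/3 + -\<sigma>/6*M - L)
        \<partial>lborel) \<partial>lborel)"
      by (rule nn_integral_cmult[symmetric]) measurable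
    finally show "(\<integral>\<^sup>+a. \<integral>\<^sup>+b. G a b (N - a - b) \<partial>lborel \<partial>lborel) = \<dots>" .
  qed
  also have "\<dots> = ennreal (1/3) * (\<integral>\<^sup>+N. \<integral>\<^sup>+M. \<integral>\<^sup>+L. G (N/3 + \<sigma>/3*M) (N/3 + -\<sigma>/6*M + L) (N/3 + -\<sigma>/6*M - L)
        \<partial>lborel \<partial>lborel \<partial>lborel)"
  proof -
    have "(\<integral>\<^sup>+M. ennreal (1/3) * (\<integral>\<^sup>+L. G (N/3 + \<sigma>/3*M) (N/3 + -\<sigma>/6*M + L) (N/3 + -\<sigma>/6*M - L)
        \<partial>lborel) \<partial>lborel) = ennreal (1/3) * (\<integral>\<^sup>+M. \<integral>\<^sup>+L. G (N/3 + \<sigma>/3*M) (N/3 + -\<sigma>/6*M + L) (N/3 + -\<sigma>/6*M - L)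
        \<partial>lborel \<partial>lborel)" for N
      by (rule nn_integral_cmult) measurable
    then show ?thesis by (simp only:) (rule nn_integral_cmult, measurable)
  qed
  also have "(\<integral>\<^sup>+N. \<integral>\<^sup>+M. \<integral>\<^sup>+L. G (N/3 + \<sigma>/3*M) (N/3 + -\<sigma>/6*M + L) (N/3 + -\<sigma>/6*M - L)
        \<partial>lborel \<partial>lborel \<partial>lborel) = (\<integral>\<^sup>+N. \<integral>\<^sup>+M. \<integral>\<^sup>+L.
      (if 0 \<le> M \<and> M \<le> 3 * r * N \<and> - (1/2) * M \<le> L \<and> L \<le> 1/2 * M
       then H N (1/3 * N\<^sup>2 + 1/6 * M\<^sup>2 + 2 * L\<^sup>2) else 0) \<partial>lborel \<partial>lborel \<partial>lborel)"
  proof (rule nn_integral_cong, rule nn_integral_cong, rule nn_integral_cong_AE)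
    fix N M :: real
    have sq: "(N/3 + \<sigma>/3*M)\<^sup>2 + (N/3 + -\<sigma>/6*M + L)\<^sup>2 + (N/3 + -\<sigma>/6*M - L)\<^sup>2 =
        1/3 * N\<^sup>2 + 1/6 * M\<^sup>2 + 2 * L\<^sup>2" for L
      using \<sigma> by (auto simp: power2_eq_square field_simps)
    have sm: "(N/3 + \<sigma>/3*M) + (N/3 + -\<sigma>/6*M + L) + (N/3 + -\<sigma>/6*M - L) = N" for L
      by (auto simp: field_simps)
    show "AE L in lborel. G (N/3 + \<sigma>/3*M) (N/3 + -\<sigma>/6*M + L) (N/3 + -\<sigma>/6*M - L) =
       (if 0 \<le> M \<and> M \<le> 3 * r * N \<and> - (1/2) * M \<le> L \<and> L \<le> 1/2 * M
       then H N (1/3 * N\<^sup>2 + 1/6 * M\<^sup>2 + 2 * L\<^sup>2) else 0)"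
    proof (rule AE_I[where N="{M/2, -M/2}"])
      have "G (N/3 + \<sigma>/3*M) (N/3 + -\<sigma>/6*M + L) (N/3 + -\<sigma>/6*M - L) =
       (if 0 \<le> M \<and> M \<le> 3 * r * N \<and> - (1/2) * M \<le> L \<and> L \<le> 1/2 * M
       then H N (1/3 * N\<^sup>2 + 1/6 * M\<^sup>2 + 2 * L\<^sup>2) else 0)" if "L \<noteq> M/2" "L \<noteq> -M/2" for L
        unfolding G_def sq sm
        by (rule if_cong) (use that \<sigma> in \<open>auto simp: field_simps split: if_splits\<close>)
      then show "{L \<in> space lborel. G (N/3 + \<sigma>/3*M) (N/3 + -\<sigma>/6*M + L) (N/3 + -\<sigma>/6*M - L) \<noteq>
       (if 0 \<le> M \<and> M \<le> 3 * r * N \<and> - (1/2) * M \<le> L \<and> L \<le> 1/2 * M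
       then H N (1/3 * N\<^sup>2 + 1/6 * M\<^sup>2 + 2 * L\<^sup>2) else 0)} \<subseteq> {M/2, -M/2}" by blast
    qed (auto simp: emeasure_lborel_countable)
  qed
  finally have "(\<integral>\<^sup>+a. \<integral>\<^sup>+b. \<integral>\<^sup>+c. G a b c \<partial>lborel \<partial>lborel \<partial>lborel) = ennreal (1/3) * (\<integral>\<^sup>+N. \<integral>\<^sup>+M. \<integral>\<^sup>+L.
      (if 0 \<le> M \<and> M \<le> 3 * r * N \<and> - (1/2) * M \<le> L \<and> L \<le> 1/2 * M
       then H N (1/3 * N\<^sup>2 + 1/6 * M\<^sup>2 + 2 * L\<^sup>2) else 0) \<partial>lborel \<partial>lborel \<partial>lborel)" .
  moreover have "3 * (ennreal (1/3) * x) = x" for x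
  proof -
    have "3 * (ennreal (1/3) * x) = (ennreal 3 * ennreal (1/3)) * x" by (simp add: mult.assoc)
    also have "ennreal 3 * ennreal (1/3) = 1" by (subst ennreal_mult[symmetric]) auto
    finally show ?thesis by simp
  qed
  ultimately show ?thesis unfolding G_def by simp
qed

text \<open>Each point goes to the sector of its largest \<open>\<sigma>\<close>-coordinate, ties to
  the earlier one; there only the inequality of that coordinate is binding. As \<open>H\<close> sees
  symmetric functions only, exchanging the order of integration carries every sector into the
  first.\<close>

lemma nn_integral_symmetric_cone:
  fixes H :: "real \<Rightarrow> real \<Rightarrow> ennreal" and \<sigma> r :: real
  assumes H: "case_prod H \<in> borel_measurable (borel \<Otimes>\<^sub>M borel)" and \<sigma>: "\<sigma> = 1 \<or> \<sigma> = -1"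
  shows "(\<integral>\<^sup>+a. \<integral>\<^sup>+b. \<integral>\<^sup>+c.
      (if \<sigma> * (a - (a + b + c) / 3) \<le> r * (a + b + c) \<and>
          \<sigma> * (b - (a + b + c) / 3) \<le> r * (a + b + c) \<and>
          \<sigma> * (c - (a + b + c) / 3) \<le> r * (a + b + c)
       then H (a + b + c) (a\<^sup>2 + b\<^sup>2 + c\<^sup>2) else 0) \<partial>lborel \<partial>lborel \<partial>lborel) =
    (\<integral>\<^sup>+N. \<integral>\<^sup>+M. \<integral>\<^sup>+L.
      (if 0 \<le> M \<and> M \<le> 3 * r * N \<and> - (1/2) * M \<le> L \<and> L \<le> 1/2 * M
       then H N (1/3 * N\<^sup>2 + 1/6 * M\<^sup>2 + 2 * L\<^sup>2) else 0) \<partial>lborel \<partial>lborel \<partial>lborel)"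
    (is "?lhs = ?R")
proof -
  note [measurable] = H
  define G where "G = (\<lambda>s1 s2 a b c.
     if (if s1 then \<sigma> * b < \<sigma> * a else \<sigma> * b \<le> \<sigma> * a) \<and>
          (if s2 then \<sigma> * c < \<sigma> * a else \<sigma> * c \<le> \<sigma> * a) \<and>
          \<sigma> * (a - (a + b + c) / 3) \<le> r * (a + b + c)
       then H (a + b + c) (a\<^sup>2 + b\<^sup>2 + c\<^sup>2) else 0)"
  have Gm [measurable]: "(\<lambda>x. G s1 s2 (f x) (g x) (h x)) \<in> borel_measurable X"
    if [measurable]: "f \<in> borel_measurable X" "g \<in> borel_measurable X" "h \<in> borel_measurable X"
    for f g h s1 s2 and X :: "'x measure"
    unfolding G_def by measurable
  let ?J = "\<lambda>s1 s2. \<integral>\<^sup>+a. \<integral>\<^sup>+b. \<integral>\<^sup>+c. G s1 s2 a b c \<partial>lborel \<partial>lborel \<partial>lborel"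
  have J: "3 * ?J s1 s2 = ?R" for s1 s2
    unfolding G_def by (rule nn_integral_symmetric_sector[OF H \<sigma>])
  \<comment> \<open>\<open>3 * ?J s1 s2\<close> is the same for all flags, and the finite nonzero
    factor 3 may be cancelled in \<open>ennreal\<close> even from infinite values.\<close>
  have Jeq: "?J s1 s2 = ?J False False" for s1 s2
  proof -
    have "3 * ?J s1 s2 = 3 * ?J False False"
      unfolding J ..
    then show ?thesis
      by (subst (asm) ennreal_mult_cancel_left) simp
  qed
  have split: "(if \<sigma> * (a - (a + b + c) / 3) \<le> r * (a + b + c) \<and>
          \<sigma> * (b - (a + b + c) / 3) \<le> r * (a + b + c) \<and>
          \<sigma> * (c - (a + b + c) / 3) \<le> r * (a + b + c)
       then H (a + b + c) (a\<^sup>2 + b\<^sup>2 + c\<^sup>2) else 0) =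
       G False False a b c + (G True False b a c + G True True c a b)" for a b c
  proof -
    have s: "b + a + c = a + b + c" "c + a + b = a + b + c"
      "b\<^sup>2 + a\<^sup>2 + c\<^sup>2 = a\<^sup>2 + b\<^sup>2 + c\<^sup>2" "c\<^sup>2 + a\<^sup>2 + b\<^sup>2 = a\<^sup>2 + b\<^sup>2 + c\<^sup>2" by auto
    define S where "S = a + b + c"
    define h where "h = H S (a\<^sup>2 + b\<^sup>2 + c\<^sup>2)"
    define v where "v = \<sigma> * S / 3 + r * S"
    have t: "\<sigma> * (x - S / 3) \<le> r * S \<longleftrightarrow> \<sigma> * x \<le> v" for x
      by (auto simp: v_def right_diff_distrib)
    show ?thesis
      unfolding G_def s S_def[symmetric] h_def[symmetric] t
      by (cases "\<sigma> * b \<le> \<sigma> * a"; cases "\<sigma> * c \<le> \<sigma> * a"; cases "\<sigma> * c \<le> \<sigma> * b") auto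
  qed
  have "?lhs = ?J False False + ((\<integral>\<^sup>+a. \<integral>\<^sup>+b. \<integral>\<^sup>+c. G True False b a c \<partial>lborel \<partial>lborel \<partial>lborel)
      + (\<integral>\<^sup>+a. \<integral>\<^sup>+b. \<integral>\<^sup>+c. G True True c a b \<partial>lborel \<partial>lborel \<partial>lborel))"
  proof -
    have i1: "(\<integral>\<^sup>+c. G False False a b c + (G True False b a c + G True True c a b) \<partial>lborel) =
        (\<integral>\<^sup>+c. G False False a b c \<partial>lborel) + ((\<integral>\<^sup>+c. G True False b a c \<partial>lborel)
         + (\<integral>\<^sup>+c. G True True c a b \<partial>lborel))" for a b
      by (rule nn_integral_add3) measurable
    have i2: "(\<integral>\<^sup>+b. (\<integral>\<^sup>+c. G False False a b c \<partial>lborel) + ((\<integral>\<^sup>+c. G True False b a c \<partial>lborel)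
         + (\<integral>\<^sup>+c. G True True c a b \<partial>lborel)) \<partial>lborel) =
        (\<integral>\<^sup>+b. \<integral>\<^sup>+c. G False False a b c \<partial>lborel \<partial>lborel) +
        ((\<integral>\<^sup>+b. \<integral>\<^sup>+c. G True False b a c \<partial>lborel \<partial>lborel)
         + (\<integral>\<^sup>+b. \<integral>\<^sup>+c. G True True c a b \<partial>lborel \<partial>lborel))" for a
      by (rule nn_integral_add3) measurable
    show ?thesis unfolding split i1 i2
      by (rule nn_integral_add3) measurable
  qed
  also have "(\<integral>\<^sup>+a. \<integral>\<^sup>+b. \<integral>\<^sup>+c. G True False b a c \<partial>lborel \<partial>lborel \<partial>lborel) = ?J True False"
    by (rule nn_integral_swap) measurable
  also have "(\<integral>\<^sup>+a. \<integral>\<^sup>+b. \<integral>\<^sup>+c. G True True c a b \<partial>lborel \<partial>lborel \<partial>lborel) = ?J True True"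
    by (subst (2) nn_integral_swap, measurable, subst nn_integral_swap, measurable)
  finally have "?lhs = ?J False False + (?J False False + ?J False False)"
    by (simp only: Jeq[of True])
  also have "\<dots> = 3 * ?J False False"
    by (simp add: distrib_right[of 1 2, simplified] mult_2)
  finally show ?thesis by (simp only: J)
qed

text \<open>Rays from the apex: \<open>M = N * u\<close> and \<open>L = M * \<tau>\<close> have
  Jacobian \<open>N\<^sup>2 * u\<close>, and the quadratic form becomes \<open>N\<^sup>2\<close>
  times a function of \<open>u\<close> and \<open>\<tau>\<close>. The substitutions degenerate at
  \<open>M = 0\<close> and \<open>N = 0\<close>, which are null sets, and \<open>0 < q\<close>
  empties the region for \<open>N < 0\<close>. Afterwards the innermost integral runs along a
  ray.\<close>

lemma nn_integral_cone_scaling: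
  fixes H :: "real \<Rightarrow> real \<Rightarrow> ennreal" and A B C q m0 m1 :: real
  assumes H: "case_prod H \<in> borel_measurable (borel \<Otimes>\<^sub>M borel)" and q: "0 < q"
  shows "(\<integral>\<^sup>+N. \<integral>\<^sup>+M. \<integral>\<^sup>+L. (if 0 \<le> M \<and> M \<le> q * N \<and> m0 * M \<le> L \<and> L \<le> m1 * M
        then H N (A * N\<^sup>2 + B * M\<^sup>2 + C * L\<^sup>2) else 0) \<partial>lborel \<partial>lborel \<partial>lborel) =
    (\<integral>\<^sup>+\<tau>. (\<integral>\<^sup>+u. (\<integral>\<^sup>+N. ennreal (N\<^sup>2 * u) * H N (N\<^sup>2 * (A + u\<^sup>2 * (B + C * \<tau>\<^sup>2))) * indicator {0..} N
        \<partial>lborel) * indicator {0..q} u \<partial>lborel) * indicator {m0..m1} \<tau> \<partial>lborel)"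
proof -
  note [measurable] = H
  define K where "K = (\<lambda>N u \<tau>. ennreal (N\<^sup>2 * u) * H N (N\<^sup>2 * (A + u\<^sup>2 * (B + C * \<tau>\<^sup>2))) * indicator {0..} N
     * indicator {0..q} u * indicator {m0..m1} \<tau>)"
  have Km [measurable]: "(\<lambda>x. K (f x) (g x) (h x)) \<in> borel_measurable X"
    if [measurable]: "f \<in> borel_measurable X" "g \<in> borel_measurable X" "h \<in> borel_measurable X"
    for f g h and X :: "'x measure"
    unfolding K_def by measurable
  have "(\<integral>\<^sup>+M. \<integral>\<^sup>+L. (if 0 \<le> M \<and> M \<le> q * N \<and> m0 * M \<le> L \<and> L \<le> m1 * M
        then H N (A * N\<^sup>2 + B * M\<^sup>2 + C * L\<^sup>2) else 0) \<partial>lborel \<partial>lborel) =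
     (\<integral>\<^sup>+u. \<integral>\<^sup>+\<tau>. K N u \<tau> \<partial>lborel \<partial>lborel)" if N: "N \<noteq> 0" for N
  proof -
    have "(\<integral>\<^sup>+M. \<integral>\<^sup>+L. (if 0 \<le> M \<and> M \<le> q * N \<and> m0 * M \<le> L \<and> L \<le> m1 * M
        then H N (A * N\<^sup>2 + B * M\<^sup>2 + C * L\<^sup>2) else 0) \<partial>lborel \<partial>lborel) =
      (\<integral>\<^sup>+M. \<integral>\<^sup>+\<tau>. (if 0 \<le> M \<and> M \<le> q * N \<and> m0 \<le> \<tau> \<and> \<tau> \<le> m1
        then ennreal \<bar>M\<bar> * H N (A * N\<^sup>2 + B * M\<^sup>2 + C * (M * \<tau>)\<^sup>2) else 0) \<partial>lborel \<partial>lborel)"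
    proof (rule nn_integral_cong_AE, rule AE_I[where N="{0}"])
      have "(\<integral>\<^sup>+L. (if 0 \<le> M \<and> M \<le> q * N \<and> m0 * M \<le> L \<and> L \<le> m1 * M
        then H N (A * N\<^sup>2 + B * M\<^sup>2 + C * L\<^sup>2) else 0) \<partial>lborel) =
        (\<integral>\<^sup>+\<tau>. (if 0 \<le> M \<and> M \<le> q * N \<and> m0 \<le> \<tau> \<and> \<tau> \<le> m1
        then ennreal \<bar>M\<bar> * H N (A * N\<^sup>2 + B * M\<^sup>2 + C * (M * \<tau>)\<^sup>2) else 0) \<partial>lborel)" if M: "M \<noteq> 0" for M
        by (subst nn_integral_affine[where c=M and t=0], measurable, fact M,
            subst nn_integral_cmult[symmetric], measurable, intro nn_integral_cong)
           (use M in \<open>auto simp: field_simps\<close>)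
      then show "{M \<in> space lborel. (\<integral>\<^sup>+L. (if 0 \<le> M \<and> M \<le> q * N \<and> m0 * M \<le> L \<and> L \<le> m1 * M
        then H N (A * N\<^sup>2 + B * M\<^sup>2 + C * L\<^sup>2) else 0) \<partial>lborel) \<noteq>
        (\<integral>\<^sup>+\<tau>. (if 0 \<le> M \<and> M \<le> q * N \<and> m0 \<le> \<tau> \<and> \<tau> \<le> m1
        then ennreal \<bar>M\<bar> * H N (A * N\<^sup>2 + B * M\<^sup>2 + C * (M * \<tau>)\<^sup>2) else 0) \<partial>lborel)} \<subseteq> {0}" by blast
    qed auto
    also have "\<dots> = (\<integral>\<^sup>+u. \<integral>\<^sup>+\<tau>. K N u \<tau> \<partial>lborel \<partial>lborel)"
    proof (cases "0 < N")
      case True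
      have "ennreal \<bar>N\<bar> * (if 0 \<le> 0 + N * u \<and> 0 + N * u \<le> q * N \<and> m0 \<le> \<tau> \<and> \<tau> \<le> m1
        then ennreal \<bar>0 + N * u\<bar> * H N (A * N\<^sup>2 + B * (0 + N * u)\<^sup>2 + C * ((0 + N * u) * \<tau>)\<^sup>2) else 0) = K N u \<tau>" for u \<tau>
      proof -
        have "A * N\<^sup>2 + B * (0 + N * u)\<^sup>2 + C * ((0 + N * u) * \<tau>)\<^sup>2 = N\<^sup>2 * (A + u\<^sup>2 * (B + C * \<tau>\<^sup>2))"
          by (simp add: power2_eq_square algebra_simps)
        moreover have "0 \<le> 0 + N * u \<longleftrightarrow> 0 \<le> u" "0 + N * u \<le> q * N \<longleftrightarrow> u \<le> q"
          using True by (auto simp: zero_le_mult_iff mult.commute)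
        moreover have "ennreal \<bar>N\<bar> * (ennreal \<bar>0 + N * u\<bar> * x) = ennreal (N\<^sup>2 * u) * x" if "0 \<le> u" for x
          using True that by (simp add: mult.assoc[symmetric] ennreal_mult[symmetric] power2_eq_square)
        ultimately show ?thesis unfolding K_def using True by (simp split: split_indicator)
      qed
      then show ?thesis
        using True
        by (subst nn_integral_affine[where c=N and t=0], measurable,
            subst nn_integral_cmult[symmetric], measurable,
            subst nn_integral_cmult[symmetric], measurable)
    next
      case False
      then have "N < 0" using N by simp
      then have 1: "(if 0 \<le> M \<and> M \<le> q * N \<and> X then z else 0) = (0::ennreal)" for M X z
        using mult_pos_neg[OF q, of N] by auto
      have 2: "K N u \<tau> = 0" for u \<tau> using \<open>N < 0\<close> by (simp add: K_def)
      show ?thesis unfolding 1 2 by simp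
    qed
    finally show ?thesis .
  qed
  then have "(\<integral>\<^sup>+N. \<integral>\<^sup>+M. \<integral>\<^sup>+L. (if 0 \<le> M \<and> M \<le> q * N \<and> m0 * M \<le> L \<and> L \<le> m1 * M
        then H N (A * N\<^sup>2 + B * M\<^sup>2 + C * L\<^sup>2) else 0) \<partial>lborel \<partial>lborel \<partial>lborel) =
     (\<integral>\<^sup>+N. \<integral>\<^sup>+u. \<integral>\<^sup>+\<tau>. K N u \<tau> \<partial>lborel \<partial>lborel \<partial>lborel)"
    by (intro nn_integral_cong_AE AE_I[where N="{0}"]) auto
  also have "\<dots> = (\<integral>\<^sup>+N. \<integral>\<^sup>+\<tau>. \<integral>\<^sup>+u. K N u \<tau> \<partial>lborel \<partial>lborel \<partial>lborel)"
    by (intro nn_integral_cong nn_integral_swap) measurable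
  also have "\<dots> = (\<integral>\<^sup>+\<tau>. \<integral>\<^sup>+N. \<integral>\<^sup>+u. K N u \<tau> \<partial>lborel \<partial>lborel \<partial>lborel)"
    by (intro nn_integral_swap) measurable
  also have "\<dots> = (\<integral>\<^sup>+\<tau>. \<integral>\<^sup>+u. \<integral>\<^sup>+N. K N u \<tau> \<partial>lborel \<partial>lborel \<partial>lborel)"
    by (intro nn_integral_cong nn_integral_swap) measurable
  also have "\<dots> = (\<integral>\<^sup>+\<tau>. (\<integral>\<^sup>+u. (\<integral>\<^sup>+N. ennreal (N\<^sup>2 * u) * H N (N\<^sup>2 * (A + u\<^sup>2 * (B + C * \<tau>\<^sup>2))) * indicator {0..} N
        \<partial>lborel) * indicator {0..q} u \<partial>lborel) * indicator {m0..m1} \<tau> \<partial>lborel)"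
  proof -
    have "(\<integral>\<^sup>+N. K N u \<tau> \<partial>lborel) = (\<integral>\<^sup>+N. ennreal (N\<^sup>2 * u) * H N (N\<^sup>2 * (A + u\<^sup>2 * (B + C * \<tau>\<^sup>2))) * indicator {0..} N
        \<partial>lborel) * indicator {0..q} u * indicator {m0..m1} \<tau>" for u \<tau>
      unfolding K_def by (auto split: split_indicator)
    then show ?thesis
      by (auto intro!: nn_integral_cong split: split_indicator)
  qed
  finally show ?thesis .
qed

subsection \<open>Volume of a hyperball in a trihedral prism\<close>

text \<open>For \<open>0 < z < 1\<close> this is the series
  \<open>\<Sum>k. z ^ k / (2 * k + 1)\<close>. Taking the squared distance as the argument keeps
  square roots out of the arguments. Total division gives \<open>Phi 0 = 0\<close> instead of the
  limit 1.\<close>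

definition Phi :: "real \<Rightarrow> real" where
  "Phi z = artanh (sqrt z) / sqrt z"

text \<open>The integral of \<open>(cosh x)\<^sup>2\<close> over \<open>{0..r}\<close>: the volume
  per unit of base area of the one-sided layer of height \<open>r\<close> over a hyperbolic
  plane.\<close>

definition hyperball_profile :: "real \<Rightarrow> real" where
  "hyperball_profile r = (sinh (2 * r) + 2 * r) / 4"

lemma nn_integral_FTC:
  fixes F f :: "real \<Rightarrow> real"
  assumes "a \<le> b" "f \<in> borel_measurable borel"
    and "\<And>x. a \<le> x \<Longrightarrow> x \<le> b \<Longrightarrow> (F has_real_derivative f x) (at x)"
    and "\<And>x. a \<le> x \<Longrightarrow> x \<le> b \<Longrightarrow> 0 \<le> f x"
  shows "(\<integral>\<^sup>+x. ennreal (f x) * indicator {a..b} x \<partial>lborel) = ennreal (F b - F a)"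
  using assms by (intro nn_integral_FTC_Icc) auto

text \<open>The order of integration matters. In \<open>u\<close> there is the primitive
  \<open>1 / (2 * w * (1 - N\<^sup>2 * (A + u\<^sup>2 * w)))\<close>; it leaves a difference of two
  terms \<open>1 / (1 - N\<^sup>2 * \<beta>)\<close>, each with an \<open>artanh\<close> as
  primitive in \<open>N\<close>.\<close>

lemma nn_integral_radial_cone:
  fixes A w a q :: real
  assumes A: "0 < A" and w: "0 < w" and a: "0 < a" and q: "0 < q" and lt1: "a\<^sup>2 * (A + q\<^sup>2 * w) < 1"
  shows "(\<integral>\<^sup>+u. (\<integral>\<^sup>+N. ennreal (N\<^sup>2 * u) * (if N \<le> a then ennreal (1 / (1 - N\<^sup>2 * (A + u\<^sup>2 * w))\<^sup>2) else 0)
        * indicator {0..} N \<partial>lborel) * indicator {0..q} u \<partial>lborel) =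
     ennreal (a / (2 * w) * (Phi (a\<^sup>2 * (A + q\<^sup>2 * w)) - Phi (a\<^sup>2 * A)))"
proof -
  define \<rho> where "\<rho> = A + q\<^sup>2 * w"
  have \<rho>: "A < \<rho>" "0 < \<rho>" using A w q by (auto simp: \<rho>_def add_pos_pos)
  have small: "N\<^sup>2 * (A + u\<^sup>2 * w) < 1" if "0 \<le> N" "N \<le> a" "0 \<le> u" "u \<le> q" for N u
  proof -
    have "N\<^sup>2 * (A + u\<^sup>2 * w) \<le> a\<^sup>2 * (A + q\<^sup>2 * w)"
      using that A w by (intro mult_mono add_mono power_mono mult_right_mono) auto
    then show ?thesis using lt1 by simp
  qed
  have "(\<integral>\<^sup>+u. (\<integral>\<^sup>+N. ennreal (N\<^sup>2 * u) * (if N \<le> a then ennreal (1 / (1 - N\<^sup>2 * (A + u\<^sup>2 * w))\<^sup>2) else 0)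
        * indicator {0..} N \<partial>lborel) * indicator {0..q} u \<partial>lborel) =
     (\<integral>\<^sup>+u. \<integral>\<^sup>+N. ennreal (N\<^sup>2 * u / (1 - N\<^sup>2 * (A + u\<^sup>2 * w))\<^sup>2) * indicator {0..q} u * indicator {0..a} N \<partial>lborel \<partial>lborel)"
    by (intro nn_integral_cong, subst nn_integral_multc[symmetric], measurable, intro nn_integral_cong)
       (auto simp: ennreal_mult[symmetric] split: split_indicator)
  also have "\<dots> = (\<integral>\<^sup>+N. \<integral>\<^sup>+u. ennreal (N\<^sup>2 * u / (1 - N\<^sup>2 * (A + u\<^sup>2 * w))\<^sup>2) * indicator {0..q} u * indicator {0..a} N \<partial>lborel \<partial>lborel)"
    by (rule nn_integral_swap) measurable
  also have "\<dots> = (\<integral>\<^sup>+N. ennreal (1 / (2 * w) * (1 / (1 - N\<^sup>2 * \<rho>) - 1 / (1 - N\<^sup>2 * A))) * indicator {0..a} N \<partial>lborel)"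
  proof (rule nn_integral_cong)
    fix N :: real
    show "(\<integral>\<^sup>+u. ennreal (N\<^sup>2 * u / (1 - N\<^sup>2 * (A + u\<^sup>2 * w))\<^sup>2) * indicator {0..q} u * indicator {0..a} N \<partial>lborel) =
       ennreal (1 / (2 * w) * (1 / (1 - N\<^sup>2 * \<rho>) - 1 / (1 - N\<^sup>2 * A))) * indicator {0..a} N"
    proof (cases "N \<in> {0..a}")
      case True
      have "(\<integral>\<^sup>+u. ennreal (N\<^sup>2 * u / (1 - N\<^sup>2 * (A + u\<^sup>2 * w))\<^sup>2) * indicator {0..q} u \<partial>lborel) =
        ennreal (1 / (2 * w * (1 - N\<^sup>2 * (A + q\<^sup>2 * w))) - 1 / (2 * w * (1 - N\<^sup>2 * (A + 0\<^sup>2 * w))))"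
      proof (rule nn_integral_FTC[where f="\<lambda>u. N\<^sup>2 * u / (1 - N\<^sup>2 * (A + u\<^sup>2 * w))\<^sup>2" and
            F="\<lambda>u. 1 / (2 * w * (1 - N\<^sup>2 * (A + u\<^sup>2 * w)))"])
        show "0 \<le> N\<^sup>2 * u / (1 - N\<^sup>2 * (A + u\<^sup>2 * w))\<^sup>2" if "0 \<le> u" "u \<le> q" for u
          using that by auto
        show "((\<lambda>u. 1 / (2 * w * (1 - N\<^sup>2 * (A + u\<^sup>2 * w)))) has_real_derivative
            N\<^sup>2 * u / (1 - N\<^sup>2 * (A + u\<^sup>2 * w))\<^sup>2) (at u)" if "0 \<le> u" "u \<le> q" for u
        proof -
          have "1 - N\<^sup>2 * (A + u\<^sup>2 * w) \<noteq> 0" using small[of N u] that True by auto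
          then show ?thesis using w
            by (auto intro!: derivative_eq_intros simp: power2_eq_square divide_simps)
        qed
      qed (use q in auto)
      also have "1 / (2 * w * (1 - N\<^sup>2 * (A + q\<^sup>2 * w))) - 1 / (2 * w * (1 - N\<^sup>2 * (A + 0\<^sup>2 * w)))
         = 1 / (2 * w) * (1 / (1 - N\<^sup>2 * \<rho>) - 1 / (1 - N\<^sup>2 * A))"
        unfolding \<rho>_def by (simp add: right_diff_distrib)
      finally show ?thesis using True by (simp add: indicator_def)
    qed simp
  qed
  also have "\<dots> = ennreal (1 / (2 * w) * (artanh (a * sqrt \<rho>) / sqrt \<rho> - artanh (a * sqrt A) / sqrt A) -
      1 / (2 * w) * (artanh (0 * sqrt \<rho>) / sqrt \<rho> - artanh (0 * sqrt A) / sqrt A))"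
  proof (rule nn_integral_FTC[where f="\<lambda>N. 1 / (2 * w) * (1 / (1 - N\<^sup>2 * \<rho>) - 1 / (1 - N\<^sup>2 * A))" and
        F="\<lambda>N. 1 / (2 * w) * (artanh (N * sqrt \<rho>) / sqrt \<rho> - artanh (N * sqrt A) / sqrt A)"])
    show "0 \<le> 1 / (2 * w) * (1 / (1 - N\<^sup>2 * \<rho>) - 1 / (1 - N\<^sup>2 * A))" if N: "0 \<le> N" "N \<le> a" for N
    proof -
      have "1 - N\<^sup>2 * \<rho> \<le> 1 - N\<^sup>2 * A" using \<rho> by (simp add: mult_left_mono)
      moreover have "0 < 1 - N\<^sup>2 * \<rho>" using small[OF N, of q] q unfolding \<rho>_def by simp
      ultimately have "1 / (1 - N\<^sup>2 * A) \<le> 1 / (1 - N\<^sup>2 * \<rho>)" by (simp add: frac_le)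
      then show ?thesis using w by simp
    qed
    have d: "((\<lambda>N. artanh (N * sqrt \<beta>) / sqrt \<beta>) has_real_derivative 1 / (1 - N\<^sup>2 * \<beta>)) (at N)"
      if "0 < \<beta>" "N\<^sup>2 * \<beta> < 1" for N \<beta> :: real
    proof -
      have "\<bar>N * sqrt \<beta>\<bar> < 1"
        using that by (intro power2_less_imp_less[where y=1]) (auto simp: power_mult_distrib)
      then have "((\<lambda>N. artanh (N * sqrt \<beta>)) has_real_derivative 1 / (1 - (N * sqrt \<beta>)\<^sup>2) * sqrt \<beta>) (at N)"
        by (intro DERIV_chain2[where f=artanh] artanh_real_has_field_derivative)
           (auto intro!: derivative_eq_intros)
      from DERIV_cdivide[OF this, of "sqrt \<beta>"] show ?thesis
        using that by (simp add: power_mult_distrib)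
    qed
    show "((\<lambda>N. 1 / (2 * w) * (artanh (N * sqrt \<rho>) / sqrt \<rho> - artanh (N * sqrt A) / sqrt A)) has_real_derivative
      1 / (2 * w) * (1 / (1 - N\<^sup>2 * \<rho>) - 1 / (1 - N\<^sup>2 * A))) (at N)" if N: "0 \<le> N" "N \<le> a" for N
      using small[OF N, of q] small[OF N, of 0] q A \<rho>
      by (intro DERIV_cmult DERIV_diff d) (auto simp: \<rho>_def)
  qed (use a in auto)
  also have "1 / (2 * w) * (artanh (a * sqrt \<rho>) / sqrt \<rho> - artanh (a * sqrt A) / sqrt A) -
      1 / (2 * w) * (artanh (0 * sqrt \<rho>) / sqrt \<rho> - artanh (0 * sqrt A) / sqrt A) =
      a / (2 * w) * (Phi (a\<^sup>2 * (A + q\<^sup>2 * w)) - Phi (a\<^sup>2 * A))"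
    using a w unfolding Phi_def \<rho>_def[symmetric] by (simp add: real_sqrt_mult right_diff_distrib mult.commute)
  finally show ?thesis .
qed

text \<open>\<open>N\<close> runs along a ray from the outer vertex: \<open>Q N\<close> is
  \<open>1 - \<bar>x\<bar>\<^sup>2\<close>, \<open>k / y \<le> N\<close> is the side beyond the
  polar plane, and the last condition is the hyperball. With \<open>\<theta> = y / k - 1 / N\<close>
  one has \<open>Q N = N\<^sup>2 * (g - k * \<theta>\<^sup>2)\<close> and
  \<open>d\<theta> = dN / N\<^sup>2\<close>, so the integrand becomes
  \<open>1 / (g - k * \<theta>\<^sup>2)\<^sup>2\<close> up to the factor \<open>u\<close>.\<close>

lemma nn_integral_radial_prism:
  fixes y k G r u :: real
  assumes y: "0 < y" and k: "0 < k" and G: "0 < G" and \<gamma>: "0 < y\<^sup>2 / k - G" and r: "0 \<le> r" and u: "0 \<le> u"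
  defines "Q \<equiv> \<lambda>N. - k + 2 * y * N - N\<^sup>2 * G"
  shows "(\<integral>\<^sup>+N. ennreal (N\<^sup>2 * u) * (if k / y \<le> N \<and> 0 < Q N \<and> (k - y * N)\<^sup>2 \<le> (sinh r)\<^sup>2 * k * Q N
        then ennreal (1 / (Q N)\<^sup>2) else 0) * indicator {0..} N \<partial>lborel) =
     ennreal (hyperball_profile r / sqrt k * (u / (sqrt (y\<^sup>2 / k - G) * (y\<^sup>2 / k - G))))"
proof -
  define g where "g = y\<^sup>2 / k - G"
  have g: "0 < g" using \<gamma> by (simp add: g_def)
  define \<theta> where "\<theta> N = y / k - 1 / N" for N
  have Q: "Q N = N\<^sup>2 * (g - k * (\<theta> N)\<^sup>2)" if "0 < N" for N
    using k that unfolding Q_def g_def \<theta>_def by (simp add: field_simps power2_eq_square)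
  have T: "(k - y * N)\<^sup>2 = N\<^sup>2 * (k\<^sup>2 * (\<theta> N)\<^sup>2)" if "0 < N" for N
    using k that unfolding \<theta>_def by (simp add: field_simps power2_eq_square)
  \<comment> \<open>\<open>\<theta> N * sqrt (k / g)\<close> is the tanh of the distance from the
    polar plane, so height \<open>r\<close> is reached at \<open>\<theta>m\<close>, that is at
    \<open>Nm\<close>.\<close>
  define \<theta>m where "\<theta>m = sqrt (g / k) * tanh r"
  have tr: "0 \<le> tanh r" "tanh r < 1" using r by (auto simp: tanh_real_lt_1)
  have \<theta>m0: "0 \<le> \<theta>m" using g k tr by (simp add: \<theta>m_def)
  \<comment> \<open>\<open>0 < G\<close> enters here: it makes the equidistant surface of height
    \<open>r\<close> meet the ray at a finite \<open>Nm\<close>.\<close>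
  have \<theta>m1: "\<theta>m < y / k"
  proof -
    have "\<theta>m \<le> sqrt (g / k)" using g k tr by (simp add: \<theta>m_def mult_left_le)
    also have "\<dots> < sqrt ((y / k)\<^sup>2)" using G k by (simp add: g_def field_simps power2_eq_square)
    also have "\<dots> = y / k" using y k by simp
    finally show ?thesis .
  qed
  define Nm where "Nm = 1 / (y / k - \<theta>m)"
  have Nm: "k / y \<le> Nm" using \<theta>m0 \<theta>m1 y k unfolding Nm_def by (simp add: field_simps)
  have ch: "(cosh r)\<^sup>2 = 1 + (sinh r)\<^sup>2" by (simp add: cosh_square_eq)
  have \<theta>m2: "k * \<theta>m\<^sup>2 * (1 + (sinh r)\<^sup>2) = (sinh r)\<^sup>2 * g"
    using g k unfolding \<theta>m_def ch[symmetric] by (simp add: tanh_def power_mult_distrib power_divide)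
  have cond: "(k / y \<le> N \<and> 0 < Q N \<and> (k - y * N)\<^sup>2 \<le> (sinh r)\<^sup>2 * k * Q N) \<longleftrightarrow> N \<in> {k/y..Nm}"
    if N: "0 \<le> N" for N
  proof (cases "k / y \<le> N")
    case True
    then have N0: "0 < N" using y k by (meson divide_pos_pos less_le_trans)
    have \<theta>0: "0 \<le> \<theta> N" using True N0 y k unfolding \<theta>_def by (simp add: field_simps)
    have "(k - y * N)\<^sup>2 \<le> (sinh r)\<^sup>2 * k * Q N \<longleftrightarrow> (N\<^sup>2 * k) * (k * (\<theta> N)\<^sup>2) \<le> (N\<^sup>2 * k) * ((sinh r)\<^sup>2 * (g - k * (\<theta> N)\<^sup>2))"
      unfolding T[OF N0] Q[OF N0] by (simp add: power2_eq_square algebra_simps)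
    also have "\<dots> \<longleftrightarrow> k * (\<theta> N)\<^sup>2 \<le> (sinh r)\<^sup>2 * (g - k * (\<theta> N)\<^sup>2)"
      using N0 k by (subst mult_le_cancel_left_pos) auto
    also have "\<dots> \<longleftrightarrow> k * (\<theta> N)\<^sup>2 * (1 + (sinh r)\<^sup>2) \<le> k * \<theta>m\<^sup>2 * (1 + (sinh r)\<^sup>2)"
      unfolding \<theta>m2 by (simp add: algebra_simps)
    finally have e1: "(k - y * N)\<^sup>2 \<le> (sinh r)\<^sup>2 * k * Q N \<longleftrightarrow>
      k * (\<theta> N)\<^sup>2 * (1 + (sinh r)\<^sup>2) \<le> k * \<theta>m\<^sup>2 * (1 + (sinh r)\<^sup>2)" .
    also have "\<dots> \<longleftrightarrow> (\<theta> N)\<^sup>2 \<le> \<theta>m\<^sup>2"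
    proof -
      have "0 < 1 + (sinh r)\<^sup>2" by (simp add: add_pos_nonneg)
      then show ?thesis using k by (simp add: mult_le_cancel_right mult_le_cancel_left)
    qed
    also have "\<dots> \<longleftrightarrow> \<theta> N \<le> \<theta>m" using \<theta>0 \<theta>m0 by (simp add: power_mono_iff)
    also have "\<dots> \<longleftrightarrow> N \<le> Nm"
      using N0 \<theta>m1 unfolding Nm_def \<theta>_def by (simp add: field_simps)
    finally have eq: "(k - y * N)\<^sup>2 \<le> (sinh r)\<^sup>2 * k * Q N \<longleftrightarrow> N \<le> Nm" .
    have "0 < Q N" if "N \<le> Nm"
    proof -
      have "k * (\<theta> N)\<^sup>2 * (1 + (sinh r)\<^sup>2) \<le> (sinh r)\<^sup>2 * g"
        using eq e1 that unfolding \<theta>m2 by simp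
      also have "\<dots> < (1 + (sinh r)\<^sup>2) * g" using g by simp
      finally have "k * (\<theta> N)\<^sup>2 < g"
        by (simp add: mult.commute[of "1 + (sinh r)\<^sup>2"] mult_less_cancel_right add_pos_nonneg not_less)
      then show ?thesis unfolding Q[OF N0] using N0 by simp
    qed
    then show ?thesis using eq True by auto
  qed simp
  have "(\<integral>\<^sup>+N. ennreal (N\<^sup>2 * u) * (if k / y \<le> N \<and> 0 < Q N \<and> (k - y * N)\<^sup>2 \<le> (sinh r)\<^sup>2 * k * Q N
        then ennreal (1 / (Q N)\<^sup>2) else 0) * indicator {0..} N \<partial>lborel) =
     (\<integral>\<^sup>+N. ennreal (N\<^sup>2 * u / (Q N)\<^sup>2) * indicator {k/y..Nm} N \<partial>lborel)"
  proof (rule nn_integral_cong)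
    fix N :: real
    have ky: "0 < k / y" using y k by simp
    show "ennreal (N\<^sup>2 * u) * (if k / y \<le> N \<and> 0 < Q N \<and> (k - y * N)\<^sup>2 \<le> (sinh r)\<^sup>2 * k * Q N
        then ennreal (1 / (Q N)\<^sup>2) else 0) * indicator {0..} N = ennreal (N\<^sup>2 * u / (Q N)\<^sup>2) * indicator {k/y..Nm} N"
    proof (cases "N \<in> {k/y..Nm}")
      case True
      then have N: "0 \<le> N" using ky by simp
      then show ?thesis using True u by (subst cond[OF N]) (simp add: ennreal_mult[symmetric])
    next
      case False
      then show ?thesis
        by (cases "0 \<le> N") (simp_all only: cond if_False, simp_all add: indicator_def)
    qed
  qed
  also have "\<dots> = ennreal (u / (sqrt k * sqrt g * g) *
        ((\<theta> Nm * sqrt (k / g) / (1 - (\<theta> Nm * sqrt (k / g))\<^sup>2) + artanh (\<theta> Nm * sqrt (k / g))) / 2) -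
      u / (sqrt k * sqrt g * g) *
        ((\<theta> (k/y) * sqrt (k / g) / (1 - (\<theta> (k/y) * sqrt (k / g))\<^sup>2) + artanh (\<theta> (k/y) * sqrt (k / g))) / 2))"
  proof (rule nn_integral_FTC[where f="\<lambda>N. N\<^sup>2 * u / (Q N)\<^sup>2" and
        F="\<lambda>N. u / (sqrt k * sqrt g * g) * ((\<theta> N * sqrt (k / g) / (1 - (\<theta> N * sqrt (k / g))\<^sup>2)
      + artanh (\<theta> N * sqrt (k / g))) / 2)"])
    show "(\<lambda>N. N\<^sup>2 * u / (Q N)\<^sup>2) \<in> borel_measurable borel" unfolding Q_def by measurable
    fix N assume N: "k / y \<le> N" "N \<le> Nm"
    show "0 \<le> N\<^sup>2 * u / (Q N)\<^sup>2" using u by simp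
    have N0: "0 < N" using N y k by (meson divide_pos_pos less_le_trans)
    define v where "v = sqrt (k / g)"
    have v: "0 < v" "v\<^sup>2 = k / g" using k g by (auto simp: v_def)
    have "0 < Q N" using cond[of N] N N0 by auto
    then have "0 < g - k * (\<theta> N)\<^sup>2" using N0 unfolding Q[OF N0] by (simp add: zero_less_mult_iff)
    then have lt: "(\<theta> N * v)\<^sup>2 < 1" using g by (simp add: power_mult_distrib v field_simps)
    then have ab: "\<bar>\<theta> N * v\<bar> < 1" by (simp add: abs_square_less_1)
    have d\<theta>: "(\<theta> has_real_derivative 1 / N\<^sup>2) (at N)"
      unfolding \<theta>_def using N0 by (auto intro!: derivative_eq_intros simp: power2_eq_square)
    have dw: "((\<lambda>N. \<theta> N * v) has_real_derivative v / N\<^sup>2) (at N)"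
      using DERIV_cmult_right[OF d\<theta>, of v] by simp
    \<comment> \<open>The primitive of \<open>1 / (1 - w\<^sup>2)\<^sup>2\<close>; at
      \<open>w = tanh r\<close> it equals \<open>(sinh r * cosh r + r) / 2\<close>, which is
      \<open>hyperball_profile r\<close>.\<close>
    have dF: "((\<lambda>w. (w / (1 - w\<^sup>2) + artanh w) / 2) has_real_derivative 1 / (1 - w\<^sup>2)\<^sup>2) (at w)"
      if "\<bar>w\<bar> < 1" for w :: real
    proof -
      have nz: "1 - w\<^sup>2 \<noteq> 0" using that by (metis abs_square_less_1 diff_gt_0_iff_gt less_numeral_extra(3))
      have "((\<lambda>w. (w / (1 - w\<^sup>2) + artanh w) / 2) has_real_derivative
          ((1 * (1 - w\<^sup>2) - w * (- (2 * w))) / ((1 - w\<^sup>2) * (1 - w\<^sup>2)) + 1 / (1 - w\<^sup>2)) / 2) (at w)"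
        using nz by (intro DERIV_cdivide DERIV_add DERIV_divide DERIV_ident artanh_real_has_field_derivative that)
           (auto intro!: derivative_eq_intros)
      moreover have "((1 * (1 - w\<^sup>2) - w * (- (2 * w))) / ((1 - w\<^sup>2) * (1 - w\<^sup>2)) + 1 / (1 - w\<^sup>2)) / 2
          = 1 / (1 - w\<^sup>2)\<^sup>2"
      proof -
        define q where "q = 1 - w\<^sup>2"
        have "w * (- (2 * w)) = 2 * q - 2" "q \<noteq> 0" using nz by (simp_all add: q_def power2_eq_square)
        then show ?thesis
          unfolding q_def[symmetric] by (simp add: power2_eq_square divide_simps)
      qed
      ultimately show ?thesis by simp
    qed
    have "((\<lambda>N. u / (sqrt k * sqrt g * g) * ((\<theta> N * v / (1 - (\<theta> N * v)\<^sup>2) + artanh (\<theta> N * v)) / 2))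
      has_real_derivative u / (sqrt k * sqrt g * g) * (1 / (1 - (\<theta> N * v)\<^sup>2)\<^sup>2 * (v / N\<^sup>2))) (at N)"
      by (intro DERIV_cmult DERIV_chain2[OF dF[OF ab] dw])
    moreover have "u / (sqrt k * sqrt g * g) * (1 / (1 - (\<theta> N * v)\<^sup>2)\<^sup>2 * (v / N\<^sup>2)) = N\<^sup>2 * u / (Q N)\<^sup>2"
    proof -
      have a1: "1 / (sqrt k * sqrt g * g) * v = 1 / g\<^sup>2"
        using k g unfolding v_def by (simp add: real_sqrt_divide power2_eq_square)
      have a2: "1 - (\<theta> N * v)\<^sup>2 = (g - k * (\<theta> N)\<^sup>2) / g"
        using g by (simp add: power_mult_distrib v field_simps)
      have "u / (sqrt k * sqrt g * g) * (1 / (1 - (\<theta> N * v)\<^sup>2)\<^sup>2 * (v / N\<^sup>2)) =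
        u * (1 / (sqrt k * sqrt g * g) * v) / (((g - k * (\<theta> N)\<^sup>2) / g)\<^sup>2 * N\<^sup>2)"
        unfolding a2 by simp
      also have "\<dots> = N\<^sup>2 * u / (Q N)\<^sup>2"
        unfolding a1 Q[OF N0] using g N0 by (simp add: power_divide power_mult_distrib power2_eq_square)
      finally show ?thesis .
    qed
    ultimately show "((\<lambda>N. u / (sqrt k * sqrt g * g) * ((\<theta> N * sqrt (k / g) / (1 - (\<theta> N * sqrt (k / g))\<^sup>2)
      + artanh (\<theta> N * sqrt (k / g))) / 2)) has_real_derivative N\<^sup>2 * u / (Q N)\<^sup>2) (at N)"
      by (simp add: v_def)
  qed (use Nm in auto)
  also have "\<theta> (k/y) = 0" using y k by (simp add: \<theta>_def)
  also have "\<theta> Nm = \<theta>m" using \<theta>m1 by (simp add: \<theta>_def Nm_def)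
  also have "\<theta>m * sqrt (k / g) = tanh r" using k g by (simp add: \<theta>m_def real_sqrt_divide)
  also have "1 - (tanh r)\<^sup>2 = 1 / (cosh r)\<^sup>2"
    by (simp add: tanh_def power_divide divide_simps ch) (smt (verit) zero_le_power2)
  also have "tanh r / (1 / (cosh r)\<^sup>2) = sinh r * cosh r" by (simp add: tanh_def power2_eq_square)
  also have "artanh (tanh r) = r" by (rule artanh_tanh_real)
  also have "u / (sqrt k * sqrt g * g) * ((sinh r * cosh r + r) / 2) -
      u / (sqrt k * sqrt g * g) * ((0 * sqrt (k / g) / (1 - (0 * sqrt (k / g))\<^sup>2) + artanh (0 * sqrt (k / g))) / 2) =
      hyperball_profile r / sqrt k * (u / (sqrt g * g))"
    unfolding hyperball_profile_def sinh_double using k g by (simp add: field_simps)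
  finally show ?thesis unfolding g_def .
qed

text \<open>The double integral is \<open>P\<close> times the area of the triangle in which the
  prism meets the polar plane: an angle defect, half of each angle being
  \<open>pi / 2 - arctan (sqrt (3 / (1 - 2 * k)))\<close>. After the integration over
  \<open>u\<close> the integrand splits into multiples of
  \<open>1 / (c \<tau> * sqrt (g - c \<tau>))\<close> and of \<open>1 / c \<tau>\<close>, and each
  has an arctangent as primitive.\<close>

lemma nn_integral_triangle_area:
  fixes k P :: real
  assumes k: "0 < k" "k < 1/2" and P: "0 \<le> P"
  shows "(\<integral>\<^sup>+\<tau>. (\<integral>\<^sup>+u. ennreal (P / sqrt k * (u / (sqrt (1/(3*k) - u\<^sup>2 * (1/6 + 2 * \<tau>\<^sup>2)) *
            (1/(3*k) - u\<^sup>2 * (1/6 + 2 * \<tau>\<^sup>2))))) * indicator {0..1} u \<partial>lborel) * indicator {- (1/2)..1/2} \<tau> \<partial>lborel) =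
     ennreal (P * (6 * arctan (sqrt (3 / (1 - 2 * k))) - 2 * pi))"
proof -
  define g where "g = 1 / (3 * k)"
  define c where "c \<tau> = 1/6 + 2 * \<tau>\<^sup>2" for \<tau> :: real
  have g: "2/3 < g" using k by (simp add: g_def field_simps)
  have c0: "0 < c \<tau>" for \<tau> by (simp add: c_def add_pos_nonneg)
  have c1: "c \<tau> \<le> 2/3" if "- (1/2) \<le> \<tau>" "\<tau> \<le> 1/2" for \<tau>
  proof -
    have "\<tau>\<^sup>2 \<le> (1/2)\<^sup>2" using that by (subst abs_le_square_iff[symmetric]) auto
    then show ?thesis by (simp add: c_def power2_eq_square)
  qed
  have u1: "u\<^sup>2 * c \<tau> \<le> c \<tau>" if "0 \<le> u" "u \<le> 1" for u \<tau>
    using that c0[of \<tau>] by (simp add: mult_le_cancel_right2 power_le_one)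
  define E where "E \<tau> = 1 / c \<tau> * (1 / sqrt (g - c \<tau>) - 1 / sqrt g)" for \<tau>
  have "(\<integral>\<^sup>+\<tau>. (\<integral>\<^sup>+u. ennreal (P / sqrt k * (u / (sqrt (g - u\<^sup>2 * c \<tau>) *
            (g - u\<^sup>2 * c \<tau>)))) * indicator {0..1} u \<partial>lborel) * indicator {- (1/2)..1/2} \<tau> \<partial>lborel) =
     (\<integral>\<^sup>+\<tau>. ennreal (P / sqrt k * E \<tau>) * indicator {- (1/2)..1/2} \<tau> \<partial>lborel)"
  proof (rule nn_integral_cong)
    fix \<tau> :: real
    show "(\<integral>\<^sup>+u. ennreal (P / sqrt k * (u / (sqrt (g - u\<^sup>2 * c \<tau>) *
            (g - u\<^sup>2 * c \<tau>)))) * indicator {0..1} u \<partial>lborel) * indicator {- (1/2)..1/2} \<tau> =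
      ennreal (P / sqrt k * E \<tau>) * indicator {- (1/2)..1/2} \<tau>"
    proof (cases "\<tau> \<in> {- (1/2)..1/2}")
      case True
      have pos: "0 < g - u\<^sup>2 * c \<tau>" if "0 \<le> u" "u \<le> 1" for u
        using u1[OF that, of \<tau>] c1[of \<tau>] True g by auto
      have "(\<integral>\<^sup>+u. ennreal (P / sqrt k * (u / (sqrt (g - u\<^sup>2 * c \<tau>) *
            (g - u\<^sup>2 * c \<tau>)))) * indicator {0..1} u \<partial>lborel) =
         ennreal (P / sqrt k * (1 / (c \<tau> * sqrt (g - 1\<^sup>2 * c \<tau>))) - P / sqrt k * (1 / (c \<tau> * sqrt (g - 0\<^sup>2 * c \<tau>))))"
      proof (rule nn_integral_FTC[where f="\<lambda>u. P / sqrt k * (u / (sqrt (g - u\<^sup>2 * c \<tau>) * (g - u\<^sup>2 * c \<tau>)))" and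
            F="\<lambda>u. P / sqrt k * (1 / (c \<tau> * sqrt (g - u\<^sup>2 * c \<tau>)))"])
        fix u :: real assume u: "0 \<le> u" "u \<le> 1"
        show "0 \<le> P / sqrt k * (u / (sqrt (g - u\<^sup>2 * c \<tau>) * (g - u\<^sup>2 * c \<tau>)))"
          using pos[OF u] P u k by simp
        have "((\<lambda>u. 1 / (c \<tau> * sqrt (g - u\<^sup>2 * c \<tau>))) has_real_derivative
            u / (sqrt (g - u\<^sup>2 * c \<tau>) * (g - u\<^sup>2 * c \<tau>))) (at u)"
        proof -
          define s where "s = sqrt (g - u\<^sup>2 * c \<tau>)"
          have s: "0 < s" "g - u\<^sup>2 * c \<tau> = s * s" using pos[OF u] by (simp_all add: s_def)
          have "((\<lambda>u. 1 / (c \<tau> * sqrt (g - u\<^sup>2 * c \<tau>))) has_real_derivative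
            - (c \<tau> * (inverse s / 2 * (- (2 * u * c \<tau>)))) / ((c \<tau> * s) * (c \<tau> * s))) (at u)"
            using pos[OF u] c0[of \<tau>] unfolding s_def by (auto intro!: derivative_eq_intros)
          moreover have "- (c \<tau> * (inverse s / 2 * (- (2 * u * c \<tau>)))) / ((c \<tau> * s) * (c \<tau> * s)) =
              u / (s * (g - u\<^sup>2 * c \<tau>))"
            using s c0[of \<tau>] by (simp add: field_simps)
          ultimately show ?thesis unfolding s_def[symmetric] by simp
        qed
        then show "((\<lambda>u. P / sqrt k * (1 / (c \<tau> * sqrt (g - u\<^sup>2 * c \<tau>)))) has_real_derivative
            P / sqrt k * (u / (sqrt (g - u\<^sup>2 * c \<tau>) * (g - u\<^sup>2 * c \<tau>)))) (at u)"
          by (rule DERIV_cmult)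
      qed auto
      also have "P / sqrt k * (1 / (c \<tau> * sqrt (g - 1\<^sup>2 * c \<tau>))) - P / sqrt k * (1 / (c \<tau> * sqrt (g - 0\<^sup>2 * c \<tau>))) =
         P / sqrt k * E \<tau>"
        unfolding E_def by (simp add: right_diff_distrib)
      finally show ?thesis using True by simp
    qed simp
  qed
  also have "\<dots> = ennreal (P / sqrt k * (sqrt 3 / sqrt g * (arctan (2 * sqrt 3 * (1/2) * sqrt g / sqrt (g - c (1/2))) - arctan (2 * sqrt 3 * (1/2)))) -
      P / sqrt k * (sqrt 3 / sqrt g * (arctan (2 * sqrt 3 * (- (1/2)) * sqrt g / sqrt (g - c (- (1/2)))) - arctan (2 * sqrt 3 * (- (1/2))))))"
  proof (rule nn_integral_FTC[where f="\<lambda>\<tau>. P / sqrt k * E \<tau>" and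
      F="\<lambda>\<tau>. P / sqrt k * (sqrt 3 / sqrt g * (arctan (2 * sqrt 3 * \<tau> * sqrt g / sqrt (g - c \<tau>)) - arctan (2 * sqrt 3 * \<tau>)))"])
    show "(\<lambda>\<tau>. P / sqrt k * E \<tau>) \<in> borel_measurable borel" unfolding E_def c_def by measurable
    fix \<tau> :: real assume \<tau>: "- (1/2) \<le> \<tau>" "\<tau> \<le> 1/2"
    define D where "D = g - c \<tau>"
    have D: "0 < D" using c1[OF \<tau>] g by (simp add: D_def)
    have "sqrt D \<le> sqrt g" using c0[of \<tau>] by (simp add: D_def)
    then have "1 / sqrt g \<le> 1 / sqrt D" using D by (intro frac_le) auto
    then show "0 \<le> P / sqrt k * E \<tau>" using P k c0[of \<tau>] unfolding E_def D_def by simp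
    have e1: "((\<lambda>\<tau>. 2 * sqrt 3 * \<tau> * sqrt g / sqrt (g - c \<tau>)) has_real_derivative
        2 * sqrt 3 * sqrt g * (g - 1/6) / (D * sqrt D)) (at \<tau>)"
    proof -
      have "((\<lambda>\<tau>. 2 * sqrt 3 * \<tau> * sqrt g / sqrt (g - c \<tau>)) has_real_derivative
        (2 * sqrt 3 * sqrt g * sqrt D - 2 * sqrt 3 * \<tau> * sqrt g * (inverse (sqrt D) / 2 * (- (4 * \<tau>)))) / (sqrt D * sqrt D)) (at \<tau>)"
        using D unfolding D_def c_def by (auto intro!: derivative_eq_intros)
      moreover have "(2 * sqrt 3 * sqrt g * sqrt D - 2 * sqrt 3 * \<tau> * sqrt g * (inverse (sqrt D) / 2 * (- (4 * \<tau>)))) / (sqrt D * sqrt D)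
        = 2 * sqrt 3 * sqrt g * (sqrt D * sqrt D + 2 * \<tau>\<^sup>2) / (D * sqrt D)"
        using D by (simp add: field_simps power2_eq_square)
      moreover have "sqrt D * sqrt D + 2 * \<tau>\<^sup>2 = g - 1/6" using D by (simp add: D_def c_def)
      ultimately show ?thesis by simp
    qed
    have e2: "1 + (2 * sqrt 3 * \<tau> * sqrt g / sqrt (g - c \<tau>))\<^sup>2 = (g - 1/6) * (6 * c \<tau>) / D"
      using D g unfolding D_def[symmetric]
      by (simp add: power_divide power_mult_distrib field_simps) (simp add: D_def c_def algebra_simps)
    have d1: "((\<lambda>\<tau>. arctan (2 * sqrt 3 * \<tau> * sqrt g / sqrt (g - c \<tau>))) has_real_derivative
        inverse (1 + (2 * sqrt 3 * \<tau> * sqrt g / sqrt (g - c \<tau>))\<^sup>2) * (2 * sqrt 3 * sqrt g * (g - 1/6) / (D * sqrt D))) (at \<tau>)"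
      by (rule DERIV_chain2[OF DERIV_arctan e1])
    have d1': "inverse (1 + (2 * sqrt 3 * \<tau> * sqrt g / sqrt (g - c \<tau>))\<^sup>2) * (2 * sqrt 3 * sqrt g * (g - 1/6) / (D * sqrt D))
       = sqrt 3 * sqrt g / (3 * c \<tau> * sqrt D)"
      unfolding e2 using D g c0[of \<tau>] by (simp add: field_simps)
    have d2: "((\<lambda>\<tau>. arctan (2 * sqrt 3 * \<tau>)) has_real_derivative sqrt 3 / (3 * c \<tau>)) (at \<tau>)"
    proof -
      have "((\<lambda>\<tau>. arctan (2 * sqrt 3 * \<tau>)) has_real_derivative inverse (1 + (2 * sqrt 3 * \<tau>)\<^sup>2) * (2 * sqrt 3)) (at \<tau>)"
        by (rule DERIV_chain2[OF DERIV_arctan]) (auto intro!: derivative_eq_intros)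
      moreover have "1 + (2 * sqrt 3 * \<tau>)\<^sup>2 = 6 * c \<tau>" by (simp add: power_mult_distrib c_def)
      ultimately show ?thesis by (simp add: field_simps)
    qed
    have "((\<lambda>\<tau>. sqrt 3 / sqrt g * (arctan (2 * sqrt 3 * \<tau> * sqrt g / sqrt (g - c \<tau>)) - arctan (2 * sqrt 3 * \<tau>)))
      has_real_derivative sqrt 3 / sqrt g * (sqrt 3 * sqrt g / (3 * c \<tau> * sqrt D) - sqrt 3 / (3 * c \<tau>))) (at \<tau>)"
      using d1 d2 unfolding d1' by (intro DERIV_cmult DERIV_diff)
    moreover have "sqrt 3 / sqrt g * (sqrt 3 * sqrt g / (3 * c \<tau> * sqrt D) - sqrt 3 / (3 * c \<tau>)) = E \<tau>"
      using D g c0[of \<tau>] unfolding E_def D_def[symmetric] by (simp add: field_simps)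
    ultimately show "((\<lambda>\<tau>. P / sqrt k * (sqrt 3 / sqrt g * (arctan (2 * sqrt 3 * \<tau> * sqrt g / sqrt (g - c \<tau>)) - arctan (2 * sqrt 3 * \<tau>))))
      has_real_derivative P / sqrt k * E \<tau>) (at \<tau>)"
      by (intro DERIV_cmult) simp
  qed simp
  also have "P / sqrt k * (sqrt 3 / sqrt g * (arctan (2 * sqrt 3 * (1/2) * sqrt g / sqrt (g - c (1/2))) - arctan (2 * sqrt 3 * (1/2)))) -
      P / sqrt k * (sqrt 3 / sqrt g * (arctan (2 * sqrt 3 * (- (1/2)) * sqrt g / sqrt (g - c (- (1/2)))) - arctan (2 * sqrt 3 * (- (1/2)))))
     = P * (6 * arctan (sqrt (3 / (1 - 2 * k))) - 2 * pi)"
  proof -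
    have c12: "c (1/2) = 2/3" "c (- (1/2)) = 2/3" by (simp_all add: c_def power2_eq_square)
    have a: "2 * sqrt 3 * (1/2) * sqrt g / sqrt (g - 2/3) = sqrt (3 / (1 - 2 * k))"
    proof -
      have "2 * sqrt 3 * (1/2) * sqrt g / sqrt (g - 2/3) = sqrt (3 * g / (g - 2/3))"
        by (simp add: real_sqrt_mult real_sqrt_divide)
      also have "3 * g / (g - 2/3) = 3 / (1 - 2 * k)" using k by (simp add: g_def field_simps)
      finally show ?thesis .
    qed
    have b: "2 * sqrt 3 * (- (1/2)) * sqrt g / sqrt (g - 2/3) = - sqrt (3 / (1 - 2 * k))"
      using a by simp
    have t: "arctan (sqrt 3) = pi / 3"
      using arctan_unique[of "pi/3" "sqrt 3"] tan_60 by (simp add: field_simps)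
    have s: "sqrt 3 / sqrt g / sqrt k = 3"
    proof -
      have "sqrt 3 / sqrt g / sqrt k = sqrt (3 / g / k)" by (simp add: real_sqrt_divide real_sqrt_mult)
      also have "3 / g / k = 3\<^sup>2" using k by (simp add: g_def power2_eq_square)
      finally show ?thesis by simp
    qed
    have "P / sqrt k * (sqrt 3 / sqrt g * (arctan (sqrt (3 / (1 - 2 * k))) - pi/3)) -
      P / sqrt k * (sqrt 3 / sqrt g * (arctan (- sqrt (3 / (1 - 2 * k))) - - (pi/3))) =
      P * (sqrt 3 / sqrt g / sqrt k) * (2 * arctan (sqrt (3 / (1 - 2 * k))) - 2 * (pi/3))"
      by (simp add: arctan_minus algebra_simps)
    also have "\<dots> = P * (6 * arctan (sqrt (3 / (1 - 2 * k))) - 2 * pi)"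
      unfolding s by (simp add: algebra_simps)
    finally show ?thesis unfolding c12 a b
      by (simp add: t arctan_minus)
  qed
  finally show ?thesis unfolding g_def c_def .
qed

text \<open>Placing the origin at the cube vertex by \<open>x = (y - a, b - y, c - y)\<close> turns
  the three cube faces through it into \<open>0 \<le> a, b, c\<close>. Written as
  \<open>-1 * (a - N / 3) \<le> 1/3 * N\<close> with \<open>N = a + b + c\<close>, this is the
  symmetric cone for \<open>\<sigma> = -1\<close>, \<open>r = 1/3\<close>; the rest of the integrand
  depends on \<open>N\<close> and \<open>a\<^sup>2 + b\<^sup>2 + c\<^sup>2\<close> only.\<close>

lemma nn_integral_hyperball_prism:
  fixes y r :: real
  assumes y: "0 < y" "1/3 < y\<^sup>2" "y\<^sup>2 < 1/2" and r: "0 \<le> r"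
  defines "k \<equiv> 3 * y\<^sup>2 - 1"
  shows "(\<integral>\<^sup>+x. (if x $ 1 \<le> y \<and> - x $ 2 \<le> y \<and> - x $ 3 \<le> y \<and> y * (x $ 1 - x $ 2 - x $ 3) \<le> 1 \<and>
        0 < 1 - ((x $ 1)\<^sup>2 + (x $ 2)\<^sup>2 + (x $ 3)\<^sup>2) \<and>
        (y * (x $ 1 - x $ 2 - x $ 3) - 1)\<^sup>2 \<le> (sinh r)\<^sup>2 * k * (1 - ((x $ 1)\<^sup>2 + (x $ 2)\<^sup>2 + (x $ 3)\<^sup>2))
      then ennreal (1 / (1 - ((x $ 1)\<^sup>2 + (x $ 2)\<^sup>2 + (x $ 3)\<^sup>2))\<^sup>2) else 0) \<partial>(lborel :: (real^3) measure)) =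
    ennreal (hyperball_profile r * (6 * arctan (sqrt (3 / (1 - 2 * k))) - 2 * pi))"
proof -
  have k: "0 < k" "k < 1/2" using y(2,3) unfolding k_def by linarith+
  have P: "0 \<le> hyperball_profile r" using r by (simp add: hyperball_profile_def)
  define H :: "real \<Rightarrow> real \<Rightarrow> ennreal" where "H N Q =
     (if k / y \<le> N \<and> 0 < - k + 2 * y * N - Q \<and> (k - y * N)\<^sup>2 \<le> (sinh r)\<^sup>2 * k * (- k + 2 * y * N - Q)
        then ennreal (1 / (- k + 2 * y * N - Q)\<^sup>2) else 0)" for N Q
  have "(\<lambda>x. H (fst x) (snd x)) \<in> borel_measurable (borel \<Otimes>\<^sub>M borel)"
    unfolding H_def by measurable
  then have H [measurable]: "case_prod H \<in> borel_measurable (borel \<Otimes>\<^sub>M borel)"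
    by (simp add: case_prod_beta')
  define K where "K a b c = (if a \<le> y \<and> - b \<le> y \<and> - c \<le> y \<and> y * (a - b - c) \<le> 1 \<and>
        0 < 1 - (a\<^sup>2 + b\<^sup>2 + c\<^sup>2) \<and>
        (y * (a - b - c) - 1)\<^sup>2 \<le> (sinh r)\<^sup>2 * k * (1 - (a\<^sup>2 + b\<^sup>2 + c\<^sup>2))
      then ennreal (1 / (1 - (a\<^sup>2 + b\<^sup>2 + c\<^sup>2))\<^sup>2) else 0)" for a b c
  have Km [measurable]: "(\<lambda>x. K (f x) (g x) (h x)) \<in> borel_measurable X"
    if [measurable]: "f \<in> borel_measurable X" "g \<in> borel_measurable X" "h \<in> borel_measurable X"
    for f g h and X :: "'x measure"
    unfolding K_def by measurable
  have KH: "K (y + -1 * a) (- y + b) (- y + c) =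
      (if -1 * (a - (a + b + c) / 3) \<le> 1/3 * (a + b + c) \<and>
          -1 * (b - (a + b + c) / 3) \<le> 1/3 * (a + b + c) \<and>
          -1 * (c - (a + b + c) / 3) \<le> 1/3 * (a + b + c)
       then H (a + b + c) (a\<^sup>2 + b\<^sup>2 + c\<^sup>2) else 0)" for a b c
  proof -
    have q: "1 - ((y + -1 * a)\<^sup>2 + (- y + b)\<^sup>2 + (- y + c)\<^sup>2) = - k + 2 * y * (a + b + c) - (a\<^sup>2 + b\<^sup>2 + c\<^sup>2)"
      by (simp add: k_def power2_eq_square algebra_simps)
    have s: "y * (y + -1 * a - (- y + b) - (- y + c)) - 1 = k - y * (a + b + c)"
      by (simp add: k_def power2_eq_square algebra_simps)
    then have s': "y * (y + -1 * a - (- y + b) - (- y + c)) \<le> 1 \<longleftrightarrow> k / y \<le> a + b + c"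
      using y(1) by (simp add: field_simps) linarith?
    have t: "y + -1 * a \<le> y \<longleftrightarrow> -1 * (a - (a + b + c) / 3) \<le> 1/3 * (a + b + c)"
      "- (- y + b) \<le> y \<longleftrightarrow> -1 * (b - (a + b + c) / 3) \<le> 1/3 * (a + b + c)"
      "- (- y + c) \<le> y \<longleftrightarrow> -1 * (c - (a + b + c) / 3) \<le> 1/3 * (a + b + c)"
      by (auto simp: field_simps)
    show ?thesis unfolding K_def H_def q s s' t by auto
  qed
  have "(\<integral>\<^sup>+x. K (x $ 1) (x $ 2) (x $ 3) \<partial>(lborel :: (real^3) measure)) =
     (\<integral>\<^sup>+a. \<integral>\<^sup>+b. \<integral>\<^sup>+c. K a b c \<partial>lborel \<partial>lborel \<partial>lborel)"
  proof -
    have "(\<lambda>x::real^3. K (x $ 1) (x $ 2) (x $ 3)) \<in> borel_measurable borel" by measurable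
    from nn_integral_lborel_vec3[OF this] show ?thesis by simp
  qed
  also have "\<dots> = (\<integral>\<^sup>+a. \<integral>\<^sup>+b. \<integral>\<^sup>+c. K (y + -1 * a) b c \<partial>lborel \<partial>lborel \<partial>lborel)"
    using nn_integral_affine[of "\<lambda>a. \<integral>\<^sup>+b. \<integral>\<^sup>+c. K a b c \<partial>lborel \<partial>lborel" "-1" y] by simp
  also have "\<dots> = (\<integral>\<^sup>+a. \<integral>\<^sup>+b. \<integral>\<^sup>+c. K (y + -1 * a) (- y + b) c \<partial>lborel \<partial>lborel \<partial>lborel)"
    by (rule nn_integral_cong, rule nn_integral_shift) measurable
  also have "\<dots> = (\<integral>\<^sup>+a. \<integral>\<^sup>+b. \<integral>\<^sup>+c. K (y + -1 * a) (- y + b) (- y + c) \<partial>lborel \<partial>lborel \<partial>lborel)"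
    by (rule nn_integral_cong, rule nn_integral_cong, rule nn_integral_shift) measurable
  also have "\<dots> = (\<integral>\<^sup>+N. \<integral>\<^sup>+M. \<integral>\<^sup>+L.
      (if 0 \<le> M \<and> M \<le> 3 * (1/3) * N \<and> - (1/2) * M \<le> L \<and> L \<le> 1/2 * M
       then H N (1/3 * N\<^sup>2 + 1/6 * M\<^sup>2 + 2 * L\<^sup>2) else 0) \<partial>lborel \<partial>lborel \<partial>lborel)"
    unfolding KH by (rule nn_integral_symmetric_cone[OF H]) simp
  also have "\<dots> = (\<integral>\<^sup>+\<tau>. (\<integral>\<^sup>+u. (\<integral>\<^sup>+N. ennreal (N\<^sup>2 * u) * H N (N\<^sup>2 * (1/3 + u\<^sup>2 * (1/6 + 2 * \<tau>\<^sup>2))) * indicator {0..} N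
        \<partial>lborel) * indicator {0..3 * (1/3)} u \<partial>lborel) * indicator {- (1/2)..1/2} \<tau> \<partial>lborel)"
    by (rule nn_integral_cone_scaling[OF H]) simp
  also have "\<dots> = (\<integral>\<^sup>+\<tau>. (\<integral>\<^sup>+u. ennreal (hyperball_profile r / sqrt k * (u / (sqrt (1/(3*k) - u\<^sup>2 * (1/6 + 2 * \<tau>\<^sup>2)) *
            (1/(3*k) - u\<^sup>2 * (1/6 + 2 * \<tau>\<^sup>2))))) * indicator {0..1} u \<partial>lborel) * indicator {- (1/2)..1/2} \<tau> \<partial>lborel)"
  proof (rule nn_integral_cong)
    fix \<tau> :: real
    have "(\<integral>\<^sup>+N. ennreal (N\<^sup>2 * u) * H N (N\<^sup>2 * (1/3 + u\<^sup>2 * (1/6 + 2 * \<tau>\<^sup>2))) * indicator {0..} N \<partial>lborel) =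
       ennreal (hyperball_profile r / sqrt k * (u / (sqrt (1/(3*k) - u\<^sup>2 * (1/6 + 2 * \<tau>\<^sup>2)) *
            (1/(3*k) - u\<^sup>2 * (1/6 + 2 * \<tau>\<^sup>2)))))" if \<tau>: "- (1/2) \<le> \<tau>" "\<tau> \<le> 1/2" and u: "0 \<le> u" "u \<le> 1" for u
    proof -
      define G where "G = 1/3 + u\<^sup>2 * (1/6 + 2 * \<tau>\<^sup>2)"
      have c1: "1/6 + 2 * \<tau>\<^sup>2 \<le> 2/3"
      proof -
        have "\<tau>\<^sup>2 \<le> (1/2)\<^sup>2" using \<tau> by (subst abs_le_square_iff[symmetric]) auto
        then show ?thesis by (simp add: power2_eq_square)
      qed
      have "u\<^sup>2 * (1/6 + 2 * \<tau>\<^sup>2) \<le> 1 * (2/3)" using u c1 by (intro mult_mono) (auto simp: power_le_one)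
      moreover have g: "y\<^sup>2 / k - G = 1/(3*k) - u\<^sup>2 * (1/6 + 2 * \<tau>\<^sup>2)"
        using k by (simp add: G_def k_def field_simps)
      moreover have "2/3 < 1/(3*k)" using k by (simp add: field_simps)
      ultimately have \<gamma>: "0 < y\<^sup>2 / k - G" by simp
      have G: "0 < G" unfolding G_def by (simp add: add_pos_nonneg)
      show ?thesis
        using nn_integral_radial_prism[OF y(1) k(1) G \<gamma> r u(1)] unfolding H_def G_def[symmetric] g .
    qed
    then show "(\<integral>\<^sup>+u. (\<integral>\<^sup>+N. ennreal (N\<^sup>2 * u) * H N (N\<^sup>2 * (1/3 + u\<^sup>2 * (1/6 + 2 * \<tau>\<^sup>2))) * indicator {0..} N
        \<partial>lborel) * indicator {0..3 * (1/3)} u \<partial>lborel) * indicator {- (1/2)..1/2} \<tau> =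
      (\<integral>\<^sup>+u. ennreal (hyperball_profile r / sqrt k * (u / (sqrt (1/(3*k) - u\<^sup>2 * (1/6 + 2 * \<tau>\<^sup>2)) *
            (1/(3*k) - u\<^sup>2 * (1/6 + 2 * \<tau>\<^sup>2))))) * indicator {0..1} u \<partial>lborel) * indicator {- (1/2)..1/2} \<tau>"
      by (cases "\<tau> \<in> {- (1/2)..1/2}") (auto intro!: nn_integral_cong split: split_indicator)
  qed
  also have "\<dots> = ennreal (hyperball_profile r * (6 * arctan (sqrt (3 / (1 - 2 * k))) - 2 * pi))"
    by (rule nn_integral_triangle_area[OF k P])
  finally show ?thesis unfolding K_def .
qed

subsection \<open>Volume of the truncated octant\<close>

text \<open>The Klein volume of a cone from the origin with base in the plane \<open>N = a\<close>, in coordinates \<open>(N, u, \<tau>)\<close> with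
  \<open>0 \<le> N \<le> a\<close>, \<open>0 \<le> u \<le> q\<close>, \<open>0 \<le> \<tau> \<le> m\<close> in which \<open>\<bar>x\<bar>\<^sup>2 = N\<^sup>2 * (A + u\<^sup>2 * (B + C * \<tau>\<^sup>2))\<close> and the Jacobian
  is \<open>N\<^sup>2 * u\<close>: \<open>cone_density\<close> is the result of integrating over \<open>N\<close> and \<open>u\<close>.\<close>

definition cone_density :: "real \<Rightarrow> real \<Rightarrow> real \<Rightarrow> real \<Rightarrow> real \<Rightarrow> real \<Rightarrow> real" where
  "cone_density A B C a q \<tau> =
     a / (2 * (B + C * \<tau>\<^sup>2)) * (Phi (a\<^sup>2 * (A + q\<^sup>2 * (B + C * \<tau>\<^sup>2))) - Phi (a\<^sup>2 * A))"

lemma borel_measurable_cone_density [measurable]: "cone_density A B C a q \<in> borel_measurable borel"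
  unfolding cone_density_def Phi_def artanh_def by measurable

lemma cone_density_minus [simp]: "cone_density A B C a q (- \<tau>) = cone_density A B C a q \<tau>"
  by (simp add: cone_density_def)

text \<open>Half of the symmetric range, as \<open>cone_density\<close> is even in
  \<open>\<tau>\<close>. The value stays in \<open>ennreal\<close>, so that pointwise bounds of the
  density transfer without integrability.\<close>

definition wedge_volume :: "real \<Rightarrow> real \<Rightarrow> real \<Rightarrow> real \<Rightarrow> real \<Rightarrow> real \<Rightarrow> ennreal" where
  "wedge_volume A B C a q m = (\<integral>\<^sup>+\<tau>. ennreal (cone_density A B C a q \<tau>) * indicator {0..m} \<tau> \<partial>lborel)"

lemma nn_integral_cone_density_symmetric:
  assumes "0 \<le> m"
  shows "(\<integral>\<^sup>+\<tau>. ennreal (cone_density A B C a q \<tau>) * indicator {- m..m} \<tau> \<partial>lborel) = 2 * wedge_volume A B C a q m"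
proof -
  have "(\<integral>\<^sup>+\<tau>. ennreal (cone_density A B C a q \<tau>) * indicator {- m..m} \<tau> \<partial>lborel) =
    2 * (\<integral>\<^sup>+\<tau>. ennreal (cone_density A B C a q \<tau>) * indicator {- m..m} \<tau> * indicator {0..} \<tau> \<partial>lborel)"
    by (rule nn_integral_even) (auto split: split_indicator)
  also have "(\<integral>\<^sup>+\<tau>. ennreal (cone_density A B C a q \<tau>) * indicator {- m..m} \<tau> * indicator {0..} \<tau> \<partial>lborel) =
      wedge_volume A B C a q m"
    unfolding wedge_volume_def using assms by (intro nn_integral_cong) (auto split: split_indicator)
  finally show ?thesis .
qed

text \<open>\<open>lt1\<close> places the farthest corner of the cone, at \<open>N = a\<close>,
  \<open>u = q\<close>, \<open>\<bar>\<tau>\<bar> = m\<close>, inside the unit ball; monotonicity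
  covers the other points. One-sided and symmetric ranges of \<open>\<tau>\<close> both occur, hence
  separate \<open>m0\<close> and \<open>m1\<close>.\<close>

lemma nn_integral_wedge:
  fixes A B C a q m0 m1 m :: real
  assumes pos: "0 < A" "0 < B" "0 \<le> C" "0 < a" "0 < q" and m: "- m \<le> m0" "m1 \<le> m"
    and lt1: "a\<^sup>2 * (A + q\<^sup>2 * (B + C * m\<^sup>2)) < 1"
  shows "(\<integral>\<^sup>+N. \<integral>\<^sup>+M. \<integral>\<^sup>+L. (if 0 \<le> M \<and> M \<le> q * N \<and> m0 * M \<le> L \<and> L \<le> m1 * M
        then (if N \<le> a then ennreal (1 / (1 - (A * N\<^sup>2 + B * M\<^sup>2 + C * L\<^sup>2))\<^sup>2) else 0) else 0)
        \<partial>lborel \<partial>lborel \<partial>lborel) =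
    (\<integral>\<^sup>+\<tau>. ennreal (cone_density A B C a q \<tau>) * indicator {m0..m1} \<tau> \<partial>lborel)"
proof -
  define H :: "real \<Rightarrow> real \<Rightarrow> ennreal" where "H N Q = (if N \<le> a then ennreal (1 / (1 - Q)\<^sup>2) else 0)" for N Q
  have H: "case_prod H \<in> borel_measurable (borel \<Otimes>\<^sub>M borel)" unfolding H_def by measurable
  show ?thesis
    unfolding H_def[symmetric] nn_integral_cone_scaling[OF H pos(5)]
  proof (rule nn_integral_cong)
    fix \<tau> :: real
    show "(\<integral>\<^sup>+u. (\<integral>\<^sup>+N. ennreal (N\<^sup>2 * u) * H N (N\<^sup>2 * (A + u\<^sup>2 * (B + C * \<tau>\<^sup>2))) * indicator {0..} N \<partial>lborel)
        * indicator {0..q} u \<partial>lborel) * indicator {m0..m1} \<tau> = ennreal (cone_density A B C a q \<tau>) * indicator {m0..m1} \<tau>"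
    proof (cases "\<tau> \<in> {m0..m1}")
      case True
      then have "\<bar>\<tau>\<bar> \<le> \<bar>m\<bar>" using m by auto
      then have t: "\<tau>\<^sup>2 \<le> m\<^sup>2" by (simp add: abs_le_square_iff)
      have w: "0 < B + C * \<tau>\<^sup>2" using pos by (intro add_pos_nonneg) auto
      have "a\<^sup>2 * (A + q\<^sup>2 * (B + C * \<tau>\<^sup>2)) \<le> a\<^sup>2 * (A + q\<^sup>2 * (B + C * m\<^sup>2))"
        using pos t by (intro mult_left_mono add_left_mono) auto
      then have lt: "a\<^sup>2 * (A + q\<^sup>2 * (B + C * \<tau>\<^sup>2)) < 1" using lt1 by simp
      show ?thesis
        using nn_integral_radial_cone[OF pos(1) w pos(4,5) lt]
        unfolding H_def cone_density_def by simp
    qed simp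
  qed
qed

text \<open>The cone over the part of the face \<open>a = y\<close> in the octant, a square with one
  corner cut off by \<open>b + c \<le> d - y\<close>. Here \<open>m\<close> is the slope of the ray
  from the face centre to a vertex of the cut; the rays of slopes \<open>m\<close> and
  \<open>1 / m\<close> leave two congruent right triangles (\<open>K1\<close>, once with
  \<open>b\<close> and \<open>c\<close> exchanged) and an isosceles one (\<open>K3\<close>), whose
  axis suggests the coordinates \<open>b + c\<close> and \<open>(b - c) / 2\<close>.\<close>

lemma nn_integral_face_cone:
  fixes y d :: real and s1 s2 :: bool
  assumes y: "0 < y" "2 * y \<le> d" "d < 3 * y" and lt1: "2 * y\<^sup>2 + (d - 2 * y)\<^sup>2 < 1"
  defines "m \<equiv> (d - 2 * y) / y"
  shows "(\<integral>\<^sup>+a. \<integral>\<^sup>+b. \<integral>\<^sup>+c.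
      (if 0 \<le> b \<and> 0 \<le> c \<and> (if s1 then b < a else b \<le> a) \<and> (if s2 then c < a else c \<le> a) \<and>
          a \<le> y \<and> y * (a + b + c) < d * a
       then ennreal (1 / (1 - (a\<^sup>2 + b\<^sup>2 + c\<^sup>2))\<^sup>2) else 0) \<partial>lborel \<partial>lborel \<partial>lborel) =
    2 * wedge_volume 1 1 1 y 1 m + 2 * wedge_volume 1 (1/2) 2 y (1 + m) ((1 - m) / (2 * (1 + m)))"
proof -
  have m: "0 \<le> m" "m < 1" using y by (auto simp: m_def field_simps)
  have d: "d = (2 + m) * y" using y by (simp add: m_def field_simps)
  define D :: "real \<Rightarrow> ennreal" where "D Q = ennreal (1 / (1 - Q)\<^sup>2)" for Q
  have Dm [measurable]: "D \<in> borel_measurable borel" unfolding D_def by measurable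
  define K1 where "K1 a b c = (if 0 \<le> b \<and> b \<le> 1 * a \<and> 0 * b \<le> c \<and> c \<le> m * b then
      (if a \<le> y then D (1 * a\<^sup>2 + 1 * b\<^sup>2 + 1 * c\<^sup>2) else 0) else 0)" for a b c
  define K3 where "K3 a b c = (if 0 \<le> b + c \<and> b + c \<le> (1 + m) * a \<and> m * b \<le> c \<and> m * c \<le> b then
      (if a \<le> y then D (a\<^sup>2 + b\<^sup>2 + c\<^sup>2) else 0) else 0)" for a b c
  have K1m [measurable]: "(\<lambda>x. K1 (f x) (g x) (h x)) \<in> borel_measurable X"
    if [measurable]: "f \<in> borel_measurable X" "g \<in> borel_measurable X" "h \<in> borel_measurable X"
    for f g h and X :: "'x measure"
    unfolding K1_def by measurable
  have K3m [measurable]: "(\<lambda>x. K3 (f x) (g x) (h x)) \<in> borel_measurable X"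
    if [measurable]: "f \<in> borel_measurable X" "g \<in> borel_measurable X" "h \<in> borel_measurable X"
    for f g h and X :: "'x measure"
    unfolding K3_def by measurable
  \<comment> \<open>Claimed only off the planes excluded by \<open>ne\<close>, which are null sets
    for the integrals below.\<close>
  have split: "(if 0 \<le> b \<and> 0 \<le> c \<and> (if s1 then b < a else b \<le> a) \<and> (if s2 then c < a else c \<le> a) \<and>
          a \<le> y \<and> y * (a + b + c) < d * a then ennreal (1 / (1 - (a\<^sup>2 + b\<^sup>2 + c\<^sup>2))\<^sup>2) else 0) =
      K1 a b c + (K1 a c b + K3 a b c)"
    if ne: "b \<noteq> a" "c \<noteq> a" "c \<noteq> m * b" "b \<noteq> m * c" "b + c \<noteq> (1 + m) * a" for a b c
  proof -
    have S: "y * (a + b + c) < d * a \<longleftrightarrow> b + c < (1 + m) * a"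
    proof -
      have "y * (a + b + c) < d * a \<longleftrightarrow> y * (b + c) < y * ((1 + m) * a)"
        unfolding d by (simp add: algebra_simps)
      then show ?thesis using y(1) by simp
    qed
    have mb: "m * b \<le> b" if "0 \<le> b" for b using m that by (simp add: mult_left_le_one_le)
    have mb0: "0 \<le> m * b" if "0 \<le> b" for b using m that by simp
    have mono: "m * b \<le> m * a" if "b \<le> a" for a b using m that by (simp add: mult_left_mono)
    have neg: "\<not> (0 \<le> b + c \<and> m * b \<le> c \<and> m * c \<le> b)" if "b < 0 \<or> c < 0"
    proof
      assume h: "0 \<le> b + c \<and> m * b \<le> c \<and> m * c \<le> b"
      from that show False
      proof
        assume "b < 0"
        then have "0 < c" using h by linarith
        then show False using h \<open>b < 0\<close> mb0[of c] by linarith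
      next
        assume "c < 0"
        then have "0 < b" using h by linarith
        then show False using h \<open>c < 0\<close> mb0[of b] by linarith
      qed
    qed
    have mm: "m * (m * b) \<le> m * b" if "0 \<le> b" for b using mono[OF mb[OF that]] .
    consider "b < 0 \<or> c < 0" | "0 \<le> b" "0 \<le> c" "c < m * b" | "0 \<le> b" "0 \<le> c" "b < m * c"
      | "0 \<le> b" "0 \<le> c" "m * b < c" "m * c < b"
    proof (cases "b < 0 \<or> c < 0")
      case False
      have "c < m * b \<or> m * b < c" "b < m * c \<or> m * c < b" using ne(3,4) by (simp_all only: neq_iff)
      then show ?thesis using that(2-4) False by (auto simp: not_less)
    qed (use that in blast)
    then show ?thesis
    proof cases
      case 1
      have "K1 a b c = 0" "K1 a c b = 0"
        using 1 mb0[of c] mb0[of b] unfolding K1_def by (force split: if_splits)+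
      moreover have "K3 a b c = 0" using neg[OF 1] unfolding K3_def by (metis (no_types, lifting))
      ultimately show ?thesis using 1 by (simp only: add_0) (auto simp: not_le)
    next
      case 2
      have nb: "\<not> b \<le> m * c" using mono[of c "m * b"] mm[OF 2(1)] mb[OF 2(1)] 2 ne
        by (smt (verit))
      have "b < a \<Longrightarrow> c < a \<and> b + c < (1 + m) * a"
        using mb[OF 2(1)] 2 mono[of b a] by (simp add: algebra_simps)
      then show ?thesis using 2 nb ne unfolding K1_def K3_def S D_def
        by (auto simp: not_le)
    next
      case 3
      have nb: "\<not> c \<le> m * b" using mono[of b "m * c"] mm[OF 3(2)] mb[OF 3(2)] 3 ne
        by (smt (verit))
      have "c < a \<Longrightarrow> b < a \<and> b + c < (1 + m) * a"
        using mb[OF 3(2)] 3 mono[of c a] by (simp add: algebra_simps)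
      then show ?thesis using 3 nb ne unfolding K1_def K3_def S D_def
        by (auto simp: not_le add.commute add.left_commute)
    next
      case 4
      have "b + c < (1 + m) * a \<Longrightarrow> b < a \<and> c < a"
      proof -
        assume h: "b + c < (1 + m) * a"
        have "(1 + m) * b < (1 + m) * a" "(1 + m) * c < (1 + m) * a"
          using h 4 by (simp_all add: algebra_simps)
        then show ?thesis using m by (simp add: mult_less_cancel_left_pos)
      qed
      then show ?thesis using 4 ne unfolding K1_def K3_def S D_def
        by (auto simp: not_le)
    qed
  qed
  let ?F = "\<lambda>a b c. (if 0 \<le> b \<and> 0 \<le> c \<and> (if s1 then b < a else b \<le> a) \<and> (if s2 then c < a else c \<le> a) \<and>
          a \<le> y \<and> y * (a + b + c) < d * a then ennreal (1 / (1 - (a\<^sup>2 + b\<^sup>2 + c\<^sup>2))\<^sup>2) else 0)"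
  have c_int: "(\<integral>\<^sup>+c. ?F a b c \<partial>lborel) = (\<integral>\<^sup>+c. K1 a b c \<partial>lborel) + ((\<integral>\<^sup>+c. K1 a c b \<partial>lborel) + (\<integral>\<^sup>+c. K3 a b c \<partial>lborel))"
    if b: "b \<noteq> a" "b \<noteq> 0" for a b
  proof -
    have "(\<integral>\<^sup>+c. ?F a b c \<partial>lborel) = (\<integral>\<^sup>+c. K1 a b c + (K1 a c b + K3 a b c) \<partial>lborel)"
    proof (rule nn_integral_cong_AE, rule AE_I[where N="{a, m * b, b / m, (1 + m) * a - b}"])
      have "?F a b c = K1 a b c + (K1 a c b + K3 a b c)" if "c \<notin> {a, m * b, b / m, (1 + m) * a - b}" for c
      proof (rule split)
        \<comment> \<open>For \<open>m = 0\<close> the listed point \<open>b / m\<close> is the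
          default 0; in that case \<open>b = m * c\<close> is excluded by
          \<open>b \<noteq> 0\<close>.\<close>
        show "b \<noteq> m * c"
        proof
          assume "b = m * c"
          then have "m \<noteq> 0" "c = b / m" using b by auto
          then show False using that by simp
        qed
      qed (use that b in auto)
      then show "{c \<in> space lborel. ?F a b c \<noteq> K1 a b c + (K1 a c b + K3 a b c)} \<subseteq> {a, m * b, b / m, (1 + m) * a - b}"
        by blast
    qed (auto simp: emeasure_lborel_countable)
    also have "\<dots> = (\<integral>\<^sup>+c. K1 a b c \<partial>lborel) + ((\<integral>\<^sup>+c. K1 a c b \<partial>lborel) + (\<integral>\<^sup>+c. K3 a b c \<partial>lborel))"
      by (rule nn_integral_add3) measurable
    finally show ?thesis .
  qed
  have b_int: "(\<integral>\<^sup>+b. \<integral>\<^sup>+c. ?F a b c \<partial>lborel \<partial>lborel) = (\<integral>\<^sup>+b. \<integral>\<^sup>+c. K1 a b c \<partial>lborel \<partial>lborel) +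
      ((\<integral>\<^sup>+b. \<integral>\<^sup>+c. K1 a c b \<partial>lborel \<partial>lborel) + (\<integral>\<^sup>+b. \<integral>\<^sup>+c. K3 a b c \<partial>lborel \<partial>lborel))" for a
  proof -
    have "(\<integral>\<^sup>+b. \<integral>\<^sup>+c. ?F a b c \<partial>lborel \<partial>lborel) =
      (\<integral>\<^sup>+b. (\<integral>\<^sup>+c. K1 a b c \<partial>lborel) + ((\<integral>\<^sup>+c. K1 a c b \<partial>lborel) + (\<integral>\<^sup>+c. K3 a b c \<partial>lborel)) \<partial>lborel)"
    proof (rule nn_integral_cong_AE, rule AE_I[where N="{a, 0}"])
      show "{b \<in> space lborel. (\<integral>\<^sup>+c. ?F a b c \<partial>lborel) \<noteq> (\<integral>\<^sup>+c. K1 a b c \<partial>lborel) +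
          ((\<integral>\<^sup>+c. K1 a c b \<partial>lborel) + (\<integral>\<^sup>+c. K3 a b c \<partial>lborel))} \<subseteq> {a, 0}"
        using c_int by blast
    qed (auto simp: emeasure_lborel_countable)
    also have "\<dots> = (\<integral>\<^sup>+b. \<integral>\<^sup>+c. K1 a b c \<partial>lborel \<partial>lborel) +
      ((\<integral>\<^sup>+b. \<integral>\<^sup>+c. K1 a c b \<partial>lborel \<partial>lborel) + (\<integral>\<^sup>+b. \<integral>\<^sup>+c. K3 a b c \<partial>lborel \<partial>lborel))"
      by (rule nn_integral_add3) measurable
    finally show ?thesis .
  qed
  have "(\<integral>\<^sup>+a. \<integral>\<^sup>+b. \<integral>\<^sup>+c. ?F a b c \<partial>lborel \<partial>lborel \<partial>lborel) =
      (\<integral>\<^sup>+a. \<integral>\<^sup>+b. \<integral>\<^sup>+c. K1 a b c \<partial>lborel \<partial>lborel \<partial>lborel) +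
      ((\<integral>\<^sup>+a. \<integral>\<^sup>+b. \<integral>\<^sup>+c. K1 a c b \<partial>lborel \<partial>lborel \<partial>lborel) +
       (\<integral>\<^sup>+a. \<integral>\<^sup>+b. \<integral>\<^sup>+c. K3 a b c \<partial>lborel \<partial>lborel \<partial>lborel))"
    unfolding b_int by (rule nn_integral_add3) measurable
  also have "(\<integral>\<^sup>+a. \<integral>\<^sup>+b. \<integral>\<^sup>+c. K1 a c b \<partial>lborel \<partial>lborel \<partial>lborel) = (\<integral>\<^sup>+a. \<integral>\<^sup>+b. \<integral>\<^sup>+c. K1 a b c \<partial>lborel \<partial>lborel \<partial>lborel)"
    by (rule nn_integral_cong, rule nn_integral_swap) measurable
  also have "(\<integral>\<^sup>+a. \<integral>\<^sup>+b. \<integral>\<^sup>+c. K1 a b c \<partial>lborel \<partial>lborel \<partial>lborel) = wedge_volume 1 1 1 y 1 m"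
    unfolding K1_def D_def wedge_volume_def
  proof (rule nn_integral_wedge[where m=m])
    have "y\<^sup>2 * (1 + 1\<^sup>2 * (1 + 1 * m\<^sup>2)) = 2 * y\<^sup>2 + (d - 2 * y)\<^sup>2"
      unfolding d by (simp add: power2_eq_square algebra_simps)
    then show "y\<^sup>2 * (1 + 1\<^sup>2 * (1 + 1 * m\<^sup>2)) < 1" using lt1 by simp
  qed (use y m in auto)
  also have "(\<integral>\<^sup>+a. \<integral>\<^sup>+b. \<integral>\<^sup>+c. K3 a b c \<partial>lborel \<partial>lborel \<partial>lborel) =
      2 * wedge_volume 1 (1/2) 2 y (1 + m) ((1 - m) / (2 * (1 + m)))"
  proof -
    have "(\<integral>\<^sup>+b. \<integral>\<^sup>+c. K3 a b c \<partial>lborel \<partial>lborel) = (\<integral>\<^sup>+M. \<integral>\<^sup>+L. K3 a (M/2 + L) (M/2 - L) \<partial>lborel \<partial>lborel)" for a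
    proof -
      have "(\<integral>\<^sup>+b. \<integral>\<^sup>+c. K3 a b c \<partial>lborel \<partial>lborel) = (\<integral>\<^sup>+b. \<integral>\<^sup>+M. K3 a b (- b + M) \<partial>lborel \<partial>lborel)"
        by (rule nn_integral_cong, rule nn_integral_shift) measurable
      also have "\<dots> = (\<integral>\<^sup>+M. \<integral>\<^sup>+b. K3 a b (- b + M) \<partial>lborel \<partial>lborel)"
        by (rule nn_integral_swap) measurable
      also have "\<dots> = (\<integral>\<^sup>+M. \<integral>\<^sup>+L. K3 a (M/2 + L) (- (M/2 + L) + M) \<partial>lborel \<partial>lborel)"
        by (rule nn_integral_cong, rule nn_integral_shift) measurable
      also have "\<dots> = (\<integral>\<^sup>+M. \<integral>\<^sup>+L. K3 a (M/2 + L) (M/2 - L) \<partial>lborel \<partial>lborel)"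
        by (intro nn_integral_cong arg_cong[where f="K3 _ _"]) (simp add: field_simps)
      finally show ?thesis .
    qed
    then have K3_sub: "(\<integral>\<^sup>+a. \<integral>\<^sup>+b. \<integral>\<^sup>+c. K3 a b c \<partial>lborel \<partial>lborel \<partial>lborel) =
       (\<integral>\<^sup>+a. \<integral>\<^sup>+M. \<integral>\<^sup>+L. K3 a (M/2 + L) (M/2 - L) \<partial>lborel \<partial>lborel \<partial>lborel)" by simp
    have "K3 a (M/2 + L) (M/2 - L) = (if 0 \<le> M \<and> M \<le> (1 + m) * a \<and>
          (- ((1 - m) / (2 * (1 + m)))) * M \<le> L \<and> L \<le> ((1 - m) / (2 * (1 + m))) * M
        then (if a \<le> y then ennreal (1 / (1 - (1 * a\<^sup>2 + 1/2 * M\<^sup>2 + 2 * L\<^sup>2))\<^sup>2) else 0) else 0)" for a M L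
    proof -
      have e: "a\<^sup>2 + (M/2 + L)\<^sup>2 + (M/2 - L)\<^sup>2 = 1 * a\<^sup>2 + 1/2 * M\<^sup>2 + 2 * L\<^sup>2"
        by (simp add: power2_eq_square field_simps)
      have s: "M/2 + L + (M/2 - L) = M" by simp
      have c1: "m * (M/2 + L) \<le> M/2 - L \<longleftrightarrow> L \<le> ((1 - m) / (2 * (1 + m))) * M"
        using m by (intro iffI) (simp_all add: field_simps)
      have c2: "m * (M/2 - L) \<le> M/2 + L \<longleftrightarrow> (- ((1 - m) / (2 * (1 + m)))) * M \<le> L"
        using m by (intro iffI) (simp_all add: field_simps)
      show ?thesis unfolding K3_def e s c1 c2 D_def by auto
    qed
    then have "(\<integral>\<^sup>+a. \<integral>\<^sup>+b. \<integral>\<^sup>+c. K3 a b c \<partial>lborel \<partial>lborel \<partial>lborel) =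
      (\<integral>\<^sup>+a. \<integral>\<^sup>+M. \<integral>\<^sup>+L. (if 0 \<le> M \<and> M \<le> (1 + m) * a \<and>
          (- ((1 - m) / (2 * (1 + m)))) * M \<le> L \<and> L \<le> ((1 - m) / (2 * (1 + m))) * M
        then (if a \<le> y then ennreal (1 / (1 - (1 * a\<^sup>2 + 1/2 * M\<^sup>2 + 2 * L\<^sup>2))\<^sup>2) else 0) else 0) \<partial>lborel \<partial>lborel \<partial>lborel)"
      unfolding K3_sub by (simp only:)
    also have "(\<integral>\<^sup>+a. \<integral>\<^sup>+M. \<integral>\<^sup>+L. (if 0 \<le> M \<and> M \<le> (1 + m) * a \<and>
          (- ((1 - m) / (2 * (1 + m)))) * M \<le> L \<and> L \<le> ((1 - m) / (2 * (1 + m))) * M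
        then (if a \<le> y then ennreal (1 / (1 - (1 * a\<^sup>2 + 1/2 * M\<^sup>2 + 2 * L\<^sup>2))\<^sup>2) else 0) else 0) \<partial>lborel \<partial>lborel \<partial>lborel) =
       (\<integral>\<^sup>+\<tau>. ennreal (cone_density 1 (1/2) 2 y (1 + m) \<tau>) *
          indicator {- ((1 - m) / (2 * (1 + m)))..(1 - m) / (2 * (1 + m))} \<tau> \<partial>lborel)"
    proof (rule nn_integral_wedge[where m="(1 - m) / (2 * (1 + m))"])
      have "y\<^sup>2 * (1 + (1 + m)\<^sup>2 * (1/2 + 2 * ((1 - m) / (2 * (1 + m)))\<^sup>2)) = 2 * y\<^sup>2 + (d - 2 * y)\<^sup>2"
      proof -
        have e: "(1 + m)\<^sup>2 * (1/2 + 2 * ((1 - m) / (2 * (1 + m)))\<^sup>2) = (1 + m)\<^sup>2 / 2 + (1 - m)\<^sup>2 / 2"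
          using m by (simp add: power_divide power_mult_distrib field_simps) (simp add: power2_eq_square algebra_simps)
        have "d - 2 * y = m * y" using d by (simp add: algebra_simps)
        then show ?thesis unfolding e by (simp add: power2_eq_square field_simps)
      qed
      then show "y\<^sup>2 * (1 + (1 + m)\<^sup>2 * (1/2 + 2 * ((1 - m) / (2 * (1 + m)))\<^sup>2)) < 1" using lt1 by simp
    qed (use y m in auto)
    also have "\<dots> = 2 * wedge_volume 1 (1/2) 2 y (1 + m) ((1 - m) / (2 * (1 + m)))"
      by (rule nn_integral_cone_density_symmetric) (use m in auto)
    finally show ?thesis .
  qed
  finally show ?thesis by (simp only: mult_2 add.assoc)
qed

text \<open>\<open>d\<close> stands for \<open>1 / y\<close> but is an independent parameter: the
  region grows with \<open>y\<close> and with \<open>d\<close>, whereas in terms of \<open>y\<close>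
  alone its two kinds of constraints move in opposite directions.\<close>

definition octant_integrand :: "real \<Rightarrow> real \<Rightarrow> real \<Rightarrow> real \<Rightarrow> real \<Rightarrow> ennreal" where
  "octant_integrand y d a b c = (if 0 \<le> a \<and> 0 \<le> b \<and> 0 \<le> c \<and> a \<le> y \<and> b \<le> y \<and> c \<le> y \<and> a + b + c \<le> d
     then ennreal (1 / (1 - (a\<^sup>2 + b\<^sup>2 + c\<^sup>2))\<^sup>2) else 0)"

definition octant_volume :: "real \<Rightarrow> real \<Rightarrow> ennreal" where
  "octant_volume y d = (\<integral>\<^sup>+a. \<integral>\<^sup>+b. \<integral>\<^sup>+c. octant_integrand y d a b c \<partial>lborel \<partial>lborel \<partial>lborel)"

text \<open>The boundary facing away from the origin consists of three cut faces and the truncating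
  triangle. A point lies over the triangle if \<open>d\<close> times its largest coordinate is at
  most \<open>y * (a + b + c)\<close>, and over the face of its largest coordinate otherwise.
  \<open>2 * y\<^sup>2 + (d - 2 * y)\<^sup>2\<close> is the squared length of the vertex
  \<open>(y, y, d - 2 * y)\<close>.\<close>

lemma octant_volume_eq:
  fixes y d :: real
  assumes y: "0 < y" "2 * y \<le> d" "d < 3 * y" and lt1: "2 * y\<^sup>2 + (d - 2 * y)\<^sup>2 < 1"
  defines "m \<equiv> (d - 2 * y) / y"
  shows "octant_volume y d = 6 * wedge_volume 1 1 1 y 1 m
     + 6 * wedge_volume 1 (1/2) 2 y (1 + m) ((1 - m) / (2 * (1 + m)))
     + 2 * wedge_volume (1/3) (1/6) 2 d (3 * y / d - 1) (1/2)"
proof -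
  have d0: "0 < d" using y by simp
  define r where "r = y / d - 1/3"
  have r: "0 < r" using y d0 by (simp add: r_def field_simps)
  define H :: "real \<Rightarrow> real \<Rightarrow> ennreal" where "H N Q = (if N \<le> d then ennreal (1 / (1 - Q)\<^sup>2) else 0)" for N Q
  have H [measurable]: "case_prod H \<in> borel_measurable (borel \<Otimes>\<^sub>M borel)" unfolding H_def by measurable
  define T where "T a b c = (if 1 * (a - (a + b + c) / 3) \<le> r * (a + b + c) \<and>
          1 * (b - (a + b + c) / 3) \<le> r * (a + b + c) \<and>
          1 * (c - (a + b + c) / 3) \<le> r * (a + b + c)
       then H (a + b + c) (a\<^sup>2 + b\<^sup>2 + c\<^sup>2) else 0)" for a b c
  define G where "G s1 s2 a b c = (if 0 \<le> b \<and> 0 \<le> c \<and> (if s1 then b < a else b \<le> a) \<and> (if s2 then c < a else c \<le> a) \<and>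
          a \<le> y \<and> y * (a + b + c) < d * a
       then ennreal (1 / (1 - (a\<^sup>2 + b\<^sup>2 + c\<^sup>2))\<^sup>2) else 0)" for s1 s2 :: bool and a b c :: real
  have Tm [measurable]: "(\<lambda>x. T (f x) (g x) (h x)) \<in> borel_measurable X"
    if [measurable]: "f \<in> borel_measurable X" "g \<in> borel_measurable X" "h \<in> borel_measurable X"
    for f g h and X :: "'x measure"
    unfolding T_def by measurable
  have Gm [measurable]: "(\<lambda>x. G s1 s2 (f x) (g x) (h x)) \<in> borel_measurable X"
    if [measurable]: "f \<in> borel_measurable X" "g \<in> borel_measurable X" "h \<in> borel_measurable X"
    for f g h s1 s2 and X :: "'x measure"
    unfolding G_def by measurable
  have split: "octant_integrand y d a b c = T a b c + (G False False a b c + (G True False b a c + G True True c a b))" for a b c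
  proof -
    define S where "S = a + b + c"
    have S': "b + a + c = S" "c + a + b = S" "b\<^sup>2 + a\<^sup>2 + c\<^sup>2 = a\<^sup>2 + b\<^sup>2 + c\<^sup>2" "c\<^sup>2 + a\<^sup>2 + b\<^sup>2 = a\<^sup>2 + b\<^sup>2 + c\<^sup>2"
      by (auto simp: S_def)
    have tc: "1 * (x - S / 3) \<le> r * S \<longleftrightarrow> d * x \<le> y * S" for x
      using d0 by (simp add: r_def field_simps)
    \<comment> \<open>In the central cone each coordinate is at most
      \<open>y * S / d \<le> S / 2\<close>, so none can be negative; this is the use of
      \<open>2 * y \<le> d\<close>, while \<open>d < 3 * y\<close> gives
      \<open>0 \<le> S\<close>.\<close>
    have nonneg: "0 \<le> S \<and> 0 \<le> a \<and> 0 \<le> b \<and> 0 \<le> c \<and> (S \<le> d \<longrightarrow> a \<le> y \<and> b \<le> y \<and> c \<le> y)"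
      if h: "d * a \<le> y * S" "d * b \<le> y * S" "d * c \<le> y * S"
    proof -
      have "d * S \<le> 3 * y * S" using h by (simp add: S_def algebra_simps)
      then have "0 \<le> (3 * y - d) * S" by (simp add: algebra_simps)
      then have S0: "0 \<le> S" using y by (simp add: zero_le_mult_iff)
      have lower: "0 \<le> x" if "d * x = d * S - d * u - d * v" "d * u \<le> y * S" "d * v \<le> y * S" for x u v
      proof -
        have "2 * y * S \<le> d * S" using y S0 by (intro mult_right_mono) auto
        then have "0 \<le> d * x" using that by linarith
        then show ?thesis using d0 by (simp add: zero_le_mult_iff)
      qed
      have upper: "x \<le> y" if "d * x \<le> y * S" "S \<le> d" for x
      proof -
        have "y * S \<le> d * y" using that y by (simp add: mult.commute)
        then have "d * x \<le> d * y" using that by simp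
        then show ?thesis using d0 by simp
      qed
      show ?thesis
        using S0 h lower[of a b c] lower[of b a c] lower[of c a b] upper by (simp add: S_def algebra_simps)
    qed
    have small: "S \<le> d" if "y * S < d * x" "x \<le> y" for x
    proof -
      have "d * x \<le> d * y" using that d0 by simp
      then have "y * S < y * d" using that by (simp add: mult.commute)
      then show ?thesis using y by simp
    qed
    have nn: "0 \<le> x" if "y * S < d * x" "S = x + u + v" "0 \<le> u" "0 \<le> v" for x u v
    proof (rule ccontr)
      assume "\<not> 0 \<le> x"
      then have "x < 0" by simp
      have "y * x \<le> y * S" using that y by simp
      then have "0 < (d - y) * x" using that(1) by (simp add: algebra_simps)
      then show False using \<open>x < 0\<close> y by (simp add: zero_less_mult_iff)
    qed
    have dm: "d * u \<le> d * v \<longleftrightarrow> u \<le> v" for u v using d0 by simp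
    consider "d * a \<le> y * S" "d * b \<le> y * S" "d * c \<le> y * S"
      | "y * S < d * a" "b \<le> a" "c \<le> a" | "y * S < d * b" "a < b" "c \<le> b" | "y * S < d * c" "a < c" "b < c"
    proof (cases "d * a \<le> y * S \<and> d * b \<le> y * S \<and> d * c \<le> y * S")
      case False
      then show ?thesis using that(2-4) dm[of a b] dm[of a c] dm[of b c] dm[of b a] dm[of c a] dm[of c b]
        by (smt (verit))
    qed (use that in blast)
    then show ?thesis
    proof cases
      case 1
      have "T a b c = octant_integrand y d a b c"
        using nonneg[OF 1] 1 tc unfolding T_def octant_integrand_def H_def S_def[symmetric] by auto
      moreover have "G False False a b c = 0" "G True False b a c = 0" "G True True c a b = 0"
        using 1 unfolding G_def S' S_def[symmetric] by auto
      ultimately show ?thesis by simp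
    next
      case 2
      have "T a b c = 0" using 2 tc unfolding T_def S_def[symmetric] by auto
      moreover have "G True False b a c = 0" "G True True c a b = 0"
        using 2 unfolding G_def by auto
      moreover have "G False False a b c = octant_integrand y d a b c"
        using 2 small[of a] nn[of a b c] unfolding G_def octant_integrand_def S_def[symmetric] S'
        by (auto simp: S_def)
      ultimately show ?thesis by simp
    next
      case 3
      have "T a b c = 0" using 3 tc unfolding T_def S_def[symmetric] by auto
      moreover have "G False False a b c = 0" "G True True c a b = 0"
        using 3 unfolding G_def by auto
      moreover have "G True False b a c = octant_integrand y d a b c"
        using 3 small[of b] nn[of b a c] unfolding G_def octant_integrand_def S_def[symmetric] S'
        by (auto simp: S_def)
      ultimately show ?thesis by simp
    next
      case 4
      have "T a b c = 0" using 4 tc unfolding T_def S_def[symmetric] by auto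
      moreover have "G False False a b c = 0" "G True False b a c = 0"
        using 4 unfolding G_def by auto
      moreover have "G True True c a b = octant_integrand y d a b c"
        using 4 small[of c] nn[of c a b] unfolding G_def octant_integrand_def S_def[symmetric] S'
        by (auto simp: S_def)
      ultimately show ?thesis by simp
    qed
  qed
  define J where "J s1 s2 = (\<integral>\<^sup>+a. \<integral>\<^sup>+b. \<integral>\<^sup>+c. G s1 s2 a b c \<partial>lborel \<partial>lborel \<partial>lborel)" for s1 s2
  have J: "J s1 s2 = 2 * wedge_volume 1 1 1 y 1 m + 2 * wedge_volume 1 (1/2) 2 y (1 + m) ((1 - m) / (2 * (1 + m)))" for s1 s2
    unfolding J_def G_def m_def by (rule nn_integral_face_cone[OF y lt1])
  have add4: "(\<integral>\<^sup>+x. f x + (g x + (h x + k x)) \<partial>lborel) = integral\<^sup>N lborel f +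
      (integral\<^sup>N lborel g + (integral\<^sup>N lborel h + integral\<^sup>N lborel k))"
    if "f \<in> borel_measurable borel" "g \<in> borel_measurable borel" "h \<in> borel_measurable borel" "k \<in> borel_measurable borel"
    for f g h k :: "real \<Rightarrow> ennreal"
    using that by (simp add: nn_integral_add)
  have i1: "(\<integral>\<^sup>+c. T a b c + (G False False a b c + (G True False b a c + G True True c a b)) \<partial>lborel) =
     (\<integral>\<^sup>+c. T a b c \<partial>lborel) + ((\<integral>\<^sup>+c. G False False a b c \<partial>lborel) +
      ((\<integral>\<^sup>+c. G True False b a c \<partial>lborel) + (\<integral>\<^sup>+c. G True True c a b \<partial>lborel)))" for a b
    by (rule add4) measurable
  have i2: "(\<integral>\<^sup>+b. (\<integral>\<^sup>+c. T a b c \<partial>lborel) + ((\<integral>\<^sup>+c. G False False a b c \<partial>lborel) +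
      ((\<integral>\<^sup>+c. G True False b a c \<partial>lborel) + (\<integral>\<^sup>+c. G True True c a b \<partial>lborel))) \<partial>lborel) =
     (\<integral>\<^sup>+b. \<integral>\<^sup>+c. T a b c \<partial>lborel \<partial>lborel) + ((\<integral>\<^sup>+b. \<integral>\<^sup>+c. G False False a b c \<partial>lborel \<partial>lborel) +
      ((\<integral>\<^sup>+b. \<integral>\<^sup>+c. G True False b a c \<partial>lborel \<partial>lborel) + (\<integral>\<^sup>+b. \<integral>\<^sup>+c. G True True c a b \<partial>lborel \<partial>lborel)))" for a
    by (rule add4) measurable
  have "octant_volume y d = (\<integral>\<^sup>+a. \<integral>\<^sup>+b. \<integral>\<^sup>+c. T a b c \<partial>lborel \<partial>lborel \<partial>lborel) +
     ((\<integral>\<^sup>+a. \<integral>\<^sup>+b. \<integral>\<^sup>+c. G False False a b c \<partial>lborel \<partial>lborel \<partial>lborel) +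
      ((\<integral>\<^sup>+a. \<integral>\<^sup>+b. \<integral>\<^sup>+c. G True False b a c \<partial>lborel \<partial>lborel \<partial>lborel) +
       (\<integral>\<^sup>+a. \<integral>\<^sup>+b. \<integral>\<^sup>+c. G True True c a b \<partial>lborel \<partial>lborel \<partial>lborel)))"
    unfolding octant_volume_def split i1 i2 by (rule add4) measurable
  also have "(\<integral>\<^sup>+a. \<integral>\<^sup>+b. \<integral>\<^sup>+c. G False False a b c \<partial>lborel \<partial>lborel \<partial>lborel) = J False False"
    by (simp add: J_def)
  also have "(\<integral>\<^sup>+a. \<integral>\<^sup>+b. \<integral>\<^sup>+c. G True False b a c \<partial>lborel \<partial>lborel \<partial>lborel) = J True False"
    unfolding J_def by (rule nn_integral_swap) measurable
  also have "(\<integral>\<^sup>+a. \<integral>\<^sup>+b. \<integral>\<^sup>+c. G True True c a b \<partial>lborel \<partial>lborel \<partial>lborel) = J True True"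
  proof -
    have "(\<integral>\<^sup>+a. \<integral>\<^sup>+b. \<integral>\<^sup>+c. G True True c a b \<partial>lborel \<partial>lborel \<partial>lborel) =
      (\<integral>\<^sup>+a. \<integral>\<^sup>+c. \<integral>\<^sup>+b. G True True c a b \<partial>lborel \<partial>lborel \<partial>lborel)"
      by (rule nn_integral_cong, rule nn_integral_swap) measurable
    also have "\<dots> = J True True" unfolding J_def by (rule nn_integral_swap) measurable
    finally show ?thesis .
  qed
  also have "(\<integral>\<^sup>+a. \<integral>\<^sup>+b. \<integral>\<^sup>+c. T a b c \<partial>lborel \<partial>lborel \<partial>lborel) = 2 * wedge_volume (1/3) (1/6) 2 d (3 * y / d - 1) (1/2)"
  proof -
    have "(\<integral>\<^sup>+a. \<integral>\<^sup>+b. \<integral>\<^sup>+c. T a b c \<partial>lborel \<partial>lborel \<partial>lborel) = (\<integral>\<^sup>+N. \<integral>\<^sup>+M. \<integral>\<^sup>+L.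
      (if 0 \<le> M \<and> M \<le> 3 * r * N \<and> - (1/2) * M \<le> L \<and> L \<le> 1/2 * M
       then H N (1/3 * N\<^sup>2 + 1/6 * M\<^sup>2 + 2 * L\<^sup>2) else 0) \<partial>lborel \<partial>lborel \<partial>lborel)"
      unfolding T_def by (rule nn_integral_symmetric_cone[OF H]) simp
    also have "\<dots> = (\<integral>\<^sup>+\<tau>. ennreal (cone_density (1/3) (1/6) 2 d (3 * r) \<tau>) * indicator {- (1/2)..1/2} \<tau> \<partial>lborel)"
      unfolding H_def
    proof (rule nn_integral_wedge[where m="1/2"])
      have "d\<^sup>2 * (1/3 + (3 * r)\<^sup>2 * (1/6 + 2 * (1/2)\<^sup>2)) = d\<^sup>2 / 3 + (d * (3 * r))\<^sup>2 * (2/3)"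
        by (simp add: power2_eq_square algebra_simps)
      also have "d * (3 * r) = 3 * y - d" using d0 by (simp add: r_def field_simps)
      also have "d\<^sup>2 / 3 + (3 * y - d)\<^sup>2 * (2/3) = 2 * y\<^sup>2 + (d - 2 * y)\<^sup>2"
        by (simp add: power2_eq_square field_simps)
      finally show "d\<^sup>2 * (1/3 + (3 * r)\<^sup>2 * (1/6 + 2 * (1/2)\<^sup>2)) < 1" using lt1 by simp
    qed (use d0 r in auto)
    also have "\<dots> = 2 * wedge_volume (1/3) (1/6) 2 d (3 * r) (1/2)"
      by (rule nn_integral_cone_density_symmetric) simp
    also have "3 * r = 3 * y / d - 1" by (simp add: r_def)
    finally show ?thesis .
  qed
  finally have V: "octant_volume y d = 2 * wedge_volume (1/3) (1/6) 2 d (3 * y / d - 1) (1/2) +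
    (J False False + (J True False + J True True))" .
  have e3: "X + (X + X) = 3 * X" for X :: ennreal
    using distrib_right[of 1 2 X] by (simp add: mult_2)
  have e6: "3 * (2 * X + 2 * Y) = 6 * X + 6 * Y" for X Y :: ennreal
    by (simp add: distrib_left mult.assoc[symmetric])
  show ?thesis unfolding V J e3 e6 by (simp add: add_ac)
qed

subsection \<open>Distances in the truncated cube\<close>

text \<open>The Cauchy-Schwarz inequality reversed for the Lorentz form on the pairs
  \<open>(s, u)\<close> and \<open>(1, a)\<close>, the second being timelike. If
  \<open>(s, u)\<close> is not timelike, the left side is at most 0.\<close>

lemma reverse_Cauchy_Schwarz:
  fixes u a :: "'a::real_inner" and s :: real
  assumes a: "norm a < 1"
  shows "(s\<^sup>2 - u \<bullet> u) * (1 - a \<bullet> a) \<le> (s - u \<bullet> a)\<^sup>2"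
proof (cases "norm u < \<bar>s\<bar>")
  case True
  have "\<bar>u \<bullet> a\<bar> \<le> norm u * norm a" by (rule Cauchy_Schwarz_ineq2)
  moreover have "norm u * norm a \<le> \<bar>s\<bar>"
    using True a by (metis less_imp_le mult_left_le norm_ge_zero order.trans)
  ultimately have "(\<bar>s\<bar> - norm u * norm a)\<^sup>2 \<le> \<bar>s - u \<bullet> a\<bar>\<^sup>2"
    by (intro power_mono) auto
  moreover have "(\<bar>s\<bar> - norm u * norm a)\<^sup>2 - (s\<^sup>2 - u \<bullet> u) * (1 - a \<bullet> a) = (\<bar>s\<bar> * norm a - norm u)\<^sup>2"
    by (simp add: dot_square_norm power2_eq_square algebra_simps)
  moreover have "0 \<le> (\<bar>s\<bar> * norm a - norm u)\<^sup>2" by simp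
  ultimately show ?thesis
    unfolding power2_abs by linarith
next
  case False
  then have "s\<^sup>2 \<le> u \<bullet> u" by (simp add: dot_square_norm abs_le_square_iff[symmetric])
  moreover have "a \<bullet> a \<le> 1" using a by (simp add: dot_square_norm power_le_one)
  ultimately have "(s\<^sup>2 - u \<bullet> u) * (1 - a \<bullet> a) \<le> 0" by (intro mult_nonpos_nonneg) auto
  then show ?thesis by (smt (verit) zero_le_power2)
qed

lemma arcosh_sqrt_one_plus_square:
  fixes w :: real
  assumes "0 \<le> w"
  shows "arcosh (sqrt (1 + w\<^sup>2)) = arsinh w"
proof -
  have "arcosh (cosh (arsinh w)) = arsinh w" using assms sinh_real_nonneg_iff[of "arsinh w"] by (intro arcosh_cosh_real) (simp add: sinh_arsinh_real)
  moreover have "cosh (arsinh w) = sqrt (1 + w\<^sup>2)"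
    by (simp add: cosh_arsinh_real add.commute)
  ultimately show ?thesis by simp
qed

lemma arcosh_mono:
  fixes x y :: real
  assumes "1 \<le> x" "x \<le> y"
  shows "arcosh x \<le> arcosh y"
  using assms by (cases "x = y") (auto intro!: less_imp_le arcosh_less_iff_real[THEN iffD2])

lemma arsinh_mono: "x \<le> y \<Longrightarrow> arsinh x \<le> arsinh y" for x y :: real
  by (subst sinh_real_le_iff[symmetric]) (simp add: sinh_arsinh_real)

text \<open>The foot of the perpendicular is a Lorentz projection:
  \<open>(s, u) = (1, x) - (v / k) * (1, B)\<close>, rescaled to the point \<open>u / s\<close>.
  Every \<open>b\<close> in the polar plane satisfies
  \<open>s - u \<bullet> b = 1 - x \<bullet> b\<close>, so by the reverse Cauchy-Schwarz inequality
  no point is nearer.\<close>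

lemma hdist_pt_set_pol:
  fixes x B :: pt
  assumes x: "norm x < 1" and B: "1 < B \<bullet> B"
  shows "hdist_pt_set x (pol B) = arsinh (\<bar>x \<bullet> B - 1\<bar> / sqrt ((B \<bullet> B - 1) * (1 - x \<bullet> x)))"
proof -
  define k v e where "k = B \<bullet> B - 1" and "v = x \<bullet> B - 1" and "e = 1 - x \<bullet> x"
  have k: "0 < k" using B by (simp add: k_def)
  have e: "0 < e" using x by (simp add: e_def dot_square_norm power_less_one_iff)
  define w where "w = \<bar>v\<bar> / sqrt (k * e)"
  have w: "0 \<le> w" "w\<^sup>2 = v\<^sup>2 / (k * e)" using k e by (auto simp: w_def power_divide)
  define s u where "s = 1 - v / k" and "u = x - (v / k) *\<^sub>R B"
  have su: "s\<^sup>2 - u \<bullet> u = e + v\<^sup>2 / k"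
  proof -
    have "u \<bullet> u = x \<bullet> x - 2 * (v / k) * (x \<bullet> B) + (v / k)\<^sup>2 * (B \<bullet> B)"
      by (simp add: u_def inner_diff_left inner_diff_right inner_commute power2_eq_square algebra_simps)
    also have "\<dots> = (1 - e) - 2 * (v / k) * (v + 1) + (v / k)\<^sup>2 * (k + 1)"
      by (simp add: e_def v_def k_def)
    finally show ?thesis using k by (simp add: s_def power2_eq_square field_simps)
  qed
  have upos: "0 < e + v\<^sup>2 / k" using k e by (simp add: add_pos_nonneg)
  have ratio: "sqrt ((e + v\<^sup>2 / k) / e) = sqrt (1 + w\<^sup>2)" using k e w by (simp add: field_simps)
  have nB: "1 < norm B" using B by (simp add: norm_eq_sqrt_inner)
  have xB: "x \<bullet> B < B \<bullet> B"
  proof -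
    have "x \<bullet> B \<le> norm x * norm B" by (rule norm_cauchy_schwarz)
    also have "\<dots> < norm B * norm B" using x nB by (intro mult_strict_right_mono) auto
    finally show ?thesis by (simp add: dot_square_norm power2_eq_square)
  qed
  then have s: "0 < s" using k by (simp add: s_def v_def k_def)
  define a where "a = (1 / s) *\<^sub>R u"
  have aa: "1 - a \<bullet> a = (e + v\<^sup>2 / k) / s\<^sup>2"
    unfolding su[symmetric] a_def using s by (simp add: field_simps power2_eq_square)
  have "a \<bullet> a < 1"
    using aa upos s by (smt (verit) divide_pos_pos zero_less_power)
  then have na: "norm a < 1" by (simp add: norm_eq_sqrt_inner)
  have "u \<bullet> B = s"
    using k by (simp add: u_def s_def inner_diff_left v_def k_def field_simps)
  then have aB: "a \<bullet> B = 1" using s by (simp add: a_def)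
  have apol: "a \<in> pol B" using na aB by (simp add: pol_def hball_def)
  have "x \<bullet> u = x \<bullet> x - (v / k) * (x \<bullet> B)" by (simp add: u_def inner_diff_right)
  then have xu: "s - x \<bullet> u = e + v\<^sup>2 / k"
    using k by (simp add: s_def e_def v_def field_simps power2_eq_square)
  have "1 - x \<bullet> a = (s - x \<bullet> u) / s" using s by (simp add: a_def field_simps)
  then have xa: "1 - x \<bullet> a = (e + v\<^sup>2 / k) / s" unfolding xu .
  have da: "hdist x a = arsinh w"
  proof -
    have "(1 - x \<bullet> a) / sqrt ((1 - x \<bullet> x) * (1 - a \<bullet> a)) = sqrt ((e + v\<^sup>2 / k) / e)"
    proof -
      define E where "E = e + v\<^sup>2 / k"
      have "E / s / sqrt (e * (E / s\<^sup>2)) = E / sqrt E / sqrt e"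
        using s by (simp add: real_sqrt_mult real_sqrt_divide)
      also have "\<dots> = sqrt (E / e)"
        using upos by (simp add: real_div_sqrt real_sqrt_divide E_def)
      finally show ?thesis unfolding xa aa e_def[symmetric] E_def .
    qed
    then show ?thesis unfolding hdist_def ratio using arcosh_sqrt_one_plus_square[OF w(1)] by simp
  qed
  have lower: "arsinh w \<le> hdist x b" if b: "b \<in> pol B" for b
  proof -
    have nb: "norm b < 1" and bB: "B \<bullet> b = 1" using b by (auto simp: pol_def hball_def inner_commute)
    have bb: "0 < 1 - b \<bullet> b" using nb by (simp add: dot_square_norm power_less_one_iff)
    have "s - u \<bullet> b = 1 - x \<bullet> b" by (simp add: s_def u_def inner_diff_left bB)
    then have rc: "(e + v\<^sup>2 / k) * (1 - b \<bullet> b) \<le> (1 - x \<bullet> b)\<^sup>2"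
      using reverse_Cauchy_Schwarz[OF nb, of s u] unfolding su by simp
    have "x \<bullet> b \<le> norm x * norm b" by (rule norm_cauchy_schwarz)
    also have "\<dots> < 1" using x nb by (metis mult_left_le norm_ge_zero order.strict_trans1 less_imp_le)
    finally have pos: "0 < 1 - x \<bullet> b" by simp
    have "sqrt (1 + w\<^sup>2) \<le> (1 - x \<bullet> b) / sqrt (e * (1 - b \<bullet> b))"
    proof (rule power2_le_imp_le)
      show "(sqrt (1 + w\<^sup>2))\<^sup>2 \<le> ((1 - x \<bullet> b) / sqrt (e * (1 - b \<bullet> b)))\<^sup>2"
      proof -
        define E where "E = e + v\<^sup>2 / k"
        have "E / e = E * (1 - b \<bullet> b) / (e * (1 - b \<bullet> b))" using bb by simp
        also have "\<dots> \<le> (1 - x \<bullet> b)\<^sup>2 / (e * (1 - b \<bullet> b))"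
          using rc e bb unfolding E_def by (intro divide_right_mono) auto
        finally show ?thesis
          unfolding ratio[symmetric] E_def[symmetric] using e bb upos by (simp add: power_divide E_def)
      qed
    qed (use pos e bb in auto)
    then have "arcosh (sqrt (1 + w\<^sup>2)) \<le> hdist x b"
      unfolding hdist_def e_def by (intro arcosh_mono) auto
    then show ?thesis using arcosh_sqrt_one_plus_square[OF w(1)] by simp
  qed
  have "hdist_pt_set x (pol B) = arsinh w"
    unfolding hdist_pt_set_def
    by (rule cInf_eq_minimum) (use apol da lower in \<open>auto simp: image_iff intro!: bexI[of _ a]\<close>)
  then show ?thesis by (simp add: w_def v_def k_def e_def)
qed

text \<open>\<open>C\<close> is minus the Lorentz product of the unit normals
  \<open>(1, B) / sqrt k\<close> and \<open>(1, B') / sqrt k\<close>, hence the cosh of the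
  distance. The common perpendicular meets the first plane at the rescaled combination
  \<open>(1, B') + C * (1, B)\<close>. The inner infimum is a distance from a point to a
  plane.\<close>

lemma hdist_sets_pol:
  fixes B B' :: pt and k C :: real
  assumes k: "0 < k" "B \<bullet> B = k + 1" "B' \<bullet> B' = k + 1" and C: "1 < C" "B \<bullet> B' = 1 - C * k"
  shows "hdist_sets (pol B) (pol B') = arcosh C"
proof -
  define f where "f a = arsinh (\<bar>a \<bullet> B' - 1\<bar> / sqrt (k * (1 - a \<bullet> a)))" for a :: pt
  have f: "(INF c\<in>pol B'. hdist a c) = f a" if "a \<in> pol B" for a
    using hdist_pt_set_pol[of a B'] that k unfolding f_def hdist_pt_set_def pol_def hball_def by auto
  define s u where "s = 1 + C" and "u = B' + C *\<^sub>R B"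
  have su: "s\<^sup>2 - u \<bullet> u = k * (C\<^sup>2 - 1)"
  proof -
    have "u \<bullet> u = B' \<bullet> B' + 2 * C * (B \<bullet> B') + C\<^sup>2 * (B \<bullet> B)"
      by (simp add: u_def inner_add_left inner_add_right inner_commute power2_eq_square algebra_simps)
    then show ?thesis unfolding k C s_def by (simp add: power2_eq_square algebra_simps)
  qed
  have C2: "0 < C\<^sup>2 - 1" using C by (simp add: one_less_power)
  define a where "a = (1 / s) *\<^sub>R u"
  have s: "0 < s" using C by (simp add: s_def)
  have aa: "1 - a \<bullet> a = k * (C\<^sup>2 - 1) / s\<^sup>2"
    unfolding su[symmetric] a_def using s by (simp add: field_simps power2_eq_square)
  have "a \<bullet> a < 1" using aa k C2 s by (smt (verit) divide_pos_pos mult_pos_pos zero_less_power)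
  then have na: "norm a < 1" by (simp add: norm_eq_sqrt_inner)
  have "u \<bullet> B = B \<bullet> B' + C * (B \<bullet> B)"
    by (simp add: u_def inner_add_left inner_add_right inner_commute)
  then have "u \<bullet> B = s" unfolding k C s_def by (simp add: algebra_simps)
  then have apol: "a \<in> pol B" using na s by (simp add: pol_def hball_def a_def)
  have "u \<bullet> B' = B' \<bullet> B' + C * (B \<bullet> B')"
    by (simp add: u_def inner_add_left)
  then have "u \<bullet> B' - s = k * (1 - C\<^sup>2)"
    unfolding k C s_def by (simp add: power2_eq_square algebra_simps)
  then have aB': "a \<bullet> B' - 1 = k * (1 - C\<^sup>2) / s" using s by (simp add: a_def field_simps)
  have ar: "arsinh (sqrt (C\<^sup>2 - 1)) = arcosh C"
    using arcosh_sqrt_one_plus_square[of "sqrt (C\<^sup>2 - 1)"] C2 C by simp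
  have fa: "f a = arcosh C"
  proof -
    have "\<bar>a \<bullet> B' - 1\<bar> = k * (C\<^sup>2 - 1) / s"
      unfolding aB' using k(1) C2 s by (simp add: abs_mult abs_divide)
    moreover have "sqrt (k * (1 - a \<bullet> a)) = k * sqrt (C\<^sup>2 - 1) / s"
      unfolding aa using k(1) s by (simp add: real_sqrt_mult real_sqrt_divide)
    ultimately have "\<bar>a \<bullet> B' - 1\<bar> / sqrt (k * (1 - a \<bullet> a)) = (C\<^sup>2 - 1) / sqrt (C\<^sup>2 - 1)"
      using k(1) s by simp
    also have "\<dots> = sqrt (C\<^sup>2 - 1)" using C2 by (simp add: real_div_sqrt)
    finally show ?thesis unfolding f_def ar[symmetric] by simp
  qed
  have lower: "arcosh C \<le> f b" if b: "b \<in> pol B" for b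
  proof -
    have nb: "norm b < 1" and bB: "B \<bullet> b = 1" using b by (auto simp: pol_def hball_def inner_commute)
    have bb: "0 < 1 - b \<bullet> b" using nb by (simp add: dot_square_norm power_less_one_iff)
    have "s - u \<bullet> b = 1 - b \<bullet> B'" by (simp add: s_def u_def inner_add_left bB inner_commute[of b B'])
    then have "k * (C\<^sup>2 - 1) * (1 - b \<bullet> b) \<le> (b \<bullet> B' - 1)\<^sup>2"
      using reverse_Cauchy_Schwarz[OF nb, of s u] unfolding su by (simp add: power2_commute)
    then have "C\<^sup>2 - 1 \<le> (\<bar>b \<bullet> B' - 1\<bar> / sqrt (k * (1 - b \<bullet> b)))\<^sup>2"
      using k(1) bb by (simp add: power_divide field_simps)
    then have "sqrt (C\<^sup>2 - 1) \<le> \<bar>b \<bullet> B' - 1\<bar> / sqrt (k * (1 - b \<bullet> b))"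
      using k(1) bb by (intro real_le_lsqrt) auto
    then show ?thesis unfolding f_def ar[symmetric] by (rule arsinh_mono)
  qed
  have "hdist_sets (pol B) (pol B') = (INF a\<in>pol B. f a)"
    unfolding hdist_sets_def using f by (rule INF_cong[OF refl])
  also have "\<dots> = arcosh C"
    by (rule cInf_eq_minimum) (use apol fa lower in \<open>auto simp: image_iff intro!: bexI[of _ a]\<close>)
  finally show ?thesis .
qed

text \<open>Squaring turns the distance condition into a polynomial inequality, the form in which
  the prism integral contains it.\<close>

lemma hyperball_iff:
  fixes x B :: pt
  assumes B: "1 < B \<bullet> B" and r: "0 \<le> r"
  shows "x \<in> hyperball B r \<longleftrightarrow> norm x < 1 \<and> (x \<bullet> B - 1)\<^sup>2 \<le> (sinh r)\<^sup>2 * (B \<bullet> B - 1) * (1 - x \<bullet> x)"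
proof (cases "norm x < 1")
  case True
  define q where "q = sqrt ((B \<bullet> B - 1) * (1 - x \<bullet> x))"
  have pos: "0 < (B \<bullet> B - 1) * (1 - x \<bullet> x)"
    using True B by (simp add: dot_square_norm power_less_one_iff)
  then have q: "0 < q" "q\<^sup>2 = (B \<bullet> B - 1) * (1 - x \<bullet> x)" by (simp_all add: q_def)
  have "x \<in> hyperball B r \<longleftrightarrow> arsinh (\<bar>x \<bullet> B - 1\<bar> / q) \<le> r"
    using hdist_pt_set_pol[OF True B] True by (simp add: hyperball_def hball_def q_def)
  also have "\<dots> \<longleftrightarrow> sinh (arsinh (\<bar>x \<bullet> B - 1\<bar> / q)) \<le> sinh r"
    by (rule sinh_real_le_iff[symmetric])
  also have "\<dots> \<longleftrightarrow> \<bar>x \<bullet> B - 1\<bar> \<le> sinh r * q" using q by (simp add: sinh_arsinh_real field_simps)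
  also have "\<dots> \<longleftrightarrow> (x \<bullet> B - 1)\<^sup>2 \<le> (sinh r * q)\<^sup>2"
    using q r by (metis abs_le_square_iff abs_of_nonneg mult_nonneg_nonneg less_imp_le sinh_real_nonneg_iff)
  finally show ?thesis using True by (simp add: power_mult_distrib q(2) mult.assoc)
qed (simp add: hyperball_def hball_def)

lemma inner_vec3: "(x :: pt) \<bullet> z = x $ 1 * z $ 1 + x $ 2 * z $ 2 + x $ 3 * z $ 3"
  by (simp add: inner_vec_def sum_3)

lemma norm_vec3_less_1_iff: "norm (x :: pt) < 1 \<longleftrightarrow> (x $ 1)\<^sup>2 + (x $ 2)\<^sup>2 + (x $ 3)\<^sup>2 < 1"
  by (simp add: norm_eq_sqrt_inner inner_vec3 power2_eq_square)

lemma cos_two_pi_div_bounds: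
  fixes p :: real
  assumes "6 < p"
  shows "1/2 < cos (2 * pi / p)" "cos (2 * pi / p) < 1"
proof -
  have "2 * pi / p < pi / 3" "0 < 2 * pi / p" using assms by (simp_all add: field_simps)
  moreover have "pi / 3 \<le> pi" by simp
  ultimately show "1/2 < cos (2 * pi / p)" "cos (2 * pi / p) < 1"
    using cos_monotone_0_pi[of "2 * pi / p" "pi / 3"] cos_monotone_0_pi[of 0 "2 * pi / p"]
    by (auto simp: cos_60)
qed

lemma dihedral_angle_faces:
  fixes y :: real
  assumes y: "0 < y" "y\<^sup>2 < 1"
  shows "dihedral_angle (vector [1 / y, 0, 0]) (vector [0, 1 / y, 0]) = arccos (y\<^sup>2 / (1 - y\<^sup>2))"
proof -
  have "1 < 1 / y * (1 / y)" using y by (simp add: power2_eq_square field_simps)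
  then have "sqrt ((1 / y * (1 / y) - 1) * (1 / y * (1 / y) - 1)) = 1 / y * (1 / y) - 1" by simp
  moreover have "1 / (1 / y * (1 / y) - 1) = y\<^sup>2 / (1 - y\<^sup>2)"
    using y by (simp add: power2_eq_square field_simps)
  ultimately show ?thesis by (simp add: dihedral_angle_def inner_vec3)
qed

lemma cube_param_eq:
  fixes p :: real
  assumes p: "6 < p"
  shows "cube_param p = sqrt (cos (2 * pi / p) / (1 + cos (2 * pi / p)))"
proof -
  define c where "c = cos (2 * pi / p)"
  have c: "1/2 < c" "c < 1" using cos_two_pi_div_bounds[OF p] by (auto simp: c_def)
  define z where "z = sqrt (c / (1 + c))"
  have z2: "z\<^sup>2 = c / (1 + c)" using c by (simp add: z_def)
  have sq: "sqrt a < z \<longleftrightarrow> a < c / (1 + c)" "z < sqrt a \<longleftrightarrow> c / (1 + c) < a" for a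
    by (simp_all add: z_def)
  have dih: "dihedral_angle (vector [1 / y, 0, 0]) (vector [0, 1 / y, 0]) = arccos (y\<^sup>2 / (1 - y\<^sup>2))"
    if "1 / sqrt 3 < y" "y < 1 / sqrt 2" for y
  proof -
    have "0 < 1 / sqrt 3" by simp
    then have y0: "0 < y" using that by linarith
    have "y\<^sup>2 < (1 / sqrt 2)\<^sup>2" using that y0 by (intro power_strict_mono) auto
    then have "y\<^sup>2 < 1" by (simp add: power_divide)
    with y0 show ?thesis by (rule dihedral_angle_faces)
  qed
  have zr: "1 / sqrt 3 < z \<and> z < 1 / sqrt 2"
    using sq(1)[of "1/3"] sq(2)[of "1/2"] c by (simp add: real_sqrt_divide field_simps)
  have "cube_param p = z"
    unfolding cube_param_def
  proof (rule the_equality)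
    have "z\<^sup>2 / (1 - z\<^sup>2) = c" unfolding z2 using c by (simp add: field_simps)
    moreover have "arccos c = 2 * pi / p"
      unfolding c_def using p by (intro arccos_cos) (auto simp: field_simps)
    ultimately show "1 / sqrt 3 < z \<and> z < 1 / sqrt 2 \<and>
      dihedral_angle (vector [1 / z, 0, 0]) (vector [0, 1 / z, 0]) = 2 * pi / p"
      using zr dih by simp
  next
    fix y assume y: "1 / sqrt 3 < y \<and> y < 1 / sqrt 2 \<and>
      dihedral_angle (vector [1 / y, 0, 0]) (vector [0, 1 / y, 0]) = 2 * pi / p"
    have "0 < 1 / sqrt 3" by simp
    then have y0: "0 < y" using y by (blast intro: less_trans)
    have "y\<^sup>2 < (1 / sqrt 2)\<^sup>2" using y y0 by (intro power_strict_mono) auto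
    then have y2: "y\<^sup>2 < 1/2" by (simp add: power_divide)
    have ac: "arccos (y\<^sup>2 / (1 - y\<^sup>2)) = 2 * pi / p" using y dih[of y] by metis
    have "cos (arccos (y\<^sup>2 / (1 - y\<^sup>2))) = y\<^sup>2 / (1 - y\<^sup>2)"
    proof (rule cos_arccos)
      have "0 \<le> y\<^sup>2 / (1 - y\<^sup>2)" using y2 by (intro divide_nonneg_nonneg) auto
      then show "- 1 \<le> y\<^sup>2 / (1 - y\<^sup>2)" by linarith
      show "y\<^sup>2 / (1 - y\<^sup>2) \<le> 1" using y2 by (simp add: divide_le_eq)
    qed
    then have "y\<^sup>2 / (1 - y\<^sup>2) = c" unfolding ac c_def ..
    then have "y\<^sup>2 = c * (1 - y\<^sup>2)" using y2 by (simp add: divide_eq_eq split: if_splits)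
    then have "y\<^sup>2 * (1 + c) = c" by (simp add: algebra_simps)
    then have "y\<^sup>2 = z\<^sup>2" unfolding z2 using c by (simp add: eq_divide_eq)
    moreover have "0 \<le> z" using c by (simp add: z_def)
    ultimately show "y = z" using less_imp_le[OF y0] by (simp only: power2_eq_imp_eq)
  qed
  then show ?thesis by (simp add: z_def c_def)
qed

lemma cube_param_bounds:
  fixes p :: real
  assumes p: "6 < p"
  shows "0 < cube_param p" "1/3 < (cube_param p)\<^sup>2" "(cube_param p)\<^sup>2 < 1/2"
    and "(cube_param p)\<^sup>2 = cos (2 * pi / p) / (1 + cos (2 * pi / p))"
  using cos_two_pi_div_bounds[OF p] unfolding cube_param_eq[OF p]
  by (auto simp: field_simps)

lemma inner_cube_vertex:
  shows "cube_vertex y 1 \<bullet> cube_vertex y 1 = 3 * y\<^sup>2" "cube_vertex y 2 \<bullet> cube_vertex y 2 = 3 * y\<^sup>2"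
    and "cube_vertex y 1 \<bullet> cube_vertex y 2 = y\<^sup>2"
    and "x \<bullet> cube_vertex y 1 = y * (x $ 1 - x $ 2 - x $ 3)"
  by (simp_all add: cube_vertex_def inner_vec3 power2_eq_square algebra_simps)

text \<open>With \<open>3 * y\<^sup>2 - 1 = (2 * c - 1) / (1 + c)\<close> and
  \<open>1 - y\<^sup>2 = 1 / (1 + c)\<close> the general distance formulas become functions of
  \<open>c\<close> alone.\<close>

lemma
  fixes p :: real
  assumes p: "6 < p"
  defines "c \<equiv> cos (2 * pi / p)"
  shows h_dist_eq: "h_dist p = arcosh (1 / (2 * c - 1)) / 2"
    and t_dist_eq: "t_dist p = arsinh (sqrt ((1 + c) / (2 * c - 1)))"
    and s_dist_eq: "s_dist p = arsinh (sqrt (1 / (2 * c - 1)))"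
proof -
  define y where "y = cube_param p"
  note yb = cube_param_bounds[OF p, folded y_def c_def]
  have c: "1/2 < c" "c < 1" using cos_two_pi_div_bounds[OF p] by (auto simp: c_def)
  have k: "3 * y\<^sup>2 - 1 = (2 * c - 1) / (1 + c)" "1 - y\<^sup>2 = 1 / (1 + c)"
    unfolding yb(4) using c by (simp_all add: field_simps)
  have B: "1 < cube_vertex y 1 \<bullet> cube_vertex y 1" unfolding inner_cube_vertex(1) using yb(2) by simp
  have "hdist_sets (beta p 1) (beta p 2) = arcosh (1 / (2 * c - 1))"
    unfolding beta_def y_def[symmetric]
  proof (rule hdist_sets_pol[where k="3 * y\<^sup>2 - 1"])
    show "cube_vertex y 1 \<bullet> cube_vertex y 2 = 1 - 1 / (2 * c - 1) * (3 * y\<^sup>2 - 1)"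
    proof -
      have "1 / (2 * c - 1) * (3 * y\<^sup>2 - 1) = 1 - y\<^sup>2" unfolding k using c by simp
      then show ?thesis unfolding inner_cube_vertex(3) by simp
    qed
    show "1 < 1 / (2 * c - 1)" using c by simp
    show "cube_vertex y 1 \<bullet> cube_vertex y 1 = 3 * y\<^sup>2 - 1 + 1" unfolding inner_cube_vertex(1) by simp
    show "cube_vertex y 2 \<bullet> cube_vertex y 2 = 3 * y\<^sup>2 - 1 + 1" unfolding inner_cube_vertex(2) by simp
    show "0 < 3 * y\<^sup>2 - 1" using yb(2) by simp
  qed
  then show "h_dist p = arcosh (1 / (2 * c - 1)) / 2" by (simp add: h_dist_def)
  have "t_dist p = arsinh (1 / sqrt (3 * y\<^sup>2 - 1))"
    unfolding t_dist_def beta_def y_def[symmetric]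
    by (subst hdist_pt_set_pol[OF _ B], simp, unfold inner_cube_vertex(1), simp)
  also have "1 / sqrt (3 * y\<^sup>2 - 1) = sqrt ((1 + c) / (2 * c - 1))"
    unfolding k using c by (simp add: real_sqrt_divide)
  finally show "t_dist p = arsinh (sqrt ((1 + c) / (2 * c - 1)))" .
  have n: "norm (vector [y, 0, 0] :: pt) < 1" using yb(3) by (simp add: norm_vec3_less_1_iff)
  have "s_dist p = arsinh (\<bar>y\<^sup>2 - 1\<bar> / sqrt ((3 * y\<^sup>2 - 1) * (1 - y\<^sup>2)))"
    unfolding s_dist_def beta_def y_def[symmetric]
    unfolding hdist_pt_set_pol[OF n B] inner_cube_vertex(1)
    by (simp only: inner_cube_vertex(4)) (simp add: inner_vec3 power2_eq_square)
  also have "\<bar>y\<^sup>2 - 1\<bar> / sqrt ((3 * y\<^sup>2 - 1) * (1 - y\<^sup>2)) = sqrt ((1 - y\<^sup>2) / (3 * y\<^sup>2 - 1))"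
  proof -
    define e where "e = 1 - y\<^sup>2"
    have e: "0 < e" "\<bar>y\<^sup>2 - 1\<bar> = e" using yb(3) by (simp_all add: e_def)
    have "e / sqrt ((3 * y\<^sup>2 - 1) * e) = e / sqrt e / sqrt (3 * y\<^sup>2 - 1)"
      by (simp add: real_sqrt_mult mult.commute)
    then show ?thesis unfolding e(2) e_def[symmetric] using e(1) by (simp add: real_div_sqrt real_sqrt_divide)
  qed
  also have "(1 - y\<^sup>2) / (3 * y\<^sup>2 - 1) = 1 / (2 * c - 1)" unfolding k using c by simp
  finally show "s_dist p = arsinh (sqrt (1 / (2 * c - 1)))" .
qed

text \<open>The eight vertices carry all sign patterns, so their half-spaces together bound the sum
  of the absolute values of the coordinates.\<close>

lemma trunc_cube_iff:
  fixes x :: pt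
  assumes y: "0 < cube_param p"
  shows "x \<in> trunc_cube p \<longleftrightarrow> norm x < 1 \<and> \<bar>x $ 1\<bar> \<le> cube_param p \<and> \<bar>x $ 2\<bar> \<le> cube_param p \<and> \<bar>x $ 3\<bar> \<le> cube_param p
    \<and> cube_param p * (\<bar>x $ 1\<bar> + \<bar>x $ 2\<bar> + \<bar>x $ 3\<bar>) \<le> 1"
proof -
  define y where "y = cube_param p"
  have y0: "0 < y" using assms by (simp add: y_def)
  define a b c where "a = x $ 1" and "b = x $ 2" and "c = x $ 3"
  have set8: "{1..8::nat} = {1, 2, 3, 4, 5, 6, 7, 8}" by auto
  have "(\<forall>i\<in>{1..8}. x \<bullet> cube_vertex y i \<le> 1) \<longleftrightarrow>
    y * (a - b - c) \<le> 1 \<and> y * (a + b - c) \<le> 1 \<and> y * (- a + b - c) \<le> 1 \<and> y * (- a - b - c) \<le> 1 \<and>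
    y * (a - b + c) \<le> 1 \<and> y * (a + b + c) \<le> 1 \<and> y * (- a + b + c) \<le> 1 \<and> y * (- a - b + c) \<le> 1"
    unfolding set8 by (simp add: cube_vertex_def inner_vec3 a_def b_def c_def algebra_simps)
  also have "\<dots> \<longleftrightarrow> a - b - c \<le> 1 / y \<and> a + b - c \<le> 1 / y \<and> - a + b - c \<le> 1 / y \<and> - a - b - c \<le> 1 / y \<and>
    a - b + c \<le> 1 / y \<and> a + b + c \<le> 1 / y \<and> - a + b + c \<le> 1 / y \<and> - a - b + c \<le> 1 / y"
    using y0 by (simp add: pos_le_divide_eq mult.commute)
  also have "\<dots> \<longleftrightarrow> \<bar>a\<bar> + \<bar>b\<bar> + \<bar>c\<bar> \<le> 1 / y" by linarith
  also have "\<dots> \<longleftrightarrow> y * (\<bar>a\<bar> + \<bar>b\<bar> + \<bar>c\<bar>) \<le> 1" using y0 by (simp add: pos_le_divide_eq mult.commute)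
  finally show ?thesis
    unfolding trunc_cube_def y_def[symmetric] by (auto simp: forall_3 hball_def a_def b_def c_def)
qed

section \<open>Hyperbolic volumes as nonnegative integrals\<close>

lemma pred_le_continuous:
  fixes f g :: "'a::topological_space \<Rightarrow> real"
  assumes "continuous_on UNIV f" "continuous_on UNIV g"
  shows "Measurable.pred borel (\<lambda>x. f x \<le> g x)"
proof -
  have [measurable]: "f \<in> borel_measurable borel" "g \<in> borel_measurable borel"
    using assms by (auto intro: borel_measurable_continuous_onI)
  show ?thesis by measurable
qed

lemma pred_less_continuous:
  fixes f g :: "'a::topological_space \<Rightarrow> real"
  assumes "continuous_on UNIV f" "continuous_on UNIV g"
  shows "Measurable.pred borel (\<lambda>x. f x < g x)"
proof -
  have [measurable]: "f \<in> borel_measurable borel" "g \<in> borel_measurable borel"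
    using assms by (auto intro: borel_measurable_continuous_onI)
  show ?thesis by measurable
qed

definition klein_density :: "pt \<Rightarrow> ennreal" where
  "klein_density x = ennreal (1 / (1 - ((x $ 1)\<^sup>2 + (x $ 2)\<^sup>2 + (x $ 3)\<^sup>2))\<^sup>2)"

text \<open>Valid for infinite integrals as well: both sides are then 0, by the conventions for the
  Bochner integral and for \<open>enn2real\<close>.\<close>

lemma hvol_eq_nn_integral:
  assumes [measurable]: "Measurable.pred borel P"
  shows "hvol {x. P x} = enn2real (\<integral>\<^sup>+x. (if P x then klein_density x else 0) \<partial>lborel)"
proof -
  have n: "(norm x)\<^sup>2 = (x $ 1)\<^sup>2 + (x $ 2)\<^sup>2 + (x $ 3)\<^sup>2" for x :: pt
    unfolding power2_norm_eq_inner inner_vec3 by (simp add: power2_eq_square)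
  have "hvol {x. P x} = (LINT x|lborel. (if P x then 1 / (1 - ((x $ 1)\<^sup>2 + (x $ 2)\<^sup>2 + (x $ 3)\<^sup>2))\<^sup>2 else 0))"
    unfolding hvol_def set_lebesgue_integral_def n
    by (intro Bochner_Integration.integral_cong) auto
  also have "\<dots> = enn2real (\<integral>\<^sup>+x. ennreal (if P x then 1 / (1 - ((x $ 1)\<^sup>2 + (x $ 2)\<^sup>2 + (x $ 3)\<^sup>2))\<^sup>2 else 0) \<partial>lborel)"
    by (intro integral_eq_nn_integral) auto
  also have "(\<integral>\<^sup>+x. ennreal (if P x then 1 / (1 - ((x $ 1)\<^sup>2 + (x $ 2)\<^sup>2 + (x $ 3)\<^sup>2))\<^sup>2 else 0) \<partial>lborel) =
     (\<integral>\<^sup>+x. (if P x then klein_density x else 0) \<partial>lborel)"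
    by (intro nn_integral_cong) (auto simp: klein_density_def)
  finally show ?thesis .
qed

text \<open>By the half-angle formulas the root is
  \<open>cot (pi / p) = tan (pi / 2 - pi / p)\<close>; the result is the defect of a triangle with
  three angles \<open>2 * pi / p\<close>.\<close>

lemma prism_area:
  fixes p :: real
  assumes p: "6 < p"
  shows "6 * arctan (sqrt (3 / (1 - 2 * (3 * (cube_param p)\<^sup>2 - 1)))) - 2 * pi = pi - 6 * pi / p"
proof -
  define c where "c = cos (2 * pi / p)"
  have c: "1/2 < c" "c < 1" using cos_two_pi_div_bounds[OF p] by (auto simp: c_def)
  define x where "x = pi / p"
  have x: "0 < x" "x < pi / 2" using p by (auto simp: x_def field_simps)
  have sc: "0 < sin x" "0 < cos x" using x by (auto intro: sin_gt_zero cos_gt_zero)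
  have c2: "1 + c = 2 * (cos x)\<^sup>2" "1 - c = 2 * (sin x)\<^sup>2"
    using cos_double_cos[of x] cos_double_sin[of x] by (simp_all add: c_def x_def)
  have "3 / (1 - 2 * (3 * (cube_param p)\<^sup>2 - 1)) = (1 + c) / (1 - c)"
    unfolding cube_param_bounds(4)[OF p] c_def[symmetric] using c by (simp add: field_simps)
  also have "\<dots> = (cos x / sin x)\<^sup>2" unfolding c2 by (simp add: power_divide)
  also have "sqrt \<dots> = tan (pi / 2 - x)"
    using sc by (simp add: tan_def sin_diff cos_diff)
  also have "arctan \<dots> = pi / 2 - x" using x by (intro arctan_tan) auto
  finally show ?thesis by (simp add: x_def)
qed

text \<open>\<open>ball\<close> describes height \<open>s\<close>, since
  \<open>(sinh s)\<^sup>2 * (3 * y\<^sup>2 - 1) = 1 - y\<^sup>2\<close>; the coordinates are those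
  of a point with its last two signs flipped. Minimising over two coordinates bounds the third from
  below by \<open>- (2/5) * y\<close>. If some coordinate is negative, the absolute values therefore
  sum to at most \<open>2 * y + 2/5 * y\<close>, and \<open>y * (12/5 * y) \<le> 1\<close> is the
  origin of \<open>5/12\<close>.\<close>

lemma prism_subset_trunc_cube:
  fixes y a b c :: real
  assumes y: "0 < y" "1/3 < y\<^sup>2" "y\<^sup>2 \<le> 5/12"
    and le: "a \<le> y" "b \<le> y" "c \<le> y" "y * (a + b + c) \<le> 1"
    and ball: "(y * (a + b + c) - 1)\<^sup>2 \<le> (1 - y\<^sup>2) * (1 - (a\<^sup>2 + b\<^sup>2 + c\<^sup>2))"
  shows "\<bar>a\<bar> \<le> y \<and> \<bar>b\<bar> \<le> y \<and> \<bar>c\<bar> \<le> y \<and> y * (\<bar>a\<bar> + \<bar>b\<bar> + \<bar>c\<bar>) \<le> 1"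
proof -
  have lower: "- (2/5) * y \<le> a"
    if ball: "(y * (a + b + c) - 1)\<^sup>2 \<le> (1 - y\<^sup>2) * (1 - (a\<^sup>2 + b\<^sup>2 + c\<^sup>2))" for a b c
  proof (rule ccontr)
    assume "\<not> - (2/5) * y \<le> a"
    then have t: "2/5 * y < - a" by simp
    define u where "u = b + c"
    define w where "w = 1 - y * a"
    \<comment> \<open>Splitting off \<open>(b - c)\<^sup>2\<close> and completing the square in
      \<open>u = b + c\<close> leaves \<open>(1 - y\<^sup>2) / (1 + y\<^sup>2) * w\<^sup>2\<close>
      as the minimum over \<open>b\<close> and \<open>c\<close>.\<close>
    have "(y * (a + b + c) - 1)\<^sup>2 + (1 - y\<^sup>2) * (b\<^sup>2 + c\<^sup>2) =
      (w - y * u)\<^sup>2 + (1 - y\<^sup>2) * u\<^sup>2 / 2 + (1 - y\<^sup>2) * (b - c)\<^sup>2 / 2"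
      unfolding u_def w_def by (simp add: power2_eq_square field_simps)
    moreover have "(1 + y\<^sup>2) * ((w - y * u)\<^sup>2 + (1 - y\<^sup>2) * u\<^sup>2 / 2) = (1 - y\<^sup>2) * w\<^sup>2 + ((1 + y\<^sup>2) * u - 2 * y * w)\<^sup>2 / 2"
      by (simp add: power2_eq_square field_simps)
    moreover have "0 \<le> (1 - y\<^sup>2) * (b - c)\<^sup>2 / 2" using y by simp
    ultimately have "(1 - y\<^sup>2) * w\<^sup>2 \<le> (1 + y\<^sup>2) * ((y * (a + b + c) - 1)\<^sup>2 + (1 - y\<^sup>2) * (b\<^sup>2 + c\<^sup>2))"
      by (smt (verit) mult_left_mono zero_le_power2 divide_nonneg_nonneg)
    also have "\<dots> \<le> (1 + y\<^sup>2) * ((1 - y\<^sup>2) * (1 - a\<^sup>2))"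
      using ball by (intro mult_left_mono) (simp_all add: algebra_simps)
    finally have "(1 - y\<^sup>2) * w\<^sup>2 \<le> (1 - y\<^sup>2) * ((1 + y\<^sup>2) * (1 - a\<^sup>2))" by (simp add: mult_ac)
    then have "w\<^sup>2 \<le> (1 + y\<^sup>2) * (1 - a\<^sup>2)" using y by simp
    then have main: "(1 + 2 * y\<^sup>2) * a\<^sup>2 - 2 * y * a \<le> y\<^sup>2"
      by (simp add: w_def power2_eq_square algebra_simps)
    \<comment> \<open>Because \<open>5/3 \<le> 1 + 2 * y\<^sup>2\<close>, the left side of
      \<open>main\<close> would exceed
      \<open>(4/15 + 4/5) * y\<^sup>2 = 16/15 * y\<^sup>2\<close>.\<close>
    have "(2/5 * y)\<^sup>2 \<le> (- a)\<^sup>2" using t y by (intro power_mono) auto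
    then have "(5/3) * (4/25 * y\<^sup>2) \<le> (1 + 2 * y\<^sup>2) * a\<^sup>2"
      using y by (intro mult_mono) (auto simp: power_mult_distrib power2_eq_square)
    moreover have "2 * y * (2/5 * y) < 2 * y * (- a)" using t y by (intro mult_strict_left_mono) auto
    ultimately show False using main y by (simp add: power2_eq_square algebra_simps)
  qed
  have la: "- (2/5) * y \<le> a" using lower ball by blast
  have lb: "- (2/5) * y \<le> b" using lower[of b a c] ball by (simp add: add_ac)
  have lc: "- (2/5) * y \<le> c" using lower[of c a b] ball by (simp add: add_ac)
  have y24: "y * (12/5 * y) \<le> 1" using y by (simp add: power2_eq_square)
  have "\<bar>a\<bar> + \<bar>b\<bar> + \<bar>c\<bar> \<le> 12/5 * y \<or> \<bar>a\<bar> + \<bar>b\<bar> + \<bar>c\<bar> = a + b + c"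
    using la lb lc le y(1) by linarith
  then have "y * (\<bar>a\<bar> + \<bar>b\<bar> + \<bar>c\<bar>) \<le> 1"
  proof
    assume "\<bar>a\<bar> + \<bar>b\<bar> + \<bar>c\<bar> \<le> 12/5 * y"
    then show ?thesis using y24 y(1) by (meson mult_left_mono order.trans less_imp_le)
  qed (use le(4) in simp)
  then show ?thesis using la lb lc le y(1) by auto
qed

text \<open>The prism is bounded by the three cube faces through the vertex and the truncating
  plane, so the truncated cube lies inside it (\<open>PQ\<close>); this gives the upper bound at
  every height. The condition on \<open>sinh r\<close> says that \<open>r\<close> is at most
  \<open>s\<close>, and there \<open>prism_subset_trunc_cube\<close> supplies the converse
  inclusion.\<close>

lemma
  fixes p r :: real
  assumes p: "6 < p" and r: "0 \<le> r"
  shows Vh_le: "Vh p r \<le> hyperball_profile r * (pi - 6 * pi / p)"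
    and Vh_eq: "(sinh r)\<^sup>2 * (3 * (cube_param p)\<^sup>2 - 1) \<le> 1 - (cube_param p)\<^sup>2 \<Longrightarrow> (cube_param p)\<^sup>2 \<le> 5/12 \<Longrightarrow>
      Vh p r = hyperball_profile r * (pi - 6 * pi / p)"
proof -
  define y where "y = cube_param p"
  note yb = cube_param_bounds(1,2,3)[OF p, folded y_def]
  define k where "k = 3 * y\<^sup>2 - 1"
  have area: "0 \<le> pi - 6 * pi / p" using p by (simp add: field_simps)
  have prof: "0 \<le> hyperball_profile r" using r by (simp add: hyperball_profile_def)
  define Q where "Q x \<longleftrightarrow> x $ 1 \<le> y \<and> - x $ 2 \<le> y \<and> - x $ 3 \<le> y \<and> y * (x $ 1 - x $ 2 - x $ 3) \<le> 1 \<and>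
        0 < 1 - ((x $ 1)\<^sup>2 + (x $ 2)\<^sup>2 + (x $ 3)\<^sup>2) \<and>
        (y * (x $ 1 - x $ 2 - x $ 3) - 1)\<^sup>2 \<le> (sinh r)\<^sup>2 * k * (1 - ((x $ 1)\<^sup>2 + (x $ 2)\<^sup>2 + (x $ 3)\<^sup>2))" for x :: pt
  have QI: "(\<integral>\<^sup>+x. (if Q x then klein_density x else 0) \<partial>lborel) = ennreal (hyperball_profile r * (pi - 6 * pi / p))"
    unfolding prism_area[OF p, folded y_def, symmetric] klein_density_def Q_def k_def
    by (rule nn_integral_hyperball_prism[OF yb r])
  define P where "P x \<longleftrightarrow> (norm x < 1 \<and> \<bar>x $ 1\<bar> \<le> y \<and> \<bar>x $ 2\<bar> \<le> y \<and> \<bar>x $ 3\<bar> \<le> y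
    \<and> y * (\<bar>x $ 1\<bar> + \<bar>x $ 2\<bar> + \<bar>x $ 3\<bar>) \<le> 1) \<and>
    (y * (x $ 1 - x $ 2 - x $ 3) - 1)\<^sup>2 \<le> (sinh r)\<^sup>2 * k * (1 - ((x $ 1)\<^sup>2 + (x $ 2)\<^sup>2 + (x $ 3)\<^sup>2))" for x :: pt
  have Pm: "Measurable.pred borel P"
    unfolding P_def by (intro pred_intros_logic(3) pred_le_continuous pred_less_continuous continuous_intros)
  have B: "1 < cube_vertex y 1 \<bullet> cube_vertex y 1" unfolding inner_cube_vertex(1) using yb(2) by simp
  have "hyperball (cube_vertex y 1) r \<inter> trunc_cube p = {x. P x}"
  proof (rule set_eqI)
    fix x :: pt
    have "x \<bullet> x = (x $ 1)\<^sup>2 + (x $ 2)\<^sup>2 + (x $ 3)\<^sup>2" by (simp add: inner_vec3 power2_eq_square)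
    then show "x \<in> hyperball (cube_vertex y 1) r \<inter> trunc_cube p \<longleftrightarrow> x \<in> {x. P x}"
      unfolding Int_iff hyperball_iff[OF B r, unfolded inner_cube_vertex(1)] trunc_cube_iff[OF yb(1)[unfolded y_def]] P_def
        inner_cube_vertex(4) k_def y_def[symmetric] by auto
  qed
  then have V: "Vh p r = enn2real (\<integral>\<^sup>+x. (if P x then klein_density x else 0) \<partial>lborel)"
    unfolding Vh_def y_def[symmetric] using hvol_eq_nn_integral[OF Pm] by simp
  have PQ: "Q x" if "P x" for x
  proof -
    have "x $ 1 - x $ 2 - x $ 3 \<le> \<bar>x $ 1\<bar> + \<bar>x $ 2\<bar> + \<bar>x $ 3\<bar>" by linarith
    then have "y * (x $ 1 - x $ 2 - x $ 3) \<le> y * (\<bar>x $ 1\<bar> + \<bar>x $ 2\<bar> + \<bar>x $ 3\<bar>)"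
      using yb(1) by (intro mult_left_mono) auto
    then show ?thesis using that unfolding P_def Q_def norm_vec3_less_1_iff by auto
  qed
  have "(\<integral>\<^sup>+x. (if P x then klein_density x else 0) \<partial>lborel) \<le> (\<integral>\<^sup>+x. (if Q x then klein_density x else 0) \<partial>lborel)"
    using PQ by (intro nn_integral_mono) auto
  then show "Vh p r \<le> hyperball_profile r * (pi - 6 * pi / p)"
    unfolding V QI using area prof
    by (metis enn2real_ennreal enn2real_mono ennreal_less_top mult_nonneg_nonneg)
  assume s: "(sinh r)\<^sup>2 * (3 * (cube_param p)\<^sup>2 - 1) \<le> 1 - (cube_param p)\<^sup>2" and y5: "(cube_param p)\<^sup>2 \<le> 5/12"
  have QP: "P x" if q: "Q x" for x
  proof -
    have pos: "0 \<le> 1 - ((x $ 1)\<^sup>2 + (x $ 2)\<^sup>2 + (x $ 3)\<^sup>2)" using q by (simp add: Q_def)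
    have "(y * (x $ 1 - x $ 2 - x $ 3) - 1)\<^sup>2 \<le> (sinh r)\<^sup>2 * k * (1 - ((x $ 1)\<^sup>2 + (x $ 2)\<^sup>2 + (x $ 3)\<^sup>2))"
      using q by (simp add: Q_def)
    also have "\<dots> \<le> (1 - y\<^sup>2) * (1 - ((x $ 1)\<^sup>2 + (x $ 2)\<^sup>2 + (x $ 3)\<^sup>2))"
      using s pos unfolding k_def y_def by (intro mult_right_mono) auto
    finally have "\<bar>x $ 1\<bar> \<le> y \<and> \<bar>- x $ 2\<bar> \<le> y \<and> \<bar>- x $ 3\<bar> \<le> y \<and> y * (\<bar>x $ 1\<bar> + \<bar>- x $ 2\<bar> + \<bar>- x $ 3\<bar>) \<le> 1"
      using q y5 yb unfolding Q_def y_def[symmetric] by (intro prism_subset_trunc_cube) auto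
    then show ?thesis using q unfolding P_def Q_def norm_vec3_less_1_iff by simp
  qed
  have "P = Q" using PQ QP by blast
  then show "Vh p r = hyperball_profile r * (pi - 6 * pi / p)"
    unfolding V QI using area prof QI by simp
qed

text \<open>The squared length is convex, hence largest at a vertex, here \<open>(y, y, m)\<close>
  with \<open>m = 1 / y - 2 * y\<close> up to order. If all coordinates are at least
  \<open>m\<close>, the chord of the square over the interval from \<open>m\<close> to
  \<open>y\<close> proves it; otherwise one coordinate is at most \<open>m\<close> and the others at
  most \<open>y\<close>.\<close>

lemma octant_norm_less_1:
  fixes y a b c :: real
  assumes y: "0 < y" "1/3 < y\<^sup>2" "y\<^sup>2 < 1/2"
    and abc: "0 \<le> a" "0 \<le> b" "0 \<le> c" "a \<le> y" "b \<le> y" "c \<le> y" "a + b + c \<le> 1 / y"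
  shows "a\<^sup>2 + b\<^sup>2 + c\<^sup>2 \<le> 2 * y\<^sup>2 + (1 / y - 2 * y)\<^sup>2" "2 * y\<^sup>2 + (1 / y - 2 * y)\<^sup>2 < 1"
proof -
  define m where "m = 1 / y - 2 * y"
  have m: "0 < m" "m < y" using y by (simp_all add: m_def field_simps power2_eq_square)
  have sq: "x\<^sup>2 \<le> z\<^sup>2" if "0 \<le> x" "x \<le> z" for x z :: real using that by (intro power_mono) auto
  show "a\<^sup>2 + b\<^sup>2 + c\<^sup>2 \<le> 2 * y\<^sup>2 + (1 / y - 2 * y)\<^sup>2"
  proof (cases "m \<le> a \<and> m \<le> b \<and> m \<le> c")
    case True
    have q: "x\<^sup>2 \<le> (y + m) * x - y * m" if "m \<le> x" "x \<le> y" for x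
    proof -
      have "0 \<le> (x - m) * (y - x)" using that by simp
      then show ?thesis by (simp add: power2_eq_square algebra_simps)
    qed
    have "a\<^sup>2 + b\<^sup>2 + c\<^sup>2 \<le> (y + m) * (a + b + c) - 3 * (y * m)"
      using q[of a] q[of b] q[of c] True abc by (simp add: algebra_simps)
    also have "\<dots> \<le> (y + m) * (2 * y + m) - 3 * (y * m)"
      using abc(7) m y by (intro diff_right_mono mult_left_mono) (auto simp: m_def)
    also have "\<dots> = 2 * y\<^sup>2 + m\<^sup>2" by (simp add: power2_eq_square algebra_simps)
    finally show ?thesis by (simp add: m_def)
  next
    case False
    then consider "a \<le> m" | "b \<le> m" | "c \<le> m" by linarith
    then show ?thesis
    proof cases
      case 1
      then show ?thesis using sq[OF abc(1) 1] sq[OF abc(2,5)] sq[OF abc(3,6)]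
        unfolding m_def[symmetric] by linarith
    next
      case 2
      then show ?thesis using sq[OF abc(1,4)] sq[OF abc(2) 2] sq[OF abc(3,6)]
        unfolding m_def[symmetric] by linarith
    next
      case 3
      then show ?thesis using sq[OF abc(1,4)] sq[OF abc(2,5)] sq[OF abc(3) 3]
        unfolding m_def[symmetric] by linarith
    qed
  qed
  have "2 * y\<^sup>2 + (1 / y - 2 * y)\<^sup>2 - 1 = (3 * y\<^sup>2 - 1) * (2 * y\<^sup>2 - 1) / y\<^sup>2"
    using y by (simp add: power2_eq_square field_simps)
  also have "\<dots> < 0" using y by (intro divide_neg_pos mult_pos_neg) auto
  finally show "2 * y\<^sup>2 + (1 / y - 2 * y)\<^sup>2 < 1" by simp
qed

lemma borel_measurable_octant_integrand [measurable]:
  assumes [measurable]: "f \<in> borel_measurable M" "g \<in> borel_measurable M" "h \<in> borel_measurable M"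
  shows "(\<lambda>x. octant_integrand y d (f x) (g x) (h x)) \<in> borel_measurable M"
  unfolding octant_integrand_def by measurable

lemma octant_volume_mono:
  assumes "y \<le> y'" "d \<le> d'"
  shows "octant_volume y d \<le> octant_volume y' d'"
  unfolding octant_volume_def octant_integrand_def
  using assms by (intro nn_integral_mono) auto

text \<open>\<open>enn2real\<close> sends an infinite value to 0; finiteness is what lets lower
  bounds pass through it.\<close>

lemma octant_volume_finite:
  fixes y :: real
  assumes y: "0 < y" "1/3 < y\<^sup>2" "y\<^sup>2 < 1/2"
  shows "octant_volume y (1 / y) < \<infinity>"
proof -
  define z where "z = 2 * y\<^sup>2 + (1 / y - 2 * y)\<^sup>2"
  have z: "z < 1" unfolding z_def by (rule octant_norm_less_1(2)[OF y, of 0 0 0]) (use y in auto)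
  have "octant_volume y (1 / y) \<le> (\<integral>\<^sup>+a. \<integral>\<^sup>+b. \<integral>\<^sup>+c. ennreal (1 / (1 - z)\<^sup>2) * indicator {0..y} c * indicator {0..y} b * indicator {0..y} a
      \<partial>lborel \<partial>lborel \<partial>lborel)"
    unfolding octant_volume_def
  proof (intro nn_integral_mono)
    fix a b c
    have "1 / (1 - (a\<^sup>2 + b\<^sup>2 + c\<^sup>2))\<^sup>2 \<le> 1 / (1 - z)\<^sup>2"
      if "0 \<le> a" "0 \<le> b" "0 \<le> c" "a \<le> y" "b \<le> y" "c \<le> y" "a + b + c \<le> 1 / y"
    proof -
      have "a\<^sup>2 + b\<^sup>2 + c\<^sup>2 \<le> z" unfolding z_def by (rule octant_norm_less_1(1)[OF y that])
      then show ?thesis using z by (intro divide_left_mono power_mono mult_pos_pos) auto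
    qed
    then show "octant_integrand y (1 / y) a b c \<le> ennreal (1 / (1 - z)\<^sup>2) * indicator {0..y} c * indicator {0..y} b * indicator {0..y} a"
      unfolding octant_integrand_def by (auto intro!: ennreal_leI split: split_indicator)
  qed
  also have "\<dots> = ennreal (1 / (1 - z)\<^sup>2) * ennreal y * ennreal y * ennreal y"
    using y(1) by (simp add: nn_integral_multc nn_integral_cmult)
  also have "\<dots> < \<infinity>" by (simp add: ennreal_mult_less_top)
  finally show ?thesis .
qed

text \<open>Evenness in each coordinate is applied three times, from the innermost integral
  outwards.\<close>

lemma V0_eq_octant_volume:
  fixes p :: real
  assumes p: "6 < p"
  shows "V0 p = 8 * enn2real (octant_volume (cube_param p) (1 / cube_param p))"
proof -
  define y where "y = cube_param p"
  note yb = cube_param_bounds(1,2,3)[OF p, folded y_def]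
  define K where "K a b c = (if \<bar>a\<bar> \<le> y \<and> \<bar>b\<bar> \<le> y \<and> \<bar>c\<bar> \<le> y \<and> \<bar>a\<bar> + \<bar>b\<bar> + \<bar>c\<bar> \<le> 1 / y
     then ennreal (1 / (1 - (a\<^sup>2 + b\<^sup>2 + c\<^sup>2))\<^sup>2) else 0)" for a b c :: real
  have Km [measurable]: "(\<lambda>x. K (f x) (g x) (h x)) \<in> borel_measurable X"
    if [measurable]: "f \<in> borel_measurable X" "g \<in> borel_measurable X" "h \<in> borel_measurable X"
    for f g h and X :: "'x measure"
    unfolding K_def by measurable
  define P where "P x \<longleftrightarrow> \<bar>x $ 1\<bar> \<le> y \<and> \<bar>x $ 2\<bar> \<le> y \<and> \<bar>x $ 3\<bar> \<le> y \<and> \<bar>x $ 1\<bar> + \<bar>x $ 2\<bar> + \<bar>x $ 3\<bar> \<le> 1 / y" for x :: pt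
  have Pm: "Measurable.pred borel P"
    unfolding P_def by (intro pred_intros_logic(3) pred_le_continuous pred_less_continuous continuous_intros)
  have "trunc_cube p = {x. P x}"
  proof (rule set_eqI)
    fix x :: pt
    have "norm x < 1" if "P x"
      using octant_norm_less_1[OF yb, of "\<bar>x $ 1\<bar>" "\<bar>x $ 2\<bar>" "\<bar>x $ 3\<bar>"] that
      unfolding P_def norm_vec3_less_1_iff by simp
    moreover have "y * (\<bar>x $ 1\<bar> + \<bar>x $ 2\<bar> + \<bar>x $ 3\<bar>) \<le> 1 \<longleftrightarrow> \<bar>x $ 1\<bar> + \<bar>x $ 2\<bar> + \<bar>x $ 3\<bar> \<le> 1 / y"
      using yb(1) by (simp add: pos_le_divide_eq mult.commute)
    ultimately show "x \<in> trunc_cube p \<longleftrightarrow> x \<in> {x. P x}"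
      unfolding trunc_cube_iff[OF yb(1)[unfolded y_def]] y_def[symmetric] P_def by auto
  qed
  then have "V0 p = enn2real (\<integral>\<^sup>+x. (if P x then klein_density x else 0) \<partial>lborel)"
    unfolding V0_def using hvol_eq_nn_integral[OF Pm] by simp
  also have "(\<integral>\<^sup>+x. (if P x then klein_density x else 0) \<partial>lborel) = (\<integral>\<^sup>+x. K (x $ 1) (x $ 2) (x $ 3) \<partial>(lborel :: pt measure))"
    unfolding K_def P_def klein_density_def ..
  also have "\<dots> = (\<integral>\<^sup>+a. \<integral>\<^sup>+b. \<integral>\<^sup>+c. K a b c \<partial>lborel \<partial>lborel \<partial>lborel)"
  proof -
    have "(\<lambda>x::real^3. K (x $ 1) (x $ 2) (x $ 3)) \<in> borel_measurable borel" by measurable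
    from nn_integral_lborel_vec3[OF this] show ?thesis by simp
  qed
  also have "\<dots> = 8 * octant_volume y (1 / y)"
  proof -
    define G where "G a b = (\<integral>\<^sup>+c. K a b c * indicator {0..} c \<partial>lborel)" for a b
    define G' where "G' a = (\<integral>\<^sup>+b. G a b * indicator {0..} b \<partial>lborel)" for a
    have Gm [measurable]: "(\<lambda>x. G (f x) (g x)) \<in> borel_measurable X"
      if [measurable]: "f \<in> borel_measurable X" "g \<in> borel_measurable X" for f g and X :: "'x measure"
      unfolding G_def by measurable
    have G'm [measurable]: "G' \<in> borel_measurable borel"
      unfolding G'_def by measurable
    have sym: "K (- a) b c = K a b c" "K a (- b) c = K a b c" "K a b (- c) = K a b c" for a b c
      by (simp_all add: K_def)
    have c: "(\<integral>\<^sup>+c. K a b c \<partial>lborel) = 2 * G a b" for a b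
      unfolding G_def by (rule nn_integral_even) (measurable, rule sym)
    have "(\<integral>\<^sup>+b. 2 * G a b \<partial>lborel) = 2 * (\<integral>\<^sup>+b. G a b \<partial>lborel)" for a
      by (rule nn_integral_cmult) measurable
    moreover have "(\<integral>\<^sup>+b. G a b \<partial>lborel) = 2 * G' a" for a
      unfolding G'_def by (rule nn_integral_even) (measurable, simp add: G_def sym)
    ultimately have b: "(\<integral>\<^sup>+b. 2 * G a b \<partial>lborel) = 4 * G' a" for a
      by (simp add: mult.assoc[symmetric])
    have "(\<integral>\<^sup>+a. 4 * G' a \<partial>lborel) = 4 * (\<integral>\<^sup>+a. G' a \<partial>lborel)"
      by (rule nn_integral_cmult) measurable
    also have "(\<integral>\<^sup>+a. G' a \<partial>lborel) = 2 * (\<integral>\<^sup>+a. G' a * indicator {0..} a \<partial>lborel)"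
      by (rule nn_integral_even) (measurable, simp add: G'_def G_def sym)
    also have "(\<integral>\<^sup>+a. G' a * indicator {0..} a \<partial>lborel) = octant_volume y (1 / y)"
      unfolding octant_volume_def
    proof (rule nn_integral_cong)
      fix a :: real
      have "(\<integral>\<^sup>+b. \<integral>\<^sup>+c. octant_integrand y (1 / y) a b c \<partial>lborel \<partial>lborel) =
        (\<integral>\<^sup>+b. G a b * indicator {0..} b * indicator {0..} a \<partial>lborel)"
      proof (rule nn_integral_cong)
        fix b :: real
        have "(\<integral>\<^sup>+c. octant_integrand y (1 / y) a b c \<partial>lborel) =
          (\<integral>\<^sup>+c. K a b c * indicator {0..} c * (indicator {0..} b * indicator {0..} a) \<partial>lborel)"
          by (intro nn_integral_cong) (auto simp: K_def octant_integrand_def split: split_indicator)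
        also have "\<dots> = G a b * (indicator {0..} b * indicator {0..} a)"
          unfolding G_def by (rule nn_integral_multc) measurable
        finally show "(\<integral>\<^sup>+c. octant_integrand y (1 / y) a b c \<partial>lborel) = G a b * indicator {0..} b * indicator {0..} a"
          by (simp add: mult.assoc)
      qed
      also have "\<dots> = G' a * indicator {0..} a"
        unfolding G'_def by (rule nn_integral_multc) measurable
      finally show "G' a * indicator {0..} a = (\<integral>\<^sup>+b. \<integral>\<^sup>+c. octant_integrand y (1 / y) a b c \<partial>lborel \<partial>lborel)" ..
    qed
    finally show ?thesis unfolding c b by (simp add: mult.assoc[symmetric])
  qed
  also have "enn2real (8 * octant_volume y (1 / y)) = 8 * enn2real (octant_volume y (1 / y))"
    by (simp add: enn2real_mult)
  finally show ?thesis by (simp add: y_def)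
qed

subsection \<open>Certified bounds for the cone integrals\<close>

lemma artanh_sqrt_has_real_derivative:
  assumes "0 < z" "z < (1::real)"
  shows "((\<lambda>z. artanh (sqrt z)) has_real_derivative 1 / (1 - z) / (2 * sqrt z)) (at z)"
proof -
  have "((\<lambda>z. artanh (sqrt z)) has_real_derivative 1 / (1 - (sqrt z)\<^sup>2) * (inverse (sqrt z) / 2)) (at z)"
    by (rule DERIV_chain2[OF artanh_real_has_field_derivative DERIV_real_sqrt]) (use assms in auto)
  moreover have "1 / (1 - (sqrt z)\<^sup>2) * (inverse (sqrt z) / 2) = 1 / (1 - z) / (2 * sqrt z)"
    using assms by (simp add: field_simps)
  ultimately show ?thesis by simp
qed

text \<open>\<open>Phi\<close> solves \<open>2 z \<Phi>' + \<Phi> = 1 / (1 - z)\<close>, so \<open>sqrt z * (Phi z - P z)\<close> is monotone as soon as the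
  residual of this equation at \<open>P\<close> has a sign.\<close>

lemma Phi_ode_comparison:
  fixes P P' :: "real \<Rightarrow> real" and zb \<beta> s \<epsilon> :: real
  assumes zb: "0 < zb" "0 < \<beta>" "zb + \<beta> < 1" and s: "0 \<le> s" "s \<le> 1"
    and P: "\<And>s. 0 \<le> s \<Longrightarrow> s \<le> 1 \<Longrightarrow> (P has_real_derivative P' s) (at s)"
    and start: "0 \<le> \<epsilon> * (Phi zb - P 0)"
    and res: "\<And>s. 0 \<le> s \<Longrightarrow> s \<le> 1 \<Longrightarrow> 0 \<le> \<epsilon> * (\<beta> / (1 - (zb + \<beta> * s)) - (\<beta> * P s + 2 * (zb + \<beta> * s) * P' s))"
  shows "0 \<le> \<epsilon> * (Phi (zb + \<beta> * s) - P s)"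
proof -
  \<comment> \<open>\<open>\<epsilon>\<close> is 1 when \<open>P\<close> is to be a lower bound of
    \<open>Phi\<close> and \<open>-1\<close> when it is to be an upper bound.\<close>
  define D where "D s = \<epsilon> * (artanh (sqrt (zb + \<beta> * s)) - sqrt (zb + \<beta> * s) * P s)" for s
  have z: "0 < zb + \<beta> * s" "zb + \<beta> * s < 1" if "0 \<le> s" "s \<le> 1" for s
  proof -
    show "0 < zb + \<beta> * s" using zb that by (simp add: add_pos_nonneg)
    have "\<beta> * s \<le> \<beta> * 1" using zb that by (intro mult_left_mono) auto
    then show "zb + \<beta> * s < 1" using zb(3) by linarith
  qed
  have DPhi: "D s = sqrt (zb + \<beta> * s) * (\<epsilon> * (Phi (zb + \<beta> * s) - P s))" if "0 \<le> s" "s \<le> 1" for s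
    using z[OF that] unfolding D_def Phi_def by (simp add: field_simps)
  have "D 0 \<le> D s"
  proof (rule DERIV_nonneg_imp_nondecreasing[OF s(1)])
    fix x assume "0 \<le> x" "x \<le> s"
    then have x: "0 \<le> x" "x \<le> 1" using s by auto
    define q where "q = sqrt (zb + \<beta> * x)"
    have q: "0 < q" "q * q = zb + \<beta> * x" using z[OF x] by (simp_all add: q_def)
    have dz: "((\<lambda>s. zb + \<beta> * s) has_real_derivative \<beta>) (at x)" by (auto intro!: derivative_eq_intros)
    have d1: "((\<lambda>s. artanh (sqrt (zb + \<beta> * s))) has_real_derivative 1 / (1 - (zb + \<beta> * x)) / (2 * q) * \<beta>) (at x)"
      unfolding q_def by (rule DERIV_chain2[OF artanh_sqrt_has_real_derivative[OF z[OF x]] dz])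
    have d2: "((\<lambda>s. sqrt (zb + \<beta> * s)) has_real_derivative inverse q / 2 * \<beta>) (at x)"
      unfolding q_def by (rule DERIV_chain2[OF DERIV_real_sqrt[OF z(1)[OF x]] dz])
    have "(D has_real_derivative \<epsilon> * (1 / (1 - (zb + \<beta> * x)) / (2 * q) * \<beta> - (inverse q / 2 * \<beta> * P x + P' x * q))) (at x)"
      unfolding D_def using DERIV_cmult[OF DERIV_diff[OF d1 DERIV_mult[OF d2 P[OF x]]], of \<epsilon>] by (simp add: q_def)
    moreover have "\<epsilon> * (1 / (1 - (zb + \<beta> * x)) / (2 * q) * \<beta> - (inverse q / 2 * \<beta> * P x + P' x * q)) =
       \<epsilon> * (\<beta> / (1 - (zb + \<beta> * x)) - (\<beta> * P x + 2 * (zb + \<beta> * x) * P' x)) / (2 * q)"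
    proof -
      define W where "W = 1 - (zb + \<beta> * x)"
      have "W \<noteq> 0" using z[OF x] by (simp add: W_def)
      then show ?thesis
        unfolding W_def[symmetric] unfolding q(2)[symmetric] using q(1) by (simp add: field_simps)
    qed
    moreover have "0 \<le> \<epsilon> * (\<beta> / (1 - (zb + \<beta> * x)) - (\<beta> * P x + 2 * (zb + \<beta> * x) * P' x)) / (2 * q)"
      using res[OF x] q(1) by simp
    ultimately show "\<exists>y. (D has_real_derivative y) (at x) \<and> 0 \<le> y" by metis
  qed
  moreover have "0 \<le> D 0" unfolding DPhi[of 0, simplified] using zb start by simp
  ultimately have "0 \<le> sqrt (zb + \<beta> * s) * (\<epsilon> * (Phi (zb + \<beta> * s) - P s))"
    unfolding DPhi[OF s] by (rule order.trans[rotated])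
  then show ?thesis using z(1)[OF s] by (subst (asm) zero_le_mult_iff) auto
qed

section \<open>Polynomials as coefficient lists and their residual in the equation of
  \<open>Phi\<close>\<close>

definition list_coeff :: "real list \<Rightarrow> nat \<Rightarrow> real" where
  "list_coeff ps k = (if k < length ps then ps ! k else 0)"

lemma list_coeff_simps [simp]:
  "list_coeff [] k = 0" "list_coeff (p # ps) 0 = p" "list_coeff (p # ps) (Suc k) = list_coeff ps k"
  by (simp_all add: list_coeff_def)

definition list_poly :: "real list \<Rightarrow> real \<Rightarrow> real" where
  "list_poly ps s = (\<Sum>k<length ps. list_coeff ps k * s ^ k)"

lemma list_poly_simps [simp]:
  "list_poly [] s = 0" "list_poly (p # ps) s = p + s * list_poly ps s"
  by (simp_all add: list_poly_def sum.lessThan_Suc_shift sum_distrib_left mult.left_commute del: sum.lessThan_Suc)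

text \<open>In the variable \<open>s\<close> with \<open>z = zb + \<beta> * s\<close> the equation
  of \<open>Phi\<close> reads \<open>\<beta> * P + 2 * (zb + \<beta> * s) * P' = \<beta> / (1 -
  z)\<close>; these are the coefficients of its left side. At the top degree
  \<open>list_coeff ps (Suc k)\<close> is the default 0.\<close>

lemma list_poly_residual:
  obtains P' where "\<And>s. (list_poly ps has_real_derivative P' s) (at s)"
    and "\<And>s \<beta> zb. \<beta> * list_poly ps s + 2 * (zb + \<beta> * s) * P' s =
      (\<Sum>k<length ps. (\<beta> * (2 * real k + 1) * list_coeff ps k + 2 * zb * (real k + 1) * list_coeff ps (Suc k)) * s ^ k)"
proof
  define P' where "P' s = (\<Sum>k<length ps. list_coeff ps k * (real k * s ^ (k - 1)))" for s
  show "(list_poly ps has_real_derivative P' s) (at s)" for s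
    unfolding list_poly_def[abs_def] P'_def by (auto intro!: derivative_eq_intros sum.cong)
  have e1: "s * P' s = (\<Sum>k<length ps. real k * list_coeff ps k * s ^ k)" for s
    unfolding P'_def sum_distrib_left
    by (intro sum.cong refl) (auto simp: power_eq_if)
  have e2: "P' s = (\<Sum>k<length ps. (real k + 1) * list_coeff ps (Suc k) * s ^ k)" for s
  proof -
    have "(\<Sum>k<Suc (length ps). list_coeff ps k * (real k * s ^ (k - 1))) = P' s"
      by (simp add: P'_def list_coeff_def)
    then show ?thesis
      by (subst (asm) sum.lessThan_Suc_shift) (simp add: mult_ac add.commute)
  qed
  show "\<beta> * list_poly ps s + 2 * (zb + \<beta> * s) * P' s =
      (\<Sum>k<length ps. (\<beta> * (2 * real k + 1) * list_coeff ps k + 2 * zb * (real k + 1) * list_coeff ps (Suc k)) * s ^ k)" for s \<beta> zb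
  proof -
    have "\<beta> * list_poly ps s + 2 * (zb + \<beta> * s) * P' s = \<beta> * list_poly ps s + 2 * zb * P' s + 2 * \<beta> * (s * P' s)"
      by (simp add: algebra_simps)
    also have "\<dots> = (\<Sum>k<length ps. \<beta> * (list_coeff ps k * s ^ k) + 2 * zb * ((real k + 1) * list_coeff ps (Suc k) * s ^ k)
        + 2 * \<beta> * (real k * list_coeff ps k * s ^ k))"
      unfolding e1 unfolding e2 list_poly_def by (simp add: sum.distrib sum_distrib_left)
    also have "\<dots> = (\<Sum>k<length ps. (\<beta> * (2 * real k + 1) * list_coeff ps k + 2 * zb * (real k + 1) * list_coeff ps (Suc k)) * s ^ k)"
      by (intro sum.cong refl) (simp add: algebra_simps)
    finally show ?thesis .
  qed
qed

text \<open>A truncation is a lower bound. For an upper bound with equally many terms the last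
  coefficient is divided by \<open>1 - R\<close>, which pays for the tail as long as
  \<open>s \<le> 1\<close>.\<close>

lemma geometric_bound:
  fixes R s :: real
  assumes "0 \<le> R * s" "R * s < 1"
  shows "(\<Sum>k<n. (R * s) ^ k) \<le> 1 / (1 - R * s)"
    and "0 < n \<Longrightarrow> 0 \<le> R \<Longrightarrow> R < 1 \<Longrightarrow> 0 \<le> s \<Longrightarrow> s \<le> 1 \<Longrightarrow>
       1 / (1 - R * s) \<le> (\<Sum>k<n. (if Suc k = n then R ^ k / (1 - R) else R ^ k) * s ^ k)"
proof -
  have g: "(\<Sum>k<n. (R * s) ^ k) = (1 - (R * s) ^ n) / (1 - R * s)" for n
    using assms sum_gp_strict[of "R * s" n] by simp
  show "(\<Sum>k<n. (R * s) ^ k) \<le> 1 / (1 - R * s)"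
    unfolding g using assms by (intro divide_right_mono) auto
  assume n: "0 < n" and R: "0 \<le> R" "R < 1" and s: "0 \<le> s" "s \<le> 1"
  obtain j where j: "n = Suc j" using n by (cases n) auto
  have "R * s \<le> R" using R s by (simp add: mult_left_le)
  then have "(R * s) ^ j / (1 - R * s) \<le> (R * s) ^ j / (1 - R)"
    using assms R by (intro divide_left_mono) auto
  moreover have "1 / (1 - R * s) = (\<Sum>k<j. (R * s) ^ k) + (R * s) ^ j / (1 - R * s)"
    unfolding g using assms by (simp add: add_divide_distrib[symmetric])
  moreover have "(\<Sum>k<n. (if Suc k = n then R ^ k / (1 - R) else R ^ k) * s ^ k) = (\<Sum>k<j. (R * s) ^ k) + (R * s) ^ j / (1 - R)"
    unfolding j by (simp add: power_mult_distrib)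
  ultimately show "1 / (1 - R * s) \<le> (\<Sum>k<n. (if Suc k = n then R ^ k / (1 - R) else R ^ k) * s ^ k)" by simp
qed

text \<open>\<open>\<beta> / (1 - (zb + \<beta> * s))\<close> is \<open>\<beta> / (1 - zb)\<close>
  times a geometric series of ratio \<open>\<beta> * s / (1 - zb)\<close>. With \<open>g\<close> and
  \<open>\<rho>\<close> rounded down from \<open>1 / (1 - zb)\<close> and
  \<open>\<beta> / (1 - zb)\<close>, the comparison \<open>chk\<close> of coefficients fixes the
  sign of the residual.\<close>

lemma list_poly_le_Phi:
  assumes zb: "0 < zb" "0 < \<beta>" "zb + \<beta> < 1" and s: "0 \<le> s" "s \<le> 1"
    and g: "0 \<le> g" "g * (1 - zb) \<le> 1" and \<rho>: "0 \<le> \<rho>" "\<rho> * (1 - zb) \<le> \<beta>"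
    and start: "list_poly ps 0 \<le> Phi zb" and chk: "\<And>i. i < length ps \<Longrightarrow> \<beta> * (2 * real i + 1) * list_coeff ps i + 2 * zb * (real i + 1) * list_coeff ps (Suc i)
      \<le> \<beta> * g * \<rho> ^ i"
  shows "list_poly ps s \<le> Phi (zb + \<beta> * s)"
proof -
  obtain P' where P': "\<And>s. (list_poly ps has_real_derivative P' s) (at s)"
    and res: "\<And>s \<beta> zb. \<beta> * list_poly ps s + 2 * (zb + \<beta> * s) * P' s =
      (\<Sum>k<length ps. (\<beta> * (2 * real k + 1) * list_coeff ps k + 2 * zb * (real k + 1) * list_coeff ps (Suc k)) * s ^ k)"
    by (rule list_poly_residual[of ps], blast)
  have "0 \<le> 1 * (Phi (zb + \<beta> * s) - list_poly ps s)"
  proof (rule Phi_ode_comparison[OF zb s P'])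
    fix s :: real assume s: "0 \<le> s" "s \<le> 1"
    have "\<rho> * s * (1 - zb) \<le> \<beta> * s" using mult_right_mono[OF \<rho>(2) s(1)] by (simp add: mult_ac)
    moreover have "\<beta> * s \<le> \<beta>" using s zb by (simp add: mult_left_le)
    ultimately have "\<rho> * s * (1 - zb) \<le> \<beta>" by (rule order.trans)
    also have "\<beta> < 1 * (1 - zb)" using zb(3) by simp
    finally have "\<rho> * s * (1 - zb) < 1 * (1 - zb)" .
    moreover have "0 < 1 - zb" using zb by simp
    ultimately have rs: "\<rho> * s < 1" by (rule mult_right_less_imp_less[OF _ less_imp_le])
    have "\<beta> * list_poly ps s + 2 * (zb + \<beta> * s) * P' s \<le> (\<Sum>k<length ps. \<beta> * g * \<rho> ^ k * s ^ k)"
      unfolding res using chk s by (intro sum_mono mult_right_mono) auto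
    also have "\<dots> = \<beta> * g * (\<Sum>k<length ps. (\<rho> * s) ^ k)"
      by (simp add: sum_distrib_left power_mult_distrib mult.assoc)
    also have "\<dots> \<le> \<beta> * g * (1 / (1 - \<rho> * s))"
      using geometric_bound(1)[of \<rho> s "length ps"] \<rho> s rs zb g by (intro mult_left_mono) auto
    also have "\<dots> \<le> \<beta> / (1 - (zb + \<beta> * s))"
    proof -
      have div: "g / v \<le> 1 / w" if "0 < v" "0 < w" "g * w \<le> v" for v w g :: real
        using that by (simp add: field_simps)
      have "g * (1 - (zb + \<beta> * s)) \<le> g * (1 - zb) * (1 - \<rho> * s)"
      proof -
        have "1 - (zb + \<beta> * s) \<le> (1 - zb) * (1 - \<rho> * s)"
          using \<open>\<rho> * s * (1 - zb) \<le> \<beta> * s\<close> by (simp add: algebra_simps)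
        then show ?thesis using g by (simp add: mult_left_mono mult.assoc)
      qed
      also have "\<dots> \<le> 1 * (1 - \<rho> * s)" using g rs by (intro mult_right_mono) auto
      finally have "g / (1 - \<rho> * s) \<le> 1 / (1 - (zb + \<beta> * s))"
        using div[of "1 - \<rho> * s" "1 - (zb + \<beta> * s)" g] rs zb(3) \<open>\<beta> * s \<le> \<beta>\<close> by simp
      then have "\<beta> * (g / (1 - \<rho> * s)) \<le> \<beta> * (1 / (1 - (zb + \<beta> * s)))"
        using zb by (intro mult_left_mono) auto
      then show ?thesis by simp
    qed
    finally show "0 \<le> 1 * (\<beta> / (1 - (zb + \<beta> * s)) - (\<beta> * list_poly ps s + 2 * (zb + \<beta> * s) * P' s))" by simp
  qed (use start in simp)
  then show ?thesis by simp
qed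

text \<open>The mirror image, with \<open>g\<close> and \<open>\<rho>\<close> rounded up; dividing
  the last geometric term by \<open>1 - \<rho>\<close> accounts for the tail of the series.\<close>

lemma Phi_le_list_poly:
  assumes zb: "0 < zb" "0 < \<beta>" "zb + \<beta> < 1" and s: "0 \<le> s" "s \<le> 1"
    and g: "1 \<le> g * (1 - zb)" and \<rho>: "0 \<le> \<rho>" "\<rho> < 1" "\<beta> \<le> \<rho> * (1 - zb)" and ne: "ps \<noteq> []"
    and start: "Phi zb \<le> list_poly ps 0" and chk: "\<And>i. i < length ps \<Longrightarrow> (if Suc i = length ps then \<beta> * g * \<rho> ^ i / (1 - \<rho>) else \<beta> * g * \<rho> ^ i)
      \<le> \<beta> * (2 * real i + 1) * list_coeff ps i + 2 * zb * (real i + 1) * list_coeff ps (Suc i)"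
  shows "Phi (zb + \<beta> * s) \<le> list_poly ps s"
proof -
  obtain P' where P': "\<And>s. (list_poly ps has_real_derivative P' s) (at s)"
    and res: "\<And>s \<beta> zb. \<beta> * list_poly ps s + 2 * (zb + \<beta> * s) * P' s =
      (\<Sum>k<length ps. (\<beta> * (2 * real k + 1) * list_coeff ps k + 2 * zb * (real k + 1) * list_coeff ps (Suc k)) * s ^ k)"
    by (rule list_poly_residual[of ps], blast)
  have "0 \<le> -1 * (Phi (zb + \<beta> * s) - list_poly ps s)"
  proof (rule Phi_ode_comparison[OF zb s P'])
    fix s :: real assume s: "0 \<le> s" "s \<le> 1"
    have "\<rho> * s \<le> \<rho>" using \<rho> s by (simp add: mult_left_le)
    then have rs: "\<rho> * s < 1" using \<rho> by simp
    have bs: "\<beta> * s \<le> \<rho> * s * (1 - zb)" using mult_right_mono[OF \<rho>(3) s(1)] by (simp add: mult_ac)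
    have bs1: "\<beta> * s \<le> \<beta>" using s zb by (simp add: mult_left_le)
    have g0: "0 < g" using g zb by (smt (verit) mult_nonpos_nonneg)
    have "\<beta> / (1 - (zb + \<beta> * s)) \<le> \<beta> * g * (1 / (1 - \<rho> * s))"
    proof -
      have div: "1 / w \<le> g / v" if "0 < v" "0 < w" "v \<le> g * w" for v w g :: real
        using that by (simp add: field_simps)
      have "1 * (1 - \<rho> * s) \<le> g * (1 - zb) * (1 - \<rho> * s)" using g rs by (intro mult_right_mono) auto
      also have "\<dots> \<le> g * (1 - (zb + \<beta> * s))"
      proof -
        have "(1 - zb) * (1 - \<rho> * s) \<le> 1 - (zb + \<beta> * s)" using bs by (simp add: algebra_simps)
        then show ?thesis using g0 by (simp add: mult_left_mono mult.assoc)
      qed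
      finally have "1 / (1 - (zb + \<beta> * s)) \<le> g / (1 - \<rho> * s)"
        using div[of "1 - \<rho> * s" "1 - (zb + \<beta> * s)" g] rs zb(3) bs1 by simp
      then have "\<beta> * (1 / (1 - (zb + \<beta> * s))) \<le> \<beta> * (g / (1 - \<rho> * s))"
        using zb by (intro mult_left_mono) auto
      then show ?thesis by simp
    qed
    also have "\<dots> \<le> \<beta> * g * (\<Sum>k<length ps. (if Suc k = length ps then \<rho> ^ k / (1 - \<rho>) else \<rho> ^ k) * s ^ k)"
      using geometric_bound(2)[of \<rho> s "length ps"] \<rho> s rs zb g0 ne by (intro mult_left_mono) auto
    also have "\<dots> = (\<Sum>k<length ps. (if Suc k = length ps then \<beta> * g * \<rho> ^ k / (1 - \<rho>) else \<beta> * g * \<rho> ^ k) * s ^ k)"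
      unfolding sum_distrib_left by (intro sum.cong refl) auto
    also have "\<dots> \<le> \<beta> * list_poly ps s + 2 * (zb + \<beta> * s) * P' s"
      unfolding res using chk s by (intro sum_mono mult_right_mono) auto
    finally show "0 \<le> -1 * (\<beta> / (1 - (zb + \<beta> * s)) - (\<beta> * list_poly ps s + 2 * (zb + \<beta> * s) * P' s))" by simp
  qed (use start in simp)
  then show ?thesis by simp
qed

type_synonym cert_row = "real \<times> real \<times> real \<times> real"

text \<open>A certificate is a list of rows \<open>(E, Q, P, T)\<close> of integers in units of \<open>1 / S\<close>: the coefficient of the
  bound of the cone density, a bound of its moment, the coefficient of the induced bound of \<open>Phi\<close>, and a
  bound of the geometric term \<open>\<beta> * g * \<rho> ^ k\<close>.
  In the checkers \<open>b\<close>, \<open>Z\<close>, \<open>R\<close>, \<open>K\<close> are \<open>\<beta>\<close>, \<open>zb\<close>, \<open>\<rho>\<close>, \<open>\<kappa>\<close> in the same units, \<open>k\<close> is the index of the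
  current row, and \<open>t\<close> and \<open>off\<close>, in units of \<open>1 / S\<^sup>2\<close>, carry the geometric term and \<open>K * E\<close> from the row before.\<close>

definition cert_E :: "real \<Rightarrow> cert_row list \<Rightarrow> real list" where
  "cert_E S xs = map (\<lambda>(E, Q, P, T). E / S) xs"

definition cert_P :: "real \<Rightarrow> cert_row list \<Rightarrow> real list" where
  "cert_P S xs = map (\<lambda>(E, Q, P, T). P / S) xs"

fun cert_moment :: "cert_row list \<Rightarrow> real" where
  "cert_moment [] = 0"
| "cert_moment ((E, Q, P, T) # xs) = Q + cert_moment xs"

fun next_P :: "cert_row list \<Rightarrow> real" where
  "next_P [] = 0"
| "next_P ((E, Q, P, T) # xs) = P"

text \<open>The density contains \<open>(Phi z - Phi za) / (1 + \<kappa> * s)\<close>, so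
  coefficientwise \<open>P\<close> has to dominate \<open>F + (1 + \<kappa> * s) * E\<close>, with
  \<open>F\<close> entering as the initial \<open>off\<close>. The \<open>2 * k + 1\<close> next to
  \<open>Q\<close> comes from integrating \<open>s ^ k = (\<tau> / m) ^ (2 * k)\<close>. The final
  \<open>off \<le> 0\<close> catches the product term beyond the top degree; this is why the lower
  tables end in a row with \<open>E = 0\<close>.\<close>

fun lower_cert :: "real \<Rightarrow> real \<Rightarrow> real \<Rightarrow> real \<Rightarrow> real \<Rightarrow> real \<Rightarrow> real \<Rightarrow> real \<Rightarrow> cert_row list \<Rightarrow> bool" where
  "lower_cert S b Z R K k t off [] = (off \<le> 0)"
| "lower_cert S b Z R K k t off ((E, Q, P, T) # xs) =
    (0 \<le> E \<and> 0 \<le> P \<and> T * S \<le> t \<and> Q * (2 * k + 1) \<le> E \<and> off + E * S \<le> P * S \<and>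
     b * (2 * k + 1) * P + 2 * Z * (k + 1) * next_P xs \<le> T * S \<and>
     lower_cert S b Z R K (k + 1) (T * R) (K * E) xs)"

text \<open>In the last row the geometric term is enlarged by \<open>S / (S - R)\<close>, that is by
  \<open>1 / (1 - \<rho>)\<close>, for the tail of the series.\<close>

fun upper_cert :: "real \<Rightarrow> real \<Rightarrow> real \<Rightarrow> real \<Rightarrow> real \<Rightarrow> real \<Rightarrow> real \<Rightarrow> real \<Rightarrow> cert_row list \<Rightarrow> bool" where
  "upper_cert S b Z R K k t off [] = (0 \<le> off)"
| "upper_cert S b Z R K k t off ((E, Q, P, T) # xs) =
    (0 \<le> E \<and> 0 \<le> P \<and> t \<le> T * S \<and> E \<le> Q * (2 * k + 1) \<and> P * S \<le> off + E * S \<and>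
     (if xs = [] then T * (S * S) \<le> (S - R) * (b * (2 * k + 1) * P)
      else T * S \<le> b * (2 * k + 1) * P + 2 * Z * (k + 1) * next_P xs) \<and>
     upper_cert S b Z R K (k + 1) (T * R) (K * E) xs)"

lemma cert_simps [simp]:
  "cert_E S [] = []" "cert_E S ((E, Q, P, T) # xs) = E / S # cert_E S xs"
  "cert_P S [] = []" "cert_P S ((E, Q, P, T) # xs) = P / S # cert_P S xs"
  "length (cert_P S xs) = length xs"
  by (simp_all add: cert_E_def cert_P_def)

lemma list_coeff_cert_P_0: "list_coeff (cert_P S xs) 0 = next_P xs / S"
  by (cases xs rule: next_P.cases) auto

lemma lower_cert_nonneg:
  "lower_cert S b Z R K k t off xs \<Longrightarrow> 0 < S \<Longrightarrow> list_all (\<lambda>e. 0 \<le> e) (cert_E S xs) \<and> 0 \<le> list_coeff (cert_P S xs) i"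
proof (induction S b Z R K k t off xs arbitrary: i rule: lower_cert.induct)
  case (2 S b Z R K k t off E Q P T xs)
  then show ?case by (cases i) auto
qed simp

lemma upper_cert_nonneg:
  "upper_cert S b Z R K k t off xs \<Longrightarrow> 0 < S \<Longrightarrow> list_all (\<lambda>e. 0 \<le> e) (cert_E S xs) \<and> 0 \<le> list_coeff (cert_P S xs) i"
proof (induction S b Z R K k t off xs arbitrary: i rule: upper_cert.induct)
  case (2 S b Z R K k t off E Q P T xs)
  then show ?case by (cases i) auto
qed simp

text \<open>The induction over the rows is multiplication by \<open>1 + \<kappa> * s\<close> in
  Horner form: \<open>off\<close> is the term \<open>\<kappa> * E\<close> handed down by the
  previous row.\<close>

lemma lower_cert_poly:
  assumes "lower_cert S b Z R K k t off xs" "0 < S" "\<kappa> \<le> K / S" "0 \<le> s"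
  shows "off / S\<^sup>2 + (1 + \<kappa> * s) * list_poly (cert_E S xs) s \<le> list_poly (cert_P S xs) s"
  using assms
proof (induction S b Z R K k t off xs rule: lower_cert.induct)
  case (2 S b Z R K k t off E Q P T xs)
  have ih: "K * E / S\<^sup>2 + (1 + \<kappa> * s) * list_poly (cert_E S xs) s \<le> list_poly (cert_P S xs) s"
    using 2 by simp
  have "\<kappa> * (E / S) \<le> K / S * (E / S)" using 2 by (intro mult_right_mono) auto
  then have "s * (\<kappa> * (E / S) + (1 + \<kappa> * s) * list_poly (cert_E S xs) s) \<le> s * list_poly (cert_P S xs) s"
    using ih 2 by (intro mult_left_mono) (auto simp: power2_eq_square)
  moreover have "off / S\<^sup>2 + E / S \<le> P / S"
  proof -
    have "(off + E * S) / S\<^sup>2 \<le> P * S / S\<^sup>2" using 2 by (intro divide_right_mono) auto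
    then show ?thesis using 2 by (simp add: add_divide_distrib power2_eq_square)
  qed
  ultimately show ?case by (simp add: algebra_simps)
qed (simp add: divide_nonpos_nonneg)

lemma upper_cert_poly:
  assumes "upper_cert S b Z R K k t off xs" "0 < S" "K / S \<le> \<kappa>" "0 \<le> s"
  shows "list_poly (cert_P S xs) s \<le> off / S\<^sup>2 + (1 + \<kappa> * s) * list_poly (cert_E S xs) s"
  using assms
proof (induction S b Z R K k t off xs rule: upper_cert.induct)
  case (2 S b Z R K k t off E Q P T xs)
  have ih: "list_poly (cert_P S xs) s \<le> K * E / S\<^sup>2 + (1 + \<kappa> * s) * list_poly (cert_E S xs) s"
    using 2 by simp
  have "K / S * (E / S) \<le> \<kappa> * (E / S)" using 2 by (intro mult_right_mono) auto
  then have "s * list_poly (cert_P S xs) s \<le> s * (\<kappa> * (E / S) + (1 + \<kappa> * s) * list_poly (cert_E S xs) s)"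
    using ih 2 by (intro mult_left_mono) (auto simp: power2_eq_square)
  moreover have "P / S \<le> off / S\<^sup>2 + E / S"
  proof -
    have "P * S / S\<^sup>2 \<le> (off + E * S) / S\<^sup>2" using 2 by (intro divide_right_mono) auto
    then show ?thesis using 2 by (simp add: add_divide_distrib power2_eq_square)
  qed
  ultimately show ?case by (simp add: algebra_simps)
qed simp

text \<open>Provides the hypothesis \<open>chk\<close> of \<open>list_poly_le_Phi\<close>. Every row
  rounds the geometric term down, so the recorded \<open>T\<close> never exceeds the true
  power.\<close>

lemma lower_cert_residual:
  assumes "lower_cert S b Z R K k t off xs" "0 < S" "0 \<le> R" "i < length xs"
  shows "b / S * (2 * (k + real i) + 1) * list_coeff (cert_P S xs) i + 2 * (Z / S) * (k + real i + 1) * list_coeff (cert_P S xs) (Suc i)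
    \<le> t / S\<^sup>2 * (R / S) ^ i"
  using assms
proof (induction S b Z R K k t off xs arbitrary: i rule: lower_cert.induct)
  case (2 S b Z R K k t off E Q P T xs)
  have T: "T / S \<le> t / S\<^sup>2" using 2 by (simp add: power2_eq_square field_simps)
  show ?case
  proof (cases i)
    case 0
    have "b / S * (2 * k + 1) * (P / S) + 2 * (Z / S) * (k + 1) * (next_P xs / S) =
      (b * (2 * k + 1) * P + 2 * Z * (k + 1) * next_P xs) / S\<^sup>2"
      by (simp add: add_divide_distrib power2_eq_square)
    also have "\<dots> \<le> T * S / S\<^sup>2" using 2 by (intro divide_right_mono) auto
    also have "\<dots> = T / S" by (simp add: power2_eq_square)
    finally show ?thesis using 0 T by (simp add: list_coeff_cert_P_0)
  next
    case (Suc j)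
    have "b / S * (2 * (k + 1 + real j) + 1) * list_coeff (cert_P S xs) j +
        2 * (Z / S) * (k + 1 + real j + 1) * list_coeff (cert_P S xs) (Suc j) \<le> T * R / S\<^sup>2 * (R / S) ^ j"
      using 2 Suc by simp
    also have "\<dots> = T / S * (R / S) ^ i" by (simp add: Suc power2_eq_square)
    also have "\<dots> \<le> t / S\<^sup>2 * (R / S) ^ i" using T 2 by (intro mult_right_mono) auto
    finally show ?thesis using Suc by (simp add: add_ac)
  qed
qed simp

text \<open>Provides the hypothesis \<open>chk\<close> of \<open>Phi_le_list_poly\<close>; the
  geometric term is rounded up, and the case distinction follows the last row through the
  induction.\<close>

lemma upper_cert_residual:
  assumes "upper_cert S b Z R K k t off xs" "0 < S" "0 \<le> R" "R < S" "i < length xs"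
  shows "(if Suc i = length xs then t / S\<^sup>2 * (R / S) ^ i / (1 - R / S) else t / S\<^sup>2 * (R / S) ^ i) \<le>
    b / S * (2 * (k + real i) + 1) * list_coeff (cert_P S xs) i + 2 * (Z / S) * (k + real i + 1) * list_coeff (cert_P S xs) (Suc i)"
  using assms
proof (induction S b Z R K k t off xs arbitrary: i rule: upper_cert.induct)
  case (2 S b Z R K k t off E Q P T xs)
  have T: "t / S\<^sup>2 \<le> T / S" using 2 by (simp add: power2_eq_square field_simps)
  have RS: "0 < 1 - R / S" using 2 by simp
  show ?case
  proof (cases i)
    case 0
    show ?thesis
    proof (cases "xs = []")
      case True
      have "t / S\<^sup>2 / (1 - R / S) \<le> T / S / (1 - R / S)" using T RS by (intro divide_right_mono) auto
      also have "\<dots> = T * (S * S) / (S - R) / S\<^sup>2" using 2 by (simp add: power2_eq_square field_simps)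
      also have "\<dots> \<le> (b * (2 * k + 1) * P) / S\<^sup>2"
        using 2 True by (intro divide_right_mono) (auto simp: pos_divide_le_eq mult.commute)
      finally show ?thesis using 0 True by (simp add: power2_eq_square)
    next
      case False
      have "t / S\<^sup>2 \<le> T * S / S\<^sup>2" using T by (simp add: power2_eq_square)
      also have "\<dots> \<le> (b * (2 * k + 1) * P + 2 * Z * (k + 1) * next_P xs) / S\<^sup>2"
        using 2 False by (intro divide_right_mono) auto
      also have "\<dots> = b / S * (2 * k + 1) * (P / S) + 2 * (Z / S) * (k + 1) * (next_P xs / S)"
        by (simp add: add_divide_distrib power2_eq_square)
      finally show ?thesis using 0 False by (simp add: list_coeff_cert_P_0)
    qed
  next
    case (Suc j)
    have le: "t / S\<^sup>2 * (R / S) ^ i \<le> T * R / S\<^sup>2 * (R / S) ^ j"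
    proof -
      have "t / S\<^sup>2 * (R / S) ^ i \<le> T / S * (R / S) ^ i" using T 2 by (intro mult_right_mono) auto
      then show ?thesis by (simp add: Suc power2_eq_square)
    qed
    define A where "A = t / S\<^sup>2 * (R / S) ^ i"
    define A' where "A' = T * R / S\<^sup>2 * (R / S) ^ j"
    define X where "X = b / S * (2 * (k + 1 + real j) + 1) * list_coeff (cert_P S xs) j +
        2 * (Z / S) * (k + 1 + real j + 1) * list_coeff (cert_P S xs) (Suc j)"
    have ih: "(if Suc j = length xs then A' / (1 - R / S) else A') \<le> X"
      unfolding A'_def X_def using 2 Suc by simp
    have X: "b / S * (2 * (k + real i) + 1) * list_coeff (cert_P S ((E, Q, P, T) # xs)) i +
        2 * (Z / S) * (k + real i + 1) * list_coeff (cert_P S ((E, Q, P, T) # xs)) (Suc i) = X"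
      unfolding X_def by (simp add: Suc add_ac)
    have l: "Suc i = length ((E, Q, P, T) # xs) \<longleftrightarrow> Suc j = length xs" by (simp add: Suc)
    have "A / (1 - R / S) \<le> A' / (1 - R / S)"
      using le RS unfolding A_def A'_def by (intro divide_right_mono) auto
    then show ?thesis
      using ih le unfolding X l A_def[symmetric] A'_def[symmetric] by (auto split: if_splits)
  qed
qed simp

section \<open>From certificates to bounds for wedge volumes\<close>

fun moment_sum :: "real \<Rightarrow> real list \<Rightarrow> real" where
  "moment_sum k [] = 0"
| "moment_sum k (e # es) = e / (2 * k + 1) + moment_sum (k + 1) es"

lemma moment_sum_conv: "moment_sum k es = (\<Sum>i<length es. list_coeff es i / (2 * (k + real i) + 1))"
proof (induction k es rule: moment_sum.induct)
  case (2 k e es)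
  show ?case
    unfolding moment_sum.simps 2 by (simp add: sum.lessThan_Suc_shift add_ac del: sum.lessThan_Suc)
qed simp

lemma lower_cert_moment:
  "lower_cert S b Z R K k t off xs \<Longrightarrow> 0 < S \<Longrightarrow> 0 \<le> k \<Longrightarrow> cert_moment xs / S \<le> moment_sum k (cert_E S xs)"
proof (induction S b Z R K k t off xs rule: lower_cert.induct)
  case (2 S b Z R K k t off E Q P T xs)
  have "Q \<le> E / (2 * k + 1)" using 2 by (simp add: pos_le_divide_eq)
  then have "Q / S \<le> E / (2 * k + 1) / S" using 2 by (intro divide_right_mono) auto
  then have "Q / S \<le> E / S / (2 * k + 1)" by (simp add: mult.commute)
  then show ?case using 2 by (simp add: add_divide_distrib)
qed simp

lemma upper_cert_moment:
  "upper_cert S b Z R K k t off xs \<Longrightarrow> 0 < S \<Longrightarrow> 0 \<le> k \<Longrightarrow> moment_sum k (cert_E S xs) \<le> cert_moment xs / S"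
proof (induction S b Z R K k t off xs rule: upper_cert.induct)
  case (2 S b Z R K k t off E Q P T xs)
  have "E / (2 * k + 1) \<le> Q" using 2 by (simp add: pos_divide_le_eq)
  then have "E / (2 * k + 1) / S \<le> Q / S" using 2 by (intro divide_right_mono) auto
  then have "E / S / (2 * k + 1) \<le> Q / S" by (simp add: mult.commute)
  then show ?case using 2 by (simp add: add_divide_distrib)
qed simp

text \<open>\<open>moment_sum 0 es\<close> is the integral of
  \<open>list_poly es (x\<^sup>2)\<close> over the unit interval; the factor \<open>m\<close> comes
  from \<open>\<tau> = m * x\<close>.\<close>

lemma nn_integral_list_poly:
  fixes m c :: real
  assumes m: "0 < m" and c: "0 \<le> c" and es: "list_all (\<lambda>e. 0 \<le> e) es"
  shows "(\<integral>\<^sup>+\<tau>. ennreal (c * list_poly es ((\<tau> / m)\<^sup>2)) * indicator {0..m} \<tau> \<partial>lborel) = ennreal (c * (m * moment_sum 0 es))"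
proof -
  define F where "F \<tau> = c * (\<Sum>k<length es. list_coeff es k * (m * ((\<tau> / m) ^ (2 * k + 1) / (2 * real k + 1))))" for \<tau>
  have nonneg: "0 \<le> list_coeff es k" for k
    using es by (auto simp: list_coeff_def list_all_length)
  have "(\<integral>\<^sup>+\<tau>. ennreal (c * list_poly es ((\<tau> / m)\<^sup>2)) * indicator {0..m} \<tau> \<partial>lborel) = ennreal (F m - F 0)"
  proof (rule nn_integral_FTC)
    show "(\<lambda>\<tau>. c * list_poly es ((\<tau> / m)\<^sup>2)) \<in> borel_measurable borel" unfolding list_poly_def by measurable
    show "0 \<le> c * list_poly es ((\<tau> / m)\<^sup>2)" for \<tau>
      unfolding list_poly_def using nonneg c by (intro mult_nonneg_nonneg sum_nonneg) auto
    have t: "((\<lambda>\<tau>. m * ((\<tau> / m) ^ (2 * k + 1) / (2 * real k + 1))) has_real_derivative ((\<tau> / m)\<^sup>2) ^ k) (at \<tau>)" for k \<tau>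
    proof -
      have "((\<lambda>\<tau>. m * ((\<tau> / m) ^ (2 * k + 1) / (2 * real k + 1))) has_real_derivative
          m * (real (2 * k + 1) * (\<tau> / m) ^ (2 * k) * (1 / m) / (2 * real k + 1))) (at \<tau>)"
      proof -
        have "((\<lambda>\<tau>. (\<tau> / m) ^ (2 * k + 1)) has_real_derivative real (2 * k + 1) * (\<tau> / m) ^ (2 * k) * (1 / m)) (at \<tau>)"
          using DERIV_chain2[OF DERIV_pow[of "2 * k + 1" "\<tau> / m" UNIV] DERIV_cdivide[OF DERIV_ident, of m \<tau> UNIV]]
          by simp
        from DERIV_cmult[OF DERIV_cdivide[OF this, of "2 * real k + 1"], of m] show ?thesis .
      qed
      moreover have "m * (real (2 * k + 1) * (\<tau> / m) ^ (2 * k) * (1 / m) / (2 * real k + 1)) = ((\<tau> / m)\<^sup>2) ^ k"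
      proof -
        define c where "c = 2 * real k + 1"
        have c: "real (2 * k + 1) = c" "c \<noteq> 0" unfolding c_def by linarith+
        show ?thesis unfolding c(1) c_def[symmetric] power_mult using m c(2) by simp
      qed
      ultimately show ?thesis by simp
    qed
    show "(F has_real_derivative c * list_poly es ((\<tau> / m)\<^sup>2)) (at \<tau>)" for \<tau>
      unfolding F_def list_poly_def by (intro DERIV_cmult DERIV_sum t)
  qed (use m in simp)
  also have "F m - F 0 = c * (m * moment_sum 0 es)"
    unfolding F_def moment_sum_conv using m by (simp add: sum_distrib_left algebra_simps)
  finally show ?thesis .
qed

text \<open>In \<open>s = (\<tau> / m)\<^sup>2\<close>, which runs through the unit interval, both
  the argument of \<open>Phi\<close> and the denominator are affine. This is the variable of the
  certificates.\<close>

lemma cone_density_linear: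
  assumes B: "0 < B" and m: "0 < m" and zb: "zb = a\<^sup>2 * (A + q\<^sup>2 * B)" and \<beta>: "\<beta> = a\<^sup>2 * q\<^sup>2 * C * m\<^sup>2" and \<kappa>: "\<kappa> = C * m\<^sup>2 / B"
  shows "cone_density A B C a q \<tau> = a / (2 * B * (1 + \<kappa> * (\<tau> / m)\<^sup>2)) * (Phi (zb + \<beta> * (\<tau> / m)\<^sup>2) - Phi (a\<^sup>2 * A))"
proof -
  have "B + C * \<tau>\<^sup>2 = B * (1 + \<kappa> * (\<tau> / m)\<^sup>2)"
    unfolding \<kappa> using B m by (simp add: power_divide field_simps)
  moreover have "a\<^sup>2 * (A + q\<^sup>2 * (B + C * \<tau>\<^sup>2)) = zb + \<beta> * (\<tau> / m)\<^sup>2"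
    unfolding zb \<beta> using m by (simp add: power_divide field_simps)
  ultimately show ?thesis unfolding cone_density_def by (simp add: mult.assoc)
qed

text \<open>As the coefficients \<open>E\<close> and \<open>P\<close> are nonnegative, rounding
  \<open>b\<close>, \<open>Z\<close> and \<open>K\<close> up only sharpens the checked inequalities,
  while \<open>R\<close> and \<open>G\<close>, the scaled \<open>\<rho>\<close> and
  \<open>g\<close>, are rounded down.\<close>

lemma wedge_volume_ge:
  assumes pos: "0 < a" "0 < B" "0 \<le> C" "0 < m"
    and zb: "zb = a\<^sup>2 * (A + q\<^sup>2 * B)" and \<beta>: "\<beta> = a\<^sup>2 * q\<^sup>2 * C * m\<^sup>2" and \<kappa>: "\<kappa> = C * m\<^sup>2 / B" and za: "za = a\<^sup>2 * A"
    and r: "0 < zb" "0 < \<beta>" "zb + \<beta> < 1"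
    and S: "0 < S" and scaled: "\<beta> * S \<le> b" "zb * S \<le> Z" "\<kappa> * S \<le> K" "0 \<le> R" "R * (1 - zb) \<le> \<beta> * S"
      "0 \<le> G" "G * (1 - zb) \<le> S"
    and Pa: "Phi za \<le> F / S" and P0: "next_P xs / S \<le> Phi zb"
    and chk: "lower_cert S b Z R K 0 (\<beta> * S * G) (F * S) xs"
    and L: "L \<le> a / (2 * B) * (m * (cert_moment xs / S))"
  shows "ennreal L \<le> wedge_volume A B C a q m"
proof -
  define es where "es = cert_E S xs"
  note nonneg = lower_cert_nonneg[OF chk S]
  have "ennreal L \<le> ennreal (a / (2 * B) * (m * moment_sum 0 es))"
  proof (rule ennreal_leI, rule order.trans[OF L])
    show "a / (2 * B) * (m * (cert_moment xs / S)) \<le> a / (2 * B) * (m * moment_sum 0 es)"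
      unfolding es_def using lower_cert_moment[OF chk S] pos by (intro mult_left_mono) auto
  qed
  also have "\<dots> = (\<integral>\<^sup>+\<tau>. ennreal (a / (2 * B) * list_poly es ((\<tau> / m)\<^sup>2)) * indicator {0..m} \<tau> \<partial>lborel)"
    by (rule nn_integral_list_poly[symmetric]) (use pos nonneg es_def in auto)
  also have "\<dots> \<le> wedge_volume A B C a q m"
    unfolding wedge_volume_def
  proof (intro nn_integral_mono)
    fix \<tau> :: real
    have "a / (2 * B) * list_poly es ((\<tau> / m)\<^sup>2) \<le> cone_density A B C a q \<tau>" if \<tau>: "0 \<le> \<tau>" "\<tau> \<le> m"
    proof -
      define s where "s = (\<tau> / m)\<^sup>2"
      have s: "0 \<le> s" "s \<le> 1" using \<tau> pos by (auto simp: s_def intro!: power_le_one)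
      have \<kappa>0: "0 < 1 + \<kappa> * s" using pos s by (simp add: \<kappa> add_pos_nonneg)
      have F: "F * S / S\<^sup>2 = F / S" by (simp add: power2_eq_square)
      have "list_poly (cert_P S xs) s \<le> Phi (zb + \<beta> * s)"
      proof (rule list_poly_le_Phi[OF r s, where g="G / S" and \<rho>="R / S"])
        show "list_poly (cert_P S xs) 0 \<le> Phi zb"
          using P0 by (cases xs rule: next_P.cases) auto
        fix i assume i: "i < length (cert_P S xs)"
        have "\<beta> * (2 * real i + 1) * list_coeff (cert_P S xs) i + 2 * zb * (real i + 1) * list_coeff (cert_P S xs) (Suc i) \<le>
          b / S * (2 * real i + 1) * list_coeff (cert_P S xs) i + 2 * (Z / S) * (real i + 1) * list_coeff (cert_P S xs) (Suc i)"
          using scaled(1,2) S nonneg by (intro add_mono mult_right_mono mult_left_mono) (auto simp: field_simps)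
        also have "\<dots> \<le> \<beta> * S * G / S\<^sup>2 * (R / S) ^ i"
          using lower_cert_residual[OF chk S scaled(4), of i] i by simp
        also have "\<dots> = \<beta> * (G / S) * (R / S) ^ i" using S by (simp add: power2_eq_square)
        finally show "\<beta> * (2 * real i + 1) * list_coeff (cert_P S xs) i + 2 * zb * (real i + 1) * list_coeff (cert_P S xs) (Suc i)
          \<le> \<beta> * (G / S) * (R / S) ^ i" .
      qed (use S scaled in \<open>auto simp: field_simps\<close>)
      moreover have "F / S + (1 + \<kappa> * s) * list_poly es s \<le> list_poly (cert_P S xs) s"
        using lower_cert_poly[OF chk S _ s(1), of \<kappa>] scaled(3) S unfolding F es_def by (simp add: field_simps)
      ultimately have "(1 + \<kappa> * s) * list_poly es s \<le> Phi (zb + \<beta> * s) - Phi za"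
        using Pa by linarith
      then have "a / (2 * B * (1 + \<kappa> * s)) * ((1 + \<kappa> * s) * list_poly es s) \<le>
         a / (2 * B * (1 + \<kappa> * s)) * (Phi (zb + \<beta> * s) - Phi za)"
        using pos \<kappa>0 by (intro mult_left_mono) auto
      then show ?thesis
        unfolding cone_density_linear[OF pos(2,4) zb \<beta> \<kappa>] s_def[symmetric] za[symmetric] using \<kappa>0 by simp
    qed
    then show "ennreal (a / (2 * B) * list_poly es ((\<tau> / m)\<^sup>2)) * indicator {0..m} \<tau> \<le> ennreal (cone_density A B C a q \<tau>) * indicator {0..m} \<tau>"
      by (auto intro!: ennreal_leI split: split_indicator)
  qed
  finally show ?thesis .
qed

text \<open>All rounding directions of the lower bound are reversed.\<close>

lemma wedge_volume_le:
  assumes pos: "0 < a" "0 < B" "0 \<le> C" "0 < m"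
    and zb: "zb = a\<^sup>2 * (A + q\<^sup>2 * B)" and \<beta>: "\<beta> = a\<^sup>2 * q\<^sup>2 * C * m\<^sup>2" and \<kappa>: "\<kappa> = C * m\<^sup>2 / B" and za: "za = a\<^sup>2 * A"
    and r: "0 < zb" "0 < \<beta>" "zb + \<beta> < 1"
    and S: "0 < S" and scaled: "b \<le> \<beta> * S" "Z \<le> zb * S" "K \<le> \<kappa> * S" "0 \<le> R" "R < S" "\<beta> * S \<le> R * (1 - zb)"
      "S \<le> G * (1 - zb)"
    and ne: "xs \<noteq> []" and Pa: "F / S \<le> Phi za" and P0: "Phi zb \<le> next_P xs / S"
    and chk: "upper_cert S b Z R K 0 (\<beta> * S * G) (F * S) xs"
    and L: "a / (2 * B) * (m * (cert_moment xs / S)) \<le> L"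
  shows "wedge_volume A B C a q m \<le> ennreal L"
proof -
  define es where "es = cert_E S xs"
  note nonneg = upper_cert_nonneg[OF chk S]
  have "wedge_volume A B C a q m \<le>
     (\<integral>\<^sup>+\<tau>. ennreal (a / (2 * B) * list_poly es ((\<tau> / m)\<^sup>2)) * indicator {0..m} \<tau> \<partial>lborel)"
    unfolding wedge_volume_def
  proof (intro nn_integral_mono)
    fix \<tau> :: real
    have "cone_density A B C a q \<tau> \<le> a / (2 * B) * list_poly es ((\<tau> / m)\<^sup>2)" if \<tau>: "0 \<le> \<tau>" "\<tau> \<le> m"
    proof -
      define s where "s = (\<tau> / m)\<^sup>2"
      have s: "0 \<le> s" "s \<le> 1" using \<tau> pos by (auto simp: s_def intro!: power_le_one)
      have \<kappa>0: "0 < 1 + \<kappa> * s" using pos s by (simp add: \<kappa> add_pos_nonneg)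
      have F: "F * S / S\<^sup>2 = F / S" by (simp add: power2_eq_square)
      have "Phi (zb + \<beta> * s) \<le> list_poly (cert_P S xs) s"
      proof (rule Phi_le_list_poly[OF r s, where g="G / S" and \<rho>="R / S"])
        show "Phi zb \<le> list_poly (cert_P S xs) 0"
          using P0 by (cases xs rule: next_P.cases) auto
        show "cert_P S xs \<noteq> []" using ne by (simp add: cert_P_def)
        fix i assume i: "i < length (cert_P S xs)"
        have "(if Suc i = length (cert_P S xs) then \<beta> * (G / S) * (R / S) ^ i / (1 - R / S) else \<beta> * (G / S) * (R / S) ^ i) =
          (if Suc i = length xs then \<beta> * S * G / S\<^sup>2 * (R / S) ^ i / (1 - R / S) else \<beta> * S * G / S\<^sup>2 * (R / S) ^ i)"
          using S by (simp add: power2_eq_square)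
        also have "\<dots> \<le> b / S * (2 * real i + 1) * list_coeff (cert_P S xs) i + 2 * (Z / S) * (real i + 1) * list_coeff (cert_P S xs) (Suc i)"
          using upper_cert_residual[OF chk S scaled(4,5), of i] i by simp
        also have "\<dots> \<le> \<beta> * (2 * real i + 1) * list_coeff (cert_P S xs) i + 2 * zb * (real i + 1) * list_coeff (cert_P S xs) (Suc i)"
          using scaled(1,2) S nonneg by (intro add_mono mult_right_mono mult_left_mono) (auto simp: field_simps)
        finally show "(if Suc i = length (cert_P S xs) then \<beta> * (G / S) * (R / S) ^ i / (1 - R / S) else \<beta> * (G / S) * (R / S) ^ i)
          \<le> \<beta> * (2 * real i + 1) * list_coeff (cert_P S xs) i + 2 * zb * (real i + 1) * list_coeff (cert_P S xs) (Suc i)" .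
      qed (use S scaled in \<open>auto simp: field_simps\<close>)
      moreover have "list_poly (cert_P S xs) s \<le> F / S + (1 + \<kappa> * s) * list_poly es s"
        using upper_cert_poly[OF chk S _ s(1), of \<kappa>] scaled(3) S unfolding F es_def by (simp add: field_simps)
      ultimately have "Phi (zb + \<beta> * s) - Phi za \<le> (1 + \<kappa> * s) * list_poly es s"
        using Pa by linarith
      then have "a / (2 * B * (1 + \<kappa> * s)) * (Phi (zb + \<beta> * s) - Phi za) \<le>
         a / (2 * B * (1 + \<kappa> * s)) * ((1 + \<kappa> * s) * list_poly es s)"
        using pos \<kappa>0 by (intro mult_left_mono) auto
      then show ?thesis
        unfolding cone_density_linear[OF pos(2,4) zb \<beta> \<kappa>] s_def[symmetric] za[symmetric] using \<kappa>0 by simp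
    qed
    then show "ennreal (cone_density A B C a q \<tau>) * indicator {0..m} \<tau> \<le> ennreal (a / (2 * B) * list_poly es ((\<tau> / m)\<^sup>2)) * indicator {0..m} \<tau>"
      by (auto intro!: ennreal_leI split: split_indicator)
  qed
  also have "\<dots> = ennreal (a / (2 * B) * (m * moment_sum 0 es))"
    by (rule nn_integral_list_poly) (use pos nonneg es_def in auto)
  also have "\<dots> \<le> ennreal L"
  proof (rule ennreal_leI, rule order.trans[OF _ L])
    show "a / (2 * B) * (m * moment_sum 0 es) \<le> a / (2 * B) * (m * (cert_moment xs / S))"
      unfolding es_def using upper_cert_moment[OF chk S] pos by (intro mult_left_mono) auto
  qed
  finally show ?thesis .
qed

lemma octant_volume_ge:
  fixes y d :: real
  assumes y: "0 < y" "2 * y \<le> d" "d < 3 * y" "2 * y\<^sup>2 + (d - 2 * y)\<^sup>2 < 1"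
    and w: "ennreal wa \<le> wedge_volume 1 1 1 y 1 ((d - 2 * y) / y)"
      "ennreal wb \<le> wedge_volume 1 (1/2) 2 y ((d - y) / y) ((3 * y - d) / (2 * (d - y)))"
      "ennreal wc \<le> wedge_volume (1/3) (1/6) 2 d (3 * y / d - 1) (1/2)"
    and nonneg: "0 \<le> wa" "0 \<le> wb" "0 \<le> wc" and L: "L \<le> 6 * wa + 6 * wb + 2 * wc"
  shows "ennreal L \<le> octant_volume y d"
proof -
  have e: "1 + (d - 2 * y) / y = (d - y) / y" "(1 - (d - 2 * y) / y) / (2 * ((d - y) / y)) = (3 * y - d) / (2 * (d - y))"
    using y by (simp_all add: field_simps)
  have "ennreal L \<le> ennreal (6 * wa + 6 * wb + 2 * wc)" using L by (rule ennreal_leI)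
  also have "\<dots> = 6 * ennreal wa + 6 * ennreal wb + 2 * ennreal wc"
    using nonneg by (simp add: ennreal_plus ennreal_mult)
  also have "\<dots> \<le> octant_volume y d"
    unfolding octant_volume_eq[OF y] e using w by (intro add_mono mult_left_mono) auto
  finally show ?thesis .
qed

lemma octant_volume_le:
  fixes y d :: real
  assumes y: "0 < y" "2 * y \<le> d" "d < 3 * y" "2 * y\<^sup>2 + (d - 2 * y)\<^sup>2 < 1"
    and w: "wedge_volume 1 1 1 y 1 ((d - 2 * y) / y) \<le> ennreal wa"
      "wedge_volume 1 (1/2) 2 y ((d - y) / y) ((3 * y - d) / (2 * (d - y))) \<le> ennreal wb"
      "wedge_volume (1/3) (1/6) 2 d (3 * y / d - 1) (1/2) \<le> ennreal wc"
    and nonneg: "0 \<le> wa" "0 \<le> wb" "0 \<le> wc" and L: "6 * wa + 6 * wb + 2 * wc \<le> L"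
  shows "octant_volume y d \<le> ennreal L"
proof -
  have e: "1 + (d - 2 * y) / y = (d - y) / y" "(1 - (d - 2 * y) / y) / (2 * ((d - y) / y)) = (3 * y - d) / (2 * (d - y))"
    using y by (simp_all add: field_simps)
  have "octant_volume y d \<le> 6 * ennreal wa + 6 * ennreal wb + 2 * ennreal wc"
    unfolding octant_volume_eq[OF y] e using w by (intro add_mono mult_left_mono) auto
  also have "\<dots> = ennreal (6 * wa + 6 * wb + 2 * wc)"
    using nonneg by (simp add: ennreal_plus ennreal_mult)
  also have "\<dots> \<le> ennreal L" using L by (rule ennreal_leI)
  finally show ?thesis .
qed

text \<open>Horner evaluations of the series \<open>\<Sum>i. (V / S) ^ i / (2 * (k + i) + 1)\<close> of the area tangent, rounded to
  integers in units of \<open>1 / S\<close>; the last entry of a \<open>horner_ge\<close> list also covers the tail.\<close>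

fun horner_le :: "real \<Rightarrow> real \<Rightarrow> real \<Rightarrow> real list \<Rightarrow> bool" where
  "horner_le S V k [] = True"
| "horner_le S V k (h # hs) =
    (h * (2 * k + 1) * S \<le> S * S + (2 * k + 1) * V * (case hs of [] \<Rightarrow> 0 | h' # _ \<Rightarrow> h') \<and> horner_le S V (k + 1) hs)"

fun horner_ge :: "real \<Rightarrow> real \<Rightarrow> real \<Rightarrow> real list \<Rightarrow> bool" where
  "horner_ge S V k [] = False"
| "horner_ge S V k [h] = (S * S \<le> h * (2 * k + 1) * (S - V))"
| "horner_ge S V k (h # h' # hs) =
    (S * S + (2 * k + 1) * V * h' \<le> h * (2 * k + 1) * S \<and> horner_ge S V (k + 1) (h' # hs))"

lemma horner_le_sum:
  assumes "horner_le S V k hs" "0 < S" "0 \<le> V" "0 \<le> k"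
  shows "(case hs of [] \<Rightarrow> 0 | h # _ \<Rightarrow> h) / S \<le> (\<Sum>i<length hs. (V / S) ^ i / (2 * (k + real i) + 1))"
  using assms
proof (induction S V k hs rule: horner_le.induct)
  case (2 S V k h hs)
  let ?n = "(case hs of [] \<Rightarrow> 0 | h' # _ \<Rightarrow> h')"
  have c: "0 < 2 * k + 1" using 2 by simp
  have "h / S = h * (2 * k + 1) * S / ((2 * k + 1) * (S * S))" using 2(3) c by simp
  also have "\<dots> \<le> (S * S + (2 * k + 1) * V * ?n) / ((2 * k + 1) * (S * S))"
    using 2 by (intro divide_right_mono) auto
  also have "\<dots> = 1 / (2 * k + 1) + V / S * (?n / S)" using 2(3) c by (simp add: add_divide_distrib)
  also have "\<dots> \<le> 1 / (2 * k + 1) + V / S * (\<Sum>i<length hs. (V / S) ^ i / (2 * (k + 1 + real i) + 1))"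
    using 2 by (intro add_left_mono mult_left_mono) auto
  also have "\<dots> = (\<Sum>i<length (h # hs). (V / S) ^ i / (2 * (k + real i) + 1))"
    by (simp add: sum.lessThan_Suc_shift sum_distrib_left add_ac del: sum.lessThan_Suc)
  finally show ?case by simp
qed simp

lemma horner_ge_sum:
  assumes "horner_ge S V k hs" "0 < S" "0 \<le> V" "V < S" "0 \<le> k"
  shows "(\<Sum>i<length hs - 1. (V / S) ^ i / (2 * (k + real i) + 1)) +
      (V / S) ^ (length hs - 1) / ((2 * (k + real (length hs - 1)) + 1) * (1 - V / S)) \<le> hd hs / S"
  using assms
proof (induction S V k hs rule: horner_ge.induct)
  case (2 S V k h)
  have p: "0 < (2 * k + 1) * (S - V)" using 2 by simp
  have "S * S / ((2 * k + 1) * (S - V)) \<le> h" using 2 p by (simp add: pos_divide_le_eq mult.assoc)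
  then have "S * S / ((2 * k + 1) * (S - V)) / S \<le> h / S" using 2 by (intro divide_right_mono) auto
  moreover have "S * S / ((2 * k + 1) * (S - V)) / S = 1 / ((2 * k + 1) * (1 - V / S))"
  proof -
    have "1 - V / S = (S - V) / S" using 2 by (simp add: diff_divide_distrib)
    then show ?thesis using 2 by simp
  qed
  ultimately show ?case by simp
next
  case (3 S V k h h' hs)
  have c: "0 < 2 * k + 1" using 3 by simp
  have ih: "(\<Sum>i<length hs. (V / S) ^ i / (2 * (k + 1 + real i) + 1)) +
      (V / S) ^ length hs / ((2 * (k + 1 + real (length hs)) + 1) * (1 - V / S)) \<le> h' / S"
    using 3 by simp
  have "(\<Sum>i<length (h' # hs). (V / S) ^ i / (2 * (k + real i) + 1)) +
      (V / S) ^ length (h' # hs) / ((2 * (k + real (length (h' # hs))) + 1) * (1 - V / S)) =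
      1 / (2 * k + 1) + V / S * ((\<Sum>i<length hs. (V / S) ^ i / (2 * (k + 1 + real i) + 1)) +
      (V / S) ^ length hs / ((2 * (k + 1 + real (length hs)) + 1) * (1 - V / S)))"
    by (simp add: sum.lessThan_Suc_shift sum_distrib_left add_ac distrib_left del: sum.lessThan_Suc)
  also have "\<dots> \<le> 1 / (2 * k + 1) + V / S * (h' / S)"
    using ih 3 by (intro add_left_mono mult_left_mono) auto
  also have "\<dots> = (S * S + (2 * k + 1) * V * h') / ((2 * k + 1) * (S * S))" using 3(3) c by (simp add: add_divide_distrib)
  also have "\<dots> \<le> h * (2 * k + 1) * S / ((2 * k + 1) * (S * S))" using 3 by (intro divide_right_mono) auto
  also have "\<dots> = h / S" using 3(3) c by simp
  finally show ?case by simp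
qed simp

section \<open>Rational enclosures of logarithms and of \<open>Phi\<close>\<close>

lemma ln_bounds_horner:
  fixes v S V h :: real
  assumes v: "0 < v" "v < 1" and S: "0 < S" "0 \<le> V"
  shows "horner_le S V 0 (h # hs) \<Longrightarrow> V \<le> v\<^sup>2 * S \<Longrightarrow> 2 * v * (h / S) \<le> ln ((1 + v) / (1 - v))"
    and "horner_ge S V 0 (h # hs) \<Longrightarrow> v\<^sup>2 * S \<le> V \<Longrightarrow> V < S \<Longrightarrow> ln ((1 + v) / (1 - v)) \<le> 2 * v * (h / S)"
proof -
  define x where "x = (1 + v) / (1 - v)"
  have x: "1 < x" using v by (simp add: x_def)
  have xv: "(x - 1) / (x + 1) = v"
  proof -
    have "x - 1 = 2 * v / (1 - v)" "x + 1 = 2 / (1 - v)" using v by (simp_all add: x_def field_simps)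
    then show ?thesis using v by simp
  qed
  have sum: "(\<Sum>k<n. 2 * v ^ (2 * k + 1) / real (2 * k + 1)) = 2 * v * (\<Sum>k<n. (v\<^sup>2) ^ k / (2 * (0 + real k) + 1))" for n
    by (simp add: sum_distrib_left power_mult mult.assoc add.commute)
  have approx: "(\<Sum>k<n. 2 * v ^ (2 * k + 1) / real (2 * k + 1)) \<le> ln x"
    "ln x \<le> (\<Sum>k<n. 2 * v ^ (2 * k + 1) / real (2 * k + 1)) + 2 * (v ^ (2 * n + 1) / (1 - v\<^sup>2) / real (2 * n + 1))" for n
    using ln_approx_bounds[OF x, of n] unfolding xv by auto
  show "2 * v * (h / S) \<le> ln ((1 + v) / (1 - v))" if "horner_le S V 0 (h # hs)" "V \<le> v\<^sup>2 * S"
  proof -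
    have q: "V / S \<le> v\<^sup>2" using that(2) S by (simp add: pos_divide_le_eq)
    have "h / S \<le> (\<Sum>i<length (h # hs). (V / S) ^ i / (2 * (0 + real i) + 1))"
      using horner_le_sum[OF that(1)] S by simp
    also have "\<dots> \<le> (\<Sum>i<length (h # hs). (v\<^sup>2) ^ i / (2 * (0 + real i) + 1))"
      using q S by (intro sum_mono divide_right_mono power_mono) auto
    finally have "2 * v * (h / S) \<le> 2 * v * (\<Sum>i<length (h # hs). (v\<^sup>2) ^ i / (2 * (0 + real i) + 1))"
      using v by (intro mult_left_mono) auto
    then show ?thesis using approx(1)[of "length (h # hs)"] unfolding sum x_def by linarith
  qed
  show "ln ((1 + v) / (1 - v)) \<le> 2 * v * (h / S)" if "horner_ge S V 0 (h # hs)" "v\<^sup>2 * S \<le> V" "V < S"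
  proof -
    define n where "n = length hs"
    define w where "w = v\<^sup>2"
    have w: "0 \<le> w" "w \<le> V / S" "V / S < 1" using that(2,3) S by (simp_all add: w_def pos_le_divide_eq)
    have "w ^ n / ((2 * (0 + real n) + 1) * (1 - w)) \<le> (V / S) ^ n / ((2 * (0 + real n) + 1) * (1 - V / S))"
      using w by (intro frac_le power_mono mult_left_mono) (auto intro!: mult_pos_pos)
    moreover have "(\<Sum>i<n. w ^ i / (2 * (0 + real i) + 1)) \<le> (\<Sum>i<n. (V / S) ^ i / (2 * (0 + real i) + 1))"
      using w by (intro sum_mono divide_right_mono power_mono) auto
    moreover have "(\<Sum>i<n. (V / S) ^ i / (2 * (0 + real i) + 1)) + (V / S) ^ n / ((2 * (0 + real n) + 1) * (1 - V / S)) \<le> h / S"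
      using horner_ge_sum[OF that(1) S that(3)] by (simp add: n_def)
    ultimately have "(\<Sum>i<n. w ^ i / (2 * (0 + real i) + 1)) + w ^ n / ((2 * (0 + real n) + 1) * (1 - w)) \<le> h / S" by linarith
    then have "2 * v * ((\<Sum>i<n. w ^ i / (2 * (0 + real i) + 1)) + w ^ n / ((2 * (0 + real n) + 1) * (1 - w))) \<le> 2 * v * (h / S)"
      using v by (intro mult_left_mono) auto
    moreover have "2 * (v ^ (2 * n + 1) / (1 - v\<^sup>2) / real (2 * n + 1)) = 2 * v * (w ^ n / ((2 * (0 + real n) + 1) * (1 - w)))"
      by (simp add: w_def power_mult[symmetric] mult.commute add.commute)
    ultimately show ?thesis using approx(2)[of n] unfolding sum x_def[symmetric] w_def[symmetric] distrib_left by linarith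
  qed
qed

text \<open>At \<open>x = 2\<close> the series parameter \<open>(x - 1) / (x + 1)\<close> is
  \<open>1/3\<close>, and twelve terms suffice for the stated digits.\<close>

lemma ln_2_bounds: "69314718055 / 100000000000 \<le> ln (2 :: real)" "ln (2 :: real) \<le> 69314718057 / 100000000000"
proof -
  have "(\<Sum>k<12. 2 * (1/3 :: real) ^ (2 * k + 1) / real (2 * k + 1)) =
      2 * (1/3) * list_poly [1, 1/3, 1/5, 1/7, 1/9, 1/11, 1/13, 1/15, 1/17, 1/19, 1/21, 1/23] ((1/3)\<^sup>2)"
    by (simp add: eval_nat_numeral)
  then show "69314718055 / 100000000000 \<le> ln (2 :: real)" "ln (2 :: real) \<le> 69314718057 / 100000000000"
    using ln_approx_bounds[of 2 12] by (simp_all add: power2_eq_square power_divide)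
qed

text \<open>Argument reduction: \<open>v\<close> is meant to put
  \<open>2 ^ n * (1 + v) / (1 - v)\<close> just below \<open>u\<close>, which keeps \<open>v\<close>
  small and the series short.\<close>

lemma ln_ge_reduced:
  fixes u v :: real
  assumes v: "0 < v" "v < 1" and u: "0 < u" "(1 + v) * 2 ^ n \<le> u * (1 - v)"
    and h: "0 < S" "0 \<le> V" "horner_le S V 0 (h # hs)" "V \<le> v\<^sup>2 * S"
  shows "real n * (69314718055 / 100000000000) + 2 * v * (h / S) \<le> ln u"
proof -
  have "real n * (69314718055 / 100000000000) + 2 * v * (h / S) \<le> real n * ln 2 + ln ((1 + v) / (1 - v))"
    using ln_2_bounds(1) ln_bounds_horner(1)[OF v h] by (intro add_mono mult_left_mono) auto
  also have "\<dots> = ln (2 ^ n * ((1 + v) / (1 - v)))"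
    by (subst ln_mult_pos) (use v in \<open>simp_all add: ln_realpow\<close>)
  also have "\<dots> \<le> ln u"
  proof (rule ln_mono)
    show "2 ^ n * ((1 + v) / (1 - v)) \<le> u" using v u by (simp add: field_simps)
  qed (use v in auto)
  finally show ?thesis .
qed

lemma ln_le_reduced:
  fixes u v :: real
  assumes v: "0 < v" "v < 1" and u: "0 < u" "u * (1 - v) \<le> (1 + v) * 2 ^ n"
    and h: "0 < S" "0 \<le> V" "horner_ge S V 0 (h # hs)" "v\<^sup>2 * S \<le> V" "V < S"
  shows "ln u \<le> real n * (69314718057 / 100000000000) + 2 * v * (h / S)"
proof -
  have "ln u \<le> ln (2 ^ n * ((1 + v) / (1 - v)))" using v u by (intro ln_mono) (auto simp: field_simps)
  also have "\<dots> = real n * ln 2 + ln ((1 + v) / (1 - v))"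
    by (subst ln_mult_pos) (use v in \<open>simp_all add: ln_realpow\<close>)
  also have "\<dots> \<le> real n * (69314718057 / 100000000000) + 2 * v * (h / S)"
    using ln_2_bounds(2) ln_bounds_horner(2)[OF v h] by (intro add_mono mult_left_mono) auto
  finally show ?thesis .
qed

lemma Phi_conv_ln:
  assumes "0 < z" "z < 1"
  shows "Phi z * (2 * sqrt z) = ln ((1 + sqrt z) / (1 - sqrt z))"
  using assms by (simp add: Phi_def artanh_def)

text \<open>\<open>Phi z * (2 * sqrt z)\<close> is a logarithm that increases with
  \<open>sqrt z\<close>. Hence the lower bound \<open>rl\<close> of the root goes into the logarithm
  and the upper bound \<open>ru\<close> into the divisor; for \<open>Phi_le\<close> they change
  places.\<close>

lemma Phi_ge:
  fixes z rl ru v \<phi> :: real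
  assumes z: "0 < rl" "rl\<^sup>2 \<le> z" "z \<le> ru\<^sup>2" "z < 1" "0 < ru" "0 \<le> \<phi>" and v: "0 < v" "v < 1"
    and red: "(1 + v) * 2 ^ n * (1 - rl) \<le> (1 + rl) * (1 - v)"
    and h: "0 < S" "0 \<le> V" "horner_le S V 0 (h # hs)" "V \<le> v\<^sup>2 * S"
    and val: "\<phi> * (2 * ru) \<le> real n * (69314718055 / 100000000000) + 2 * v * (h / S)"
  shows "\<phi> \<le> Phi z"
proof -
  have "0 < rl\<^sup>2" using z(1) by simp
  then have zb: "0 < z" using z(2) by linarith
  have r: "rl \<le> sqrt z" "sqrt z \<le> ru" "sqrt z < 1" using z zb by (auto intro: real_le_rsqrt real_le_lsqrt)
  have rl1: "rl < 1" using r by linarith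
  have "(1 + v) * 2 ^ n \<le> (1 + rl) / (1 - rl) * (1 - v)"
    unfolding times_divide_eq_left by (subst pos_le_divide_eq) (use red r in linarith)+
  then have "real n * (69314718055 / 100000000000) + 2 * v * (h / S) \<le> ln ((1 + rl) / (1 - rl))"
    using rl1 z(1) by (intro ln_ge_reduced[OF v _ _ h]) auto
  also have "\<dots> \<le> ln ((1 + sqrt z) / (1 - sqrt z))"
    by (intro ln_mono frac_le divide_pos_pos) (use rl1 r z(1) in linarith)+
  also have "\<dots> = Phi z * (2 * sqrt z)" by (rule Phi_conv_ln[symmetric]) (use z zb in auto)
  finally have "\<phi> * (2 * ru) \<le> Phi z * (2 * sqrt z)" using val by linarith
  moreover have "\<phi> * (2 * sqrt z) \<le> \<phi> * (2 * ru)" using r z by (intro mult_left_mono) auto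
  ultimately have "\<phi> * (2 * sqrt z) \<le> Phi z * (2 * sqrt z)" by linarith
  then show ?thesis using zb by simp
qed

lemma Phi_le:
  fixes z rl ru v \<phi> :: real
  assumes z: "0 < rl" "rl\<^sup>2 \<le> z" "z \<le> ru\<^sup>2" "0 < ru" "ru < 1" "0 \<le> \<phi>" and v: "0 < v" "v < 1"
    and red: "(1 + ru) * (1 - v) \<le> (1 + v) * 2 ^ n * (1 - ru)"
    and h: "0 < S" "0 \<le> V" "horner_ge S V 0 (h # hs)" "v\<^sup>2 * S \<le> V" "V < S"
    and val: "real n * (69314718057 / 100000000000) + 2 * v * (h / S) \<le> \<phi> * (2 * rl)"
  shows "Phi z \<le> \<phi>"
proof -
  have "0 < rl\<^sup>2" using z(1) by simp
  then have zb: "0 < z" using z(2) by linarith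
  have r: "rl \<le> sqrt z" "sqrt z \<le> ru" using z zb by (auto intro: real_le_rsqrt real_le_lsqrt)
  have z1: "z < 1" using r(2) z(5) by (metis le_less_trans real_sqrt_lt_1_iff)
  have "Phi z * (2 * sqrt z) = ln ((1 + sqrt z) / (1 - sqrt z))" by (rule Phi_conv_ln) (use zb z1 in auto)
  also have "\<dots> \<le> ln ((1 + ru) / (1 - ru))"
    using r z zb z1 by (intro ln_mono frac_le divide_pos_pos) (auto intro: add_pos_nonneg)
  also have "\<dots> \<le> real n * (69314718057 / 100000000000) + 2 * v * (h / S)"
  proof (rule ln_le_reduced[OF v _ _ h])
    show "(1 + ru) / (1 - ru) * (1 - v) \<le> (1 + v) * 2 ^ n"
      unfolding times_divide_eq_left by (subst pos_divide_le_eq) (use red z in auto)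
  qed (use z in auto)
  finally have "Phi z * (2 * sqrt z) \<le> \<phi> * (2 * rl)" using val by linarith
  moreover have "\<phi> * (2 * rl) \<le> \<phi> * (2 * sqrt z)" using r z by (intro mult_left_mono) auto
  ultimately have "Phi z * (2 * sqrt z) \<le> \<phi> * (2 * sqrt z)" by linarith
  then show ?thesis using zb by simp
qed

subsection \<open>Volumes of the truncated cubes\<close>

lemma octant7_lower_w1_a: "Phi (960107345388801/2500000000000000) \<le> 5845758821/5000000000"
  by (rule Phi_le[where rl="30985599/50000000" and ru="30985599/50000000" and v="3137986813/100000000000" and n=2 and S="1000000000000" and V="984696124" and h="1000328426104" and
      hs="[333530411183, 200140778718, 142966661381, 111220629635]"])
    (simp_all add: power2_eq_square)

lemma octant7_lower_w1_0: "7759264777/5000000000 \<le> Phi (960107345388801/1250000000000000)"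
  by (rule Phi_ge[where rl="2191012717/2500000000" and ru="8764050869/10000000000" and v="6196124617/20000000000" and n=3 and S="1000000000000" and V="95979900673" and h="1033972275335" and
      hs="[353951974291, 214822486935, 154433238954, 120609586139, 98963167928, 83914204566, 72839496549, 64313776528, 57202050407, 47619047619]"])
    (simp_all add: power2_eq_square)

text \<open>\<open>w1\<close>, \<open>w2\<close>, \<open>w3\<close> are the wedges over the right
  triangle of a face, the isosceles triangle of a face and the truncating triangle.
  \<open>za\<close> is the squared distance from the origin to the centre of the face or of the
  truncating triangle, \<open>zb\<close> that to the foot of the centre on the outer edge, and
  \<open>zb + \<beta>\<close> that to the vertex shared by all three; the suffixes \<open>_a\<close>
  and \<open>_0\<close> mark the bounds for \<open>Phi za\<close> and \<open>Phi zb\<close>.\<close>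

lemma octant7_lower_w1: "ennreal (810631163/10000000000) \<le> wedge_volume (1) (1) (1) (30985599/50000000) (1) (12474295/20657066)"
  by (rule wedge_volume_ge[where zb="960107345388801/1250000000000000" and \<beta>="56018892868929/400000000000000" and \<kappa>="155608035747025/426714375728356" and za="960107345388801/2500000000000000" and S="1000000000000" and b="140047232173" and Z="768085876312" and K="364665557568" and
      R="603875391220" and G="4311940920602" and F="1169151764200" and xs="[
      (382701191200, 382701191200, 1551852955400, 603875391220),
      (112069310646, 37356436882, 251627253917, 364665488121),
      (43415201530, 8683040306, 84283019183, 220212514303),
      (19145504732, 2735072104, 34977533405, 132980918226),
      (9079546542, 1008838504, 16061252701, 80303904018),
      (4508426950, 409856995, 7819424853, 48493551455),
      (2310304719, 177715747, 3954372747, 29284062356),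
      (1211288075, 80752538, 2053776634, 17683924611),
      (646179118, 38010536, 1087894160, 10678886892),
      (349424421, 18390759, 585063690, 6448716999),
      (191025848, 9096468, 318448900, 3894221500),
      (105371095, 4581351, 175031643, 2351624531),
      (58560034, 2342401, 96985244, 1420088183),
      (32751936, 1213034, 54106764, 857556307),
      (18417827, 635097, 30361331, 517857150),
      (10406209, 335684, 17122557, 312721189),
      (0, 0, 3794787, 188844630)]"])
    (use octant7_lower_w1_a octant7_lower_w1_0 in \<open>simp_all add: power2_eq_square\<close>)

lemma octant7_lower_w2_0: "9140837889/5000000000 \<le> Phi (17560042498521297/20000000000000000)"
  by (rule Phi_ge[where rl="4685088379/5000000000" and ru="9370176759/10000000000" and v="15779018007/50000000000" and n=4 and S="1000000000000" and V="99590963706" and h="1035333674439" and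
      hs="[354787955903, 215427401962, 154907648130, 120999986592, 99294907026, 84202580287, 73094014696, 64537461940, 57374005790, 47619047619]"])
    (simp_all add: power2_eq_square)

lemma octant7_lower_w2: "ennreal (523770673/10000000000) \<le> wedge_volume (1) (1/2) (2) (30985599/50000000) (33131361/20657066) (8182771/66262722)"
  by (rule wedge_volume_ge[where zb="17560042498521297/20000000000000000" and \<beta>="602619671145969/20000000000000000" and \<kappa>="66957741238441/1097687081712321" and za="960107345388801/2500000000000000" and S="1000000000000" and b="30130983558" and Z="878002124927" and K="60998933443" and
      R="246979576808" and G="8196864079755" and F="1169151764200" and xs="[
      (659015813600, 659015813600, 1828167577800, 246979576808),
      (69080137449, 23026712483, 109279399201, 60998911360),
      (10342193327, 2068438665, 14556008034, 15065485313),
      (1812667960, 258952565, 2443530723, 3720867187),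
      (345789863, 38421095, 456360676, 918978203),
      (69479023, 6316274, 90571836, 226968847),
      (14454805, 1111908, 18692952, 56056669),
      (3082981, 205532, 3964709, 13844852),
      (669900, 39405, 857959, 3419395),
      (0, 0, 40864, 844520)]"])
    (use octant7_lower_w1_a octant7_lower_w2_0 in \<open>simp_all add: power2_eq_square\<close>)

lemma octant7_lower_w3_a: "Phi (8679584637402987/10000000000000000) \<le> 17932732313/10000000000"
  by (rule Phi_le[where rl="4658214421/5000000000" and ru="9316428843/10000000000" and v="1384843353/5000000000" and n=4 and S="1000000000000" and V="76711644494" and h="1026816078479" and
      hs="[349569855470, 211656551535, 151952830779, 118569846620, 97230812316, 82408889137, 71512118526, 63164489444, 56588019458, 51575488130]"])
    (simp_all add: power2_eq_square)

text \<open>The edge between a cut face and the truncating triangle belongs to both, so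
  \<open>zb\<close>, \<open>\<beta>\<close> and the bound for \<open>Phi zb\<close> are those of
  \<open>w2\<close>. For a truncating triangle
  \<open>\<kappa> = 2 * (1/2)\<^sup>2 / (1/6) = 3\<close>.\<close>

lemma octant7_lower_w3: "ennreal (1107491/12500000) \<le> wedge_volume (1/3) (1/6) (2) (161365281/100000000) (8182771/53788427) (1/2)"
  by (rule wedge_volume_ge[where zb="17560042498521297/20000000000000000" and \<beta>="602619671145969/20000000000000000" and \<kappa>="3" and za="8679584637402987/10000000000000000" and S="1000000000000" and b="30130983558" and Z="878002124927" and K="3000000000000" and
      R="246979576808" and G="8196864079755" and F="1793273231300" and xs="[
      (34894346500, 34894346500, 1828167577800, 246979576808),
      (4596355178, 1532118392, 109279394678, 60998911360),
      (766942438, 153388487, 14556007972, 15065485313),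
      (142703347, 20386192, 2443530661, 3720867187),
      (28250574, 3138952, 456360615, 918978203),
      (5820055, 529095, 90571777, 226968847),
      (1232727, 94825, 18692892, 56056669),
      (266468, 17764, 3964649, 13844852),
      (58495, 3440, 857899, 3419395),
      (12988, 683, 188473, 844520),
      (0, 0, 38964, 208579)]"])
    (use octant7_lower_w3_a octant7_lower_w2_0 in \<open>simp_all add: power2_eq_square\<close>)

text \<open>The arguments are rational numbers just below \<open>cube_param 7\<close> and its
  inverse; those of \<open>octant7_upper\<close> lie just above.\<close>

lemma octant7_lower: "ennreal (977839661/1000000000) \<le> octant_volume (30985599/50000000) (161365281/100000000)"
  by (rule octant_volume_ge[where wa="810631163/10000000000" and wb="523770673/10000000000" and wc="1107491/12500000"])
    (use octant7_lower_w1 octant7_lower_w2 octant7_lower_w3 in \<open>simp_all add: power2_eq_square\<close>)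

lemma octant7_upper_w1_a: "5845758857/5000000000 \<le> Phi (3840429505497601/10000000000000000)"
  by (rule Phi_ge[where rl="61971199/100000000" and ru="61971199/100000000" and v="1568994217/50000000000" and n=2 and S="1000000000000" and V="984697141" and h="1000328426442" and
      hs="[333530411279, 200140671020, 142857142857]"])
    (simp_all add: power2_eq_square)

lemma octant7_upper_w1_0: "Phi (3840429505497601/5000000000000000) \<le> 15518530009/10000000000"
  by (rule Phi_le[where rl="876405101/1000000000" and ru="8764051011/10000000000" and v="30980628661/100000000000" and n=3 and S="1000000000000" and V="95979935224" and h="1033972288331" and
      hs="[353951982272, 214822492739, 154433243826, 120609593471, 98963208691, 83914599056, 72843580441, 64356302795, 57645104358, 52235140585, 48094353836]"])
    (simp_all add: power2_eq_square)

lemma octant7_upper_w1: "wedge_volume (1) (1) (1) (61971199/100000000) (1) (37422887/61971199) \<le> ennreal (202658069/2500000000)"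
  by (rule wedge_volume_le[where zb="3840429505497601/5000000000000000" and \<beta>="1400472471414769/10000000000000000" and \<kappa>="1400472471414769/3840429505497601" and za="3840429505497601/10000000000000000" and S="1000000000000" and b="140047247141" and Z="768085901099" and K="364665584776" and
      R="603875520314" and G="4311941381491" and F="1169151771400" and xs="[
      (382701229500, 382701229500, 1551853000900, 603875520314),
      (112069343438, 37356447813, 251627311088, 364665644035),
      (43415223169, 8683044634, 84283055829, 220212655533),
      (19145518303, 2735074044, 34977556048, 132981031940),
      (9079554915, 1008839435, 16061266542, 80303989855),
      (4508432084, 409857463, 7819433286, 48493613657),
      (2310307860, 177715990, 3954377882, 29284106180),
      (1211289999, 80752667, 2053779765, 17683954857),
      (646180301, 38010606, 1087896076, 10678907441),
      (349425155, 18390798, 585064872, 6448730788),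
      (191026308, 9096491, 318449636, 3894230660),
      (105371390, 4581365, 175032110, 2351630567),
      (58560228, 2342410, 96985547, 1420092133),
      (32752070, 1213040, 54106969, 857558876),
      (18417924, 635101, 30361476, 517858813),
      (10406284, 335687, 17122667, 312722261),
      (5904037, 178911, 9698850, 188845319),
      (3361946, 96056, 5514945, 114039066),
      (1920639, 51910, 3146625, 68865401),
      (1100440, 28217, 1800830, 41586130),
      (632162, 15419, 1033454, 25112846),
      (6146556, 142944, 6377083, 15165033)]"])
    (use octant7_upper_w1_a octant7_upper_w1_0 in \<open>simp_all add: power2_eq_square\<close>)

lemma octant7_upper_w2_0: "Phi (8780021671385299/10000000000000000) \<le> 9140838663/5000000000"
  by (rule Phi_le[where rl="1171272123/1250000000" and ru="1874035397/2000000000" and v="31558052769/100000000000" and n=4 and S="1000000000000" and V="99591069458" and h="1035333714405" and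
      hs="[354787980460, 215427419780, 154907662537, 121000002757, 99294963890, 84203061843, 73098772399, 64585165784, 57852942062, 52428025353, 48287238604]"])
    (simp_all add: power2_eq_square)

lemma octant7_upper_w2: "wedge_volume (1) (1/2) (2) (61971199/100000000) (99394086/61971199) (6137078/49697043) \<le> ennreal (261885387/5000000000)"
  by (rule wedge_volume_le[where zb="8780021671385299/10000000000000000" and \<beta>="9415931594521/312500000000000" and \<kappa>="150654905512336/2469796082943849" and za="3840429505497601/10000000000000000" and S="1000000000000" and b="30130981102" and Z="878002167138" and K="60998924790" and
      R="246979642144" and G="8196866915952" and F="1169151771400" and xs="[
      (659015961200, 659015961200, 1828167732600, 246979642144),
      (69080166182, 23026722061, 109279431234, 60998943634),
      (10342200114, 2068440023, 14556015975, 15065497270),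
      (1812669640, 258952806, 2443532726, 3720871125),
      (345790306, 38421146, 456361205, 918979419),
      (69479163, 6316288, 90571999, 226969209),
      (14454870, 1111914, 18693024, 56056775),
      (3083028, 205536, 3964759, 13844883),
      (669942, 39409, 858003, 3419405),
      (147710, 7775, 188575, 844524),
      (32958, 1570, 41968, 208581),
      (7436, 324, 9446, 51516),
      (1703, 69, 2156, 12724),
      (5065, 188, 5168, 3143)]"])
    (use octant7_upper_w1_a octant7_upper_w2_0 in \<open>simp_all add: power2_eq_square\<close>)

lemma octant7_upper_w3_a: "3586546747/2000000000 \<le> Phi (1041550208125249/1200000000000000)"
  by (rule Phi_ge[where rl="9316429073/10000000000" and ru="4658214537/5000000000" and v="27696883141/100000000000" and n=4 and S="1000000000000" and V="76711733572" and h="1026816111148" and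
      hs="[349569875423, 211656565873, 151952841245, 118569845373, 97230683170, 82407109932, 71488842112, 62860989073, 52631578947]"])
    (simp_all add: power2_eq_square)

lemma octant7_upper_w3: "wedge_volume (1/3) (1/6) (2) (32273057/20000000) (24548312/161365285) (1/2) \<le> ennreal (442997709/5000000000)"
  by (rule wedge_volume_le[where zb="8780021671385299/10000000000000000" and \<beta>="9415931594521/312500000000000" and \<kappa>="3" and za="1041550208125249/1200000000000000" and S="1000000000000" and b="30130981102" and Z="878002167138" and K="3000000000000" and
      R="246979642144" and G="8196866915952" and F="1793273373500" and xs="[
      (34894359100, 34894359100, 1828167732600, 246979642144),
      (4596357651, 1532119217, 109279434951, 60998943634),
      (766943083, 153388617, 14556016036, 15065497270),
      (142703538, 20386220, 2443532787, 3720871125),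
      (28250652, 3138962, 456361266, 918979419),
      (5820105, 529101, 90572061, 226969209),
      (1232770, 94829, 18693085, 56056775),
      (266509, 17768, 3964819, 13844883),
      (58536, 3444, 858063, 3419405),
      (1791510, 94290, 1967118, 844524)]"])
    (use octant7_upper_w3_a octant7_upper_w2_0 in \<open>simp_all add: power2_eq_square\<close>)

lemma octant7_upper: "octant_volume (61971199/100000000) (32273057/20000000) \<le> ennreal (488920457/500000000)"
  by (rule octant_volume_le[where wa="202658069/2500000000" and wb="261885387/5000000000" and wc="442997709/5000000000"])
    (use octant7_upper_w1 octant7_upper_w2 octant7_upper_w3 in \<open>simp_all add: power2_eq_square\<close>)

section \<open>Lower volume bounds for \<open>p = 8\<close>, \<open>p = 9\<close> and
  \<open>p = 10\<close>\<close>

lemma octant8_lower_w1_a: "Phi (1656369/4000000) \<le> 59373/50000"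
  by (rule Phi_le[where rl="1287/2000" and ru="1287/2000" and v="70859/1000000" and n=2 and S="10000000" and V="50210" and h="10016788" and
      hs="[3343412, 2007210, 1435781]"])
    (simp_all add: power2_eq_square)

lemma octant8_lower_w1_0: "41969/25000 \<le> Phi (1656369/2000000)"
  by (rule Phi_ge[where rl="22751/25000" and ru="18201/20000" and v="70263/500000" and n=4 and S="10000000" and V="197475" and h="10066615" and
      hs="[3373385, 2028210, 1428571]"])
    (simp_all add: power2_eq_square)

lemma octant8_lower_w1: "ennreal (881/12500) \<le> wedge_volume (1) (1) (1) (1287/2000) (1) (889/2145)"
  by (rule wedge_volume_ge[where zb="1656369/2000000" and \<beta>="7112889/100000000" and \<kappa>="790321/4601025" and za="1656369/4000000" and S="10000000" and b="711289" and Z="8281845" and K="1717707" and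
      R="4139841" and G="58201966" and F="11874600" and xs="[
      (4913000, 4913000, 16787600, 4139841),
      (934391, 311463, 1778301, 1713828),
      (242265, 48453, 402766, 709497),
      (72316, 10330, 113931, 293720),
      (23323, 2591, 35745, 121595),
      (0, 0, 4007, 50338)]"])
    (use octant8_lower_w1_a octant8_lower_w1_0 in \<open>simp_all add: power2_eq_square\<close>)

lemma octant8_lower_w2_0: "20989/12500 \<le> Phi (82832427/100000000)"
  by (rule Phi_ge[where rl="22753/25000" and ru="91013/100000" and v="140983/1000000" and n=4 and S="10000000" and V="198762" and h="10067055" and
      hs="[3373650, 2028394, 1428571]"])
    (simp_all add: power2_eq_square)

lemma octant8_lower_w2: "ennreal (7027/100000) \<le> wedge_volume (1) (1/2) (2) (1287/2000) (3034/2145) (314/1517)"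
  by (rule wedge_volume_ge[where zb="82832427/100000000" and \<beta>="221841/3125000" and \<kappa>="394384/2301289" and za="1656369/4000000" and S="10000000" and b="709892" and Z="8283243" and K="1713753" and
      R="4135070" and G="58249351" and F="11874600" and xs="[
      (4916600, 4916600, 16791200, 4135070),
      (933821, 311273, 1776405, 1709880),
      (241820, 48364, 401854, 707047),
      (0, 0, 41442, 292368)]"])
    (use octant8_lower_w1_a octant8_lower_w2_0 in \<open>simp_all add: power2_eq_square\<close>)

lemma octant8_lower_w3_a: "Phi (80466123/100000000) \<le> 32481/20000"
  by (rule Phi_le[where rl="44851/50000" and ru="89703/100000" and v="70393/1000000" and n=4 and S="10000000" and V="49552" and h="10016567" and
      hs="[3343279, 2007115, 1435686]"])
    (simp_all add: power2_eq_square)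

lemma octant8_lower_w3: "ennreal (13981/100000) \<le> wedge_volume (1/3) (1/6) (2) (15537/10000) (1256/5179) (1/2)"
  by (rule wedge_volume_ge[where zb="82832427/100000000" and \<beta>="221841/3125000" and \<kappa>="3" and za="80466123/100000000" and S="10000000" and b="709892" and Z="8283243" and K="30000000" and
      R="4135070" and G="58249351" and F="16240500" and xs="[
      (550700, 550700, 16791200, 4135070),
      (122508, 40836, 1774608, 1709880),
      (34271, 6854, 401795, 707047),
      (10667, 1523, 113480, 292368),
      (0, 0, 32001, 120896)]"])
    (use octant8_lower_w3_a octant8_lower_w2_0 in \<open>simp_all add: power2_eq_square\<close>)

lemma octant8_lower: "ennreal (11241/10000) \<le> octant_volume (1287/2000) (15537/10000)"
  by (rule octant_volume_ge[where wa="881/12500" and wb="7027/100000" and wc="13981/100000"])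
    (use octant8_lower_w1 octant8_lower_w2 octant8_lower_w3 in \<open>simp_all add: power2_eq_square\<close>)

lemma octant9_lower_w1_a: "Phi (1734489/4000000) \<le> 23999/20000"
  by (rule Phi_le[where rl="1317/2000" and ru="1317/2000" and v="96711/1000000" and n=2 and S="10000000" and V="93531" and h="10031354" and
      hs="[3352166, 2013488, 1442060]"])
    (simp_all add: power2_eq_square)

lemma octant9_lower_w1_0: "89541/50000 \<le> Phi (1734489/2000000)"
  by (rule Phi_ge[where rl="149/160" and ru="46563/50000" and v="137113/500000" and n=4 and S="10000000" and V="751998" and h="10262621" and
      hs="[3492313, 2114098, 1517267, 1179474, 909090]"])
    (simp_all add: power2_eq_square)

lemma octant9_lower_w1: "ennreal (1559/25000) \<le> wedge_volume (1) (1) (1) (1317/2000) (1) (134/439)"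
  by (rule wedge_volume_ge[where zb="1734489/2000000" and \<beta>="40401/1000000" and \<kappa>="17956/192721" and za="1734489/4000000" and S="10000000" and b="404010" and Z="8672445" and K="931710" and
      R="3043263" and G="75326445" and F="11999500" and xs="[
      (5908700, 5908700, 17908200, 3043263),
      (786783, 262261, 1337303, 926144),
      (146924, 29384, 220230, 281849),
      (31904, 4557, 45594, 85774),
      (7509, 834, 10482, 26103),
      (0, 0, 700, 7943)]"])
    (use octant9_lower_w1_a octant9_lower_w1_0 in \<open>simp_all add: power2_eq_square\<close>)

lemma octant9_lower_w2_0: "40509/25000 \<le> Phi (6423939/8000000)"
  by (rule Phi_ge[where rl="89609/100000" and ru="8961/10000" and v="65623/1000000" and n=4 and S="10000000" and V="43063" and h="10014391" and
      hs="[3341945, 2000000]"])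
    (simp_all add: power2_eq_square)

lemma octant9_lower_w2: "ennreal (507/6250) \<le> wedge_volume (1) (1/2) (2) (1317/2000) (573/439) (305/1146)"
  by (rule wedge_volume_ge[where zb="6423939/8000000" and \<beta>="33489/320000" and \<kappa>="93025/328329" and za="1734489/4000000" and S="10000000" and b="1046532" and Z="8029924" and K="2833287" and
      R="5312135" and G="50759456" and F="11999500" and xs="[
      (4204100, 4204100, 16203600, 5312135),
      (1060418, 353472, 2251561, 2821877),
      (357974, 71594, 658421, 1499019),
      (0, 0, 101425, 796299)]"])
    (use octant9_lower_w1_a octant9_lower_w2_0 in \<open>simp_all add: power2_eq_square\<close>)

lemma octant9_lower_w3_a: "Phi (192027/250000) \<le> 19399/12500"
  by (rule Phi_le[where rl="87641/100000" and ru="43821/50000" and v="61973/200000" and n=3 and S="10000000" and V="960164" and h="10339861" and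
      hs="[3539605, 2148287, 1544391, 1206244, 990795, 850935]"])
    (simp_all add: power2_eq_square)

lemma octant9_lower_w3: "ennreal (17483/100000) \<le> wedge_volume (1/3) (1/6) (2) (759/500) (305/1012) (1/2)"
  by (rule wedge_volume_ge[where zb="6423939/8000000" and \<beta>="33489/320000" and \<kappa>="3" and za="192027/250000" and S="10000000" and b="1046532" and Z="8029924" and K="30000000" and
      R="5312135" and G="50759456" and F="15519200" and xs="[
      (684400, 684400, 16203600, 5312135),
      (195972, 65324, 2249172, 2821877),
      (70450, 14090, 658366, 1499019),
      (28188, 4026, 239538, 796299),
      (0, 0, 84564, 423004)]"])
    (use octant9_lower_w3_a octant9_lower_w2_0 in \<open>simp_all add: power2_eq_square\<close>)

lemma octant9_lower: "ennreal (2421/2000) \<le> octant_volume (1317/2000) (759/500)"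
  by (rule octant_volume_ge[where wa="1559/25000" and wb="507/6250" and wc="17483/100000"])
    (use octant9_lower_w1 octant9_lower_w2 octant9_lower_w3 in \<open>simp_all add: power2_eq_square\<close>)

lemma octant10_lower_w1_a: "Phi (44715969/100000000) \<le> 12089/10000"
  by (rule Phi_le[where rl="6687/10000" and ru="6687/10000" and v="57367/500000" and n=2 and S="10000000" and V="131639" and h="10044230" and
      hs="[3359912, 2019001, 1443394, 1125933]"])
    (simp_all add: power2_eq_square)

lemma octant10_lower_w1_0: "189199/100000 \<le> Phi (44715969/50000000)"
  by (rule Phi_ge[where rl="11821/12500" and ru="94569/100000" and v="56309/1000000" and n=5 and S="10000000" and V="31707" and h="10010589" and
      hs="[3339674, 2000000]"])
    (simp_all add: power2_eq_square)

lemma octant10_lower_w1: "ennreal (697/12500) \<le> wedge_volume (1) (1) (1) (6687/10000) (1) (1576/6687)"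
  by (rule wedge_volume_ge[where zb="44715969/50000000" and \<beta>="38809/1562500" and \<kappa>="2483776/44715969" and za="44715969/100000000" and S="10000000" and b="248378" and Z="8943194" and K="555457" and
      R="2350266" and G="94624728" and F="12089000" and xs="[
      (6830900, 6830900, 18919900, 2350266),
      (671778, 223926, 1051206, 552375),
      (95179, 19035, 132494, 129822),
      (15819, 2259, 21106, 30511),
      (2851, 316, 3730, 7170),
      (0, 0, 159, 1685)]"])
    (use octant10_lower_w1_a octant10_lower_w1_0 in \<open>simp_all add: power2_eq_square\<close>)

lemma octant10_lower_w2_0: "3181/2000 \<le> Phi (157709107/200000000)"
  by (rule Phi_ge[where rl="111/125" and ru="88801/100000" and v="13043/500000" and n=4 and S="10000000" and V="6804" and h="10002267" and
      hs="[3333333]"])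
    (simp_all add: power2_eq_square)

lemma octant10_lower_w2: "ennreal (8863/100000) \<le> wedge_volume (1) (1/2) (2) (6687/10000) (8263/6687) (5111/16526)"
  by (rule wedge_volume_ge[where zb="157709107/200000000" and \<beta>="26122321/200000000" and \<kappa>="26122321/68277169" and za="44715969/100000000" and S="10000000" and b="1306117" and Z="7885456" and K="3825924" and
      R="6176819" and G="47291505" and F="12089000" and xs="[
      (3816000, 3816000, 15905000, 6176819),
      (1139220, 379740, 2599193, 3815309),
      (450809, 90161, 886666, 2356647),
      (0, 0, 172477, 1455658)]"])
    (use octant10_lower_w1_a octant10_lower_w2_0 in \<open>simp_all add: power2_eq_square\<close>)

lemma octant10_lower_w3_a: "Phi (89401/120000) \<le> 18907/12500"
  by (rule Phi_le[where rl="86313/100000" and ru="43157/50000" and v="129861/500000" and n=3 and S="10000000" and V="674556" and h="10234416" and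
      hs="[3475106, 2101718, 1507912, 1176188, 964734, 824874]"])
    (simp_all add: power2_eq_square)

lemma octant10_lower_w3: "ennreal (627/3125) \<le> wedge_volume (1/3) (1/6) (2) (299/200) (5111/14950) (1/2)"
  by (rule wedge_volume_ge[where zb="157709107/200000000" and \<beta>="26122321/200000000" and \<kappa>="3" and za="89401/120000" and S="10000000" and b="1306117" and Z="7885456" and K="30000000" and
      R="6176819" and G="47291505" and F="15125600" and xs="[
      (779400, 779400, 15905000, 6176819),
      (259404, 86468, 2597604, 3815309),
      (108401, 21680, 886613, 2356647),
      (50425, 7203, 375628, 1455658),
      (0, 0, 151275, 899133)]"])
    (use octant10_lower_w3_a octant10_lower_w2_0 in \<open>simp_all add: power2_eq_square\<close>)

lemma octant10_lower: "ennreal (3169/2500) \<le> octant_volume (6687/10000) (299/200)"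
  by (rule octant_volume_ge[where wa="697/12500" and wb="8863/100000" and wc="627/3125"])
    (use octant10_lower_w1 octant10_lower_w2 octant10_lower_w3 in \<open>simp_all add: power2_eq_square\<close>)

section \<open>A common lower volume bound for all \<open>p \<ge> 11\<close>\<close>

lemma octant11_lower_w1_a: "Phi (45684081/100000000) \<le> 60773/50000"
  by (rule Phi_le[where rl="6759/10000" and ru="6759/10000" and v="127679/1000000" and n=2 and S="10000000" and V="163020" and h="10054878" and
      hs="[3366322, 2023589, 1446985, 1129525]"])
    (simp_all add: power2_eq_square)

lemma octant11_lower_w1_0: "24789/12500 \<le> Phi (45684081/50000000)"
  by (rule Phi_ge[where rl="47793/50000" and ru="95587/100000" and v="161319/1000000" and n=5 and S="10000000" and V="260238" and h="10088125" and
      hs="[3386348, 2037176, 1428571]"])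
    (simp_all add: power2_eq_square)

lemma octant11_lower_w1: "ennreal (2409/100000) \<le> wedge_volume (1) (1) (1) (6759/10000) (1) (208/2253)"
  by (rule wedge_volume_ge[where zb="45684081/50000000" and \<beta>="1521/390625" and \<kappa>="43264/5076009" and za="45684081/100000000" and S="10000000" and b="38938" and Z="9136817" and K="85233" and
      R="451092" and G="115850181" and F="12154600" and xs="[
      (7676600, 7676600, 19831200, 451092),
      (139138, 46379, 204568, 20348),
      (3707, 741, 4893, 917),
      (98, 14, 130, 41),
      (0, 0, 1, 1),
      (0, 0, 0, 0)]"])
    (use octant11_lower_w1_a octant11_lower_w1_0 in \<open>simp_all add: power2_eq_square\<close>)

lemma octant11_lower_w2_0: "29761/20000 \<le> Phi (145876851/200000000)"
  by (rule Phi_ge[where rl="85403/100000" and ru="21351/25000" and v="227107/1000000" and n=3 and S="10000000" and V="515775" and h="10177449" and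
      hs="[3440441, 2076637, 1485879, 1111111]"])
    (simp_all add: power2_eq_square)

lemma octant11_lower_w2: "ennreal (1761/20000) \<le> wedge_volume (1) (1/2) (2) (6759/10000) (2461/2253) (2045/4922)"
  by (rule wedge_volume_ge[where zb="145876851/200000000" and \<beta>="1505529/8000000" and \<kappa>="4182025/6056521" and za="45684081/100000000" and S="10000000" and b="1881912" and Z="7293843" and K="6904996" and
      R="6954182" and G="36952764" and F="12154600" and xs="[
      (2725900, 2725900, 14880500, 6954182),
      (964804, 321601, 2847037, 4836064),
      (440350, 88070, 1106547, 3363086),
      (0, 0, 304062, 2338751)]"])
    (use octant11_lower_w1_a octant11_lower_w2_0 in \<open>simp_all add: power2_eq_square\<close>)

lemma octant11_lower_w3_a: "Phi (16666347/25000000) \<le> 140383/100000"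
  by (rule Phi_le[where rl="5103/6250" and ru="81649/100000" and v="4243/40000" and n=3 and S="10000000" and V="112520" and h="10037762" and
      hs="[3356021, 2016258, 1444829]"])
    (simp_all add: power2_eq_square)

lemma octant11_lower_w3: "ennreal (5249/25000) \<le> wedge_volume (1/3) (1/6) (2) (7071/5000) (2045/4714) (1/2)"
  by (rule wedge_volume_ge[where zb="145876851/200000000" and \<beta>="1505529/8000000" and \<kappa>="3" and za="16666347/25000000" and S="10000000" and b="1881912" and Z="7293843" and K="30000000" and
      R="6954182" and G="36952764" and F="14038300" and xs="[
      (842200, 842200, 14880500, 6954182),
      (318667, 106222, 2845267, 4836064),
      (150498, 30099, 1106499, 3363086),
      (78972, 11281, 530466, 2338751),
      (0, 0, 236916, 1626410)]"])
    (use octant11_lower_w3_a octant11_lower_w2_0 in \<open>simp_all add: power2_eq_square\<close>)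

text \<open>\<open>6759/10000\<close> is below \<open>cube_param 11\<close>, and
  \<open>7071/5000\<close> is below \<open>sqrt 2\<close>, hence below
  \<open>1 / cube_param p\<close> for every \<open>p\<close>. This one body therefore lies in the
  octant for all \<open>p \<ge> 11\<close>.\<close>

lemma octant11_lower: "ennreal (10927/10000) \<le> octant_volume (6759/10000) (7071/5000)"
  by (rule octant_volume_ge[where wa="2409/100000" and wb="1761/20000" and wc="5249/25000"])
    (use octant11_lower_w1 octant11_lower_w2 octant11_lower_w3 in \<open>simp_all add: power2_eq_square\<close>)

subsection \<open>Comparison of the densities\<close>

lemma arcosh_nonneg: "1 \<le> x \<Longrightarrow> 0 \<le> arcosh x" for x :: real
  using arcosh_mono[of 1 x] by (simp add: arcosh_real_def)

lemma arsinh_nonneg: "0 \<le> x \<Longrightarrow> 0 \<le> arsinh x" for x :: real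
  using arsinh_mono[of 0 x] by (simp add: arsinh_real_def)

text \<open>Distances are handled through their exponentials: the profile is built from
  \<open>exp (2 * r)\<close>, differences of distances become quotients, and the square roots are
  enclosed by comparing squares.\<close>

lemma dist_params:
  fixes p :: real
  assumes p: "6 < p"
  defines "c \<equiv> cos (2 * pi / p)"
  defines "C \<equiv> 1 / (2 * c - 1)" and "T \<equiv> (1 + c) / (2 * c - 1)"
  shows "1 < C" "0 < T" "0 \<le> h_dist p" "0 \<le> s_dist p" "0 \<le> t_dist p"
    and "exp (2 * h_dist p) = C + sqrt (C\<^sup>2 - 1)" "exp (s_dist p) = sqrt C + sqrt (C + 1)"
    and "exp (t_dist p) = sqrt T + sqrt (T + 1)" "(sinh (s_dist p))\<^sup>2 = C"
proof -
  have c: "1/2 < c" "c < 1" using cos_two_pi_div_bounds[OF p] by (auto simp: c_def)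
  show C: "1 < C" using c by (simp add: C_def)
  show T: "0 < T" using c by (simp add: T_def)
  have h: "h_dist p = arcosh C / 2" and t: "t_dist p = arsinh (sqrt T)" and s: "s_dist p = arsinh (sqrt C)"
    unfolding C_def T_def c_def using h_dist_eq[OF p] t_dist_eq[OF p] s_dist_eq[OF p] by simp_all
  show "0 \<le> h_dist p" unfolding h using arcosh_nonneg C by simp
  show "0 \<le> s_dist p" unfolding s using arsinh_nonneg C by simp
  show "0 \<le> t_dist p" unfolding t using arsinh_nonneg T by simp
  have "1 < C\<^sup>2" using C by (simp add: one_less_power)
  then show "exp (2 * h_dist p) = C + sqrt (C\<^sup>2 - 1)"
    unfolding h using C by (simp add: arcosh_real_def add_pos_nonneg)
  show "exp (s_dist p) = sqrt C + sqrt (C + 1)"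
    unfolding s using C by (simp add: arsinh_real_def add_pos_pos)
  show "exp (t_dist p) = sqrt T + sqrt (T + 1)"
    unfolding t using T by (simp add: arsinh_real_def add_pos_pos)
  show "(sinh (s_dist p))\<^sup>2 = C" unfolding s using C by (simp add: sinh_arsinh_real)
qed

text \<open>The distances decrease in \<open>cos (2 * pi / p)\<close>, so a lower bound
  \<open>cl\<close> bounds them above. \<open>Ch\<close> and \<open>sh\<close> stand for bounds of
  \<open>cosh (2 * h)\<close> and \<open>sinh (2 * h)\<close>, \<open>a\<close> and \<open>b\<close>
  for bounds of sinh and cosh of \<open>s\<close> or \<open>t\<close>, and \<open>Th\<close> for a
  bound of \<open>(sinh t)\<^sup>2\<close>.\<close>

lemma exp_dist_le:
  fixes p :: real
  assumes p: "6 < p" and c: "cl \<le> cos (2 * pi / p)" "1/2 < cl"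
  shows "1 \<le> Ch * (2 * cl - 1) \<Longrightarrow> Ch\<^sup>2 - 1 \<le> sh\<^sup>2 \<Longrightarrow> 0 \<le> sh \<Longrightarrow> exp (2 * h_dist p) \<le> Ch + sh"
    and "1 \<le> Ch * (2 * cl - 1) \<Longrightarrow> Ch \<le> a\<^sup>2 \<Longrightarrow> Ch + 1 \<le> b\<^sup>2 \<Longrightarrow> 0 \<le> a \<Longrightarrow> 0 \<le> b \<Longrightarrow> exp (s_dist p) \<le> a + b"
    and "1 + cl \<le> Th * (2 * cl - 1) \<Longrightarrow> Th \<le> a\<^sup>2 \<Longrightarrow> Th + 1 \<le> b\<^sup>2 \<Longrightarrow> 0 \<le> a \<Longrightarrow> 0 \<le> b \<Longrightarrow> exp (t_dist p) \<le> a + b"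
proof -
  define co where "co = cos (2 * pi / p)"
  note dp = dist_params[OF p, folded co_def]
  have co: "cl \<le> co" using c by (simp add: co_def)
  have C: "1 / (2 * co - 1) \<le> Ch" if "1 \<le> Ch * (2 * cl - 1)"
  proof -
    have "1 / (2 * co - 1) \<le> 1 / (2 * cl - 1)" using co c by (intro divide_left_mono mult_pos_pos) auto
    also have "\<dots> \<le> Ch" using that c by (simp add: pos_divide_le_eq)
    finally show ?thesis .
  qed
  show "exp (2 * h_dist p) \<le> Ch + sh" if h: "1 \<le> Ch * (2 * cl - 1)" "Ch\<^sup>2 - 1 \<le> sh\<^sup>2" "0 \<le> sh"
  proof -
    have "0 \<le> 1 / (2 * co - 1)" using dp(1) by linarith
    with C[OF h(1)] have "(1 / (2 * co - 1))\<^sup>2 \<le> Ch\<^sup>2" by (rule power_mono)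
    then have "sqrt ((1 / (2 * co - 1))\<^sup>2 - 1) \<le> sh" using h by (intro real_le_lsqrt) auto
    then show ?thesis unfolding dp(6) using C[OF h(1)] by linarith
  qed
  show "exp (s_dist p) \<le> a + b" if h: "1 \<le> Ch * (2 * cl - 1)" "Ch \<le> a\<^sup>2" "Ch + 1 \<le> b\<^sup>2" "0 \<le> a" "0 \<le> b"
    unfolding dp(7) using C[OF h(1)] h by (intro add_mono real_le_lsqrt) auto
  show "exp (t_dist p) \<le> a + b" if h: "1 + cl \<le> Th * (2 * cl - 1)" "Th \<le> a\<^sup>2" "Th + 1 \<le> b\<^sup>2" "0 \<le> a" "0 \<le> b"
  proof -
    have "(1 + co) / (2 * co - 1) \<le> (1 + cl) / (2 * cl - 1)"
      using co c by (simp add: divide_le_eq le_divide_eq mult.commute) (simp add: field_simps)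
    also have "\<dots> \<le> Th" using h(1) c by (simp add: pos_divide_le_eq)
    finally show ?thesis unfolding dp(8) using h by (intro add_mono real_le_lsqrt) auto
  qed
qed

lemma exp_dist_ge:
  fixes p :: real
  assumes p: "6 < p" and c: "cos (2 * pi / p) \<le> ch"
  shows "Cl * (2 * ch - 1) \<le> 1 \<Longrightarrow> 0 \<le> Cl \<Longrightarrow> sl\<^sup>2 \<le> Cl\<^sup>2 - 1 \<Longrightarrow> Cl + sl \<le> exp (2 * h_dist p)"
    and "Cl * (2 * ch - 1) \<le> 1 \<Longrightarrow> 0 \<le> Cl \<Longrightarrow> a\<^sup>2 \<le> Cl \<Longrightarrow> b\<^sup>2 \<le> Cl + 1 \<Longrightarrow> a + b \<le> exp (s_dist p)"
    and "Tl * (2 * ch - 1) \<le> 1 + ch \<Longrightarrow> a\<^sup>2 \<le> Tl \<Longrightarrow> b\<^sup>2 \<le> Tl + 1 \<Longrightarrow> a + b \<le> exp (t_dist p)"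
proof -
  define co where "co = cos (2 * pi / p)"
  note dp = dist_params[OF p, folded co_def]
  have co: "co \<le> ch" "1/2 < co" using c cos_two_pi_div_bounds[OF p] by (simp_all add: co_def)
  have C: "Cl \<le> 1 / (2 * co - 1)" if "Cl * (2 * ch - 1) \<le> 1"
  proof -
    have "Cl \<le> 1 / (2 * ch - 1)" using that co by (simp add: pos_le_divide_eq)
    also have "\<dots> \<le> 1 / (2 * co - 1)" using co by (intro divide_left_mono mult_pos_pos) auto
    finally show ?thesis .
  qed
  show "Cl + sl \<le> exp (2 * h_dist p)" if h: "Cl * (2 * ch - 1) \<le> 1" "0 \<le> Cl" "sl\<^sup>2 \<le> Cl\<^sup>2 - 1"
  proof -
    have "Cl\<^sup>2 \<le> (1 / (2 * co - 1))\<^sup>2" using C[OF h(1)] h by (intro power_mono) auto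
    then have "sl \<le> sqrt ((1 / (2 * co - 1))\<^sup>2 - 1)" using h by (intro real_le_rsqrt) auto
    then show ?thesis unfolding dp(6) using C[OF h(1)] by linarith
  qed
  show "a + b \<le> exp (s_dist p)" if h: "Cl * (2 * ch - 1) \<le> 1" "0 \<le> Cl" "a\<^sup>2 \<le> Cl" "b\<^sup>2 \<le> Cl + 1"
    unfolding dp(7) using C[OF h(1)] h by (intro add_mono real_le_rsqrt) auto
  show "a + b \<le> exp (t_dist p)" if h: "Tl * (2 * ch - 1) \<le> 1 + ch" "a\<^sup>2 \<le> Tl" "b\<^sup>2 \<le> Tl + 1"
  proof -
    have "Tl \<le> (1 + ch) / (2 * ch - 1)" using h(1) co by (simp add: pos_le_divide_eq)
    also have "\<dots> \<le> (1 + co) / (2 * co - 1)"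
      using co by (simp add: divide_le_eq le_divide_eq mult.commute) (simp add: field_simps)
    finally show ?thesis unfolding dp(8) using h by (intro add_mono real_le_rsqrt) auto
  qed
qed

section \<open>Monotonicity and convexity of the hyperball profile\<close>

lemma hyperball_profile_mono: "r \<le> r' \<Longrightarrow> hyperball_profile r \<le> hyperball_profile r'"
  by (simp add: hyperball_profile_def add_mono)

lemma hyperball_profile_nonneg: "0 \<le> r \<Longrightarrow> 0 \<le> hyperball_profile r"
  by (simp add: hyperball_profile_def)

lemma hyperball_profile_pair:
  "hyperball_profile (a + x) + hyperball_profile (a - x) = sinh (2 * a) * cosh (2 * x) / 2 + a"
  by (simp add: hyperball_profile_def sinh_add sinh_diff distrib_left right_diff_distrib field_simps)

text \<open>Only \<open>cosh (2 * x)\<close> varies, so two heights placed symmetrically about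
  \<open>a \<ge> 0\<close> contribute more when spread further, even where \<open>a - x\<close> is
  negative.\<close>

lemma hyperball_profile_pair_mono:
  assumes "0 \<le> a" "0 \<le> x" "x \<le> x'"
  shows "hyperball_profile (a + x) + hyperball_profile (a - x) \<le> hyperball_profile (a + x') + hyperball_profile (a - x')"
  unfolding hyperball_profile_pair using assms
  by (intro add_right_mono divide_right_mono mult_left_mono) (auto simp: cosh_real_nonneg_le_iff)

lemma sinh_conv_exp: "sinh x = (exp x - 1 / exp x) / 2" for x :: real
  by (simp add: sinh_field_def exp_minus inverse_eq_divide)

lemma four_hyperball_profile: "4 * hyperball_profile r = (exp (2 * r) - 1 / exp (2 * r)) / 2 + 2 * r"
  by (simp add: hyperball_profile_def sinh_conv_exp)

lemma hyperball_profile_le: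
  assumes "exp (2 * r) \<le> q" "ln q \<le> l"
  shows "4 * hyperball_profile r \<le> (q - 1 / q) / 2 + l"
proof -
  have q: "0 < q" using less_le_trans[OF exp_gt_zero assms(1)] .
  have "1 / q \<le> 1 / exp (2 * r)" using assms(1) q by (intro divide_left_mono mult_pos_pos) auto
  moreover have "ln (exp (2 * r)) \<le> ln q" using assms(1) q by (intro ln_mono) auto
  ultimately show ?thesis using assms(1,2) unfolding four_hyperball_profile ln_exp
    by (intro add_mono divide_right_mono diff_mono) auto
qed

lemma hyperball_profile_ge:
  assumes "q \<le> exp (2 * r)" "0 < q" "l \<le> ln q"
  shows "(q - 1 / q) / 2 + l \<le> 4 * hyperball_profile r"
proof -
  have "1 / exp (2 * r) \<le> 1 / q" using assms by (intro divide_left_mono mult_pos_pos) auto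
  moreover have "ln q \<le> ln (exp (2 * r))" using assms by (intro ln_mono) auto
  ultimately show ?thesis using assms(1,3) unfolding four_hyperball_profile ln_exp
    by (intro add_mono divide_right_mono diff_mono) auto
qed

lemma V0_ge:
  assumes p: "6 < p" and "y \<le> cube_param p" "d \<le> 1 / cube_param p" and L: "ennreal L \<le> octant_volume y d" "0 \<le> L"
  shows "8 * L \<le> V0 p"
proof -
  note b = cube_param_bounds[OF p]
  have "ennreal L \<le> octant_volume (cube_param p) (1 / cube_param p)"
    using L(1) octant_volume_mono[OF assms(2,3)] by (rule order.trans)
  then have "enn2real (ennreal L) \<le> enn2real (octant_volume (cube_param p) (1 / cube_param p))"
    using octant_volume_finite[OF b(1-3)] by (intro enn2real_mono) auto
  then show ?thesis using L(2) by (simp add: V0_eq_octant_volume[OF p])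
qed

lemma V0_le:
  assumes p: "6 < p" and "cube_param p \<le> y" "1 / cube_param p \<le> d" and L: "octant_volume y d \<le> ennreal L" "0 \<le> L"
  shows "V0 p \<le> 8 * L"
proof -
  have "octant_volume (cube_param p) (1 / cube_param p) \<le> ennreal L"
    using octant_volume_mono[OF assms(2,3)] L(1) by (rule order.trans)
  then have "enn2real (octant_volume (cube_param p) (1 / cube_param p)) \<le> enn2real (ennreal L)"
    by (intro enn2real_mono) auto
  then show ?thesis using L(2) by (simp add: V0_eq_octant_volume[OF p])
qed

section \<open>Rational enclosures of \<open>cube_param p\<close> and of
  \<open>cos (2 * pi / p)\<close>\<close>

lemma cube_param_ge:
  assumes p: "6 < p" and c: "cl \<le> cos (2 * pi / p)" "1/2 < cl" and y: "y\<^sup>2 * (1 + cl) \<le> cl"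
  shows "y \<le> cube_param p"
proof (rule power2_le_imp_le)
  have "y\<^sup>2 \<le> cl / (1 + cl)" using y c by (simp add: pos_le_divide_eq)
  also have "\<dots> \<le> cos (2 * pi / p) / (1 + cos (2 * pi / p))"
    using c by (simp add: divide_le_eq le_divide_eq mult.commute) (simp add: field_simps)
  finally show "y\<^sup>2 \<le> (cube_param p)\<^sup>2" unfolding cube_param_bounds(4)[OF p] .
  show "0 \<le> cube_param p" using cube_param_bounds(1)[OF p] by simp
qed

lemma cube_param_le:
  assumes p: "6 < p" and c: "cos (2 * pi / p) \<le> ch" and y: "ch \<le> y\<^sup>2 * (1 + ch)" "0 \<le> y"
  shows "cube_param p \<le> y"
proof (rule power2_le_imp_le)
  have c0: "1/2 < cos (2 * pi / p)" using cos_two_pi_div_bounds[OF p] by simp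
  have "cos (2 * pi / p) / (1 + cos (2 * pi / p)) \<le> ch / (1 + ch)"
    using c c0 by (simp add: divide_le_eq le_divide_eq mult.commute) (simp add: field_simps)
  also have "\<dots> \<le> y\<^sup>2" using y c c0 by (simp add: pos_divide_le_eq)
  finally show "(cube_param p)\<^sup>2 \<le> y\<^sup>2" unfolding cube_param_bounds(4)[OF p] .
qed (use y in simp)

lemma le_inverse_cube_param:
  assumes p: "6 < p" and "cube_param p \<le> y" "d * y \<le> 1" "0 \<le> d"
  shows "d \<le> 1 / cube_param p"
proof -
  have "d * cube_param p \<le> d * y" using assms by (intro mult_left_mono)
  then show ?thesis using assms cube_param_bounds(1)[OF p] by (simp add: pos_le_divide_eq)
qed

lemma inverse_cube_param_le:
  assumes p: "6 < p" and "y \<le> cube_param p" "1 \<le> d * y" "0 \<le> d"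
  shows "1 / cube_param p \<le> d"
proof -
  have "d * y \<le> d * cube_param p" using assms by (intro mult_left_mono)
  then show ?thesis using assms cube_param_bounds(1)[OF p] by (simp add: pos_divide_le_eq)
qed

text \<open>Taylor expansion with Lagrange remainder of order 8, whose cosine factor lies between
  \<open>-1\<close> and 1.\<close>

lemma cos_poly_bounds:
  fixes x :: real
  shows "1 - x\<^sup>2 / 2 + x ^ 4 / 24 - x ^ 6 / 720 - x ^ 8 / 40320 \<le> cos x"
    and "cos x \<le> 1 - x\<^sup>2 / 2 + x ^ 4 / 24 - x ^ 6 / 720 + x ^ 8 / 40320"
proof -
  obtain t where t: "cos x = (\<Sum>m<8. cos_coeff m * x ^ m) + (cos (t + 1/2 * real 8 * pi) / fact 8) * x ^ 8"
    using Maclaurin_cos_expansion[of x 8] by blast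
  define w where "w = cos (t + 1/2 * real 8 * pi)"
  have w: "-1 \<le> w" "w \<le> 1" by (simp_all add: w_def)
  have x8: "0 \<le> x ^ 8 / 40320" by simp
  have "(\<Sum>m<8. cos_coeff m * x ^ m) = 1 - x\<^sup>2 / 2 + x ^ 4 / 24 - x ^ 6 / 720"
  proof -
    have "{..<8::nat} = {0, 1, 2, 3, 4, 5, 6, 7}" by auto
    then show ?thesis by (simp add: cos_coeff_def fact_numeral)
  qed
  moreover have "(fact 8 :: real) = 40320" by (simp add: fact_numeral)
  ultimately have c: "cos x = 1 - x\<^sup>2 / 2 + x ^ 4 / 24 - x ^ 6 / 720 + w * (x ^ 8 / 40320)"
    unfolding t w_def[symmetric] by simp
  have "w * (x ^ 8 / 40320) \<le> 1 * (x ^ 8 / 40320)" "-1 * (x ^ 8 / 40320) \<le> w * (x ^ 8 / 40320)"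
    using w x8 by (intro mult_right_mono; simp)+
  then show "1 - x\<^sup>2 / 2 + x ^ 4 / 24 - x ^ 6 / 720 - x ^ 8 / 40320 \<le> cos x"
    and "cos x \<le> 1 - x\<^sup>2 / 2 + x ^ 4 / 24 - x ^ 6 / 720 + x ^ 8 / 40320" unfolding c by linarith+
qed

text \<open>\<open>X\<close> is a rational upper bound of \<open>2 * pi / p0\<close>; as
  \<open>X \<le> 3 < pi\<close>, the cosine is decreasing up to it, and one evaluation serves all
  \<open>p \<ge> p0\<close>.\<close>

lemma cos_two_pi_div_ge:
  fixes p X :: real
  assumes p: "0 < p0" "p0 \<le> p" and X: "2 * (31416/10000) \<le> X * p0" "X \<le> 3"
    and cl: "cl \<le> 1 - X\<^sup>2 / 2 + X ^ 4 / 24 - X ^ 6 / 720 - X ^ 8 / 40320"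
  shows "cl \<le> cos (2 * pi / p)"
proof -
  have "0 < X * p0" using X(1) by linarith
  then have X0: "0 \<le> X" using p(1) by (simp add: zero_less_mult_iff)
  have "2 * pi \<le> X * p0" using pi_approx X by simp
  also have "\<dots> \<le> X * p" using p X0 by (intro mult_left_mono) auto
  finally have "2 * pi / p \<le> X" using p by (simp add: pos_divide_le_eq)
  then have "cos X \<le> cos (2 * pi / p)" using p X pi_gt3 by (intro cos_monotone_0_pi_le) auto
  then show ?thesis using cos_poly_bounds(1)[of X] cl by linarith
qed

lemma cos_two_pi_div_le:
  fixes p X :: real
  assumes p: "6 < p" and X: "0 \<le> X" "X * p \<le> 2 * (31415/10000)"
    and ch: "1 - X\<^sup>2 / 2 + X ^ 4 / 24 - X ^ 6 / 720 + X ^ 8 / 40320 \<le> ch"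
  shows "cos (2 * pi / p) \<le> ch"
proof -
  have "X * p \<le> 2 * pi" using pi_approx X by simp
  then have "X \<le> 2 * pi / p" using p by (simp add: pos_le_divide_eq)
  moreover have "2 * pi / p \<le> pi" using p by (simp add: field_simps)
  ultimately have "cos (2 * pi / p) \<le> cos X" using X by (intro cos_monotone_0_pi_le) auto
  then show ?thesis using cos_poly_bounds(2)[of X] ch by linarith
qed

text \<open>The Taylor bounds with four decimals of \<open>pi\<close> are far coarser than the ten
  digits stated here. With \<open>\<theta> = 2 * pi / 7\<close> the relation
  \<open>cos (4 * \<theta>) = cos (3 * \<theta>)\<close>, freed from the root 1, makes the cosine a
  root of a cubic; above 1/2 the cubic changes sign only there, so its sign at a rational number
  decides the comparison.\<close>

lemma cos_two_pi_div_7: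
  "6234898018 / 10000000000 \<le> cos (2 * pi / 7)" "cos (2 * pi / 7) \<le> 6234898019 / 10000000000"
proof -
  define \<theta> where "\<theta> = 2 * pi / 7"
  define c where "c = cos \<theta>"
  have cb: "1/2 < c" "c < 1" using cos_two_pi_div_bounds[of 7] by (simp_all add: c_def \<theta>_def)
  have "cos (4 * \<theta>) = cos (2 * pi - 3 * \<theta>)" by (simp add: \<theta>_def field_simps)
  also have "\<dots> = cos (3 * \<theta>)" by simp
  finally have "cos (2 * (2 * \<theta>)) = cos (3 * \<theta>)" by simp
  then have "2 * (2 * c\<^sup>2 - 1)\<^sup>2 - 1 = 4 * c ^ 3 - 3 * c"
    using cos_treble_cos[of \<theta>] cos_double_cos[of "2 * \<theta>"] cos_double_cos[of \<theta>] by (simp add: c_def)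
  then have "(c - 1) * (8 * c ^ 3 + 4 * c\<^sup>2 - 4 * c - 1) = 0"
    by (simp add: power2_eq_square power3_eq_cube algebra_simps)
  then have root: "8 * c ^ 3 + 4 * c\<^sup>2 - 4 * c - 1 = 0" using cb by simp
  have mono: "a < c \<longleftrightarrow> 8 * a ^ 3 + 4 * a\<^sup>2 - 4 * a - 1 < 0" "c < a \<longleftrightarrow> 0 < 8 * a ^ 3 + 4 * a\<^sup>2 - 4 * a - 1"
    if "1/2 < a" for a :: real
  proof -
    \<comment> \<open>The cubic divided by its root \<open>c\<close>; the cofactor is positive
      because \<open>a\<close> and \<open>c\<close> both exceed 1/2.\<close>
    have e: "8 * a ^ 3 + 4 * a\<^sup>2 - 4 * a - 1 = (a - c) * (8 * (a\<^sup>2 + a * c + c\<^sup>2) + 4 * (a + c) - 4)"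
      using root by (simp add: power2_eq_square power3_eq_cube algebra_simps)
    have "0 < 8 * (a\<^sup>2 + a * c + c\<^sup>2) + 4 * (a + c) - 4"
    proof -
      have "0 < a * c" using that cb by simp
      then have "0 < a\<^sup>2 + a * c + c\<^sup>2" using zero_le_power2[of a] zero_le_power2[of c] by linarith
      moreover have "0 < 4 * (a + c) - 4" using that cb by simp
      ultimately have "0 < 8 * (a\<^sup>2 + a * c + c\<^sup>2) + (4 * (a + c) - 4)" by (intro add_pos_pos) simp_all
      then show ?thesis by (simp add: add_diff_eq)
    qed
    then show "a < c \<longleftrightarrow> 8 * a ^ 3 + 4 * a\<^sup>2 - 4 * a - 1 < 0" "c < a \<longleftrightarrow> 0 < 8 * a ^ 3 + 4 * a\<^sup>2 - 4 * a - 1"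
      unfolding e by (auto simp: mult_less_0_iff zero_less_mult_iff)
  qed
  have "6234898018 / 10000000000 < c" "c < 6234898019 / 10000000000"
    by (subst mono; simp add: power2_eq_square power3_eq_cube)+
  then show "6234898018 / 10000000000 \<le> cos (2 * pi / 7)" "cos (2 * pi / 7) \<le> 6234898019 / 10000000000"
    by (simp_all add: c_def \<theta>_def)
qed

text \<open>Makes the admissible interval of the second family empty for \<open>p \<ge> 9\<close>.
  It reduces to \<open>C\<^sup>2 < T + 1\<close>, that is to \<open>1 < 3 * c * (2 * c - 1)\<close>,
  which holds from \<open>c = 3/4\<close> on.\<close>

lemma two_h_dist_less_t_dist:
  fixes p :: real
  assumes p: "9 \<le> p"
  shows "2 * h_dist p < t_dist p"
proof -
  have p6: "6 < p" using p by simp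
  define c where "c = cos (2 * pi / p)"
  have c: "3/4 \<le> c" unfolding c_def
    by (rule cos_two_pi_div_ge[of 9 _ "7/10"]) (use p in \<open>simp_all add: power2_eq_square eval_nat_numeral\<close>)
  have c1: "c < 1" using cos_two_pi_div_bounds[OF p6] by (simp add: c_def)
  define C where "C = 1 / (2 * c - 1)"
  define T where "T = (1 + c) / (2 * c - 1)"
  note dp = dist_params[OF p6, folded c_def, folded C_def T_def]
  have "C\<^sup>2 < T + 1"
  proof -
    \<comment> \<open>This is \<open>3 * c * (2 * c - 1) - 1\<close>, expanded around
      \<open>c = 3/4\<close>.\<close>
    have "0 < (c - 3/4) * (6 * c + 3/2) + 1/8" using c by (intro add_nonneg_pos mult_nonneg_nonneg) auto
    then have q: "1 < 3 * c * (2 * c - 1)" by (simp add: power2_eq_square algebra_simps)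
    have "T + 1 = 3 * c / (2 * c - 1)" using c by (simp add: T_def field_simps)
    then have "T + 1 = 3 * c * (2 * c - 1) / (2 * c - 1)\<^sup>2" using c by (simp add: power2_eq_square)
    moreover have "C\<^sup>2 = 1 / (2 * c - 1)\<^sup>2" by (simp add: C_def power_divide)
    ultimately show ?thesis using q c by (simp add: divide_strict_right_mono)
  qed
  then have "sqrt (C\<^sup>2) < sqrt (T + 1)" "sqrt (C\<^sup>2 - 1) < sqrt T"
    by (intro real_sqrt_less_mono; simp)+
  moreover have "sqrt (C\<^sup>2) = C" using dp(1) by simp
  ultimately have "exp (2 * h_dist p) < exp (t_dist p)" unfolding dp(6,8) by linarith
  then show ?thesis by simp
qed

section \<open>Densities bounded by sums of profiles\<close>

definition height_sum1 :: "real \<Rightarrow> real \<Rightarrow> real" where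
  "height_sum1 p x = 2 * hyperball_profile (h_dist p + x) + 6 * hyperball_profile (h_dist p - x)"

definition height_sum2 :: "real \<Rightarrow> real \<Rightarrow> real" where
  "height_sum2 p x = hyperball_profile (t_dist p + x) + hyperball_profile (t_dist p - x) +
     3 * hyperball_profile (2 * h_dist p - t_dist p - x) + 3 * hyperball_profile (2 * h_dist p - t_dist p + x)"

definition height_sum3 :: "real \<Rightarrow> real \<Rightarrow> real" where
  "height_sum3 p x = 4 * hyperball_profile (h_dist p + x) + 4 * hyperball_profile (h_dist p - x)"

text \<open>\<open>L\<close> and \<open>M\<close> stand in for the volume and the height sum. The
  conditions on \<open>x\<close> keep all heights nonnegative, as \<open>Vh_le\<close>
  requires.\<close>

lemma delta_le:
  assumes p: "6 < p" and x: "0 \<le> x" and L: "0 < L" "L \<le> V0 p" and bound: "(pi - 6 * pi / p) * M \<le> D * L"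
    and D: "0 \<le> D"
  shows "x \<le> h_dist p \<Longrightarrow> height_sum1 p x \<le> M \<Longrightarrow> delta1 p x \<le> D"
    and "x \<le> t_dist p \<Longrightarrow> x \<le> 2 * h_dist p - t_dist p \<Longrightarrow> height_sum2 p x \<le> M \<Longrightarrow> delta2 p x \<le> D"
    and "x \<le> h_dist p \<Longrightarrow> height_sum3 p x \<le> M \<Longrightarrow> delta3 p x \<le> D"
proof -
  define A where "A = pi - 6 * pi / p"
  have A: "0 \<le> A" using p by (simp add: A_def field_simps)
  note V = Vh_le[OF p, folded A_def]
  have main: "X / V0 p \<le> D" if "X \<le> A * N" "N \<le> M" for X N
  proof -
    have "X \<le> A * M" using that A by (meson mult_left_mono order.trans)
    also have "\<dots> \<le> D * L" using bound by (simp add: A_def)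
    also have "\<dots> \<le> D * V0 p" using L D by (intro mult_left_mono)
    finally show ?thesis using L by (simp add: pos_divide_le_eq)
  qed
  show "delta1 p x \<le> D" if "x \<le> h_dist p" "height_sum1 p x \<le> M"
    unfolding delta1_def
    by (rule main[OF _ that(2)])
      (use V[of "h_dist p + x"] V[of "h_dist p - x"] that x dist_params(3)[OF p] in \<open>simp add: height_sum1_def algebra_simps\<close>)
  show "delta2 p x \<le> D" if "x \<le> t_dist p" "x \<le> 2 * h_dist p - t_dist p" "height_sum2 p x \<le> M"
    unfolding delta2_def
    by (rule main[OF _ that(3)])
      (use V[of "t_dist p + x"] V[of "t_dist p - x"] V[of "2 * h_dist p - t_dist p - x"] V[of "2 * h_dist p - t_dist p + x"]
        that x dist_params(5)[OF p] in \<open>simp add: height_sum2_def algebra_simps\<close>)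
  show "delta3 p x \<le> D" if "x \<le> h_dist p" "height_sum3 p x \<le> M"
    unfolding delta3_def
    by (rule main[OF _ that(2)])
      (use V[of "h_dist p + x"] V[of "h_dist p - x"] that x dist_params(3)[OF p] in \<open>simp add: height_sum3_def algebra_simps\<close>)
qed

text \<open>Two of the six heights \<open>h - x\<close> are raised to \<open>h + x\<close>.\<close>

lemma height_sum1_le_height_sum3: "0 \<le> x \<Longrightarrow> height_sum1 p x \<le> height_sum3 p x"
  using hyperball_profile_mono[of "h_dist p - x" "h_dist p + x"] by (simp add: height_sum1_def height_sum3_def)

lemma height_sum3_mono: "6 < p \<Longrightarrow> 0 \<le> x \<Longrightarrow> x \<le> x' \<Longrightarrow> height_sum3 p x \<le> height_sum3 p x'"
  using hyperball_profile_pair_mono[OF dist_params(3), of p x x'] by (simp add: height_sum3_def)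

text \<open>The two terms of the first family move in opposite directions; on an interval each is
  bounded at its own worst end.\<close>

lemma height_sum1_le:
  assumes "x0 \<le> x" "x \<le> x1"
  shows "height_sum1 p x \<le> 2 * hyperball_profile (h_dist p + x1) + 6 * hyperball_profile (h_dist p - x0)"
  unfolding height_sum1_def using assms by (intro add_mono mult_left_mono hyperball_profile_mono) auto

text \<open>The heights form symmetric pairs about \<open>t\<close> and about
  \<open>z = 2 * h - t\<close>, so \<open>x = z\<close> is the worst case, in which one height
  vanishes.\<close>

lemma height_sum2_le:
  assumes p: "6 < p" and x: "0 \<le> x" "x \<le> 2 * h_dist p - t_dist p"
  shows "height_sum2 p x \<le> hyperball_profile (2 * h_dist p) + hyperball_profile (2 * t_dist p - 2 * h_dist p)
     + 3 * hyperball_profile (4 * h_dist p - 2 * t_dist p)"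
proof -
  define z where "z = 2 * h_dist p - t_dist p"
  have "hyperball_profile (t_dist p + x) + hyperball_profile (t_dist p - x) \<le> hyperball_profile (t_dist p + z) + hyperball_profile (t_dist p - z)"
    by (rule hyperball_profile_pair_mono) (use x dist_params(5)[OF p] in \<open>auto simp: z_def\<close>)
  moreover have "hyperball_profile (z + x) + hyperball_profile (z - x) \<le> hyperball_profile (z + z) + hyperball_profile (z - z)"
    by (rule hyperball_profile_pair_mono) (use x in \<open>auto simp: z_def\<close>)
  moreover have "hyperball_profile (z - z) = 0" by (simp add: hyperball_profile_def)
  moreover have "t_dist p + z = 2 * h_dist p" "t_dist p - z = 2 * t_dist p - 2 * h_dist p" "z + z = 4 * h_dist p - 2 * t_dist p"
    by (simp_all add: z_def)
  ultimately show ?thesis unfolding height_sum2_def z_def[symmetric] by simp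
qed

definition density_bound :: "real \<Rightarrow> real \<Rightarrow> bool" where
  "density_bound p D \<longleftrightarrow> (\<forall>x. (adm1 p x \<longrightarrow> delta1 p x \<le> D) \<and> (adm2 p x \<longrightarrow> delta2 p x \<le> D) \<and>
     (adm3 p x \<longrightarrow> delta3 p x \<le> D))"

text \<open>A crude estimate: from \<open>x \<le> h\<close> the worst heights are
  \<open>2 * h\<close> and 0, and the second family is void. \<open>q\<close> bounds
  \<open>exp (4 * h)\<close>.\<close>

lemma deltas_le_large:
  assumes p: "9 \<le> p" and L: "0 < L" "L \<le> V0 p" and u: "exp (2 * h_dist p) \<le> u" "u\<^sup>2 \<le> q" and l: "ln q \<le> l"
    and A: "pi - 6 * pi / p \<le> A" "A * ((q - 1 / q) / 2 + l) \<le> D * L" and D: "0 \<le> D"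
  shows "density_bound p D"
proof -
  have p6: "6 < p" using p by simp
  note h0 = dist_params(3)[OF p6]
  define M where "M = height_sum3 p (h_dist p)"
  have "exp (2 * (2 * h_dist p)) = (exp (2 * h_dist p))\<^sup>2" by (simp add: exp_double[symmetric])
  also have "\<dots> \<le> u\<^sup>2" using u by (intro power_mono) auto
  also note u(2)
  finally have "4 * hyperball_profile (2 * h_dist p) \<le> (q - 1 / q) / 2 + l"
    by (rule hyperball_profile_le) (rule l)
  moreover have "M = 4 * hyperball_profile (2 * h_dist p)"
    by (simp add: M_def height_sum3_def hyperball_profile_def)
  ultimately have M: "M \<le> (q - 1 / q) / 2 + l" by simp
  have M0: "0 \<le> M" using h0 by (simp add: M_def height_sum3_def hyperball_profile_nonneg)
  have "0 \<le> pi - 6 * pi / p" using p by (simp add: field_simps)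
  then have bound: "(pi - 6 * pi / p) * M \<le> D * L"
    using mult_mono[OF A(1) M] A M0 by (meson order.trans)
  have sum3: "height_sum3 p x \<le> M" if "0 \<le> x" "x \<le> h_dist p" for x
    unfolding M_def using p6 that by (rule height_sum3_mono)
  have "delta1 p x \<le> D" if a: "adm1 p x" for x
  proof -
    have x: "0 \<le> x" "x \<le> h_dist p" using a by (auto simp: adm1_def)
    show ?thesis
      by (rule delta_le(1)[OF p6 x(1) L bound D x(2)]) (use height_sum1_le_height_sum3[OF x(1)] sum3[OF x] in \<open>rule order.trans\<close>)
  qed
  moreover have "delta2 p x \<le> D" if a: "adm2 p x" for x
    using two_h_dist_less_t_dist[OF p] a by (auto simp: adm2_def)
  moreover have "delta3 p x \<le> D" if a: "adm3 p x" for x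
  proof -
    have x: "0 \<le> x" "x \<le> h_dist p" using a by (auto simp: adm3_def)
    show ?thesis by (rule delta_le(3)[OF p6 x(1) L bound D x(2) sum3[OF x]])
  qed
  ultimately show ?thesis unfolding density_bound_def by blast
qed

lemma area_le:
  assumes "0 < p" "p \<le> P"
  shows "pi - 6 * pi / p \<le> pi * (1 - 6 / P)"
proof -
  have "6 / P \<le> 6 / p" using assms by (intro divide_left_mono mult_pos_pos) auto
  then have "pi * (1 - 6 / p) \<le> pi * (1 - 6 / P)" by (intro mult_left_mono) auto
  then show ?thesis by (simp add: right_diff_distrib mult.commute)
qed

lemma area_le_pi: "0 < p \<Longrightarrow> pi - 6 * pi / p \<le> pi * 1"
  by simp

lemma pi_less: "pi < 31416/10000"
  using pi_approx by simp

text \<open>On a block of values of \<open>p\<close> the distance \<open>h\<close> is largest at the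
  left end \<open>P\<close>, while the area of the prism grows with \<open>p\<close>;
  \<open>a\<close> carries its value at the right end, or is 1 if there is no right end.\<close>

lemma deltas_le_block:
  assumes p: "9 \<le> P" "P \<le> p" and X: "2 * (31416/10000) \<le> X * P" "X \<le> 3"
    and cl: "cl \<le> 1 - X\<^sup>2 / 2 + X ^ 4 / 24 - X ^ 6 / 720 - X ^ 8 / 40320" "1/2 < cl"
    and u: "1 \<le> Ch * (2 * cl - 1)" "Ch\<^sup>2 - 1 \<le> sh\<^sup>2" "0 \<le> sh" "(Ch + sh)\<^sup>2 \<le> q" and l: "ln q \<le> l"
    and A: "pi - 6 * pi / p \<le> pi * a" "0 \<le> a" "0 \<le> (q - 1 / q) / 2 + l" "31416/10000 * a * ((q - 1 / q) / 2 + l) \<le> D * L"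
    and L: "0 < L" "L \<le> V0 p" and D: "0 \<le> D"
  shows "density_bound p D"
proof -
  have p9: "9 \<le> p" and p6: "6 < p" and P0: "0 < P" using p by simp_all
  have c: "cl \<le> cos (2 * pi / p)" by (rule cos_two_pi_div_ge[OF P0 p(2) X cl(1)])
  have h: "exp (2 * h_dist p) \<le> Ch + sh" by (rule exp_dist_le(1)[OF p6 c cl(2) u(1-3)])
  have "pi * a \<le> 31416/10000 * a" using pi_less A(2) by (intro mult_right_mono) auto
  then have "pi - 6 * pi / p \<le> 31416/10000 * a" using A(1) by linarith
  from deltas_le_large[OF p9 L h u(4) l this A(4) D] show ?thesis .
qed

section \<open>Volume bounds for \<open>p \<ge> 8\<close>\<close>

lemma cos_two_pi_div_8: "7070983/10000000 \<le> cos (2 * pi / 8)" "cos (2 * pi / 8) \<le> 55244/78125"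
  by (rule cos_two_pi_div_ge[of 8 _ "3927/5000"] cos_two_pi_div_le[of _ "6283/8000"]; simp add: power_divide)+

lemma V0_8_ge: "11241/1250 \<le> V0 8"
proof -
  have "1287/2000 \<le> cube_param 8" by (rule cube_param_ge[OF _ cos_two_pi_div_8(1)]) (simp_all add: power_divide)
  moreover have "cube_param 8 \<le> 32181/50000" by (rule cube_param_le[OF _ cos_two_pi_div_8(2)]) (simp_all add: power_divide)
  then have "15537/10000 \<le> 1 / cube_param 8" by (rule le_inverse_cube_param[rotated]) simp_all
  ultimately show ?thesis using V0_ge[OF _ _ _ octant8_lower, of 8] by simp
qed

lemma cos_two_pi_div_9: "1532081/2000000 \<le> cos (2 * pi / 9)" "cos (2 * pi / 9) \<le> 7660577/10000000"
  by (rule cos_two_pi_div_ge[of 9 _ "3490667/5000000"] cos_two_pi_div_le[of _ "6981111/10000000"]; simp add: power_divide)+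

lemma V0_9_ge: "2421/250 \<le> V0 9"
proof -
  have "1317/2000 \<le> cube_param 9" by (rule cube_param_ge[OF _ cos_two_pi_div_9(1)]) (simp_all add: power_divide)
  moreover have "cube_param 9 \<le> 6587/10000" by (rule cube_param_le[OF _ cos_two_pi_div_9(2)]) (simp_all add: power_divide)
  then have "759/500 \<le> 1 / cube_param 9" by (rule le_inverse_cube_param[rotated]) simp_all
  ultimately show ?thesis using V0_ge[OF _ _ _ octant9_lower, of 9] by simp
qed

lemma cos_two_pi_div_10: "8090149/10000000 \<le> cos (2 * pi / 10)" "cos (2 * pi / 10) \<le> 8090279/10000000"
  by (rule cos_two_pi_div_ge[of 10 _ "3927/6250"] cos_two_pi_div_le[of _ "6283/10000"]; simp add: power_divide)+

lemma V0_10_ge: "6338/625 \<le> V0 10"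
proof -
  have "6687/10000 \<le> cube_param 10" by (rule cube_param_ge[OF _ cos_two_pi_div_10(1)]) (simp_all add: power_divide)
  moreover have "cube_param 10 \<le> 8361/12500" by (rule cube_param_le[OF _ cos_two_pi_div_10(2)]) (simp_all add: power_divide)
  then have "299/200 \<le> 1 / cube_param 10" by (rule le_inverse_cube_param[rotated]) simp_all
  ultimately show ?thesis using V0_ge[OF _ _ _ octant10_lower, of 10] by simp
qed

lemma V0_ge_11:
  assumes p: "11 \<le> p"
  shows "10927/1250 \<le> V0 p"
proof -
  have p6: "6 < p" using p by simp
  have "4206261/5000000 \<le> cos (2 * pi / p)"
    by (rule cos_two_pi_div_ge[of 11 _ "357/625"]) (use p in \<open>simp_all add: power_divide\<close>)
  then have y: "6759/10000 \<le> cube_param p" by (rule cube_param_ge[OF p6]) (simp_all add: power_divide)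
  \<comment> \<open>The bound \<open>1 / sqrt 2\<close>, valid for every \<open>p\<close>, rounded
    up; its inverse yields the second argument of \<open>octant11_lower\<close>.\<close>
  have "(cube_param p)\<^sup>2 \<le> (70711/100000)\<^sup>2" using cube_param_bounds(3)[OF p6] by (simp add: power_divide)
  then have "cube_param p \<le> 70711/100000" by (rule power2_le_imp_le) simp
  then have "7071/5000 \<le> 1 / cube_param p" by (rule le_inverse_cube_param[OF p6]) simp_all
  from V0_ge[OF p6 y this octant11_lower] show ?thesis by simp
qed

section \<open>The density for \<open>p \<ge> 10\<close>, in blocks\<close>

lemma ln_block_10: "ln (837/100 :: real) \<le> 17/8"
  by (rule order.trans[OF ln_le_reduced[where v="227/10000" and n=3 and S="1000000" and V="516" and h="1000173" and
      hs="[333437, 200104]"]]) (simp_all add: power2_eq_square)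

text \<open>\<open>X\<close> is \<open>2 * pi / 10\<close> rounded up, \<open>cl\<close> the cosine
  of \<open>X\<close> rounded down, \<open>Ch\<close> and \<open>sh\<close> are
  \<open>cosh (2 * h)\<close> and \<open>sinh (2 * h)\<close> rounded up. The later blocks follow
  the same scheme at their left ends.\<close>

lemma deltas_le_block_10:
  fixes p :: real
  assumes "p = 10"
  shows "density_bound p (8493/10000)"
  by (rule deltas_le_block[where P=10 and X="1571/2500" and cl="8089/10000" and Ch="1619/1000" and sh="637/500" and L="6338/625", OF _ _ _ _ _ _ _ _ _ _ ln_block_10 area_le[of p 10]];
      use assms V0_10_ge in \<open>simp add: power_divide\<close>)

lemma ln_block_11: "ln (129/20 :: real) \<le> 373/200"
  by (rule order.trans[OF ln_le_reduced[where v="469/2000" and n=2 and S="1000000" and V="54991" and h="1018961" and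
      hs="[344784, 208212, 149323, 117577]"]]) (simp_all add: power2_eq_square)

lemma deltas_le_block_11:
  fixes p :: real
  assumes "p = 11"
  shows "density_bound p (8493/10000)"
  by (rule deltas_le_block[where P=11 and X="357/625" and cl="2103/2500" and Ch="733/500" and sh="134/125" and L="10927/1250", OF _ _ _ _ _ _ _ _ _ _ ln_block_11 area_le[of p 11]];
      use assms V0_ge_11 in \<open>simp add: power_divide\<close>)

lemma ln_block_12: "ln (529/100 :: real) \<le> 833/500"
  by (rule order.trans[OF ln_le_reduced[where v="1389/10000" and n=2 and S="1000000" and V="19294" and h="1006507" and
      hs="[337247, 202811, 145668]"]]) (simp_all add: power2_eq_square)

lemma deltas_le_block_12:
  fixes p :: real
  assumes "12 \<le> p" "p \<le> 13"
  shows "density_bound p (8493/10000)"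
  by (rule deltas_le_block[where P=12 and X="1309/2500" and cl="433/500" and Ch="1367/1000" and sh="933/1000" and L="10927/1250", OF _ _ _ _ _ _ _ _ _ _ ln_block_12 area_le[of p 13]];
      use assms V0_ge_11 in \<open>simp add: power_divide\<close>)

lemma ln_block_14: "ln (399/100 :: real) \<le> 173/125"
  by (rule order.trans[OF ln_le_reduced[where v="3323/10000" and n=1 and S="1000000" and V="110424" and h="1039458" and
      hs="[357325, 217266, 156352, 122205, 100458, 86472]"]]) (simp_all add: power2_eq_square)

lemma deltas_le_block_14:
  fixes p :: real
  assumes "14 \<le> p" "p \<le> 19"
  shows "density_bound p (8493/10000)"
  by (rule deltas_le_block[where P=14 and X="561/1250" and cl="9009/10000" and Ch="156/125" and sh="747/1000" and L="10927/1250", OF _ _ _ _ _ _ _ _ _ _ ln_block_14 area_le[of p 19]];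
      use assms V0_ge_11 in \<open>simp add: power_divide\<close>)

lemma ln_block_20: "ln (253/100 :: real) \<le> 929/1000"
  by (rule order.trans[OF ln_le_reduced[where v="117/1000" and n=1 and S="1000000" and V="13689" and h="1004601" and
      hs="[336099, 201983, 144840]"]]) (simp_all add: power2_eq_square)

text \<open>The area is bounded by \<open>pi\<close>, so this block extends to infinity.\<close>

lemma deltas_le_block_20:
  fixes p :: real
  assumes "20 \<le> p"
  shows "density_bound p (8493/10000)"
  by (rule deltas_le_block[where P=20 and X="1571/5000" and cl="951/1000" and Ch="1109/1000" and sh="12/25" and L="10927/1250", OF _ _ _ _ _ _ _ _ _ _ ln_block_20 area_le_pi];
      use assms V0_ge_11 in \<open>simp add: power_divide\<close>)

section \<open>Height sums for \<open>p = 7\<close>, \<open>p = 8\<close> and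
  \<open>p = 9\<close>\<close>

lemma exp_double_diff: "exp (2 * (a - b)) = (exp a / exp b)\<^sup>2" for a b :: real
  by (metis exp_diff exp_double)

lemma hyperball_profile_diff_le:
  assumes "exp a \<le> \<alpha>" "\<beta> \<le> exp b" "0 < \<beta>" "(\<alpha> / \<beta>)\<^sup>2 \<le> q" "ln q \<le> l"
  shows "4 * hyperball_profile (a - b) \<le> (q - 1 / q) / 2 + l"
proof (rule hyperball_profile_le)
  have "exp a / exp b \<le> \<alpha> / \<beta>" using assms(1-3) less_le_trans[OF exp_gt_zero assms(1)] by (intro frac_le) auto
  then have "(exp a / exp b)\<^sup>2 \<le> (\<alpha> / \<beta>)\<^sup>2" by (intro power_mono) auto
  then show "exp (2 * (a - b)) \<le> q" using assms(4) unfolding exp_double_diff by linarith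
qed (rule assms)

lemma hyperball_profile_diff_ge:
  assumes "\<alpha> \<le> exp a" "exp b \<le> \<beta>" "0 < \<alpha>" "q \<le> (\<alpha> / \<beta>)\<^sup>2" "0 < q" "l \<le> ln q"
  shows "(q - 1 / q) / 2 + l \<le> 4 * hyperball_profile (a - b)"
proof (rule hyperball_profile_ge)
  have "\<alpha> / \<beta> \<le> exp a / exp b" using assms(1-3) by (intro frac_le) auto
  moreover have "0 < \<beta>" using less_le_trans[OF exp_gt_zero assms(2)] .
  ultimately have "(\<alpha> / \<beta>)\<^sup>2 \<le> (exp a / exp b)\<^sup>2" using assms(3) by (intro power_mono) auto
  then show "q \<le> exp (2 * (a - b))" using assms(4) unfolding exp_double_diff by linarith
qed (use assms in auto)

text \<open>\<open>x = s - h\<close> separates two regimes of the first family. Up to it the third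
  family dominates; beyond it the terms are bounded at the ends \<open>m - h\<close> and
  \<open>s - h\<close> of the remaining range, which produces the heights \<open>m\<close> and
  \<open>2 * h - s\<close>. For \<open>m\<close> either of the limits \<open>2 * h\<close> and
  \<open>t\<close> in \<open>adm1\<close> can be taken.\<close>

lemma density_boundI:
  assumes p: "6 < p" and L: "0 < L" "L \<le> V0 p" and bound: "(pi - 6 * pi / p) * M \<le> D * L" and D: "0 \<le> D"
    and sum3: "height_sum3 p (s_dist p - h_dist p) \<le> M"
    and m: "2 * h_dist p \<le> m \<or> t_dist p \<le> m"
    and sum1: "2 * hyperball_profile m + 6 * hyperball_profile (2 * h_dist p - s_dist p) \<le> M"
    and sum2: "t_dist p \<le> 2 * h_dist p \<Longrightarrow> hyperball_profile (2 * h_dist p) + hyperball_profile (2 * t_dist p - 2 * h_dist p)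
     + 3 * hyperball_profile (4 * h_dist p - 2 * t_dist p) \<le> M"
  shows "density_bound p D"
proof -
  have s3: "height_sum3 p x \<le> M" if "0 \<le> x" "x \<le> s_dist p - h_dist p" for x
    using height_sum3_mono[OF p that] sum3 by linarith
  have "delta1 p x \<le> D" if a: "adm1 p x" for x
  proof -
    have x: "0 \<le> x" "x \<le> h_dist p" "x \<le> m - h_dist p" using a m by (auto simp: adm1_def)
    have "height_sum1 p x \<le> M"
    proof (cases "x \<le> s_dist p - h_dist p")
      case True
      then show ?thesis using height_sum1_le_height_sum3[OF x(1), of p] s3[OF x(1)] by linarith
    next
      case False
      then have "s_dist p - h_dist p \<le> x" by simp
      moreover have "h_dist p - (s_dist p - h_dist p) = 2 * h_dist p - s_dist p" "h_dist p + (m - h_dist p) = m" by simp_all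
      ultimately show ?thesis using height_sum1_le[OF _ x(3), of "s_dist p - h_dist p" p] sum1 by simp
    qed
    then show ?thesis by (rule delta_le(1)[OF p x(1) L bound D x(2)])
  qed
  moreover have "delta2 p x \<le> D" if a: "adm2 p x" for x
  proof -
    have x: "0 \<le> x" "x \<le> t_dist p" "x \<le> 2 * h_dist p - t_dist p" using a by (auto simp: adm2_def)
    have "height_sum2 p x \<le> M" using height_sum2_le[OF p x(1,3)] sum2 x by linarith
    then show ?thesis by (rule delta_le(2)[OF p x(1) L bound D x(2,3)])
  qed
  moreover have "delta3 p x \<le> D" if a: "adm3 p x" for x
  proof -
    have x: "0 \<le> x" "x \<le> h_dist p" "x \<le> s_dist p - h_dist p" using a by (auto simp: adm3_def)
    show ?thesis by (rule delta_le(3)[OF p x(1) L bound D x(2) s3[OF x(1,3)]])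
  qed
  ultimately show ?thesis unfolding density_bound_def by blast
qed

text \<open>\<open>s_dist p - 0\<close> is a difference on purpose: with \<open>exp 0 = 1\<close>
  the estimates for differences of distances apply to it.\<close>

lemma height_sum3_s_dist:
  "height_sum3 p (s_dist p - h_dist p) = 4 * hyperball_profile (s_dist p - 0) + 4 * hyperball_profile (2 * h_dist p - s_dist p)"
  by (simp add: height_sum3_def algebra_simps)

lemma one_le_exp_0: "1 \<le> exp (0 :: real)" and exp_0_le_one: "exp (0 :: real) \<le> 1"
  by simp_all

text \<open>\<open>s\<close> and \<open>h\<close> enter the extremal density and are needed with
  high accuracy; \<open>t\<close> occurs only in the families that stay clearly below, where three
  digits do.\<close>

lemma dist_bounds_7:
  shows "exp (2 * h_dist 7) \<le> 7972401973/1000000000" "7972401963/1000000000 \<le> exp (2 * h_dist 7)"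
    and "exp (s_dist 7) \<le> 4259171779/1000000000" "170366871/40000000 \<le> exp (s_dist 7)"
    and "exp (t_dist 7) \<le> 5317/1000" "2657/500 \<le> exp (t_dist 7)"
  using exp_dist_le(1)[OF _ cos_two_pi_div_7(1), of "2024458671/500000000" "3923484631/1000000000"] exp_dist_ge(1)[OF _ cos_two_pi_div_7(2), of "2024458669/500000000" "31387877/8000000"]
    exp_dist_le(2)[OF _ cos_two_pi_div_7(1), of "2024458671/500000000" "1006096087/500000000" "449395921/200000000"] exp_dist_ge(2)[OF _ cos_two_pi_div_7(2), of "2024458669/500000000" "503048043/250000000" "2246979603/1000000000"]
    exp_dist_le(3)[OF _ cos_two_pi_div_7(1), of "3287/500" "641/250" "2753/1000"] exp_dist_ge(3)[OF _ cos_two_pi_div_7(2), of "6573/1000" "2563/1000" "2751/1000"]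
  by (simp_all add: power_divide)

lemma exp_two_t_dist_7:
  "exp (2 * t_dist 7) \<le> 28270489/1000000" "exp (4 * h_dist 7) \<le> 63559193219094292729/1000000000000000000" "7059649/250000 \<le> exp (2 * t_dist 7)"
  using power_mono[OF dist_bounds_7(5), of 2] power_mono[OF dist_bounds_7(1), of 2] power_mono[OF dist_bounds_7(6), of 2]
  by (simp_all add: exp_double[symmetric] power_divide)

text \<open>The argument is \<open>exp (2 * r)\<close> for the height \<open>r = s\<close>, rounded
  up. The following logarithms treat the other heights likewise, those with the suffix
  \<open>_ge\<close> with rounding down.\<close>

lemma ln_7_s_le: "ln (72562177/4000000 :: real) \<le> 5796299/2000000"
  by (rule order.trans[OF ln_le_reduced[where v="3134901/50000000" and n=4 and S="10000000000" and V="39310418" and h="10013134466" and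
      hs="[3341217561, 2005633012, 1432956491, 1115496174]"]]) (simp_all add: power2_eq_square)

lemma profile_7_s_le: "4 * hyperball_profile (s_dist 7 - 0) \<le> 119408591/10000000"
  using hyperball_profile_diff_le[where a="s_dist 7" and b="0", OF dist_bounds_7(3) one_le_exp_0 _ _ ln_7_s_le] by (simp add: power_divide)

lemma ln_7_hs_le: "ln (350370929/100000000 :: real) \<le> 12538223/10000000"
  by (rule order.trans[OF ln_le_reduced[where v="27321743/100000000" and n=1 and S="10000000000" and V="746477641" and h="10260601435" and
      hs="[3491081585, 2113234780, 1516921248, 1183556136, 970491546, 822538183, 714119354, 635687981]"]]) (simp_all add: power2_eq_square)

lemma profile_7_hs_le: "4 * hyperball_profile (2 * h_dist 7 - s_dist 7) \<le> 28629711/10000000"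
  using hyperball_profile_diff_le[where a="2 * h_dist 7" and b="s_dist 7", OF dist_bounds_7(1) dist_bounds_7(4) _ _ ln_7_hs_le] by (simp add: power_divide)

lemma ln_7_h_le: "ln (1589/25 :: real) \<le> 4153/1000"
  by (rule order.trans[OF ln_le_reduced[where v="3303/10000" and n=5 and S="1000000" and V="109099" and h="1038950" and
      hs="[357013, 217039, 156174, 122058, 100330, 86344]"]]) (simp_all add: power2_eq_square)

lemma profile_7_h_le: "4 * hyperball_profile (2 * h_dist 7 - 0) \<le> 17963/500"
  using hyperball_profile_diff_le[where a="2 * h_dist 7" and b="0", OF dist_bounds_7(1) one_le_exp_0 _ _ ln_7_h_le] by (simp add: power_divide)

lemma ln_7_t_le: "ln (28271/1000 :: real) \<le> 1671/500"
  by (rule order.trans[OF ln_le_reduced[where v="693/2500" and n=4 and S="1000000" and V="76840" and h="1026864" and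
      hs="[349599, 211678, 151977, 118679, 98476]"]]) (simp_all add: power2_eq_square)

lemma profile_7_t_le: "4 * hyperball_profile (t_dist 7 - 0) \<le> 873/50"
  using hyperball_profile_diff_le[where a="t_dist 7" and b="0", OF dist_bounds_7(5) one_le_exp_0 _ _ ln_7_t_le] by (simp add: power_divide)

lemma ln_7_th_le: "ln (503/40 :: real) \<le> 633/250"
  by (rule order.trans[OF ln_le_reduced[where v="139/625" and n=3 and S="1000000" and V="49462" and h="1016995" and
      hs="[343590, 207352, 148639, 116893]"]]) (simp_all add: power2_eq_square)

lemma profile_7_th_le: "4 * hyperball_profile (2 * t_dist 7 - 2 * h_dist 7) \<le> 439/50"
  using hyperball_profile_diff_le[where a="2 * t_dist 7" and b="2 * h_dist 7", OF exp_two_t_dist_7(1) dist_bounds_7(2) _ _ ln_7_th_le] by (simp add: power_divide)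

lemma ln_7_ht_le: "ln (5067/1000 :: real) \<le> 1623/1000"
  by (rule order.trans[OF ln_le_reduced[where v="1177/10000" and n=2 and S="1000000" and V="13854" and h="1004657" and
      hs="[336132, 202007, 144865]"]]) (simp_all add: power2_eq_square)

lemma profile_7_ht_le: "4 * hyperball_profile (4 * h_dist 7 - 2 * t_dist 7) \<le> 2029/500"
  using hyperball_profile_diff_le[where a="4 * h_dist 7" and b="2 * t_dist 7", OF exp_two_t_dist_7(2) exp_two_t_dist_7(3) _ _ ln_7_ht_le] by (simp add: power_divide)

lemma ln_7_s_ge: "14490747/5000000 \<le> ln (90702721/5000000 :: real)"
  by (rule order.trans[OF _ ln_ge_reduced[where v="6269801/100000000" and n=4 and S="10000000000" and V="39310404" and h="10013134460" and
      hs="[3341217489, 2005615771, 1428571428]"]]) (simp_all add: power2_eq_square)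

lemma profile_7_s_ge: "119408589/10000000 \<le> 4 * hyperball_profile (s_dist 7 - 0)"
  using hyperball_profile_diff_ge[where a="s_dist 7" and b="0", OF dist_bounds_7(4) exp_0_le_one _ _ _ ln_7_s_ge] by (simp add: power_divide)

lemma ln_7_hs_ge: "12538221/10000000 \<le> ln (350370927/100000000 :: real)"
  by (rule order.trans[OF _ ln_ge_reduced[where v="13660871/50000000" and n=1 and S="10000000000" and V="746477585" and h="10260601413" and
      hs="[3491081563, 2113234660, 1516919767, 1183536390, 970227120, 818995941, 666666666]"]]) (simp_all add: power2_eq_square)

lemma profile_7_hs_ge: "7157427/2500000 \<le> 4 * hyperball_profile (2 * h_dist 7 - s_dist 7)"
  using hyperball_profile_diff_ge[where a="2 * h_dist 7" and b="s_dist 7", OF dist_bounds_7(2) dist_bounds_7(3) _ _ _ ln_7_hs_ge] by (simp add: power_divide)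

lemma dist_bounds_8:
  shows "exp (2 * h_dist 8) \<le> 1153/250" "46111/10000 \<le> exp (2 * h_dist 8)"
    and "exp (s_dist 8) \<le> 17009/5000" "17007/5000 \<le> exp (s_dist 8)"
    and "exp (t_dist 8) \<le> 859/200" "1073/250 \<le> exp (t_dist 8)"
  using exp_dist_le(1)[OF _ cos_two_pi_div_8(1), of "1509/625" "2747/1250"] exp_dist_ge(1)[OF _ cos_two_pi_div_8(2), of "1207/500" "21971/10000"]
    exp_dist_le(2)[OF _ cos_two_pi_div_8(1), of "1509/625" "15539/10000" "18479/10000"] exp_dist_ge(2)[OF _ cos_two_pi_div_8(2), of "1207/500" "15537/10000" "18477/10000"]
    exp_dist_le(3)[OF _ cos_two_pi_div_8(1), of "2061/500" "2031/1000" "283/125"] exp_dist_ge(3)[OF _ cos_two_pi_div_8(2), of "4121/1000" "203/100" "1131/500"]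
  by (simp_all add: power_divide)

lemma exp_two_t_dist_8:
  "exp (2 * t_dist 8) \<le> 737881/40000" "exp (4 * h_dist 8) \<le> 1329409/62500" "1151329/62500 \<le> exp (2 * t_dist 8)"
  using power_mono[OF dist_bounds_8(5), of 2] power_mono[OF dist_bounds_8(1), of 2] power_mono[OF dist_bounds_8(6), of 2]
  by (simp_all add: exp_double[symmetric] power_divide)

lemma ln_8_s_le: "ln (11573/1000 :: real) \<le> 2449/1000"
  by (rule order.trans[OF ln_le_reduced[where v="913/5000" and n=3 and S="1000000" and V="33343" and h="1011343" and
      hs="[340166, 204892, 146690, 114944]"]]) (simp_all add: power2_eq_square)

lemma profile_8_s_le: "4 * hyperball_profile (s_dist 8 - 0) \<le> 8193/1000"
  using hyperball_profile_diff_le[where a="s_dist 8" and b="0", OF dist_bounds_8(3) one_le_exp_0 _ _ ln_8_s_le] by (simp add: power_divide)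

lemma ln_8_hs_le: "ln (1839/1000 :: real) \<le> 61/100"
  by (rule order.trans[OF ln_le_reduced[where v="739/2500" and n=0 and S="1000000" and V="87380" and h="1030757" and
      hs="[351981, 213398, 153327, 119816, 99614]"]]) (simp_all add: power2_eq_square)

lemma profile_8_hs_le: "4 * hyperball_profile (2 * h_dist 8 - s_dist 8) \<le> 629/500"
  using hyperball_profile_diff_le[where a="2 * h_dist 8" and b="s_dist 8", OF dist_bounds_8(1) dist_bounds_8(4) _ _ ln_8_hs_le] by (simp add: power_divide)

lemma ln_8_h_le: "ln (21271/1000 :: real) \<le> 1529/500"
  by (rule order.trans[OF ln_le_reduced[where v="283/2000" and n=4 and S="1000000" and V="20023" and h="1006756" and
      hs="[337397, 202919, 145777]"]]) (simp_all add: power2_eq_square)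

lemma profile_8_h_le: "4 * hyperball_profile (2 * h_dist 8 - 0) \<le> 1367/100"
  using hyperball_profile_diff_le[where a="2 * h_dist 8" and b="0", OF dist_bounds_8(1) one_le_exp_0 _ _ ln_8_h_le] by (simp add: power_divide)

lemma ln_8_th_le: "ln (3201/200 :: real) \<le> 2773/1000"
  by (rule order.trans[OF ln_le_reduced[where v="1/5000" and n=4 and S="1000000" and V="1" and h="1000001" and
      hs="[333334]"]]) (simp_all add: power2_eq_square)

lemma profile_8_th_le: "4 * hyperball_profile (2 * t_dist 8 - 2 * h_dist 8) \<le> 2149/200"
  using hyperball_profile_diff_le[where a="2 * t_dist 8" and b="2 * h_dist 8", OF exp_two_t_dist_8(1) dist_bounds_8(2) _ _ ln_8_th_le] by (simp add: power_divide)

lemma ln_8_ht_le: "ln (667/500 :: real) \<le> 289/1000"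
  by (rule order.trans[OF ln_le_reduced[where v="179/1250" and n=0 and S="1000000" and V="20507" and h="1006922" and
      hs="[337497, 202991, 145849]"]]) (simp_all add: power2_eq_square)

lemma profile_8_ht_le: "4 * hyperball_profile (4 * h_dist 8 - 2 * t_dist 8) \<le> 291/500"
  using hyperball_profile_diff_le[where a="4 * h_dist 8" and b="2 * t_dist 8", OF exp_two_t_dist_8(2) exp_two_t_dist_8(3) _ _ ln_8_ht_le] by (simp add: power_divide)

lemma dist_bounds_9:
  shows "exp (2 * h_dist 9) \<le> 34709/10000" "17351/5000 \<le> exp (2 * h_dist 9)"
    and "exp (s_dist 9) \<le> 767/250" "7669/2500 \<le> exp (s_dist 9)"
    and "exp (t_dist 9) \<le> 1951/500" "1949/500 \<le> exp (t_dist 9)"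
  using exp_dist_le(1)[OF _ cos_two_pi_div_9(1), of "3759/2000" "7957/5000"] exp_dist_ge(1)[OF _ cos_two_pi_div_9(2), of "2349/1250" "1591/1000"]
    exp_dist_le(2)[OF _ cos_two_pi_div_9(1), of "3759/2000" "1371/1000" "1697/1000"] exp_dist_ge(2)[OF _ cos_two_pi_div_9(2), of "2349/1250" "3427/2500" "2121/1250"]
    exp_dist_le(3)[OF _ cos_two_pi_div_9(1), of "83/25" "1823/1000" "2079/1000"] exp_dist_ge(3)[OF _ cos_two_pi_div_9(2), of "1659/500" "1821/1000" "2077/1000"]
  by (simp_all add: power_divide)

lemma ln_9_s_le: "ln (9413/1000 :: real) \<le> 2243/1000"
  by (rule order.trans[OF ln_le_reduced[where v="203/2500" and n=3 and S="1000000" and V="6594" and h="1002207" and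
      hs="[334659, 200949, 143806]"]]) (simp_all add: power2_eq_square)

lemma profile_9_s_le: "4 * hyperball_profile (s_dist 9 - 0) \<le> 6897/1000"
  using hyperball_profile_diff_le[where a="s_dist 9" and b="0", OF dist_bounds_9(3) one_le_exp_0 _ _ ln_9_s_le] by (simp add: power_divide)

lemma ln_9_hs_le: "ln (1281/1000 :: real) \<le> 31/125"
  by (rule order.trans[OF ln_le_reduced[where v="77/625" and n=0 and S="1000000" and V="15179" and h="1005107" and
      hs="[336403, 202202, 145059]"]]) (simp_all add: power2_eq_square)

lemma profile_9_hs_le: "4 * hyperball_profile (2 * h_dist 9 - s_dist 9) \<le> 499/1000"
  using hyperball_profile_diff_le[where a="2 * h_dist 9" and b="s_dist 9", OF dist_bounds_9(1) dist_bounds_9(4) _ _ ln_9_hs_le] by (simp add: power_divide)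

lemma ln_9_h_le: "ln (1506/125 :: real) \<le> 249/100"
  by (rule order.trans[OF ln_le_reduced[where v="101/500" and n=3 and S="1000000" and V="40804" and h="1013945" and
      hs="[341740, 206023, 147584, 115838]"]]) (simp_all add: power2_eq_square)

lemma profile_9_h_le: "4 * hyperball_profile (2 * h_dist 9 - 0) \<le> 8473/1000"
  using hyperball_profile_diff_le[where a="2 * h_dist 9" and b="0", OF dist_bounds_9(1) one_le_exp_0 _ _ ln_9_h_le] by (simp add: power_divide)

text \<open>\<open>97/10\<close> is chosen between the height sums at \<open>p = 8\<close> and the
  largest value that the volume bound allows. Since \<open>2 * h\<close> still exceeds
  \<open>t\<close> here, the second family has to be estimated as well.\<close>

lemma density_bound_8: "density_bound 8 (8493/10000)"
proof (rule density_boundI[where M="97/10" and m="2 * h_dist 8"])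
  show "(pi - 6 * pi / 8) * (97/10) \<le> 8493/10000 * (11241/1250)" using pi_less by simp
  show "height_sum3 8 (s_dist 8 - h_dist 8) \<le> 97/10"
    unfolding height_sum3_s_dist using profile_8_s_le profile_8_hs_le by linarith
  show "2 * hyperball_profile (2 * h_dist 8) + 6 * hyperball_profile (2 * h_dist 8 - s_dist 8) \<le> 97/10"
    using profile_8_h_le profile_8_hs_le by simp
  show "hyperball_profile (2 * h_dist 8) + hyperball_profile (2 * t_dist 8 - 2 * h_dist 8) + 3 * hyperball_profile (4 * h_dist 8 - 2 * t_dist 8) \<le> 97/10"
    if "t_dist 8 \<le> 2 * h_dist 8"
    using profile_8_h_le profile_8_th_le profile_8_ht_le by simp
qed (use V0_8_ge in simp_all)

text \<open>The crude estimate of \<open>deltas_le_large\<close> fails here: it would have to fit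
  about \<open>pi / 3 * 8.47\<close> below \<open>0.8493 * 9.68\<close> with the volume bound at
  hand. The premise of \<open>sum2\<close>, however, is already impossible.\<close>

lemma density_bound_9: "density_bound 9 (8493/10000)"
proof (rule density_boundI[where M="39/5" and m="2 * h_dist 9"])
  show "(pi - 6 * pi / 9) * (39/5) \<le> 8493/10000 * (2421/250)" using pi_less by simp
  show "height_sum3 9 (s_dist 9 - h_dist 9) \<le> 39/5"
    unfolding height_sum3_s_dist using profile_9_s_le profile_9_hs_le by linarith
  show "2 * hyperball_profile (2 * h_dist 9) + 6 * hyperball_profile (2 * h_dist 9 - s_dist 9) \<le> 39/5"
    using profile_9_h_le profile_9_hs_le by simp
  show "hyperball_profile (2 * h_dist 9) + hyperball_profile (2 * t_dist 9 - 2 * h_dist 9) + 3 * hyperball_profile (4 * h_dist 9 - 2 * t_dist 9) \<le> 39/5"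
    if "t_dist 9 \<le> 2 * h_dist 9"
    using that two_h_dist_less_t_dist[of 9] by simp
qed (use V0_9_ge in simp_all)

section \<open>The extremal density at \<open>p = 7\<close>\<close>

lemma V0_7_bounds: "977839661/125000000 \<le> V0 7" "V0 7 \<le> 488920457/62500000"
proof -
  have y: "30985599/50000000 \<le> cube_param 7" by (rule cube_param_ge[OF _ cos_two_pi_div_7(1)]) (simp_all add: power_divide)
  have y': "cube_param 7 \<le> 61971199/100000000" by (rule cube_param_le[OF _ cos_two_pi_div_7(2)]) (simp_all add: power_divide)
  have d: "161365281/100000000 \<le> 1 / cube_param 7" by (rule le_inverse_cube_param[OF _ y']) simp_all
  have d': "1 / cube_param 7 \<le> 32273057/20000000" by (rule inverse_cube_param_le[OF _ y]) simp_all
  show "977839661/125000000 \<le> V0 7" using V0_ge[OF _ y d octant7_lower] by simp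
  show "V0 7 \<le> 488920457/62500000" using V0_le[OF _ y' d' octant7_upper] by simp
qed

lemma ln_7_sh_le: "ln (22754177/10000000 :: real) \<le> 205541/250000"
  by (rule order.trans[OF ln_le_reduced[where v="644189/10000000" and n=1 and S="1000000000" and V="4149795" and h="1001386720" and
      hs="[334165761, 200594750, 143320153, 111574121]"]]) (simp_all add: power2_eq_square)

lemma ln_7_sh_ge: "822163/1000000 \<le> ln (177767/78125 :: real)"
  by (rule order.trans[OF _ ln_ge_reduced[where v="161047/2500000" and n=1 and S="1000000000" and V="4149781" and h="1001386714" and
      hs="[334165749, 200592825, 142857142]"]]) (simp_all add: power2_eq_square)

text \<open>\<open>exp (2 * (s - h)) = (exp s)\<^sup>2 / exp (2 * h)\<close> is enclosed rationally,
  and its logarithm is halved.\<close>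

lemma s_dist_minus_h_dist_7:
  "s_dist 7 - h_dist 7 \<le> 205541/500000" "822163/2000000 \<le> s_dist 7 - h_dist 7"
proof -
  define s h where "s = s_dist 7" and "h = h_dist 7"
  note b = dist_bounds_7[folded s_def h_def]
  have e: "exp (2 * (s - h)) = (exp s)\<^sup>2 / exp (2 * h)"
    by (simp add: exp_diff right_diff_distrib exp_double)
  have "(exp s)\<^sup>2 / exp (2 * h) \<le> (4259171779/1000000000)\<^sup>2 / (7972401963/1000000000)"
    using b(2,3) by (intro frac_le power_mono) auto
  also have "\<dots> \<le> 22754177/10000000" by (simp add: power_divide)
  finally have "exp (2 * (s - h)) \<le> 22754177/10000000" unfolding e .
  then have "ln (exp (2 * (s - h))) \<le> ln (22754177/10000000)" by (intro ln_mono) auto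
  then show "s_dist 7 - h_dist 7 \<le> 205541/500000" using ln_7_sh_le by (simp add: s_def h_def)
  have "(177767/78125 :: real) \<le> (170366871/40000000)\<^sup>2 / (7972401973/1000000000)" by (simp add: power_divide)
  also have "\<dots> \<le> (exp s)\<^sup>2 / exp (2 * h)"
    using b(1,4) by (intro frac_le power_mono) auto
  finally have "177767/78125 \<le> exp (2 * (s - h))" unfolding e .
  then have "ln (177767/78125) \<le> ln (exp (2 * (s - h)))" by (intro ln_mono) auto
  then show "822163/2000000 \<le> s_dist 7 - h_dist 7" using ln_7_sh_ge by (simp add: s_def h_def)
qed

text \<open>Together these say that \<open>x = s - h\<close> is admissible for the third family and
  that the smaller height \<open>2 * h - s\<close> is nonnegative.\<close>

lemma dist_order_7: "h_dist 7 \<le> s_dist 7" "s_dist 7 \<le> 2 * h_dist 7"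
proof -
  show "h_dist 7 \<le> s_dist 7" using s_dist_minus_h_dist_7(2) by simp
  have "exp (s_dist 7) \<le> exp (2 * h_dist 7)" using dist_bounds_7(2,3) by linarith
  then show "s_dist 7 \<le> 2 * h_dist 7" by simp
qed

text \<open>At \<open>p = 7\<close> the two heights \<open>s\<close> and \<open>2h - s\<close> are so small that the bound \<open>Vh_le\<close> is sharp.\<close>

lemma delta3_7:
  "delta3 7 (s_dist 7 - h_dist 7) = (pi - 6 * pi / 7) * height_sum3 7 (s_dist 7 - h_dist 7) / V0 7"
proof -
  define s h where "s = s_dist 7" and "h = h_dist 7"
  define c where "c = cos (2 * pi / 7)"
  \<comment> \<open>\<open>c \<le> 5/7\<close> is the condition
    \<open>c / (1 + c) \<le> 5/12\<close> on \<open>y\<^sup>2\<close> in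
    \<open>Vh_eq\<close>.\<close>
  have c: "1/2 < c" "c \<le> 5/7" using cos_two_pi_div_7 by (simp_all add: c_def)
  have y: "(cube_param 7)\<^sup>2 = c / (1 + c)" using cube_param_bounds(4)[of 7] by (simp add: c_def)
  have y5: "(cube_param 7)\<^sup>2 \<le> 5/12" unfolding y using c by (simp add: pos_divide_le_eq)
  have k: "0 \<le> 3 * (cube_param 7)\<^sup>2 - 1" using cube_param_bounds(2)[of 7] by simp
  have "3 * (c / (1 + c)) - 1 = (2 * c - 1) / (1 + c)" "1 - c / (1 + c) = 1 / (1 + c)" using c by (simp_all add: field_simps)
  \<comment> \<open>At height \<open>s\<close> the other condition of \<open>Vh_eq\<close> holds
    with equality; smaller heights follow by monotonicity.\<close>
  then have eq: "(sinh s)\<^sup>2 * (3 * (cube_param 7)\<^sup>2 - 1) = 1 - (cube_param 7)\<^sup>2"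
    using dist_params(9)[of 7] c unfolding y s_def c_def[symmetric] by simp
  have V: "Vh 7 r = hyperball_profile r * (pi - 6 * pi / 7)" if "0 \<le> r" "r \<le> s" for r
  proof (rule Vh_eq[OF _ that(1) _ y5])
    have "(sinh r)\<^sup>2 \<le> (sinh s)\<^sup>2" using that by (intro power_mono) auto
    then show "(sinh r)\<^sup>2 * (3 * (cube_param 7)\<^sup>2 - 1) \<le> 1 - (cube_param 7)\<^sup>2"
      unfolding eq[symmetric] using k by (rule mult_right_mono)
  qed simp
  have "0 \<le> s" using dist_params(4)[of 7] by (simp add: s_def)
  moreover have "0 \<le> 2 * h - s" "2 * h - s \<le> s" using dist_order_7 by (simp_all add: s_def h_def)
  moreover have "h + (s - h) = s" "h - (s - h) = 2 * h - s" by simp_all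
  ultimately show ?thesis
    unfolding delta3_def height_sum3_def s_def[symmetric] h_def[symmetric] using V[of s] V[of "2 * h - s"]
    by (simp add: algebra_simps)
qed

lemma height_sum3_7_bounds:
  "148038297/10000000 \<le> height_sum3 7 (s_dist 7 - h_dist 7)" "height_sum3 7 (s_dist 7 - h_dist 7) \<le> 74019151/5000000"
  unfolding height_sum3_s_dist using profile_7_s_ge profile_7_hs_ge profile_7_s_le profile_7_hs_le by linarith+

text \<open>The two bounds are the tolerance around \<open>0.84931\<close>, and the lower one is
  also the threshold below which all \<open>p \<ge> 8\<close> stay.\<close>

lemma delta3_7_bounds:
  "8493/10000 \<le> delta3 7 (s_dist 7 - h_dist 7)" "delta3 7 (s_dist 7 - h_dist 7) \<le> 84932/100000"
proof -
  define N where "N = height_sum3 7 (s_dist 7 - h_dist 7)"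
  note N = height_sum3_7_bounds[folded N_def] and V = V0_7_bounds
  have pi: "392699/125000 \<le> pi" "pi \<le> 3141593/1000000" using pi_approx by simp_all
  have e: "delta3 7 (s_dist 7 - h_dist 7) = pi * N / (7 * V0 7)" by (simp add: delta3_7 N_def field_simps)
  have "392699/125000 * (148038297/10000000) \<le> pi * N" using N(1) pi(1) by (intro mult_mono) auto
  then show "8493/10000 \<le> delta3 7 (s_dist 7 - h_dist 7)" unfolding e using V by (simp add: pos_le_divide_eq)
  have "pi * N \<le> 3141593/1000000 * (74019151/5000000)" using N pi by (intro mult_mono) auto
  then show "delta3 7 (s_dist 7 - h_dist 7) \<le> 84932/100000" unfolding e using V by (simp add: pos_divide_le_eq)
qed

text \<open>\<open>L\<close>, \<open>M\<close> and \<open>D\<close> are the exact volume, height sum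
  and density, so \<open>bound\<close> is an equality by \<open>delta3_7\<close>. The choice
  \<open>m = t_dist 7\<close> is forced: \<open>2 * F (2 * h)\<close>, about 17.96, already exceeds
  the height sum 14.80.\<close>

lemma density_bound_7: "density_bound 7 (delta3 7 (s_dist 7 - h_dist 7))"
proof (rule density_boundI[where M="height_sum3 7 (s_dist 7 - h_dist 7)" and L="V0 7" and m="t_dist 7"])
  show "2 * hyperball_profile (t_dist 7) + 6 * hyperball_profile (2 * h_dist 7 - s_dist 7) \<le> height_sum3 7 (s_dist 7 - h_dist 7)"
    using profile_7_t_le profile_7_hs_le height_sum3_7_bounds(1) by simp
  show "hyperball_profile (2 * h_dist 7) + hyperball_profile (2 * t_dist 7 - 2 * h_dist 7) + 3 * hyperball_profile (4 * h_dist 7 - 2 * t_dist 7)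
      \<le> height_sum3 7 (s_dist 7 - h_dist 7)"
    using profile_7_h_le profile_7_th_le profile_7_ht_le height_sum3_7_bounds(1) by simp
qed (use V0_7_bounds(1) delta3_7_bounds(1) in \<open>simp_all add: delta3_7\<close>)

lemma density_bound_mono: "density_bound p D \<Longrightarrow> D \<le> D' \<Longrightarrow> density_bound p D'"
  unfolding density_bound_def by (meson order.trans)

theorem theorem3p13:
  shows "(\<forall>(p::nat) x. 7 \<le> p \<longrightarrow>
            (adm1 (real p) x \<longrightarrow> delta1 (real p) x \<le> delta3 7 (s_dist 7 - h_dist 7)) \<and>
            (adm2 (real p) x \<longrightarrow> delta2 (real p) x \<le> delta3 7 (s_dist 7 - h_dist 7)) \<and>
            (adm3 (real p) x \<longrightarrow> delta3 (real p) x \<le> delta3 7 (s_dist 7 - h_dist 7)))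
         \<and> adm3 7 (s_dist 7 - h_dist 7)
         \<and> \<bar>(s_dist 7 - h_dist 7) - 0.41108\<bar> \<le> 0.00001
         \<and> \<bar>delta3 7 (s_dist 7 - h_dist 7) - 0.84931\<bar> \<le> 0.00001"
proof -
  have "density_bound (real p) (delta3 7 (s_dist 7 - h_dist 7))" if p: "7 \<le> p" for p :: nat
  proof (cases "p = 7")
    case True
    then show ?thesis using density_bound_7 by simp
  next
    case False
    consider "p = 8" | "p = 9" | "p = 10" | "p = 11" | "12 \<le> p \<and> p \<le> 13" | "14 \<le> p \<and> p \<le> 19" | "20 \<le> p"
      using p False by linarith
    then have "density_bound (real p) (8493/10000)"
      by cases (use density_bound_8 density_bound_9 in \<open>auto intro: deltas_le_block_10 deltas_le_block_11 deltas_le_block_12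
        deltas_le_block_14 deltas_le_block_20\<close>)
    then show ?thesis using delta3_7_bounds(1) by (rule density_bound_mono)
  qed
  moreover have "adm3 7 (s_dist 7 - h_dist 7)" using dist_order_7 by (simp add: adm3_def)
  moreover have "\<bar>(s_dist 7 - h_dist 7) - 0.41108\<bar> \<le> 0.00001" using s_dist_minus_h_dist_7 by (simp add: abs_le_iff)
  moreover have "\<bar>delta3 7 (s_dist 7 - h_dist 7) - 0.84931\<bar> \<le> 0.00001" using delta3_7_bounds unfolding abs_le_iff by simp
  ultimately show ?thesis unfolding density_bound_def by blast
qed

end
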